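(* Let $S\ge 1$ and $h\ge 0$ be fixed integers, and let $\{\boldsymbol{X}_n\}$ be a mean-zero $L^4$--$m$--approximable sequence in $\mathbb{H}=(L^2([0,1]))^S=\mathbb{R}^S\otimes L^2([0,1])$ with lag-$h$ covariance operator $C^{(h)}=E[\boldsymbol{X}_n\otimes\boldsymbol{X}_{n+h}]$, $\mathrm{Tr}(C^{(h)})\neq 0$. Let $C_1^{(h)}=\mathrm{Tr}_2(C^{(h)})/\mathrm{Tr}(C^{(h)})$ and $C_2^{(h)}=\mathrm{Tr}_1(C^{(h)})$, let $\widehat C^{(h)},\widehat C_1^{(h)},\widehat C_2^{(h)}$ be the estimators defined in the context, and let $$\widehat T=N\,\big\|\widehat C_1^{(h)}\widetilde\otimes\widehat C_2^{(h)}-\widehat C^{(h)}\big\|_{\mathcal{S}}^2,$$ where $\|\cdot\|_{\mathcal{S}}$ is the Hilbert--Schmidt norm. Let $\gamma_1,\gamma_2,\dots$ be the eigenvalues (with multiplicity) of the covariance operator $\boldsymbol{Q}^{(h)}$ defined in the context. Suppose the separability hypothesis $H_0:\ C^{(h)}=C_1^{(h)}\widetilde\otimes C_2^{(h)}$ holds. Then, as $N\to\infty$, $$\widehat T\xrightarrow{\ \mathcal{L}\ }\sum_{r=1}^\infty\gamma_rZ_r^2,$$ where the $Z_r$ are iid standard normal random variables.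
   Context: **Approximability.** For a separable Hilbert space $\mathbb{H}$, $p\ge1$, and an $\mathbb{H}$-valued random element $Z$, put $\nu_p(Z)=(E\|Z\|^p)^{1/p}$. A sequence $\{Z_n\}_{n\in\mathbb{Z}}$ of $\mathbb{H}$-valued random elements with $\nu_p(Z_n)<\infty$ is $L^p$--$m$--approximable if (1) $Z_n=f(u_n,u_{n-1},\dots)$ for iid elements $\{u_n\}$ of a measurable space $\mathcal{U}$ and a measurable $f:\mathcal{U}^\infty\to\mathbb{H}$; and (2) with $Z_{n,M}=f(u_n,\dots,u_{n-M},u^\star_{n-M-1},u^\star_{n-M-2},\dots)$, where for each $(n,M)$ the sequence $\{u^\star_k\}=\{u_k^\star(n,M)\}$ is a copy of $\{u_k\}$, these copies being independent across $M$ and $n$ and independent of $\{u_k\}$, one has $\sum_{M=1}^\infty\nu_p(Z_n-Z_{n,M})<\infty$. **Operators.** $\mathcal{S}(\mathbb{K})$ is the Hilbert space of Hilbert--Schmidt operators on a Hilbert space $\mathbb{K}$. For $x,y\in\mathbb{K}$, $x\otimes y$ is the rank-one operator $z\mapsto\langle y,z\rangle x$. $\mathbb{H}_1=\mathbb{R}^S$, $\mathbb{H}_2=L^2([0,1])$, $\mathbb{H}=\mathbb{H}_1\otimes\mathbb{H}_2=(L^2([0,1]))^S$. For operators $A$ on $\mathbb{H}_1$, $B$ on $\mathbb{H}_2$, $A\widetilde\otimes B$ is the operator on $\mathbb{H}$ with $(A\widetilde\otimes B)(u\otimes v)=(Au)\otimes(Bv)$. $\mathrm{Tr}$ is the trace.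 With orthonormal bases $\{u_i\}$ of $\mathbb{H}_1$, $\{v_j\}$ of $\mathbb{H}_2$, and a trace-class operator $T=\sum_{ijkl}T_{ijkl}\,(u_i\otimes v_j)\otimes(u_k\otimes v_l)$ on $\mathbb{H}$, the partial traces are $\mathrm{Tr}_1(T)=\sum_{jl}\big(\sum_iT_{ijil}\big)v_j\otimes v_l$ (operator on $\mathbb{H}_2$) and $\mathrm{Tr}_2(T)=\sum_{ik}\big(\sum_jT_{ijkj}\big)u_i\otimes u_k$ (operator on $\mathbb{H}_1$); thus $\mathrm{Tr}_1(A\widetilde\otimes B)=\mathrm{Tr}(A)B$, $\mathrm{Tr}_2(A\widetilde\otimes B)=\mathrm{Tr}(B)A$. **Estimators.** From $\boldsymbol{X}_1,\dots,\boldsymbol{X}_N$: $\widehat C^{(h)}=\frac1{N-h}\sum_{n=1}^{N-h}\boldsymbol{X}_n\otimes\boldsymbol{X}_{n+h}$, $\widehat C_1^{(h)}=\mathrm{Tr}_2(\widehat C^{(h)})/\mathrm{Tr}(\widehat C^{(h)})$ (set to $0$ if $\mathrm{Tr}(\widehat C^{(h)})=0$), $\widehat C_2^{(h)}=\mathrm{Tr}_1(\widehat C^{(h)})$. **The operators $\boldsymbol{W}^{(h)}$ and $\boldsymbol{Q}^{(h)}$.** For trace-class $D$ on $\mathbb{H}$ let $$\boldsymbol{M}(D)=\Big(\frac{\mathrm{Tr}_2(D)}{\mathrm{Tr}(C^{(h)})}-\frac{\mathrm{Tr}(D)\,\mathrm{Tr}_2(C^{(h)})}{\mathrm{Tr}(C^{(h)})^2},\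 \mathrm{Tr}_1(D),\ D\Big).$$ Let $Y_n=\boldsymbol{X}_n\otimes\boldsymbol{X}_{n+h}-C^{(h)}$ and let $\boldsymbol{W}^{(h)}$ be the long-run covariance operator of $\{\boldsymbol{M}(Y_n)\}$ on $\mathcal{S}(\mathbb{H}_1)\times\mathcal{S}(\mathbb{H}_2)\times\mathcal{S}(\mathbb{H})$: $$\boldsymbol{W}^{(h)}=\boldsymbol{V}_0+\sum_{i=1}^\infty(\boldsymbol{V}_i+\boldsymbol{V}_i^* ),\qquad \boldsymbol{V}_i=E[\boldsymbol{M}(Y_1)\otimes\boldsymbol{M}(Y_{1+i})].$$ Let $\boldsymbol{G}:\mathcal{S}(\mathbb{H}_1)\times\mathcal{S}(\mathbb{H}_2)\times\mathcal{S}(\mathbb{H})\to\mathcal{S}(\mathbb{H})$ be the bounded linear map $\boldsymbol{G}(A,B,D)=A\widetilde\otimes C_2^{(h)}+C_1^{(h)}\widetilde\otimes B-D$. Then $\boldsymbol{Q}^{(h)}=\boldsymbol{G}\circ\boldsymbol{W}^{(h)}\circ\boldsymbol{G}^*\in\mathcal{S}(\mathcal{S}(\mathbb{H}))$. *)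

theory Defs
  imports "HOL-Probability.Probability"
begin

subsection \<open>Separable Hilbert spaces and orthonormal bases\<close>

lemma second_countable_if_separable:
  fixes D :: "'a::metric_space set"
  assumes "countable D" "closure D = UNIV"
  shows "\<exists>B::'a set set. countable B \<and> open = generate_topology B"
proof -
  define B where "B = (\<lambda>(d, n::nat). ball d (1 / Suc n)) ` (D \<times> UNIV)"
  have "countable B"
    unfolding B_def using assms(1) by simp
  moreover have "topological_basis B"
  proof (rule topological_basisI)
    fix V and x :: 'a assume "open V" "x \<in> V"
    then obtain e where e: "e > 0" "ball x e \<subseteq> V"
      by (meson open_contains_ball)
    obtain n :: nat where n: "1 / Suc n < e / 2"
      using e(1) by (metis half_gt_zero nat_approx_posE)
    have "x \<in> closure D" using assms(2) by simp
    then obtain d where d: "d \<in> D" "dist d x < 1 / Suc n"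
      unfolding closure_approachable by (metis of_nat_0_less_iff zero_less_Suc zero_less_divide_1_iff)
    have "ball d (1 / Suc n) \<subseteq> ball x e"
    proof
      fix y assume "y \<in> ball d (1 / Suc n)"
      then have "dist x y < e" using d(2) n dist_triangle[of x y d] by (simp add: dist_commute)
      then show "y \<in> ball x e" by simp
    qed
    then show "\<exists>U\<in>B. x \<in> U \<and> U \<subseteq> V"
      using d e(2) by (intro bexI[of _ "ball d (1 / Suc n)"]) (auto simp: B_def)
  qed (auto simp: B_def)
  ultimately show ?thesis
    using topological_basis_imp_subbasis by blast
qed

lemma second_countable_if_countable_span_dense:
  fixes S :: "'a::real_normed_vector set"
  assumes "countable S" "closure (span S) = UNIV"
  shows "\<exists>B::'a set set. countable B \<and> open = generate_topology B"
proof -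
  define R where "R = (\<lambda>l. \<Sum>p\<leftarrow>l. real_of_rat (fst p) *\<^sub>R snd p) ` lists (UNIV \<times> S)"
  have "countable R"
    unfolding R_def using assms(1) by (intro countable_image countable_lists) auto
  have R_add: "x + y \<in> R" if "x \<in> R" "y \<in> R" for x y
  proof -
    obtain l m where "l \<in> lists (UNIV \<times> S)" "m \<in> lists (UNIV \<times> S)"
      and "x = (\<Sum>p\<leftarrow>l. real_of_rat (fst p) *\<^sub>R snd p)" "y = (\<Sum>p\<leftarrow>m. real_of_rat (fst p) *\<^sub>R snd p)"
      using \<open>x \<in> R\<close> \<open>y \<in> R\<close> unfolding R_def by auto
    then show ?thesis
      unfolding R_def by (intro image_eqI[where x = "l @ m"]) (auto simp: in_lists_conv_set)
  qed
  have cl_add: "x + y \<in> closure R" if x: "x \<in> closure R" and y: "y \<in> closure R" for x y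
  proof -
    obtain f g where f: "\<And>n. f n \<in> R" "f \<longlonglongrightarrow> x" and g: "\<And>n. g n \<in> R" "g \<longlonglongrightarrow> y"
      using x y unfolding closure_sequential by blast
    then show ?thesis
      unfolding closure_sequential by (intro exI[of _ "\<lambda>n. f n + g n"]) (auto intro: R_add tendsto_add)
  qed
  have scale: "c *\<^sub>R s \<in> closure R" if "s \<in> S" for c s
  proof -
    have "c \<in> closure \<rat>"
      unfolding closure_approachable
    proof (intro allI impI)
      fix e :: real assume "e > 0"
      then obtain r where "r \<in> \<rat>" "c < r" "r < c + e" using Rats_dense_in_real[of c "c + e"] by auto
      then show "\<exists>y\<in>\<rat>. dist y c < e" by (intro bexI[of _ r]) (auto simp: dist_real_def)
    qed
    then obtain q where q: "\<And>n. q n \<in> \<rat>" "q \<longlonglongrightarrow> c"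
      unfolding closure_sequential by blast
    have "q n *\<^sub>R s \<in> R" for n
    proof -
      obtain r where "q n = of_rat r" using q(1) Rats_cases by blast
      then show ?thesis
        unfolding R_def using \<open>s \<in> S\<close> by (intro image_eqI[where x = "[(r, s)]"]) auto
    qed
    moreover have "(\<lambda>n. q n *\<^sub>R s) \<longlonglongrightarrow> c *\<^sub>R s"
      by (intro tendsto_intros q(2))
    ultimately show ?thesis
      unfolding closure_sequential by (intro exI[of _ "\<lambda>n. q n *\<^sub>R s"]) auto
  qed
  have "span S \<subseteq> closure R"
  proof
    fix x assume "x \<in> span S"
    then show "x \<in> closure R"
    proof (induction rule: span_induct_alt)
      case base
      have "0 \<in> R" unfolding R_def by (intro image_eqI[where x = "[]"]) auto
      then show ?case using closure_subset by blast
    next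
      case (step c x y)
      then show ?case using cl_add scale by blast
    qed
  qed
  then have "closure R = UNIV"
    using assms(2) by (metis closure_closure closure_mono top.extremum_uniqueI)
  then show ?thesis
    using second_countable_if_separable[OF \<open>countable R\<close>] by blast
qed

lemma countable_dense_exists:
  "\<exists>D :: 'a::{metric_space, second_countable_topology} set. countable D \<and> closure D = UNIV"
proof -
  obtain D :: "'a set" where D: "countable D" "\<And>X. open X \<Longrightarrow> X \<noteq> {} \<Longrightarrow> \<exists>d\<in>D. d \<in> X"
    by (erule countable_dense_setE)
  have "x \<in> closure D" for x
    unfolding closure_approachable
  proof (intro allI impI)
    fix e :: real assume "e > 0"
    then obtain d where "d \<in> D" "d \<in> ball x e" using D(2)[of "ball x e"] by auto
    then show "\<exists>y\<in>D. dist y x < e" by (auto simp: dist_commute)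
  qed
  then show ?thesis using D(1) by blast
qed

lemma has_sum_orthogonal:
  fixes f :: "'i \<Rightarrow> 'a::{real_inner, banach}"
  assumes orth: "\<And>i j. i \<in> A \<Longrightarrow> j \<in> A \<Longrightarrow> i \<noteq> j \<Longrightarrow> f i \<bullet> f j = 0"
    and sq: "(\<lambda>i. (norm (f i))\<^sup>2) summable_on A"
  shows "f summable_on A" "(norm (infsum f A))\<^sup>2 = (\<Sum>\<^sub>\<infinity>i\<in>A. (norm (f i))\<^sup>2)"
proof -
  have nsum: "(norm (sum f F))\<^sup>2 = (\<Sum>i\<in>F. (norm (f i))\<^sup>2)" if "finite F" "F \<subseteq> A" for F
    using that
  proof (induction F rule: finite_induct)
    case (insert x F)
    have "f x \<bullet> sum f F = 0"
      using insert orth by (auto simp: inner_sum_right intro!: sum.neutral)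
    then have "(norm (f x + sum f F))\<^sup>2 = (norm (f x))\<^sup>2 + (norm (sum f F))\<^sup>2"
      unfolding power2_norm_eq_inner by (simp add: inner_add_left inner_add_right inner_commute)
    then show ?case using insert by simp
  qed simp
  define L where "L = (\<Sum>\<^sub>\<infinity>i\<in>A. (norm (f i))\<^sup>2)"
  have lim: "(sum (\<lambda>x. (norm (f x))\<^sup>2) \<longlongrightarrow> L) (finite_subsets_at_top A)"
    unfolding L_def using sq by (rule infsum_tendsto)
  have "\<exists>P. eventually P (finite_subsets_at_top A) \<and>
              (\<forall>F F'. P F \<and> P F' \<longrightarrow> dist (sum f F) (sum f F') < e)" if "e > 0" for e
  proof -
    have "eventually (\<lambda>F. dist (sum (\<lambda>x. (norm (f x))\<^sup>2) F) L < (e/2)\<^sup>2 / 2) (finite_subsets_at_top A)"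
      using tendstoD[OF lim, of "(e/2)\<^sup>2 / 2"] that by simp
    then obtain F0 where F0: "finite F0" "F0 \<subseteq> A"
      and F0': "\<And>F. finite F \<Longrightarrow> F0 \<subseteq> F \<Longrightarrow> F \<subseteq> A \<Longrightarrow> dist (sum (\<lambda>x. (norm (f x))\<^sup>2) F) L < (e/2)\<^sup>2 / 2"
      unfolding eventually_finite_subsets_at_top by auto
    define P where "P F \<longleftrightarrow> finite F \<and> F0 \<subseteq> F \<and> F \<subseteq> A" for F
    have close: "dist (sum f F) (sum f F0) < e / 2" if "P F" for F
    proof -
      have F: "finite F" "F0 \<subseteq> F" "F \<subseteq> A" using that by (auto simp: P_def)
      have "(dist (sum f F) (sum f F0))\<^sup>2 = (norm (sum f (F - F0)))\<^sup>2"
        using F F0 by (simp add: dist_norm sum_diff)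
      also have "\<dots> = (\<Sum>i\<in>F - F0. (norm (f i))\<^sup>2)"
        using F by (intro nsum) auto
      also have "\<dots> = (\<Sum>i\<in>F. (norm (f i))\<^sup>2) - (\<Sum>i\<in>F0. (norm (f i))\<^sup>2)"
        using F F0 by (simp add: sum_diff)
      also have "\<dots> < (e/2)\<^sup>2"
        using F0'[OF F] F0'[OF F0(1) order.refl F0(2)] unfolding dist_real_def by linarith
      finally show ?thesis
        using \<open>e > 0\<close> by (metis half_gt_zero less_eq_real_def power_less_imp_less_base)
    qed
    have "eventually P (finite_subsets_at_top A)"
      unfolding eventually_finite_subsets_at_top P_def using F0 by blast
    moreover have "dist (sum f F) (sum f F') < e" if "P F" "P F'" for F F'
      using close[OF that(1)] close[OF that(2)] dist_triangle2[of "sum f F" "sum f F'" "sum f F0"] by linarith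
    ultimately show ?thesis by blast
  qed
  then have "cauchy_filter (filtermap (sum f) (finite_subsets_at_top A))"
    by (simp add: cauchy_filter_metric_filtermap)
  then obtain L' where "(sum f \<longlongrightarrow> L') (finite_subsets_at_top A)"
    using complete_uniform[where S=UNIV] complete_UNIV[where 'a='a] by (force simp add: filterlim_def)
  then show s: "f summable_on A"
    using summable_on_def has_sum_def by blast
  have "((\<lambda>F. (norm (sum f F))\<^sup>2) \<longlongrightarrow> (norm (infsum f A))\<^sup>2) (finite_subsets_at_top A)"
    by (intro tendsto_intros infsum_tendsto s)
  moreover have "\<forall>\<^sub>F F in finite_subsets_at_top A. (norm (sum f F))\<^sup>2 = (\<Sum>i\<in>F. (norm (f i))\<^sup>2)"
    by (intro eventually_finite_subsets_at_top_weakI nsum)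
  ultimately have "(sum (\<lambda>x. (norm (f x))\<^sup>2) \<longlongrightarrow> (norm (infsum f A))\<^sup>2) (finite_subsets_at_top A)"
    by (rule Lim_transform_eventually)
  then show "(norm (infsum f A))\<^sup>2 = (\<Sum>\<^sub>\<infinity>i\<in>A. (norm (f i))\<^sup>2)"
    using lim tendsto_unique[OF finite_subsets_at_top_neq_bot] unfolding L_def by blast
qed

text \<open>All Hilbert spaces here are real and separable; finite-dimensional ones are included.\<close>

class separable_hilbert = real_inner + banach + second_countable_topology

instance real :: separable_hilbert ..
instance prod :: (separable_hilbert, separable_hilbert) separable_hilbert ..

instance vec :: ("{metric_space, second_countable_topology}", finite) second_countable_topology
proof
  obtain B :: "'a set set" where B: "countable B" "topological_basis B"
    using ex_countable_basis by blast
  define C where "C = (\<lambda>f. {x :: 'a ^ 'b. \<forall>i. x $ i \<in> f i}) ` (\<Pi>\<^sub>E i\<in>UNIV. B)"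
  have "countable C"
    unfolding C_def by (intro countable_image countable_PiE) (auto simp: B)
  moreover have "topological_basis C"
  proof (rule topological_basisI)
    fix U assume "U \<in> C"
    then obtain f where f: "U = {x. \<forall>i. x $ i \<in> f i}" "\<And>i. f i \<in> B"
      unfolding C_def by auto
    show "open U"
      unfolding f(1) using topological_basis_open[OF B(2) f(2)]
      by (intro open_vector_box) auto
  next
    fix V and x :: "'a ^ 'b" assume "open V" "x \<in> V"
    then obtain A where A: "\<And>i. open (A i)" "\<And>i. x $ i \<in> A i" "\<And>y. (\<forall>i. y $ i \<in> A i) \<Longrightarrow> y \<in> V"
      unfolding open_vec_def by metis
    have "\<forall>i. \<exists>b\<in>B. x $ i \<in> b \<and> b \<subseteq> A i"
      using A B(2) by (meson topological_basisE)
    then obtain f where f: "\<And>i. f i \<in> B" "\<And>i. x $ i \<in> f i" "\<And>i. f i \<subseteq> A i"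
      by metis
    have "{x. \<forall>i. x $ i \<in> f i} \<subseteq> V"
      using A(3) f(3) by blast
    then show "\<exists>U\<in>C. x \<in> U \<and> U \<subseteq> V"
      using f by (intro bexI[of _ "{x. \<forall>i. x $ i \<in> f i}"]) (auto simp: C_def)
  qed
  ultimately show "\<exists>B::('a ^ 'b) set set. countable B \<and> open = generate_topology B"
    using topological_basis_imp_subbasis by blast
qed

instance vec :: (separable_hilbert, finite) separable_hilbert ..

definition orthonormal_basis :: "'a::separable_hilbert set \<Rightarrow> bool" where
  "orthonormal_basis B \<longleftrightarrow>
     (\<forall>x\<in>B. norm x = 1) \<and> pairwise orthogonal B \<and> closure (span B) = UNIV"

lemma bessel_summable:
  fixes B :: "'a::real_inner set"
  assumes "\<forall>x\<in>B. norm x = 1" "pairwise orthogonal B"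
  shows "(\<lambda>b. (x \<bullet> b)\<^sup>2) summable_on B"
proof -
  have "(\<Sum>b\<in>F. (x \<bullet> b)\<^sup>2) \<le> (norm x)\<^sup>2" if F: "finite F" "F \<subseteq> B" for F
  proof -
    have bb: "b \<bullet> c = (if b = c then 1 else 0)" if "b \<in> F" "c \<in> F" for b c
      using that F assms unfolding pairwise_def orthogonal_def
      by (auto simp: power2_norm_eq_inner[symmetric])
    define y where "y = (\<Sum>b\<in>F. (x \<bullet> b) *\<^sub>R b)"
    have xy: "x \<bullet> y = (\<Sum>b\<in>F. (x \<bullet> b)\<^sup>2)"
      unfolding y_def by (simp add: inner_sum_right power2_eq_square)
    have "y \<bullet> b = x \<bullet> b" if "b \<in> F" for b
    proof -
      have "y \<bullet> b = (\<Sum>c\<in>F. (x \<bullet> c) * (if c = b then 1 else 0))"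
        unfolding y_def inner_sum_left by (intro sum.cong) (auto simp: bb that)
      then show ?thesis using F that by (simp add: if_distrib sum.delta cong: if_cong)
    qed
    then have yy: "y \<bullet> y = (\<Sum>b\<in>F. (x \<bullet> b)\<^sup>2)"
      by (subst (2) y_def) (simp add: inner_sum_right power2_eq_square)
    have "0 \<le> (x - y) \<bullet> (x - y)" by simp
    also have "\<dots> = (norm x)\<^sup>2 - (\<Sum>b\<in>F. (x \<bullet> b)\<^sup>2)"
      using xy yy by (simp add: inner_diff_left inner_diff_right inner_commute power2_norm_eq_inner)
    finally show ?thesis by simp
  qed
  then show ?thesis
    by (intro nonneg_bdd_above_summable_on bdd_aboveI[of _ "(norm x)\<^sup>2"]) auto
qed

lemma orthonormal_expansion:
  fixes B :: "'a::{real_inner, banach} set"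
  assumes B: "\<forall>x\<in>B. norm x = 1" "pairwise orthogonal B"
  shows "(\<lambda>b. (x \<bullet> b) *\<^sub>R b) summable_on B"
    and "(norm (\<Sum>\<^sub>\<infinity>b\<in>B. (x \<bullet> b) *\<^sub>R b))\<^sup>2 = (\<Sum>\<^sub>\<infinity>b\<in>B. (x \<bullet> b)\<^sup>2)"
    and "c \<in> B \<Longrightarrow> (\<Sum>\<^sub>\<infinity>b\<in>B. (x \<bullet> b) *\<^sub>R b) \<bullet> c = x \<bullet> c"
proof -
  have orth: "(x \<bullet> b) *\<^sub>R b \<bullet> (x \<bullet> c) *\<^sub>R c = 0" if "b \<in> B" "c \<in> B" "b \<noteq> c" for b c
    using that B(2) by (auto simp: pairwise_def orthogonal_def)
  have sq: "((norm ((x \<bullet> b) *\<^sub>R b))\<^sup>2) = (x \<bullet> b)\<^sup>2" if "b \<in> B" for b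
    using that B(1) by simp
  have summ: "(\<lambda>b. (norm ((x \<bullet> b) *\<^sub>R b))\<^sup>2) summable_on B"
    using bessel_summable[OF B, of x] sq by (simp cong: summable_on_cong)
  show s: "(\<lambda>b. (x \<bullet> b) *\<^sub>R b) summable_on B"
    using has_sum_orthogonal(1)[OF orth summ] .
  show "(norm (\<Sum>\<^sub>\<infinity>b\<in>B. (x \<bullet> b) *\<^sub>R b))\<^sup>2 = (\<Sum>\<^sub>\<infinity>b\<in>B. (x \<bullet> b)\<^sup>2)"
    using has_sum_orthogonal(2)[OF orth summ] sq by (simp cong: infsum_cong)
  show "(\<Sum>\<^sub>\<infinity>b\<in>B. (x \<bullet> b) *\<^sub>R b) \<bullet> c = x \<bullet> c" if c: "c \<in> B"
  proof -
    have "(\<Sum>\<^sub>\<infinity>b\<in>B. (x \<bullet> b) *\<^sub>R b) \<bullet> c = (\<Sum>\<^sub>\<infinity>b\<in>B. ((x \<bullet> b) *\<^sub>R b) \<bullet> c)"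
      using infsumI[OF has_sum_bounded_linear[OF bounded_linear_inner_left has_sum_infsum[OF s]]] by simp
    also have "\<dots> = (\<Sum>\<^sub>\<infinity>b\<in>{c}. ((x \<bullet> b) *\<^sub>R b) \<bullet> c)"
      using c B(2) by (intro infsum_cong_neutral) (auto simp: pairwise_def orthogonal_def)
    also have "\<dots> = x \<bullet> c"
      using c B(1) by (auto simp: power2_norm_eq_inner[symmetric])
    finally show ?thesis .
  qed
qed

lemma closure_span_orthonormal:
  fixes B :: "'a::{real_inner, banach} set"
  assumes B: "\<forall>x\<in>B. norm x = 1" "pairwise orthogonal B"
    and total: "\<And>x. \<forall>b\<in>B. x \<bullet> b = 0 \<Longrightarrow> x = 0"
  shows "closure (span B) = UNIV"
proof -
  have "x \<in> closure (span B)" for x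
  proof -
    define y where "y = (\<Sum>\<^sub>\<infinity>b\<in>B. (x \<bullet> b) *\<^sub>R b)"
    have "((\<lambda>F. \<Sum>b\<in>F. (x \<bullet> b) *\<^sub>R b) \<longlongrightarrow> y) (finite_subsets_at_top B)"
      unfolding y_def by (intro infsum_tendsto orthonormal_expansion B)
    moreover have "\<forall>\<^sub>F F in finite_subsets_at_top B. (\<Sum>b\<in>F. (x \<bullet> b) *\<^sub>R b) \<in> closure (span B)"
      by (intro eventually_finite_subsets_at_top_weakI subsetD[OF closure_subset] span_sum span_scale)
        (auto intro: span_base)
    ultimately have "y \<in> closure (span B)"
      using Lim_in_closed_set[OF closed_closure] finite_subsets_at_top_neq_bot by blast
    moreover have "x - y = 0"
      using orthonormal_expansion(3)[OF B, of _ x] by (intro total) (auto simp: y_def inner_diff_left)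
    ultimately show ?thesis by simp
  qed
  then show ?thesis by blast
qed

lemma orthonormal_basis_exists: "\<exists>B :: 'a::separable_hilbert set. orthonormal_basis B"
proof -
  define \<A> where "\<A> = {B :: 'a set. (\<forall>x\<in>B. norm x = 1) \<and> pairwise orthogonal B}"
  have "\<exists>M\<in>\<A>. \<forall>X\<in>\<A>. M \<subseteq> X \<longrightarrow> X = M"
  proof (rule subset_Zorn')
    fix C assume C: "subset.chain \<A> C"
    then have CA: "C \<subseteq> \<A>" and total: "\<And>X Y. X \<in> C \<Longrightarrow> Y \<in> C \<Longrightarrow> X \<subseteq> Y \<or> Y \<subseteq> X"
      by (auto simp: subset_chain_def)
    have "orthogonal x y" if xy: "x \<in> \<Union>C" "y \<in> \<Union>C" "x \<noteq> y" for x y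
    proof -
      from xy obtain X Y where XY: "X \<in> C" "Y \<in> C" "x \<in> X" "y \<in> Y" by blast
      then obtain Z where Z: "Z \<in> C" "x \<in> Z" "y \<in> Z" using total[OF XY(1,2)] by blast
      then have "pairwise orthogonal Z" using CA by (auto simp: \<A>_def)
      then show "orthogonal x y"
        using Z xy by (simp add: pairwise_def)
    qed
    moreover have "norm x = 1" if "x \<in> \<Union>C" for x
      using that CA by (auto simp: \<A>_def)
    ultimately show "\<Union>C \<in> \<A>"
      unfolding \<A>_def by (simp add: pairwise_def)
  qed
  then obtain B where "B \<in> \<A>" and max: "\<And>X. X \<in> \<A> \<Longrightarrow> B \<subseteq> X \<Longrightarrow> X = B"
    by metis
  then have B: "\<forall>x\<in>B. norm x = 1" "pairwise orthogonal B"
    by (simp_all add: \<A>_def)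
  have "x = 0" if x: "\<forall>b\<in>B. x \<bullet> b = 0" for x
  proof (rule ccontr)
    assume "x \<noteq> 0"
    define z where "z = (1 / norm x) *\<^sub>R x"
    have nz: "norm z = 1" using \<open>x \<noteq> 0\<close> by (simp add: z_def)
    have "insert z B \<in> \<A>"
      using B nz x unfolding \<A>_def
      by (auto simp: pairwise_insert orthogonal_def inner_commute z_def)
    then have "z \<in> B" using max by blast
    then have "z \<bullet> z = 0" using x by (auto simp: z_def)
    then show False using nz by simp
  qed
  then have "closure (span B) = UNIV" using closure_span_orthonormal[OF B] by blast
  then show ?thesis
    using B unfolding orthonormal_basis_def by blast
qed

lemma orthonormal_basis_expansion:
  fixes B :: "'a::separable_hilbert set"
  assumes "orthonormal_basis B"
  shows "((\<lambda>b. (x \<bullet> b) *\<^sub>R b) has_sum x) B"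
    and "((\<lambda>b. (x \<bullet> b)\<^sup>2) has_sum (norm x)\<^sup>2) B"
proof -
  have B: "\<forall>x\<in>B. norm x = 1" "pairwise orthogonal B" "closure (span B) = UNIV"
    using assms by (auto simp: orthonormal_basis_def)
  define y where "y = (\<Sum>\<^sub>\<infinity>b\<in>B. (x \<bullet> b) *\<^sub>R b)"
  have "span B \<subseteq> {z. (x - y) \<bullet> z = 0}"
  proof (rule span_minimal)
    show "B \<subseteq> {z. (x - y) \<bullet> z = 0}"
      using orthonormal_expansion(3)[OF B(1,2), of _ x] by (auto simp: y_def inner_diff_left)
    show "subspace {z. (x - y) \<bullet> z = 0}"
      by (simp add: subspace_def inner_add_right)
  qed
  moreover have "closed {z. (x - y) \<bullet> z = 0}"
    by (intro closed_Collect_eq continuous_intros)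
  ultimately have "closure (span B) \<subseteq> {z. (x - y) \<bullet> z = 0}"
    by (rule closure_minimal)
  then have "(x - y) \<bullet> (x - y) = 0" using B(3) by blast
  then have xy: "y = x" by simp
  show "((\<lambda>b. (x \<bullet> b) *\<^sub>R b) has_sum x) B"
    using has_sum_infsum[OF orthonormal_expansion(1)[OF B(1,2), of x]] xy by (simp add: y_def)
  show "((\<lambda>b. (x \<bullet> b)\<^sup>2) has_sum (norm x)\<^sup>2) B"
    using has_sum_infsum[OF bessel_summable[OF B(1,2), of x]]
      orthonormal_expansion(2)[OF B(1,2), of x] xy by (simp add: y_def)
qed

lemma countable_orthonormal_basis:
  fixes B :: "'a::separable_hilbert set"
  assumes "orthonormal_basis B"
  shows "countable B"
proof -
  have d: "dist x y > 1" if "x \<in> B" "y \<in> B" "x \<noteq> y" for x y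
  proof -
    have "(dist x y)\<^sup>2 = (norm x)\<^sup>2 + (norm y)\<^sup>2"
      using that assms unfolding dist_norm power2_norm_eq_inner orthonormal_basis_def pairwise_def orthogonal_def
      by (simp add: inner_diff_left inner_diff_right inner_commute)
    then have "(dist x y)\<^sup>2 = 2" using that assms by (simp add: orthonormal_basis_def)
    then show ?thesis by (metis dist_commute not_less one_less_numeral_iff power_mono semiring_norm(76) zero_le_dist one_power2 not_le)
  qed
  define \<F> where "\<F> = (\<lambda>x. ball x (1/2)) ` B"
  have "countable \<F>"
  proof (rule countable_disjoint_open_subsets)
    show "pairwise disjnt \<F>"
      unfolding pairwise_def \<F>_def disjnt_iff
    proof (clarify)
      fix x y z assume xy: "x \<in> B" "y \<in> B" "ball x (1/2) \<noteq> ball y (1/2)" "z \<in> ball x (1/2)" "z \<in> ball y (1/2)"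
      then have "dist x y < 1" using dist_triangle2[of x y z] by simp
      then show False using d[of x y] xy by fastforce
    qed
  qed (auto simp: \<F>_def)
  moreover have "inj_on (\<lambda>x. ball x (1/2)) B"
  proof (rule inj_onI, rule ccontr)
    fix x y assume xy: "x \<in> B" "y \<in> B" "ball x (1/2) = ball y (1/2)" "x \<noteq> y"
    have "y \<in> ball x (1/2)" using xy(3) by simp
    then show False using d[OF xy(1,2,4)] by simp
  qed
  ultimately show ?thesis
    unfolding \<F>_def using countable_image_inj_on by blast
qed

lemma subspace_closure:
  fixes S :: "'a::real_normed_vector set"
  assumes "subspace S"
  shows "subspace (closure S)"
proof (rule subspaceI)
  show "0 \<in> closure S"
    using subspace_0[OF assms] closure_subset by blast
next
  fix x y assume "x \<in> closure S" "y \<in> closure S"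
  then obtain f g where "\<And>n. f n \<in> S" "f \<longlonglongrightarrow> x" "\<And>n. g n \<in> S" "g \<longlonglongrightarrow> y"
    unfolding closure_sequential by blast
  then show "x + y \<in> closure S"
    unfolding closure_sequential
    by (intro exI[of _ "\<lambda>n. f n + g n"]) (auto intro: subspace_add[OF assms] tendsto_add)
next
  fix c x assume "x \<in> closure S"
  then obtain f where "\<And>n. f n \<in> S" "f \<longlonglongrightarrow> x"
    unfolding closure_sequential by blast
  then show "c *\<^sub>R x \<in> closure S"
    unfolding closure_sequential
    by (intro exI[of _ "\<lambda>n. c *\<^sub>R f n"]) (auto intro: subspace_scale[OF assms] tendsto_intros)
qed

subsection \<open>The space \<open>L\<^sup>2([0,1])\<close>\<close>

abbreviation unit_lborel :: "real measure" where
  "unit_lborel \<equiv> restrict_space lborel {0..1}"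

definition square_integrable01 :: "(real \<Rightarrow> real) \<Rightarrow> bool" where
  "square_integrable01 f \<longleftrightarrow>
     f \<in> borel_measurable unit_lborel \<and> integrable unit_lborel (\<lambda>x. (f x)\<^sup>2)"

lemma square_integrable01_mult:
  assumes "square_integrable01 f" "square_integrable01 g"
  shows "integrable unit_lborel (\<lambda>x. f x * g x)"
proof (rule Bochner_Integration.integrable_bound)
  show "integrable unit_lborel (\<lambda>x. (f x)\<^sup>2 + (g x)\<^sup>2)"
    using assms unfolding square_integrable01_def by auto
  show "(\<lambda>x. f x * g x) \<in> borel_measurable unit_lborel"
    using assms unfolding square_integrable01_def by auto
  have "\<bar>a * b\<bar> \<le> a\<^sup>2 + b\<^sup>2" for a b :: real
  proof -
    have "0 \<le> (\<bar>a\<bar> - \<bar>b\<bar>)\<^sup>2" by simp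
    then have "2 * (\<bar>a\<bar> * \<bar>b\<bar>) \<le> a\<^sup>2 + b\<^sup>2" by (simp add: power2_diff)
    moreover have "0 \<le> \<bar>a\<bar> * \<bar>b\<bar>" by simp
    ultimately show ?thesis unfolding abs_mult by linarith
  qed
  then show "AE x in unit_lborel. norm (f x * g x) \<le> norm ((f x)\<^sup>2 + (g x)\<^sup>2)"
    by (intro AE_I2) simp
qed

lemma square_integrable01_add:
  assumes "square_integrable01 f" "square_integrable01 g"
  shows "square_integrable01 (\<lambda>x. f x + g x)"
proof -
  have "integrable unit_lborel (\<lambda>x. (f x)\<^sup>2 + (g x)\<^sup>2 + 2 * (f x * g x))"
    using assms square_integrable01_mult[OF assms] unfolding square_integrable01_def by auto
  moreover have "(\<lambda>x. (f x)\<^sup>2 + (g x)\<^sup>2 + 2 * (f x * g x)) = (\<lambda>x. (f x + g x)\<^sup>2)"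
    by (auto simp: power2_sum)
  ultimately show ?thesis using assms unfolding square_integrable01_def by auto
qed

lemma square_integrable01_scale: "square_integrable01 f \<Longrightarrow> square_integrable01 (\<lambda>x. c * f x)"
  unfolding square_integrable01_def by (auto simp: power_mult_distrib)

lemma square_integrable01_uminus: "square_integrable01 f \<Longrightarrow> square_integrable01 (\<lambda>x. - f x)"
  using square_integrable01_scale[of f "- 1"] by simp

lemma square_integrable01_diff:
  "square_integrable01 f \<Longrightarrow> square_integrable01 g \<Longrightarrow> square_integrable01 (\<lambda>x. f x - g x)"
  using square_integrable01_add[OF _ square_integrable01_uminus] by simp

lemma square_integrable01_zero: "square_integrable01 (\<lambda>x. 0)"
  unfolding square_integrable01_def by simp

definition L2_eq :: "(real \<Rightarrow> real) \<Rightarrow> (real \<Rightarrow> real) \<Rightarrow> bool" where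
  "L2_eq f g \<longleftrightarrow> square_integrable01 f \<and> square_integrable01 g \<and> (AE x in unit_lborel. f x = g x)"

quotient_type L2_unit = "real \<Rightarrow> real" / partial: L2_eq
proof (rule part_equivpI)
  show "\<exists>f. L2_eq f f"
    unfolding L2_eq_def using square_integrable01_zero by auto
  show "symp L2_eq"
    unfolding L2_eq_def by (auto intro!: sympI)
  show "transp L2_eq"
    unfolding L2_eq_def by (intro transpI) auto
qed

instantiation L2_unit :: real_inner
begin

lift_definition zero_L2_unit :: L2_unit is "\<lambda>_. 0"
  by (simp add: L2_eq_def square_integrable01_zero)

lift_definition plus_L2_unit :: "L2_unit \<Rightarrow> L2_unit \<Rightarrow> L2_unit" is "\<lambda>f g x. f x + g x"
  unfolding L2_eq_def by (auto intro: square_integrable01_add)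

lift_definition minus_L2_unit :: "L2_unit \<Rightarrow> L2_unit \<Rightarrow> L2_unit" is "\<lambda>f g x. f x - g x"
  unfolding L2_eq_def by (auto intro: square_integrable01_diff)

lift_definition uminus_L2_unit :: "L2_unit \<Rightarrow> L2_unit" is "\<lambda>f x. - f x"
  unfolding L2_eq_def by (auto intro: square_integrable01_uminus)

lift_definition scaleR_L2_unit :: "real \<Rightarrow> L2_unit \<Rightarrow> L2_unit" is "\<lambda>c f x. c * f x"
  unfolding L2_eq_def by (auto intro: square_integrable01_scale)

lift_definition inner_L2_unit :: "L2_unit \<Rightarrow> L2_unit \<Rightarrow> real"
  is "\<lambda>f g. LINT x|unit_lborel. f x * g x"
proof -
  fix f f' g g' :: "real \<Rightarrow> real"
  assume "L2_eq f f'" "L2_eq g g'"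
  then show "(LINT x|unit_lborel. f x * g x) = (LINT x|unit_lborel. f' x * g' x)"
    unfolding L2_eq_def
    by (intro integral_cong_AE) (auto simp: square_integrable01_def)
qed

definition norm_L2_unit :: "L2_unit \<Rightarrow> real" where "norm_L2_unit f = sqrt (f \<bullet> f)"
definition dist_L2_unit :: "L2_unit \<Rightarrow> L2_unit \<Rightarrow> real" where "dist_L2_unit f g = norm (f - g)"
definition sgn_L2_unit :: "L2_unit \<Rightarrow> L2_unit" where "sgn_L2_unit f = scaleR (inverse (norm f)) f"
definition uniformity_L2_unit :: "(L2_unit \<times> L2_unit) filter" where
  "uniformity_L2_unit = (INF e\<in>{0<..}. principal {(f, g). dist f g < e})"
definition open_L2_unit :: "L2_unit set \<Rightarrow> bool" where
  "open_L2_unit U \<longleftrightarrow> (\<forall>f\<in>U. eventually (\<lambda>(f', g). f' = f \<longrightarrow> g \<in> U) uniformity)"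

instance
proof
  fix f g h :: L2_unit and a b :: real
  show "f + g + h = f + (g + h)"
    by transfer (auto simp: L2_eq_def algebra_simps intro: square_integrable01_add)
  show "f + g = g + f"
    by transfer (auto simp: L2_eq_def algebra_simps intro: square_integrable01_add)
  show "0 + f = f"
    by transfer (auto simp: L2_eq_def)
  show "- f + f = 0"
    by transfer (auto simp: L2_eq_def square_integrable01_zero)
  show "f - g = f + - g"
    by transfer (auto simp: L2_eq_def intro: square_integrable01_diff)
  show "a *\<^sub>R (f + g) = a *\<^sub>R f + a *\<^sub>R g"
    by transfer (auto simp: L2_eq_def algebra_simps intro!: square_integrable01_add square_integrable01_scale)
  show "(a + b) *\<^sub>R f = a *\<^sub>R f + b *\<^sub>R f"
    by transfer (auto simp: L2_eq_def algebra_simps intro!: square_integrable01_add square_integrable01_scale)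
  show "a *\<^sub>R b *\<^sub>R f = (a * b) *\<^sub>R f"
    by transfer (auto simp: L2_eq_def algebra_simps intro!: square_integrable01_scale)
  show "1 *\<^sub>R f = f"
    by transfer (auto simp: L2_eq_def)
  show "norm f = sqrt (f \<bullet> f)" by (rule norm_L2_unit_def)
  show "dist f g = norm (f - g)" by (rule dist_L2_unit_def)
  show "sgn f = inverse (norm f) *\<^sub>R f" by (rule sgn_L2_unit_def)
  show "(uniformity :: (L2_unit \<times> L2_unit) filter) = (INF e\<in>{0<..}. principal {(f, g). dist f g < e})"
    by (rule uniformity_L2_unit_def)
  show "f \<bullet> g = g \<bullet> f"
    by transfer (simp add: mult.commute)
  show "(f + g) \<bullet> h = f \<bullet> h + g \<bullet> h"
    by transfer (auto simp: L2_eq_def distrib_right square_integrable01_mult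
      intro!: Bochner_Integration.integral_add)
  show "(a *\<^sub>R f) \<bullet> g = a * (f \<bullet> g)"
    by transfer (simp add: mult.assoc)
  show "0 \<le> f \<bullet> f"
    by transfer simp
  show "(f \<bullet> f = 0) = (f = 0)"
  proof transfer
    fix f assume "L2_eq f f"
    then have f: "square_integrable01 f" by (simp add: L2_eq_def)
    have "(LINT x|unit_lborel. f x * f x) = 0 \<longleftrightarrow> (AE x in unit_lborel. f x * f x = 0)"
      using square_integrable01_mult[OF f f] by (intro integral_nonneg_eq_0_iff_AE) auto
    then show "((LINT x|unit_lborel. f x * f x) = 0) = L2_eq f (\<lambda>_. 0)"
      using f by (simp add: L2_eq_def square_integrable01_zero)
  qed
next
  fix U :: "L2_unit set"
  show "open U = (\<forall>f\<in>U. \<forall>\<^sub>F (f', g) in uniformity. f' = f \<longrightarrow> g \<in> U)"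
    by (rule open_L2_unit_def)
qed

end

lemma abs_L2_unit_rep: "square_integrable01 (rep_L2_unit f)" "abs_L2_unit (rep_L2_unit f) = f"
  using Quotient3_rep_reflp[OF Quotient3_L2_unit, of f] Quotient3_abs_rep[OF Quotient3_L2_unit, of f]
  by (simp_all add: L2_eq_def)

lemma abs_L2_unit_simps:
  assumes "square_integrable01 f"
  shows "square_integrable01 g \<Longrightarrow> abs_L2_unit f + abs_L2_unit g = abs_L2_unit (\<lambda>x. f x + g x)"
    and "square_integrable01 g \<Longrightarrow> abs_L2_unit f - abs_L2_unit g = abs_L2_unit (\<lambda>x. f x - g x)"
    and "c *\<^sub>R abs_L2_unit f = abs_L2_unit (\<lambda>x. c * f x)"
    and "(norm (abs_L2_unit f))\<^sup>2 = (LINT x|unit_lborel. (f x)\<^sup>2)"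
  using assms unfolding power2_norm_eq_inner
  by (simp_all add: plus_L2_unit.abs_eq minus_L2_unit.abs_eq scaleR_L2_unit.abs_eq
      inner_L2_unit.abs_eq L2_eq_def power2_eq_square)

lemma abs_L2_unit_eqI:
  "square_integrable01 f \<Longrightarrow> square_integrable01 g \<Longrightarrow> (AE x in unit_lborel. f x = g x) \<Longrightarrow>
    abs_L2_unit f = abs_L2_unit g"
  using Quotient3_rel_abs[OF Quotient3_L2_unit] by (simp add: L2_eq_def)

lemma abs_L2_unit_sum:
  assumes "finite F" "\<And>i. i \<in> F \<Longrightarrow> square_integrable01 (f i)"
  shows "square_integrable01 (\<lambda>x. \<Sum>i\<in>F. f i x)"
    and "abs_L2_unit (\<lambda>x. \<Sum>i\<in>F. f i x) = (\<Sum>i\<in>F. abs_L2_unit (f i))"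
proof -
  have "square_integrable01 (\<lambda>x. \<Sum>i\<in>F. f i x) \<and>
    abs_L2_unit (\<lambda>x. \<Sum>i\<in>F. f i x) = (\<Sum>i\<in>F. abs_L2_unit (f i))"
    using assms
  proof (induction F rule: finite_induct)
    case empty
    then show ?case by (simp add: square_integrable01_zero zero_L2_unit.abs_eq)
  next
    case (insert i F)
    then have *: "square_integrable01 (f i)" "square_integrable01 (\<lambda>x. \<Sum>i\<in>F. f i x)"
      "abs_L2_unit (\<lambda>x. \<Sum>i\<in>F. f i x) = (\<Sum>i\<in>F. abs_L2_unit (f i))" by auto
    show ?case
      using insert(1,2) square_integrable01_add[OF *(1,2)] abs_L2_unit_simps(1)[OF *(1,2)] *(3)
      by simp
  qed
  then show "square_integrable01 (\<lambda>x. \<Sum>i\<in>F. f i x)"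
    and "abs_L2_unit (\<lambda>x. \<Sum>i\<in>F. f i x) = (\<Sum>i\<in>F. abs_L2_unit (f i))" by auto
qed

lemma tendsto_abs_L2_unit:
  assumes f: "\<And>n. square_integrable01 (f n)" and g: "square_integrable01 g" and w: "square_integrable01 w"
    and bound: "\<And>n. AE x in unit_lborel. \<bar>f n x\<bar> \<le> w x"
    and lim: "AE x in unit_lborel. (\<lambda>n. f n x) \<longlonglongrightarrow> g x"
  shows "(\<lambda>n. abs_L2_unit (f n)) \<longlonglongrightarrow> abs_L2_unit g"
proof -
  have "(\<lambda>n. LINT x|unit_lborel. (f n x - g x)\<^sup>2) \<longlonglongrightarrow> (LINT x|unit_lborel. 0)"
  proof (rule integral_dominated_convergence)
    show "integrable unit_lborel (\<lambda>x. 2 * (w x)\<^sup>2 + 2 * (g x)\<^sup>2)"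
      using g w by (auto simp: square_integrable01_def)
    show "(\<lambda>x. (f n x - g x)\<^sup>2) \<in> borel_measurable unit_lborel" for n
      using f[of n] g by (auto simp: square_integrable01_def)
    show "AE x in unit_lborel. (\<lambda>n. (f n x - g x)\<^sup>2) \<longlonglongrightarrow> 0"
      using lim
    proof eventually_elim
      case (elim x)
      then have "(\<lambda>n. (f n x - g x)\<^sup>2) \<longlonglongrightarrow> (g x - g x)\<^sup>2" by (intro tendsto_intros)
      then show ?case by simp
    qed
    show "AE x in unit_lborel. norm ((f n x - g x)\<^sup>2) \<le> 2 * (w x)\<^sup>2 + 2 * (g x)\<^sup>2" for n
      using bound[of n]
    proof eventually_elim
      case (elim x)
      have "(f n x - g x)\<^sup>2 \<le> 2 * (f n x)\<^sup>2 + 2 * (g x)\<^sup>2"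
        using zero_le_power2[of "f n x + g x"] by (simp add: power2_diff power2_sum)
      moreover have "(f n x)\<^sup>2 \<le> (w x)\<^sup>2"
        using elim by (metis abs_ge_zero power2_abs power_mono)
      ultimately show ?case by simp
    qed
  qed simp
  then have "(\<lambda>n. (norm (abs_L2_unit (f n) - abs_L2_unit g))\<^sup>2) \<longlonglongrightarrow> 0"
    using f g by (simp add: abs_L2_unit_simps square_integrable01_diff)
  then have "(\<lambda>n. sqrt ((norm (abs_L2_unit (f n) - abs_L2_unit g))\<^sup>2)) \<longlonglongrightarrow> sqrt 0"
    by (intro tendsto_intros)
  then have "(\<lambda>n. norm (abs_L2_unit (f n) - abs_L2_unit g)) \<longlonglongrightarrow> 0" by simp
  then show ?thesis using LIM_zero_cancel tendsto_norm_zero_iff by blast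
qed

instance L2_unit :: banach
proof
  fix X :: "nat \<Rightarrow> L2_unit" assume "Cauchy X"
  then have "\<exists>M. \<forall>m\<ge>M. \<forall>n\<ge>M. norm (X m - X n) < (1/2) ^ k" for k
    by (intro CauchyD) auto
  then obtain M where M: "\<And>k m n. m \<ge> M k \<Longrightarrow> n \<ge> M k \<Longrightarrow> norm (X m - X n) < (1/2) ^ k"
    by metis
  define r where "r k = (\<Sum>i\<le>k. Suc (M i))" for k
  have r_Suc: "r k < r (Suc k)" for k unfolding r_def by simp
  then have r: "strict_mono r" by (simp add: strict_mono_Suc_iff)
  have rM: "M k \<le> r k" for k
  proof -
    have "Suc (M k) \<le> r k" unfolding r_def by (rule member_le_sum) auto
    then show ?thesis by simp
  qed
  define f where "f k = rep_L2_unit (X (r k))" for k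
  have f: "square_integrable01 (f k)" "abs_L2_unit (f k) = X (r k)" for k
    unfolding f_def by (rule abs_L2_unit_rep)+
  have fm[measurable]: "f k \<in> borel_measurable unit_lborel" for k
    using f(1)[of k] by (simp add: square_integrable01_def)
  define d where "d k x = \<bar>f (Suc k) x - f k x\<bar>" for k x
  have dm[measurable]: "d k \<in> borel_measurable unit_lborel" for k
    unfolding d_def by measurable
  have d: "square_integrable01 (d k)" for k
    using square_integrable01_diff[OF f(1) f(1), of "Suc k" k] dm[of k]
    unfolding square_integrable01_def d_def by simp
  have dn: "norm (abs_L2_unit (d k)) \<le> (1/2) ^ k" for k
  proof -
    have "(norm (abs_L2_unit (d k)))\<^sup>2 = (norm (X (r (Suc k)) - X (r k)))\<^sup>2"
      unfolding f(2)[symmetric] abs_L2_unit_simps(2)[OF f(1) f(1)]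
        abs_L2_unit_simps(4)[OF d] abs_L2_unit_simps(4)[OF square_integrable01_diff[OF f(1) f(1)]]
      by (simp add: d_def)
    then have "norm (abs_L2_unit (d k)) = norm (X (r (Suc k)) - X (r k))"
      by simp
    also have "\<dots> < (1/2) ^ k"
      using rM[of k] r_Suc[of k] by (intro M) auto
    finally show ?thesis by simp
  qed
  define g where "g n x = (\<Sum>k<n. d k x)" for n x
  have g: "square_integrable01 (g n)" "abs_L2_unit (g n) = (\<Sum>k<n. abs_L2_unit (d k))" for n
    unfolding g_def using abs_L2_unit_sum[of "{..<n}" d] d by auto
  have gm[measurable]: "g n \<in> borel_measurable unit_lborel" for n
    using g(1)[of n] by (simp add: square_integrable01_def)
  have g_int: "(LINT x|unit_lborel. (g n x)\<^sup>2) \<le> 4" for n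
  proof -
    have "norm (abs_L2_unit (g n)) \<le> (\<Sum>k<n. (1/2) ^ k)"
      unfolding g(2) using dn by (rule sum_norm_le)
    also have "\<dots> \<le> (\<Sum>k. (1/2) ^ k)"
      by (intro sum_le_suminf) auto
    also have "\<dots> = 2" by (subst suminf_geometric) auto
    finally have "(norm (abs_L2_unit (g n)))\<^sup>2 \<le> 2\<^sup>2" by (intro power_mono) auto
    then show ?thesis by (simp add: abs_L2_unit_simps(4)[OF g(1)])
  qed
  have g_nonneg: "0 \<le> g n x" for n x unfolding g_def d_def by (intro sum_nonneg) auto
  have g_mono: "g m x \<le> g n x" if "m \<le> n" for m n x
    unfolding g_def using that by (intro sum_mono2) (auto simp: d_def)
  define H where "H x = (SUP n. ennreal ((g n x)\<^sup>2))" for x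
  have Hm[measurable]: "H \<in> borel_measurable unit_lborel" unfolding H_def by measurable
  have "(\<integral>\<^sup>+x. H x \<partial>unit_lborel) = (SUP n. \<integral>\<^sup>+x. ennreal ((g n x)\<^sup>2) \<partial>unit_lborel)"
    unfolding H_def
    by (intro nn_integral_monotone_convergence_SUP)
      (auto simp: incseq_def le_fun_def intro!: ennreal_leI power_mono g_mono g_nonneg)
  also have "\<dots> \<le> 4"
  proof (rule SUP_least)
    fix n
    have "(\<integral>\<^sup>+x. ennreal ((g n x)\<^sup>2) \<partial>unit_lborel) = ennreal (LINT x|unit_lborel. (g n x)\<^sup>2)"
      using g(1)[of n] by (intro nn_integral_eq_integral) (auto simp: square_integrable01_def)
    also have "\<dots> \<le> ennreal 4" by (intro ennreal_leI g_int)
    finally show "(\<integral>\<^sup>+x. ennreal ((g n x)\<^sup>2) \<partial>unit_lborel) \<le> 4" by simp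
  qed
  finally have H4: "(\<integral>\<^sup>+x. H x \<partial>unit_lborel) \<le> 4" .
  then have H_ne: "(\<integral>\<^sup>+x. H x \<partial>unit_lborel) \<noteq> \<infinity>" by (auto simp: top_unique)
  then have H_fin: "AE x in unit_lborel. H x \<noteq> \<infinity>"
    by (intro nn_integral_PInf_AE) auto
  have summ: "summable (\<lambda>k. d k x)" if "H x \<noteq> \<infinity>" for x
  proof -
    obtain c where c: "H x = ennreal c" "c \<ge> 0" using \<open>H x \<noteq> \<infinity>\<close> by (cases "H x") auto
    have "(\<Sum>k<n. d k x) \<le> sqrt c" for n
    proof -
      have "ennreal ((g n x)\<^sup>2) \<le> H x" unfolding H_def by (rule SUP_upper) simp
      then have "(g n x)\<^sup>2 \<le> c" using c by simp
      then show ?thesis unfolding g_def[symmetric] by (rule real_le_rsqrt)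
    qed
    then show ?thesis by (intro summableI_nonneg_bounded) (auto simp: d_def)
  qed
  define u where "u x = (\<Sum>k. d k x)" for x
  have um[measurable]: "u \<in> borel_measurable unit_lborel" unfolding u_def by measurable
  have uH: "ennreal ((u x)\<^sup>2) \<le> H x" if "H x \<noteq> \<infinity>" for x
  proof (rule LIMSEQ_le_const2)
    have "(\<lambda>n. g n x) \<longlonglongrightarrow> u x"
      unfolding g_def u_def using summ[OF that] by (rule summable_LIMSEQ)
    then show "(\<lambda>n. ennreal ((g n x)\<^sup>2)) \<longlonglongrightarrow> ennreal ((u x)\<^sup>2)"
      by (intro tendsto_intros)
    show "\<exists>N. \<forall>n\<ge>N. ennreal ((g n x)\<^sup>2) \<le> H x"
      unfolding H_def by (intro exI allI impI SUP_upper UNIV_I)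
  qed
  have u: "square_integrable01 u"
    unfolding square_integrable01_def
  proof (intro conjI um integrableI_bounded)
    have "(\<integral>\<^sup>+x. ennreal (norm ((u x)\<^sup>2)) \<partial>unit_lborel) \<le> (\<integral>\<^sup>+x. H x \<partial>unit_lborel)"
      using H_fin by (intro nn_integral_mono_AE, eventually_elim) (use uH in simp)
    also have "\<dots> < \<infinity>" using H_ne by (simp add: less_top)
    finally show "(\<integral>\<^sup>+x. ennreal (norm ((u x)\<^sup>2)) \<partial>unit_lborel) < \<infinity>" .
  qed measurable
  have f_eq: "f n x = f 0 x + (\<Sum>k<n. f (Suc k) x - f k x)" for n x
    using sum_lessThan_telescope[of "\<lambda>k. f k x" n] by simp
  define F where "F x = lim (\<lambda>n. f n x)" for x
  have Fm[measurable]: "F \<in> borel_measurable unit_lborel" unfolding F_def by measurable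
  have f_lim: "(\<lambda>n. f n x) \<longlonglongrightarrow> F x" if "H x \<noteq> \<infinity>" for x
  proof -
    have "summable (\<lambda>k. f (Suc k) x - f k x)"
      using summ[OF that] unfolding d_def by (rule summable_rabs_cancel)
    then have "(\<lambda>n. f 0 x + (\<Sum>k<n. f (Suc k) x - f k x)) \<longlonglongrightarrow> f 0 x + (\<Sum>k. f (Suc k) x - f k x)"
      by (intro tendsto_intros summable_LIMSEQ)
    then have "convergent (\<lambda>n. f n x)" unfolding f_eq[symmetric] by (rule convergentI)
    then show ?thesis unfolding F_def by (simp add: convergent_LIMSEQ_iff)
  qed
  have f_bound: "\<bar>f n x\<bar> \<le> \<bar>f 0 x\<bar> + u x" if "H x \<noteq> \<infinity>" for n x
  proof -
    have "\<bar>\<Sum>k<n. f (Suc k) x - f k x\<bar> \<le> (\<Sum>k<n. d k x)" unfolding d_def by (rule sum_abs)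
    also have "\<dots> \<le> u x"
      unfolding u_def using summ[OF that] by (intro sum_le_suminf) (auto simp: d_def)
    finally show ?thesis using f_eq[of n x] by linarith
  qed
  define w where "w x = \<bar>f 0 x\<bar> + u x" for x
  have w: "square_integrable01 w"
    unfolding w_def using f(1)[of 0] u
    by (intro square_integrable01_add) (auto simp: square_integrable01_def)
  have F: "square_integrable01 F"
    unfolding square_integrable01_def
  proof (intro conjI Fm, rule Bochner_Integration.integrable_bound)
    show "integrable unit_lborel (\<lambda>x. (w x)\<^sup>2)" using w by (simp add: square_integrable01_def)
    show "AE x in unit_lborel. norm ((F x)\<^sup>2) \<le> norm ((w x)\<^sup>2)"
      using H_fin
    proof eventually_elim
      case (elim x)
      have "\<bar>F x\<bar> \<le> w x"
        using f_bound[OF elim] tendsto_rabs[OF f_lim[OF elim]]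
        by (intro LIMSEQ_le_const2[of "\<lambda>n. \<bar>f n x\<bar>"]) (auto simp: w_def)
      then show ?case by (simp add: abs_le_square_iff[symmetric])
    qed
  qed measurable
  have "(\<lambda>n. abs_L2_unit (f n)) \<longlonglongrightarrow> abs_L2_unit F"
  proof (rule tendsto_abs_L2_unit[OF f(1) F w])
    show "AE x in unit_lborel. \<bar>f n x\<bar> \<le> w x" for n
      using H_fin by eventually_elim (simp add: w_def f_bound)
    show "AE x in unit_lborel. (\<lambda>n. f n x) \<longlonglongrightarrow> F x"
      using H_fin by eventually_elim (simp add: f_lim)
  qed
  then have "(X \<circ> r) \<longlonglongrightarrow> abs_L2_unit F" by (simp add: f o_def)
  then show "convergent X"
    using Cauchy_converges_subseq[OF \<open>Cauchy X\<close> r] by (auto simp: convergent_def)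
qed

lemma emeasure_unit_lborel: "emeasure unit_lborel (space unit_lborel) < \<infinity>"
  by (simp add: space_restrict_space emeasure_restrict_space)

lemma square_integrable01_bounded:
  assumes "f \<in> borel_measurable unit_lborel" "\<And>x. \<bar>f x\<bar> \<le> c"
  shows "square_integrable01 f"
  unfolding square_integrable01_def
proof (intro conjI assms(1) integrableI_bounded_set[where A = "space unit_lborel" and B = "c\<^sup>2"])
  show "AE x in unit_lborel. x \<in> space unit_lborel \<longrightarrow> norm ((f x)\<^sup>2) \<le> c\<^sup>2"
    using assms(2) by (intro AE_I2) (simp, metis abs_ge_zero power2_abs power_mono)
  show "space unit_lborel \<in> sets unit_lborel" by (rule sets.top)
qed (use emeasure_unit_lborel assms(1) in auto)

lemma square_integrable01_indicator:
  "A \<in> sets borel \<Longrightarrow> square_integrable01 (indicator A)"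
  by (intro square_integrable01_bounded[where c = 1] measurable_restrict_space1)
    (auto simp: indicator_def[abs_def] intro: borel_measurable_indicator)

instance L2_unit :: second_countable_topology
proof
  obtain B :: "real set set" where B: "countable B" "topological_basis B"
    using ex_countable_basis by blast
  define G where "G = Inter ` {b. finite b \<and> b \<subseteq> B}"
  have cG: "countable G"
    unfolding G_def by (intro countable_image countable_Collect_finite_subset B)
  have UG: "UNIV \<in> G"
    unfolding G_def by (intro image_eqI[where x = "{}"]) auto
  have BG: "B \<subseteq> G"
  proof
    fix b assume "b \<in> B"
    then show "b \<in> G" unfolding G_def by (intro image_eqI[where x = "{b}"]) auto
  qed
  have oG: "open A" if "A \<in> G" for A
    using that topological_basis_open[OF B(2)] unfolding G_def by (auto intro!: open_Inter)
  have G_Int: "Int_stable G"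
    unfolding Int_stable_def G_def
  proof (intro ballI, elim imageE)
    fix x y a b assume "x = \<Inter>a" "a \<in> {b. finite b \<and> b \<subseteq> B}" "y = \<Inter>b" "b \<in> {b. finite b \<and> b \<subseteq> B}"
    then show "x \<inter> y \<in> Inter ` {b. finite b \<and> b \<subseteq> B}"
      by (intro image_eqI[where x = "a \<union> b"]) auto
  qed
  have "sigma_sets UNIV G = sets (borel :: real measure)"
  proof (intro equalityI)
    show "sigma_sets UNIV G \<subseteq> sets borel"
      using sets.sigma_sets_subset[of G "borel :: real measure"] oG by (simp add: subset_iff)
    have "sets (borel :: real measure) = sigma_sets UNIV B"
      using borel_eq_countable_basis[OF B] by (metis Pow_UNIV sets_measure_of subset_UNIV)
    then show "sets borel \<subseteq> sigma_sets UNIV G" using sigma_sets_mono'[OF BG] by metis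
  qed
  note sG = this
  define S :: "L2_unit set" where "S = (\<lambda>A. abs_L2_unit (indicator A)) ` G"
  define V where "V = closure (span S)"
  have V: "subspace V" "closed V"
    unfolding V_def by (intro subspace_closure subspace_span) simp
  have ind: "abs_L2_unit (indicator A) \<in> V" if "A \<in> sets borel" for A
  proof -
    have "A \<in> sigma_sets UNIV G" using that sG by simp
    with G_Int subset_UNIV[of G, folded Pow_UNIV] show ?thesis
    proof (induction A rule: sigma_sets_induct_disjoint)
      case (basic A)
      then have "abs_L2_unit (indicator A) \<in> S" by (auto simp: S_def)
      then show ?case
        unfolding V_def using closure_subset span_superset by blast
    next
      case empty
      have "abs_L2_unit (indicator {}) = 0"
        by (simp add: zero_L2_unit.abs_eq indicator_def[abs_def])
      then show ?case using subspace_0[OF V(1)] by (simp only:)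
    next
      case (compl A)
      then have A: "A \<in> sets borel" using sG by simp
      have "abs_L2_unit (indicator UNIV) \<in> S" unfolding S_def using UG by (rule imageI)
      then have "abs_L2_unit (indicator UNIV) \<in> V"
        unfolding V_def using closure_subset span_superset by blast
      then have "abs_L2_unit (indicator UNIV) - abs_L2_unit (indicator A) \<in> V"
        using compl by (intro subspace_diff V)
      also have "abs_L2_unit (indicator UNIV) - abs_L2_unit (indicator A) = abs_L2_unit (\<lambda>x. indicator UNIV x - indicator A x)"
        using A by (intro abs_L2_unit_simps square_integrable01_indicator) auto
      also have "(\<lambda>x. indicator UNIV x - indicator A x) = (indicator (UNIV - A) :: real \<Rightarrow> real)"
        by (auto simp: indicator_def fun_eq_iff)
      finally show ?case .
    next
      case (union A)
      then have A: "A n \<in> sets borel" for n using sG by auto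
      have P: "abs_L2_unit (indicator (\<Union>i<n. A i)) \<in> V" for n
      proof -
        have "indicator (\<Union>i<n. A i) = (\<lambda>x. \<Sum>i<n. indicator (A i) x :: real)"
          using union(1) by (intro ext indicator_UN_disjoint) (auto simp: disjoint_family_on_def)
        then have "abs_L2_unit (indicator (\<Union>i<n. A i)) = (\<Sum>i<n. abs_L2_unit (indicator (A i)))"
          using abs_L2_unit_sum(2)[of "{..<n}" "\<lambda>i. indicator (A i)"] A square_integrable01_indicator by simp
        then show ?thesis using union(3) by (simp add: subspace_sum[OF V(1)])
      qed
      have "(\<lambda>n. abs_L2_unit (indicator (\<Union>i<n. A i))) \<longlonglongrightarrow> abs_L2_unit (indicator (\<Union>i. A i))"
      proof (rule tendsto_abs_L2_unit[where w = "indicator UNIV"])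
        show "AE x in unit_lborel. \<bar>indicator (\<Union>i<n. A i) x\<bar> \<le> (indicator UNIV x :: real)" for n
          by (intro AE_I2) (auto simp: indicator_def)
        show "AE x in unit_lborel. (\<lambda>n. indicator (\<Union>i<n. A i) x :: real) \<longlonglongrightarrow> indicator (\<Union>i. A i) x"
          by (intro AE_I2 LIMSEQ_indicator_UN)
      qed (use A in \<open>auto intro!: square_integrable01_indicator simp del: indicator_UNIV\<close>)
      then show ?case
        using closed_sequentially[OF V(2), of "\<lambda>n. abs_L2_unit (indicator (\<Union>i<n. A i))"] P by simp
    qed
  qed
  have "f \<in> V" for f :: L2_unit
  proof -
    define g where "g = rep_L2_unit f"
    have g: "square_integrable01 g" "abs_L2_unit g = f"
      unfolding g_def by (rule abs_L2_unit_rep)+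
    then have "g \<in> borel_measurable unit_lborel" by (simp add: square_integrable01_def)
    from borel_measurable_implies_sequence_metric[OF this, of 0]
    obtain s where s: "\<And>i. simple_function unit_lborel (s i)"
      "\<And>x. x \<in> space unit_lborel \<Longrightarrow> (\<lambda>i. s i x) \<longlonglongrightarrow> g x"
      "\<And>i x. x \<in> space unit_lborel \<Longrightarrow> \<bar>s i x\<bar> \<le> 2 * \<bar>g x\<bar>"
      unfolding dist_real_def by (simp only: diff_0_right) metis
    have w: "square_integrable01 (\<lambda>x. 2 * \<bar>g x\<bar>)"
      using g(1) by (auto simp: square_integrable01_def power_mult_distrib)
    have sq: "square_integrable01 (s i)" for i
      unfolding square_integrable01_def
    proof (intro conjI, rule_tac [2] Bochner_Integration.integrable_bound)
      show sm: "s i \<in> borel_measurable unit_lborel"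
        using s(1) by (rule borel_measurable_simple_function)
      then show "(\<lambda>x. (s i x)\<^sup>2) \<in> borel_measurable unit_lborel" by measurable
      show "integrable unit_lborel (\<lambda>x. (2 * \<bar>g x\<bar>)\<^sup>2)" using w by (simp add: square_integrable01_def)
      show "AE x in unit_lborel. norm ((s i x)\<^sup>2) \<le> norm ((2 * \<bar>g x\<bar>)\<^sup>2)"
      proof (intro AE_I2)
        fix x assume "x \<in> space unit_lborel"
        then have "\<bar>s i x\<bar>\<^sup>2 \<le> (2 * \<bar>g x\<bar>)\<^sup>2" using s(3)[of x i] by (intro power_mono) auto
        then show "norm ((s i x)\<^sup>2) \<le> norm ((2 * \<bar>g x\<bar>)\<^sup>2)" by simp
      qed
    qed
    have "abs_L2_unit (s i) \<in> V" for i
    proof -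
      define R where "R = s i ` space unit_lborel"
      have R: "finite R" using s(1)[of i] by (simp add: simple_function_def R_def)
      define A where "A y = s i -` {y} \<inter> space unit_lborel" for y
      have A: "A y \<in> sets borel" for y
      proof -
        have "A y \<in> sets unit_lborel"
          using s(1)[of i] unfolding A_def by (rule simple_functionD)
        then show ?thesis by (auto simp: sets_restrict_space)
      qed
      have ya: "square_integrable01 (\<lambda>x. y * indicator (A y) x)" for y
        by (intro square_integrable01_scale square_integrable01_indicator A)
      have "abs_L2_unit (s i) = abs_L2_unit (\<lambda>x. \<Sum>y\<in>R. y * indicator (A y) x)"
      proof (rule abs_L2_unit_eqI[OF sq abs_L2_unit_sum(1)[OF R ya]])
        show "AE x in unit_lborel. s i x = (\<Sum>y\<in>R. y * indicator (A y) x)"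
        proof (intro AE_I2)
          fix x assume x: "x \<in> space unit_lborel"
          have "(\<Sum>y\<in>R. y * indicator (A y) x) = (\<Sum>y\<in>R. if y = s i x then y else 0)"
            using x by (intro sum.cong) (auto simp: A_def indicator_def)
          also have "\<dots> = s i x" using x R by (simp add: R_def)
          finally show "s i x = (\<Sum>y\<in>R. y * indicator (A y) x)" ..
        qed
      qed
      also have "\<dots> = (\<Sum>y\<in>R. abs_L2_unit (\<lambda>x. y * indicator (A y) x))"
        by (intro abs_L2_unit_sum R ya)
      also have "\<dots> = (\<Sum>y\<in>R. y *\<^sub>R abs_L2_unit (indicator (A y)))"
        by (simp add: abs_L2_unit_simps(3)[OF square_integrable01_indicator[OF A]])
      also have "\<dots> \<in> V" by (intro subspace_sum subspace_scale V ind A)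
      finally show ?thesis .
    qed
    moreover have "(\<lambda>i. abs_L2_unit (s i)) \<longlonglongrightarrow> abs_L2_unit g"
      using s(2,3) by (intro tendsto_abs_L2_unit[OF sq g(1) w] AE_I2) auto
    ultimately show ?thesis using closed_sequentially[OF V(2), of "\<lambda>i. abs_L2_unit (s i)"] g(2) by blast
  qed
  then have "closure (span S) = UNIV" by (auto simp: V_def)
  moreover have "countable S" unfolding S_def using cG by simp
  ultimately show "\<exists>B::L2_unit set set. countable B \<and> open = generate_topology B"
    by (intro second_countable_if_countable_span_dense)
qed

instance L2_unit :: separable_hilbert ..

subsection \<open>Hilbert--Schmidt operators\<close>

lemma norm_add_sq_le:
  fixes x y :: "'a::real_inner"
  shows "(norm (x + y))\<^sup>2 \<le> 2 * (norm x)\<^sup>2 + 2 * (norm y)\<^sup>2"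
proof -
  have "0 \<le> (norm (x - y))\<^sup>2" by simp
  then show ?thesis
    unfolding power2_norm_eq_inner by (simp add: inner_add inner_diff inner_commute)
qed

lemma riesz_representation:
  fixes \<phi> :: "'a::separable_hilbert \<Rightarrow> real"
  assumes "bounded_linear \<phi>"
  shows "\<exists>y. \<forall>x. \<phi> x = x \<bullet> y"
proof -
  interpret bounded_linear \<phi> by fact
  obtain B :: "'a set" where B: "orthonormal_basis B" using orthonormal_basis_exists by blast
  then have on: "\<forall>x\<in>B. norm x = 1" "pairwise orthogonal B" by (auto simp: orthonormal_basis_def)
  obtain K where K: "\<And>x. norm (\<phi> x) \<le> norm x * K" "K > 0" using pos_bounded by blast
  have bd: "(\<Sum>b\<in>F. (\<phi> b)\<^sup>2) \<le> K\<^sup>2" if F: "finite F" "F \<subseteq> B" for F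
  proof -
    define s where "s = (\<Sum>b\<in>F. (\<phi> b)\<^sup>2)"
    define z where "z = (\<Sum>b\<in>F. \<phi> b *\<^sub>R b)"
    have bb: "b \<bullet> c = (if b = c then 1 else 0)" if "b \<in> F" "c \<in> F" for b c
      using that F on unfolding pairwise_def orthogonal_def
      by (auto simp: power2_norm_eq_inner[symmetric])
    have "(norm z)\<^sup>2 = (\<Sum>b\<in>F. \<Sum>c\<in>F. \<phi> b * \<phi> c * (if b = c then 1 else 0))"
      unfolding power2_norm_eq_inner z_def inner_sum_left inner_sum_right
      by (intro sum.cong refl) (simp add: bb)
    also have "\<dots> = s"
      using F unfolding s_def by (simp add: if_distrib sum.delta' power2_eq_square cong: if_cong)
    finally have nz: "(norm z)\<^sup>2 = s" .
    have "\<phi> z = s" unfolding z_def s_def by (simp add: sum scale power2_eq_square)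
    then have "s \<le> norm z * K" using K(1)[of z] by simp
    then have "(norm z) * norm z \<le> norm z * K" using nz by (simp add: power2_eq_square)
    then have "norm z \<le> K" using K(2) by (metis less_eq_real_def mult_le_cancel_left_pos norm_ge_zero)
    then show ?thesis using nz unfolding s_def by (metis norm_ge_zero power_mono)
  qed
  then have sq: "(\<lambda>b. (\<phi> b)\<^sup>2) summable_on B"
    by (intro nonneg_bdd_above_summable_on bdd_aboveI[of _ "K\<^sup>2"]) auto
  define y where "y = (\<Sum>\<^sub>\<infinity>b\<in>B. \<phi> b *\<^sub>R b)"
  have orth: "\<phi> b *\<^sub>R b \<bullet> \<phi> c *\<^sub>R c = 0" if "b \<in> B" "c \<in> B" "b \<noteq> c" for b c
    using that on by (auto simp: pairwise_def orthogonal_def)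
  have "(\<lambda>b. (norm (\<phi> b *\<^sub>R b))\<^sup>2) summable_on B"
    using sq by (rule summable_on_cong[THEN iffD1, rotated]) (use on in simp)
  then have "((\<lambda>b. \<phi> b *\<^sub>R b) has_sum y) B"
    unfolding y_def by (intro has_sum_infsum has_sum_orthogonal(1)[OF orth])
  then have 1: "((\<lambda>b. x \<bullet> (\<phi> b *\<^sub>R b)) has_sum (x \<bullet> y)) B" for x
    by (rule has_sum_bounded_linear[OF bounded_linear_inner_right])
  have 2: "((\<lambda>b. \<phi> ((x \<bullet> b) *\<^sub>R b)) has_sum \<phi> x) B" for x
    by (rule has_sum_bounded_linear[OF assms orthonormal_basis_expansion(1)[OF B]])
  have "\<phi> x = x \<bullet> y" for x
    using has_sum_unique[OF 2[of x]] 1[of x] by (simp add: scale mult.commute)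
  then show ?thesis by blast
qed

lemma adjoint_hilbert:
  fixes f :: "'a::separable_hilbert \<Rightarrow> 'b::real_inner"
  assumes "bounded_linear f"
  shows "x \<bullet> adjoint f y = f x \<bullet> y" and "bounded_linear (adjoint f)"
proof -
  interpret bounded_linear f by fact
  have "\<exists>z. \<forall>x. f x \<bullet> y = x \<bullet> z" for y
    by (intro riesz_representation bounded_linear_compose[OF bounded_linear_inner_left assms])
  then obtain g where "\<forall>x y. f x \<bullet> y = x \<bullet> g y" by metis
  then have adj: "x \<bullet> adjoint f y = f x \<bullet> y" for x y
    using adjoint_unique by metis
  then show "x \<bullet> adjoint f y = f x \<bullet> y" .
  obtain K where K: "\<And>x. norm (f x) \<le> norm x * K" "K > 0" using pos_bounded by blast
  show "bounded_linear (adjoint f)"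
  proof (rule bounded_linear_intro)
    show "adjoint f (y + z) = adjoint f y + adjoint f z" for y z
      by (rule vector_eq_ldot[THEN iffD1]) (simp add: adj inner_add_right)
    show "adjoint f (c *\<^sub>R y) = c *\<^sub>R adjoint f y" for c y
      by (rule vector_eq_ldot[THEN iffD1]) (simp add: adj)
    show "norm (adjoint f y) \<le> norm y * K" for y
    proof -
      have "norm (adjoint f y) * norm (adjoint f y) = f (adjoint f y) \<bullet> y"
        by (simp add: adj[symmetric] power2_norm_eq_inner[symmetric] power2_eq_square)
      also have "\<dots> \<le> norm (f (adjoint f y)) * norm y" by (rule norm_cauchy_schwarz)
      also have "\<dots> \<le> (norm (adjoint f y) * K) * norm y" by (intro mult_right_mono K) auto
      finally have "norm (adjoint f y) * norm (adjoint f y) \<le> norm (adjoint f y) * (norm y * K)"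
        by (simp add: ac_simps)
      then show ?thesis using K(2)
        by (cases "norm (adjoint f y) = 0") (auto simp: mult_le_cancel_left_pos)
    qed
  qed
qed

lemma sum_sq_adjoint:
  fixes T :: "'a::separable_hilbert \<Rightarrow> 'b::separable_hilbert"
  assumes B: "orthonormal_basis B" and C: "orthonormal_basis C"
    and adj: "\<And>x y. T x \<bullet> y = x \<bullet> S y"
    and summ: "(\<lambda>b. (norm (T b))\<^sup>2) summable_on B"
  shows "((\<lambda>c. (norm (S c))\<^sup>2) has_sum (\<Sum>\<^sub>\<infinity>b\<in>B. (norm (T b))\<^sup>2)) C"
proof -
  define f where "f = (\<lambda>(b, c). (T b \<bullet> c)\<^sup>2)"
  have T: "((\<lambda>c. f (b, c)) has_sum (norm (T b))\<^sup>2) C" for b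
    unfolding f_def using orthonormal_basis_expansion(2)[OF C] by simp
  have S: "((\<lambda>b. f (b, c)) has_sum (norm (S c))\<^sup>2) B" for c
    unfolding f_def using orthonormal_basis_expansion(2)[OF B, of "S c"] by (simp add: adj inner_commute[of "S c"])
  have f: "f summable_on B \<times> C"
    by (rule summable_on_SigmaI[OF T summ]) (auto simp: f_def)
  then have "(f has_sum infsum f (B \<times> C)) (B \<times> C)" by simp
  then have "((\<lambda>b. (norm (T b))\<^sup>2) has_sum infsum f (B \<times> C)) B"
    by (rule has_sum_SigmaD) (rule T)
  then have eq: "infsum f (B \<times> C) = (\<Sum>\<^sub>\<infinity>b\<in>B. (norm (T b))\<^sup>2)"
    by (simp add: infsumI)
  have "((\<lambda>(c, b). f (b, c)) has_sum infsum f (B \<times> C)) (C \<times> B)"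
    using has_sum_swap[of f B C "infsum f (B \<times> C)"] f by auto
  then have "((\<lambda>c. (norm (S c))\<^sup>2) has_sum infsum f (B \<times> C)) C"
    by (rule has_sum_SigmaD) (use S in auto)
  then show ?thesis using eq by simp
qed

definition some_onb :: "'a::separable_hilbert set" where
  "some_onb = (SOME B. orthonormal_basis B)"

lemma some_onb: "orthonormal_basis some_onb"
  unfolding some_onb_def using orthonormal_basis_exists by (rule someI_ex)

lemma some_onb_norm: "b \<in> some_onb \<Longrightarrow> norm b = 1"
  using some_onb unfolding orthonormal_basis_def by blast

text \<open>Neither this property nor the sum of squares depends on the chosen basis, see
  \<open>hilbert_schmidt_basis_independent\<close>.\<close>

definition hilbert_schmidt :: "('a::separable_hilbert \<Rightarrow> 'a) \<Rightarrow> bool" where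
  "hilbert_schmidt T \<longleftrightarrow> bounded_linear T \<and> (\<lambda>b. (norm (T b))\<^sup>2) summable_on some_onb"

lemma hilbert_schmidt_basis_independent:
  assumes "bounded_linear T" "orthonormal_basis B"
  shows "hilbert_schmidt T \<longleftrightarrow> (\<lambda>b. (norm (T b))\<^sup>2) summable_on B"
    and "hilbert_schmidt T \<Longrightarrow> (\<Sum>\<^sub>\<infinity>b\<in>B. (norm (T b))\<^sup>2) = (\<Sum>\<^sub>\<infinity>b\<in>some_onb. (norm (T b))\<^sup>2)"
proof -
  have 1: "T x \<bullet> y = x \<bullet> adjoint T y" and 2: "adjoint T x \<bullet> y = x \<bullet> T y" for x y
    using adjoint_hilbert(1)[OF assms(1)] by (simp_all add: inner_commute)
  have *: "((\<lambda>b. (norm (T b))\<^sup>2) has_sum (\<Sum>\<^sub>\<infinity>b\<in>C. (norm (T b))\<^sup>2)) D"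
    if "(\<lambda>b. (norm (T b))\<^sup>2) summable_on C" "orthonormal_basis C" "orthonormal_basis D" for C D
  proof -
    have "((\<lambda>b. (norm (adjoint T b))\<^sup>2) has_sum (\<Sum>\<^sub>\<infinity>b\<in>C. (norm (T b))\<^sup>2)) C"
      by (rule sum_sq_adjoint[OF that(2,2) 1 that(1)])
    then show ?thesis
      using sum_sq_adjoint[OF that(2,3) 2] by (metis has_sum_iff)
  qed
  show "hilbert_schmidt T \<longleftrightarrow> (\<lambda>b. (norm (T b))\<^sup>2) summable_on B"
    unfolding hilbert_schmidt_def using * assms some_onb by (meson has_sum_imp_summable)
  show "(\<Sum>\<^sub>\<infinity>b\<in>B. (norm (T b))\<^sup>2) = (\<Sum>\<^sub>\<infinity>b\<in>some_onb. (norm (T b))\<^sup>2)" if "hilbert_schmidt T"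
    using *[OF _ some_onb assms(2)] that unfolding hilbert_schmidt_def by (metis infsumI)
qed

lemma hilbert_schmidt_zero: "hilbert_schmidt (\<lambda>_. 0)"
  unfolding hilbert_schmidt_def by simp

lemma hilbert_schmidt_add:
  assumes "hilbert_schmidt S" "hilbert_schmidt T"
  shows "hilbert_schmidt (\<lambda>x. S x + T x)"
proof -
  have "(\<lambda>b. 2 * (norm (S b))\<^sup>2 + 2 * (norm (T b))\<^sup>2) summable_on some_onb"
    using assms unfolding hilbert_schmidt_def by (intro summable_on_add summable_on_cmult_right) auto
  then have "(\<lambda>b. (norm (S b + T b))\<^sup>2) summable_on some_onb"
    by (rule summable_on_comparison_test) (auto simp: norm_add_sq_le)
  then show ?thesis
    using assms unfolding hilbert_schmidt_def by (auto intro: bounded_linear_add)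
qed

lemma hilbert_schmidt_scaleR:
  assumes "hilbert_schmidt T"
  shows "hilbert_schmidt (\<lambda>x. c *\<^sub>R T x)"
  using assms unfolding hilbert_schmidt_def
  by (auto simp: power_mult_distrib intro!: bounded_linear_const_scaleR summable_on_cmult_right)

lemma hilbert_schmidt_uminus: "hilbert_schmidt T \<Longrightarrow> hilbert_schmidt (\<lambda>x. - T x)"
  using hilbert_schmidt_scaleR[of T "- 1"] by simp

lemma hilbert_schmidt_diff:
  "hilbert_schmidt S \<Longrightarrow> hilbert_schmidt T \<Longrightarrow> hilbert_schmidt (\<lambda>x. S x - T x)"
  using hilbert_schmidt_add[OF _ hilbert_schmidt_uminus] by simp

lemma hilbert_schmidt_inner_summable:
  assumes "hilbert_schmidt S" "hilbert_schmidt T"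
  shows "(\<lambda>b. S b \<bullet> T b) summable_on some_onb"
proof -
  have "(\<lambda>b. (norm (S b))\<^sup>2 + (norm (T b))\<^sup>2) summable_on some_onb"
    using assms unfolding hilbert_schmidt_def by (intro summable_on_add) auto
  then have "(\<lambda>b. norm (S b \<bullet> T b)) summable_on some_onb"
  proof (rule summable_on_comparison_test)
    fix b
    have "norm (S b \<bullet> T b) \<le> norm (S b) * norm (T b)"
      using Cauchy_Schwarz_ineq2 by simp
    also have "\<dots> \<le> (norm (S b))\<^sup>2 + (norm (T b))\<^sup>2"
    proof -
      have "2 * (norm (S b) * norm (T b)) \<le> (norm (S b))\<^sup>2 + (norm (T b))\<^sup>2"
        using zero_le_power2[of "norm (S b) - norm (T b)"] by (simp add: power2_diff)
      moreover have "0 \<le> norm (S b) * norm (T b)" by simp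
      ultimately show ?thesis by linarith
    qed
    finally show "norm (S b \<bullet> T b) \<le> (norm (S b))\<^sup>2 + (norm (T b))\<^sup>2" .
  qed auto
  then show ?thesis by (rule Infinite_Sum.abs_summable_summable)
qed

typedef (overloaded) ('a::separable_hilbert) hs = "{T :: 'a \<Rightarrow> 'a. hilbert_schmidt T}"
  morphisms hs_apply Abs_hs
  using hilbert_schmidt_zero by auto

setup_lifting type_definition_hs

lemma hs_apply_bounded_linear: "bounded_linear (hs_apply T)"
  using hs_apply[of T] by (simp add: hilbert_schmidt_def)

instantiation hs :: (separable_hilbert) real_inner
begin

lift_definition zero_hs :: "'a hs" is "\<lambda>_. 0" by (rule hilbert_schmidt_zero)
lift_definition plus_hs :: "'a hs \<Rightarrow> 'a hs \<Rightarrow> 'a hs" is "\<lambda>S T x. S x + T x" by (rule hilbert_schmidt_add)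
lift_definition minus_hs :: "'a hs \<Rightarrow> 'a hs \<Rightarrow> 'a hs" is "\<lambda>S T x. S x - T x" by (rule hilbert_schmidt_diff)
lift_definition uminus_hs :: "'a hs \<Rightarrow> 'a hs" is "\<lambda>T x. - T x" by (rule hilbert_schmidt_uminus)
lift_definition scaleR_hs :: "real \<Rightarrow> 'a hs \<Rightarrow> 'a hs" is "\<lambda>c T x. c *\<^sub>R T x" by (rule hilbert_schmidt_scaleR)
lift_definition inner_hs :: "'a hs \<Rightarrow> 'a hs \<Rightarrow> real" is "\<lambda>S T. \<Sum>\<^sub>\<infinity>b\<in>some_onb. S b \<bullet> T b" .

definition norm_hs :: "'a hs \<Rightarrow> real" where "norm_hs T = sqrt (T \<bullet> T)"
definition dist_hs :: "'a hs \<Rightarrow> 'a hs \<Rightarrow> real" where "dist_hs S T = norm (S - T)"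
definition sgn_hs :: "'a hs \<Rightarrow> 'a hs" where "sgn_hs T = scaleR (inverse (norm T)) T"
definition uniformity_hs :: "('a hs \<times> 'a hs) filter" where
  "uniformity_hs = (INF e\<in>{0<..}. principal {(S, T). dist S T < e})"
definition open_hs :: "'a hs set \<Rightarrow> bool" where
  "open_hs U \<longleftrightarrow> (\<forall>S\<in>U. eventually (\<lambda>(S', T). S' = S \<longrightarrow> T \<in> U) uniformity)"

instance
proof
  fix R S T :: "'a hs" and a b :: real
  show "R + S + T = R + (S + T)" "R + S = S + R" "0 + R = R" "- R + R = 0" "R - S = R + - S"
    "a *\<^sub>R (R + S) = a *\<^sub>R R + a *\<^sub>R S" "(a + b) *\<^sub>R R = a *\<^sub>R R + b *\<^sub>R R"
    "a *\<^sub>R b *\<^sub>R R = (a * b) *\<^sub>R R" "1 *\<^sub>R R = R"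
    by (transfer, simp add: algebra_simps)+
  show "norm R = sqrt (R \<bullet> R)" by (rule norm_hs_def)
  show "dist R S = norm (R - S)" by (rule dist_hs_def)
  show "sgn R = inverse (norm R) *\<^sub>R R" by (rule sgn_hs_def)
  show "(uniformity :: ('a hs \<times> 'a hs) filter) = (INF e\<in>{0<..}. principal {(S, T). dist S T < e})"
    by (rule uniformity_hs_def)
  show "R \<bullet> S = S \<bullet> R" by transfer (simp add: inner_commute)
  show "(R + S) \<bullet> T = R \<bullet> T + S \<bullet> T"
    by transfer (simp add: inner_add_left infsum_add hilbert_schmidt_inner_summable)
  show "(a *\<^sub>R R) \<bullet> S = a * (R \<bullet> S)"
    by transfer (simp add: infsum_cmult_right')
  show "0 \<le> R \<bullet> R" by transfer (simp add: infsum_nonneg)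
  show "(R \<bullet> R = 0) = (R = 0)"
  proof transfer
    fix R :: "'a \<Rightarrow> 'a" assume R: "hilbert_schmidt R"
    then interpret bounded_linear R by (simp add: hilbert_schmidt_def)
    show "((\<Sum>\<^sub>\<infinity>b\<in>some_onb. R b \<bullet> R b) = 0) = (R = (\<lambda>_. 0))"
    proof
      assume *: "(\<Sum>\<^sub>\<infinity>b\<in>some_onb. R b \<bullet> R b) = 0"
      have b0: "R b = 0" if "b \<in> some_onb" for b
      proof -
        have "R b \<bullet> R b = 0"
          by (rule nonneg_infsum_le_0D[OF _ hilbert_schmidt_inner_summable[OF R R] _ that]) (use * in auto)
        then show ?thesis by simp
      qed
      have "R x = 0" for x
      proof -
        have "((\<lambda>b. R ((x \<bullet> b) *\<^sub>R b)) has_sum R x) some_onb"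
          by (rule has_sum_bounded_linear[OF bounded_linear_axioms orthonormal_basis_expansion(1)[OF some_onb]])
        moreover have "((\<lambda>b. R ((x \<bullet> b) *\<^sub>R b)) has_sum 0) some_onb"
          by (rule has_sum_0) (simp add: scale b0)
        ultimately show ?thesis by (rule has_sum_unique)
      qed
      then show "R = (\<lambda>_. 0)" by auto
    qed simp
  qed
next
  fix U :: "'a hs set"
  show "open U = (\<forall>S\<in>U. \<forall>\<^sub>F (S', T) in uniformity. S' = S \<longrightarrow> T \<in> U)"
    by (rule open_hs_def)
qed

end

lemma hs_norm_has_sum:
  assumes "orthonormal_basis B"
  shows "((\<lambda>b. (norm (hs_apply T b))\<^sup>2) has_sum (norm T)\<^sup>2) B"
proof -
  have T: "hilbert_schmidt (hs_apply T)" using hs_apply[of T] by simp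
  have "(norm T)\<^sup>2 = (\<Sum>\<^sub>\<infinity>b\<in>some_onb. (norm (hs_apply T b))\<^sup>2)"
    unfolding power2_norm_eq_inner by transfer simp
  moreover have "(\<lambda>b. (norm (hs_apply T b))\<^sup>2) summable_on B"
    using hilbert_schmidt_basis_independent(1)[OF hs_apply_bounded_linear assms] T by blast
  ultimately show ?thesis
    using hilbert_schmidt_basis_independent(2)[OF hs_apply_bounded_linear assms T] by (metis has_sum_infsum)
qed

lemma norm_hs_apply_le: "norm (hs_apply T x) \<le> norm T * norm x"
proof -
  interpret bounded_linear "hs_apply T" by (rule hs_apply_bounded_linear)
  have lim: "((\<lambda>F. norm (\<Sum>b\<in>F. hs_apply T ((x \<bullet> b) *\<^sub>R b))) \<longlongrightarrow> norm (hs_apply T x)) (finite_subsets_at_top some_onb)"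
    using has_sum_bounded_linear[OF bounded_linear_axioms orthonormal_basis_expansion(1)[OF some_onb, of x]]
    unfolding has_sum_def by (intro tendsto_norm)
  have "norm (\<Sum>b\<in>F. hs_apply T ((x \<bullet> b) *\<^sub>R b)) \<le> norm T * norm x"
    if F: "finite F" "F \<subseteq> some_onb" for F
  proof -
    have "norm (\<Sum>b\<in>F. hs_apply T ((x \<bullet> b) *\<^sub>R b)) \<le> (\<Sum>b\<in>F. norm (hs_apply T ((x \<bullet> b) *\<^sub>R b)))"
      by (rule norm_sum)
    also have "\<dots> = (\<Sum>b\<in>F. \<bar>norm (hs_apply T b)\<bar> * \<bar>x \<bullet> b\<bar>)"
      by (simp add: scale mult.commute)
    also have "\<dots> \<le> L2_set (\<lambda>b. norm (hs_apply T b)) F * L2_set (\<lambda>b. x \<bullet> b) F"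
      by (rule L2_set_mult_ineq)
    also have "\<dots> \<le> norm T * norm x"
    proof (intro mult_mono)
      show "L2_set (\<lambda>b. norm (hs_apply T b)) F \<le> norm T"
        unfolding L2_set_def
        using finite_sum_le_has_sum[OF hs_norm_has_sum[OF some_onb, of T] F]
        by (intro real_le_lsqrt) (auto intro: sum_nonneg)
      show "L2_set (\<lambda>b. x \<bullet> b) F \<le> norm x"
        unfolding L2_set_def
        using finite_sum_le_has_sum[OF orthonormal_basis_expansion(2)[OF some_onb, of x] F]
        by (intro real_le_lsqrt) (auto intro: sum_nonneg)
    qed auto
    finally show ?thesis .
  qed
  then show ?thesis
    by (intro tendsto_upperbound[OF lim] eventually_finite_subsets_at_top_weakI) auto
qed

lemma hs_apply_simps:
  "hs_apply 0 x = 0" "hs_apply (S + T) x = hs_apply S x + hs_apply T x"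
  "hs_apply (S - T) x = hs_apply S x - hs_apply T x" "hs_apply (- T) x = - hs_apply T x"
  "hs_apply (c *\<^sub>R T) x = c *\<^sub>R hs_apply T x"
  by (transfer, simp)+

lemma hs_eqI: "(\<And>x. hs_apply S x = hs_apply T x) \<Longrightarrow> S = T"
  by transfer auto

lemma bounded_linear_hs_apply_left: "bounded_linear (\<lambda>T. hs_apply T x)"
  by (rule bounded_linear_intro[where K = "norm x"]) (auto simp: hs_apply_simps norm_hs_apply_le)

instance hs :: (separable_hilbert) banach
proof
  fix X :: "nat \<Rightarrow> 'a hs" assume X: "Cauchy X"
  have "Cauchy (\<lambda>n. Blinfun (hs_apply (X n)))"
  proof (rule CauchyI)
    fix e :: real assume "e > 0"
    then obtain M where M: "\<And>m n. m \<ge> M \<Longrightarrow> n \<ge> M \<Longrightarrow> norm (X m - X n) < e"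
      using CauchyD[OF X] by blast
    have "norm (Blinfun (hs_apply (X m)) - Blinfun (hs_apply (X n))) \<le> norm (X m - X n)" for m n
    proof (rule norm_blinfun_bound)
      show "norm (blinfun_apply (Blinfun (hs_apply (X m)) - Blinfun (hs_apply (X n))) x)
        \<le> norm (X m - X n) * norm x" for x
        using norm_hs_apply_le[of "X m - X n" x]
        by (simp add: minus_blinfun.rep_eq bounded_linear_Blinfun_apply hs_apply_bounded_linear hs_apply_simps)
    qed simp
    then show "\<exists>M. \<forall>m\<ge>M. \<forall>n\<ge>M. norm (Blinfun (hs_apply (X m)) - Blinfun (hs_apply (X n))) < e"
      using M by (meson order.strict_trans1)
  qed
  then obtain L where L: "(\<lambda>n. Blinfun (hs_apply (X n))) \<longlonglongrightarrow> L"
    using Cauchy_convergent convergent_def by blast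
  define T where "T = blinfun_apply L"
  have T: "bounded_linear T" unfolding T_def by (rule blinfun.bounded_linear_right)
  have lim: "(\<lambda>n. hs_apply (X n) x) \<longlonglongrightarrow> T x" for x
    using blinfun.tendsto[OF L tendsto_const, of x]
    by (simp add: T_def bounded_linear_Blinfun_apply hs_apply_bounded_linear)
  have bound: "(\<Sum>b\<in>F. (norm (hs_apply (X n) b - T b))\<^sup>2) \<le> e\<^sup>2"
    if M: "\<And>m. m \<ge> M \<Longrightarrow> norm (X n - X m) \<le> e" and F: "finite F" "F \<subseteq> some_onb" for M n e F
  proof (rule LIMSEQ_le_const2)
    show "(\<lambda>m. \<Sum>b\<in>F. (norm (hs_apply (X n) b - hs_apply (X m) b))\<^sup>2)
      \<longlonglongrightarrow> (\<Sum>b\<in>F. (norm (hs_apply (X n) b - T b))\<^sup>2)"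
      by (intro tendsto_intros lim)
    have "(\<Sum>b\<in>F. (norm (hs_apply (X n) b - hs_apply (X m) b))\<^sup>2) \<le> e\<^sup>2" if "m \<ge> M" for m
    proof -
      have "(\<Sum>b\<in>F. (norm (hs_apply (X n - X m) b))\<^sup>2) \<le> (norm (X n - X m))\<^sup>2"
        by (intro finite_sum_le_has_sum[OF hs_norm_has_sum[OF some_onb]] F) auto
      also have "\<dots> \<le> e\<^sup>2" using M[OF that] by (intro power_mono) auto
      finally show ?thesis by (simp add: hs_apply_simps)
    qed
    then show "\<exists>N. \<forall>m\<ge>N. (\<Sum>b\<in>F. (norm (hs_apply (X n) b - hs_apply (X m) b))\<^sup>2) \<le> e\<^sup>2" by blast
  qed
  have diff_hs: "hilbert_schmidt (\<lambda>x. hs_apply (X n) x - T x)" if "\<And>m. m \<ge> M \<Longrightarrow> norm (X n - X m) \<le> e" for M n e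
    unfolding hilbert_schmidt_def
    using bound[OF that]
    by (intro conjI bounded_linear_sub hs_apply_bounded_linear T nonneg_bdd_above_summable_on bdd_aboveI[of _ "e\<^sup>2"]) auto
  obtain M1 where M1: "\<And>m n. m \<ge> M1 \<Longrightarrow> n \<ge> M1 \<Longrightarrow> norm (X m - X n) < 1"
    using CauchyD[OF X, of 1] by auto
  have "hilbert_schmidt (\<lambda>x. hs_apply (X M1) x - (hs_apply (X M1) x - T x))"
    using hs_apply[of "X M1"] M1 by (intro hilbert_schmidt_diff diff_hs[of M1 M1 1]) (auto intro: less_imp_le)
  then have "hilbert_schmidt T" by simp
  then have T_app: "hs_apply (Abs_hs T) x = T x" for x by (simp add: Abs_hs_inverse)
  have "X \<longlonglongrightarrow> Abs_hs T"
  proof (rule LIMSEQ_I)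
    fix e :: real assume "e > 0"
    then obtain M where M: "\<And>m n. m \<ge> M \<Longrightarrow> n \<ge> M \<Longrightarrow> norm (X m - X n) < e / 2"
      using CauchyD[OF X, of "e/2"] by auto
    have "norm (X n - Abs_hs T) < e" if "n \<ge> M" for n
    proof -
      have "(norm (X n - Abs_hs T))\<^sup>2 \<le> (e / 2)\<^sup>2"
        using hs_norm_has_sum[OF some_onb, of "X n - Abs_hs T"]
      proof (rule has_sum_le_finite_sums)
        fix F :: "'a set" assume F: "finite F" "F \<subseteq> some_onb"
        have "(\<Sum>b\<in>F. (norm (hs_apply (X n) b - T b))\<^sup>2) \<le> (e/2)\<^sup>2"
          using M \<open>n \<ge> M\<close> by (intro bound[of M] F) (auto intro: less_imp_le)
        then show "(\<Sum>b\<in>F. (norm (hs_apply (X n - Abs_hs T) b))\<^sup>2) \<le> (e / 2)\<^sup>2"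
          by (simp add: hs_apply_simps T_app)
      qed
      then have "norm (X n - Abs_hs T) \<le> e / 2" by (rule power2_le_imp_le) (use \<open>e > 0\<close> in simp)
      then show ?thesis using \<open>e > 0\<close> by simp
    qed
    then show "\<exists>no. \<forall>n\<ge>no. norm (X n - Abs_hs T) < e" by blast
  qed
  then show "convergent X" by (rule convergentI)
qed

lemma hilbert_schmidt_rank_one: "hilbert_schmidt (\<lambda>z. (y \<bullet> z) *\<^sub>R x)"
proof -
  have "(\<lambda>b. (y \<bullet> b)\<^sup>2 * (norm x)\<^sup>2) summable_on some_onb"
    using orthonormal_basis_expansion(2)[OF some_onb, of y]
    by (intro summable_on_cmult_left) (rule has_sum_imp_summable)
  then show ?thesis
    unfolding hilbert_schmidt_def
    by (simp add: power_mult_distrib bounded_linear_scaleR_const[OF bounded_linear_inner_right])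
qed

lift_definition outer :: "'a::separable_hilbert \<Rightarrow> 'a \<Rightarrow> 'a hs" (infixr "\<otimes>" 70)
  is "\<lambda>x y z. (y \<bullet> z) *\<^sub>R x" by (rule hilbert_schmidt_rank_one)

lemma hs_apply_outer [simp]: "hs_apply (x \<otimes> y) z = (y \<bullet> z) *\<^sub>R x"
  by transfer simp

lemma inner_hs_has_sum: "((\<lambda>b. hs_apply S b \<bullet> hs_apply T b) has_sum (S \<bullet> T)) some_onb"
proof -
  have "(\<lambda>b. hs_apply S b \<bullet> hs_apply T b) summable_on some_onb"
    using hs_apply[of S] hs_apply[of T] by (intro hilbert_schmidt_inner_summable) auto
  moreover have "S \<bullet> T = (\<Sum>\<^sub>\<infinity>b\<in>some_onb. hs_apply S b \<bullet> hs_apply T b)" by transfer simp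
  ultimately show ?thesis by simp
qed

lemma inner_outer: "T \<bullet> (x \<otimes> y) = hs_apply T y \<bullet> x"
proof -
  have "((\<lambda>b. hs_apply T ((y \<bullet> b) *\<^sub>R b) \<bullet> x) has_sum (hs_apply T y \<bullet> x)) some_onb"
    by (intro has_sum_bounded_linear[OF bounded_linear_inner_left]
        has_sum_bounded_linear[OF hs_apply_bounded_linear] orthonormal_basis_expansion some_onb)
  moreover have "hs_apply T ((y \<bullet> b) *\<^sub>R b) \<bullet> x = hs_apply T b \<bullet> hs_apply (x \<otimes> y) b" for b
    by (simp add: bounded_linear.linear[OF hs_apply_bounded_linear] linear_cmul)
  ultimately show ?thesis
    using inner_hs_has_sum[of T "x \<otimes> y"] has_sum_unique by auto
qed

lemma norm_outer: "norm (x \<otimes> y) = norm x * norm y"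
proof -
  have "(norm (x \<otimes> y))\<^sup>2 = (norm x * norm y)\<^sup>2"
    unfolding power2_norm_eq_inner by (simp add: inner_outer power_mult_distrib power2_norm_eq_inner)
  then show ?thesis by simp
qed

lemma outer_basis:
  fixes B C :: "'a::separable_hilbert set"
  assumes "orthonormal_basis B" "orthonormal_basis C"
  defines "D \<equiv> (\<lambda>(b, c). b \<otimes> c) ` (B \<times> C)"
  shows "\<forall>x\<in>D. norm x = 1" "pairwise orthogonal D" "closure (span D) = UNIV"
proof -
  show 1: "\<forall>x\<in>D. norm x = 1"
    using assms by (auto simp: norm_outer orthonormal_basis_def)
  show 2: "pairwise orthogonal D"
    unfolding pairwise_def
  proof (intro ballI impI)
    fix x y assume "x \<in> D" "y \<in> D" "x \<noteq> y"
    then obtain b c b' c' where *: "x = b \<otimes> c" "y = b' \<otimes> c'" "b \<in> B" "b' \<in> B" "c \<in> C" "c' \<in> C"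
      unfolding D_def by auto
    then have "b \<noteq> b' \<or> c \<noteq> c'" using \<open>x \<noteq> y\<close> by auto
    then have "(c \<bullet> c') * (b \<bullet> b') = 0"
      using * assms(1,2) unfolding orthonormal_basis_def pairwise_def orthogonal_def by auto
    then show "orthogonal x y" by (simp add: orthogonal_def * inner_outer)
  qed
  show "closure (span D) = UNIV"
  proof (rule closure_span_orthonormal[OF 1 2])
    fix T :: "'a hs" assume T: "\<forall>d\<in>D. T \<bullet> d = 0"
    have "((\<lambda>c. (norm (hs_apply T c))\<^sup>2) has_sum 0) C"
    proof (rule has_sum_0)
      fix c assume "c \<in> C"
      have "((\<lambda>b. (hs_apply T c \<bullet> b)\<^sup>2) has_sum 0) B"
        using T \<open>c \<in> C\<close> by (intro has_sum_0) (auto simp: D_def inner_outer[symmetric])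
      then show "(norm (hs_apply T c))\<^sup>2 = 0"
        using orthonormal_basis_expansion(2)[OF assms(1)] has_sum_unique by blast
    qed
    then have "(norm T)\<^sup>2 = 0"
      using hs_norm_has_sum[OF assms(2)] has_sum_unique by blast
    then show "T = 0" by simp
  qed
qed

instance hs :: (separable_hilbert) second_countable_topology
proof
  have "countable ((\<lambda>(b, c). b \<otimes> c) ` (some_onb \<times> some_onb :: ('a \<times> 'a) set))"
    using countable_orthonormal_basis[OF some_onb] by auto
  then show "\<exists>B::'a hs set set. countable B \<and> open = generate_topology B"
    using outer_basis(3)[OF some_onb some_onb] by (rule second_countable_if_countable_span_dense)
qed

instance hs :: (separable_hilbert) separable_hilbert ..

lift_definition hs_adjoint :: "'a::separable_hilbert hs \<Rightarrow> 'a hs" is adjoint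
proof -
  fix T :: "'a \<Rightarrow> 'a" assume T: "hilbert_schmidt T"
  then have bl: "bounded_linear T" by (simp add: hilbert_schmidt_def)
  have "((\<lambda>c. (norm (adjoint T c))\<^sup>2) has_sum (\<Sum>\<^sub>\<infinity>b\<in>some_onb. (norm (T b))\<^sup>2)) some_onb"
    using T adjoint_hilbert(1)[OF bl] by (intro sum_sq_adjoint some_onb) (auto simp: hilbert_schmidt_def)
  then show "hilbert_schmidt (adjoint T)"
    using adjoint_hilbert(2)[OF bl] by (auto simp: hilbert_schmidt_def dest: has_sum_imp_summable)
qed

lemma hs_expansion:
  assumes "orthonormal_basis B" "orthonormal_basis C"
  shows "((\<lambda>(b, c). (b \<bullet> hs_apply T c) *\<^sub>R (b \<otimes> c)) has_sum T) (B \<times> C)"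
proof -
  define D where "D = (\<lambda>(b, c). b \<otimes> c) ` (B \<times> C)"
  have D: "orthonormal_basis D"
    using outer_basis[OF assms] unfolding orthonormal_basis_def D_def by blast
  have inj: "inj_on (\<lambda>(b, c). b \<otimes> c) (B \<times> C)"
  proof (rule inj_onI, clarify)
    fix b c b' c' assume *: "b \<in> B" "c \<in> C" "b' \<in> B" "c' \<in> C" "b \<otimes> c = b' \<otimes> c'"
    have "(b \<otimes> c) \<bullet> (b' \<otimes> c') = 1"
      unfolding *(5) power2_norm_eq_inner[symmetric]
      using * assms by (simp add: norm_outer orthonormal_basis_def)
    then have "c \<bullet> c' \<noteq> 0" "b \<bullet> b' \<noteq> 0" by (auto simp: inner_outer inner_commute)
    then show "b = b' \<and> c = c'"
      using * assms unfolding orthonormal_basis_def pairwise_def orthogonal_def by blast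
  qed
  have "((\<lambda>d. (T \<bullet> d) *\<^sub>R d) has_sum T) D"
    by (rule orthonormal_basis_expansion[OF D])
  then have "(((\<lambda>d. (T \<bullet> d) *\<^sub>R d) \<circ> (\<lambda>(b, c). b \<otimes> c)) has_sum T) (B \<times> C)"
    unfolding D_def using has_sum_reindex[OF inj] by blast
  then show ?thesis
    by (simp add: o_def case_prod_unfold inner_outer inner_commute)
qed

subsection \<open>Tensor products and partial traces\<close>

text \<open>\<open>hs_trace\<close>, \<open>ptrace1\<close> and \<open>ptrace2\<close> are total functions on Hilbert--Schmidt operators and
  use the basis \<^const>\<open>some_onb\<close>. On trace-class operators, the only ones to which
  they are applied below, the series converge and do not depend on the basis.\<close>

definition hs_trace :: "'a::separable_hilbert hs \<Rightarrow> real" where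
  "hs_trace T = (\<Sum>\<^sub>\<infinity>b\<in>some_onb. b \<bullet> hs_apply T b)"

text \<open>The space \<open>H\<^sub>1 \<otimes> H\<^sub>2\<close> with \<open>H\<^sub>1 = \<real>\<^sup>S\<close> is the type \<open>'b ^ 's\<close>.\<close>

definition vec_tensor :: "real ^ 's \<Rightarrow> 'b::real_vector \<Rightarrow> 'b ^ 's" where
  "vec_tensor u v = (\<chi> i. (u $ i) *\<^sub>R v)"

definition op_tensor ::
  "(real ^ 's::finite) hs \<Rightarrow> 'b::separable_hilbert hs \<Rightarrow> ('b ^ 's) hs" (infixr "\<otimes>\<^sub>o" 70) where
  "A \<otimes>\<^sub>o B =
     (THE T. \<forall>u v. hs_apply T (vec_tensor u v) = vec_tensor (hs_apply A u) (hs_apply B v))"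

text \<open>For \<open>T = \<Sum> T\<^sub>i\<^sub>j\<^sub>k\<^sub>l (u\<^sub>i \<otimes> v\<^sub>j) \<otimes> (u\<^sub>k \<otimes> v\<^sub>l)\<close> one has
  \<open>T\<^sub>i\<^sub>j\<^sub>k\<^sub>l = \<langle>u\<^sub>i \<otimes> v\<^sub>j, T (u\<^sub>k \<otimes> v\<^sub>l)\<rangle>\<close>.\<close>

definition ptrace1 :: "('b::separable_hilbert ^ 's::finite) hs \<Rightarrow> 'b hs" where
  "ptrace1 T = (\<Sum>\<^sub>\<infinity>(v, w)\<in>some_onb \<times> some_onb.
     (\<Sum>\<^sub>\<infinity>u\<in>some_onb. vec_tensor u v \<bullet> hs_apply T (vec_tensor u w)) *\<^sub>R (v \<otimes> w))"

definition ptrace2 :: "('b::separable_hilbert ^ 's::finite) hs \<Rightarrow> (real ^ 's) hs" where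
  "ptrace2 T = (\<Sum>\<^sub>\<infinity>(u, u')\<in>some_onb \<times> some_onb.
     (\<Sum>\<^sub>\<infinity>v\<in>some_onb. vec_tensor u v \<bullet> hs_apply T (vec_tensor u' v)) *\<^sub>R (u \<otimes> u'))"

lemma vec_tensor_axis: "vec_tensor (axis i 1) x = axis i x"
  by (simp add: vec_tensor_def axis_def vec_eq_iff)

lemma vec_eq_sum_axis: "x = (\<Sum>i\<in>UNIV. axis i (x $ i))"
  by (simp add: vec_eq_iff axis_def if_distrib sum.delta cong: if_cong)

lemma norm_axis: "norm (axis i x :: 'b::real_inner ^ 's::finite) = norm x"
  by (simp add: norm_eq_sqrt_inner inner_axis axis_nth)

lemma inner_vec_tensor: "vec_tensor u v \<bullet> vec_tensor u' v' = (u \<bullet> u') * (v \<bullet> v')"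
  by (simp add: vec_tensor_def inner_vec_def sum_distrib_left ac_simps)

lemma orthonormal_basis_axis:
  assumes "orthonormal_basis (B :: 'b::separable_hilbert set)"
  shows "orthonormal_basis ((\<lambda>(i, b). axis i b :: 'b ^ 's::finite) ` (UNIV \<times> B))"
proof -
  have 1: "\<forall>x\<in>(\<lambda>(i, b). axis i b :: 'b ^ 's) ` (UNIV \<times> B). norm x = 1"
    using assms by (auto simp: orthonormal_basis_def norm_axis)
  have ax: "axis i x \<bullet> axis j y = (if i = j then x \<bullet> y else 0)" for i j :: 's and x y :: 'b
    by (simp add: inner_axis) (simp add: axis_def)
  have 2: "pairwise orthogonal ((\<lambda>(i, b). axis i b :: 'b ^ 's) ` (UNIV \<times> B))"
    unfolding pairwise_def orthogonal_def
  proof (clarify)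
    fix i j :: 's and x y assume "x \<in> B" "y \<in> B" "(axis i x :: 'b ^ 's) \<noteq> axis j y"
    then show "(axis i x :: 'b ^ 's) \<bullet> axis j y = 0"
      using assms unfolding ax orthonormal_basis_def pairwise_def orthogonal_def by auto
  qed
  have 3: "x = 0" if x: "\<forall>b\<in>(\<lambda>(i, b). axis i b) ` (UNIV \<times> B). x \<bullet> b = 0" for x :: "'b ^ 's"
  proof -
    have "x $ i = 0" for i
    proof -
      have "((\<lambda>b. (x $ i \<bullet> b) *\<^sub>R b) has_sum 0) B"
        using x by (intro has_sum_0) (auto simp: inner_axis)
      then show ?thesis
        using orthonormal_basis_expansion(1)[OF assms, of "x $ i"] has_sum_unique by blast
    qed
    then show ?thesis by (simp add: vec_eq_iff)
  qed
  show ?thesis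
    unfolding orthonormal_basis_def using 1 2 closure_span_orthonormal[OF 1 2 3] by blast
qed

lemma hilbert_schmidt_sum:
  "finite I \<Longrightarrow> (\<And>i. i \<in> I \<Longrightarrow> hilbert_schmidt (f i)) \<Longrightarrow> hilbert_schmidt (\<lambda>x. \<Sum>i\<in>I. f i x)"
  by (induction I rule: finite_induct) (auto simp: hilbert_schmidt_zero intro!: hilbert_schmidt_add)

lemma hilbert_schmidt_block:
  fixes B :: "'b::separable_hilbert hs" and i k :: "'s::finite"
  shows "hilbert_schmidt (\<lambda>x. axis i (hs_apply B (x $ k)))"
proof -
  define T :: "'b ^ 's \<Rightarrow> 'b ^ 's" where "T = (\<lambda>x. axis i (hs_apply B (x $ k)))"
  have ax: "bounded_linear (axis i :: 'b \<Rightarrow> 'b ^ 's)"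
    by (rule bounded_linear_intro[where K = 1]) (auto simp: norm_axis, auto simp: axis_def vec_eq_iff)
  have T: "bounded_linear T"
    unfolding T_def
    by (rule bounded_linear_compose[OF ax bounded_linear_compose[OF hs_apply_bounded_linear bounded_linear_vec_nth]])
  define D where "D = (\<lambda>(i, b). axis i b :: 'b ^ 's) ` (UNIV \<times> some_onb)"
  have D: "orthonormal_basis D" unfolding D_def by (rule orthonormal_basis_axis[OF some_onb])
  have inj: "inj_on (axis k :: 'b \<Rightarrow> 'b ^ 's) some_onb" by (auto intro!: inj_onI simp: axis_eq_axis)
  have "(\<lambda>b. (norm (T (axis k b)))\<^sup>2) summable_on some_onb"
    unfolding T_def using hs_norm_has_sum[OF some_onb, of B] has_sum_imp_summable by (auto simp: axis_nth norm_axis)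
  then have "(\<lambda>x. (norm (T x))\<^sup>2) summable_on (axis k ` some_onb)"
    using summable_on_reindex[OF inj, of "\<lambda>x. (norm (T x))\<^sup>2"] by (simp add: o_def)
  moreover have "(norm (T x))\<^sup>2 = 0" if "x \<in> D - axis k ` some_onb" for x
  proof -
    from that obtain j b where x: "x = axis j b" "j \<noteq> k" unfolding D_def by auto
    then have "x $ k = 0" by (simp add: axis_def)
    then show ?thesis
      by (simp add: T_def bounded_linear.linear[OF hs_apply_bounded_linear] linear_0 bounded_linear.linear[OF ax])
  qed
  ultimately have "(\<lambda>x. (norm (T x))\<^sup>2) summable_on D"
    by (subst summable_on_cong_neutral[where T = "axis k ` some_onb" and g = "\<lambda>x. (norm (T x))\<^sup>2"])
      (auto simp: D_def)
  then show ?thesis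
    using hilbert_schmidt_basis_independent(1)[OF T D] unfolding T_def by blast
qed

lemma hs_eq_vec_tensorI:
  assumes "\<And>u v. hs_apply S (vec_tensor u v) = hs_apply T (vec_tensor u v)"
  shows "S = T"
proof (rule hs_eqI)
  fix x
  have "hs_apply S (axis i y) = hs_apply T (axis i y)" for i y
    using assms[of "axis i 1" y] by (simp add: vec_tensor_axis)
  then have "hs_apply S (\<Sum>i\<in>UNIV. axis i (x $ i)) = hs_apply T (\<Sum>i\<in>UNIV. axis i (x $ i))"
    by (simp add: linear_sum[OF bounded_linear.linear[OF hs_apply_bounded_linear]])
  then show "hs_apply S x = hs_apply T x" by (metis vec_eq_sum_axis)
qed

lemma hs_apply_op_tensor:
  "hs_apply (A \<otimes>\<^sub>o B) (vec_tensor u v) = vec_tensor (hs_apply A u) (hs_apply B v)"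
proof -
  define T where
    "T x = (\<Sum>i\<in>UNIV. \<Sum>k\<in>UNIV. (hs_apply A (axis k 1) $ i) *\<^sub>R axis i (hs_apply B (x $ k)))" for x
  have "hilbert_schmidt T"
    unfolding T_def
    by (intro hilbert_schmidt_sum hilbert_schmidt_scaleR hilbert_schmidt_block) auto
  then have T: "hs_apply (Abs_hs T) x = T x" for x by (simp add: Abs_hs_inverse)
  have "T (vec_tensor u v) = vec_tensor (hs_apply A u) (hs_apply B v)" for u v
  proof -
    have "hs_apply A u = (\<Sum>k\<in>UNIV. (u $ k) *\<^sub>R hs_apply A (axis k 1))"
    proof -
      have "hs_apply A (\<Sum>k\<in>UNIV. (u $ k) *\<^sub>R axis k 1) = (\<Sum>k\<in>UNIV. (u $ k) *\<^sub>R hs_apply A (axis k 1))"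
        by (simp add: linear_sum[OF bounded_linear.linear[OF hs_apply_bounded_linear]]
            linear_cmul[OF bounded_linear.linear[OF hs_apply_bounded_linear]])
      moreover have "(\<Sum>k\<in>UNIV. (u $ k) *\<^sub>R axis k 1) = u"
        by (simp add: vec_eq_iff axis_def if_distrib sum.delta cong: if_cong)
      ultimately show ?thesis by simp
    qed
    then have Au: "hs_apply A u $ i = (\<Sum>k\<in>UNIV. u $ k * hs_apply A (axis k 1) $ i)" for i
      by simp
    have "T (vec_tensor u v) $ i = (\<Sum>k\<in>UNIV. (hs_apply A (axis k 1) $ i) *\<^sub>R hs_apply B (u $ k *\<^sub>R v))" for i
    proof -
      have "T (vec_tensor u v) $ i = (\<Sum>j\<in>UNIV. if j = i then
         (\<Sum>k\<in>UNIV. (hs_apply A (axis k 1) $ i) *\<^sub>R hs_apply B (u $ k *\<^sub>R v)) else 0)"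
        unfolding T_def sum_component
        by (intro sum.cong) (auto simp: axis_def vec_tensor_def)
      then show ?thesis by simp
    qed
    then show ?thesis
      by (simp add: vec_eq_iff vec_tensor_def Au scaleR_sum_left
          linear_cmul[OF bounded_linear.linear[OF hs_apply_bounded_linear]] mult.commute)
  qed
  then have ex: "\<forall>u v. hs_apply (Abs_hs T) (vec_tensor u v) = vec_tensor (hs_apply A u) (hs_apply B v)"
    by (simp add: T)
  have "\<forall>u v. hs_apply (A \<otimes>\<^sub>o B) (vec_tensor u v) = vec_tensor (hs_apply A u) (hs_apply B v)"
    unfolding op_tensor_def
    by (rule theI[where P = "\<lambda>T. \<forall>u v. hs_apply T (vec_tensor u v) = vec_tensor (hs_apply A u) (hs_apply B v)", OF ex])
      (use ex in \<open>auto intro: hs_eq_vec_tensorI\<close>)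
  then show ?thesis by blast
qed

lemma ptrace_op_tensor:
  "ptrace1 (A \<otimes>\<^sub>o B) = hs_trace A *\<^sub>R B" "ptrace2 (A \<otimes>\<^sub>o B) = hs_trace B *\<^sub>R A"
proof -
  have "ptrace1 (A \<otimes>\<^sub>o B) =
    (\<Sum>\<^sub>\<infinity>x\<in>some_onb \<times> some_onb. hs_trace A *\<^sub>R (case x of (v, w) \<Rightarrow> (v \<bullet> hs_apply B w) *\<^sub>R (v \<otimes> w)))"
    unfolding ptrace1_def hs_trace_def
    by (intro infsum_cong) (auto simp: hs_apply_op_tensor inner_vec_tensor infsum_cmult_left')
  also have "\<dots> = hs_trace A *\<^sub>R B"
    by (intro infsumI has_sum_bounded_linear[OF bounded_linear_scaleR_right] hs_expansion some_onb)
  finally show "ptrace1 (A \<otimes>\<^sub>o B) = hs_trace A *\<^sub>R B" .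
  have "ptrace2 (A \<otimes>\<^sub>o B) =
    (\<Sum>\<^sub>\<infinity>x\<in>some_onb \<times> some_onb. hs_trace B *\<^sub>R (case x of (v, w) \<Rightarrow> (v \<bullet> hs_apply A w) *\<^sub>R (v \<otimes> w)))"
    unfolding ptrace2_def hs_trace_def
    by (intro infsum_cong) (auto simp: hs_apply_op_tensor inner_vec_tensor infsum_cmult_right')
  also have "\<dots> = hs_trace B *\<^sub>R A"
    by (intro infsumI has_sum_bounded_linear[OF bounded_linear_scaleR_right] hs_expansion some_onb)
  finally show "ptrace2 (A \<otimes>\<^sub>o B) = hs_trace B *\<^sub>R A" .
qed

subsection \<open>\<open>L\<^sup>p\<close>-\<open>m\<close>-approximability\<close>

text \<open>The value \<open>\<infinity>\<close> avoids the convention that a Bochner integral of a non-integrable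
  function is \<open>0\<close>.\<close>

definition nu :: "'w measure \<Rightarrow> real \<Rightarrow> ('w \<Rightarrow> 'h::real_normed_vector) \<Rightarrow> ennreal" where
  "nu P p Z =
     (if integrable P (\<lambda>\<omega>. norm (Z \<omega>) powr p)
      then ennreal ((LINT \<omega>|P. norm (Z \<omega>) powr p) powr (1 / p)) else \<infinity>)"

text \<open>\<open>u' n M\<close> is the copy of \<open>u\<close> that is used to build \<open>Z\<^bsub>n,M\<^esub>\<close>. In the independent family
  below, the index \<^term>\<open>None\<close> stands for \<open>u\<close> itself and \<open>Some (n, M)\<close> for this copy.\<close>

definition independent_copies ::
  "'w measure \<Rightarrow> 'u measure \<Rightarrow> (int \<Rightarrow> 'w \<Rightarrow> 'u) \<Rightarrow> (int \<Rightarrow> nat \<Rightarrow> int \<Rightarrow> 'w \<Rightarrow> 'u) \<Rightarrow> bool" where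
  "independent_copies P U u u' \<longleftrightarrow>
     (\<forall>n M. distr P (\<Pi>\<^sub>M k\<in>UNIV. U) (\<lambda>\<omega> k. u' n M k \<omega>) = distr P (\<Pi>\<^sub>M k\<in>UNIV. U) (\<lambda>\<omega> k. u k \<omega>)) \<and>
     prob_space.indep_vars P (\<lambda>_. \<Pi>\<^sub>M k\<in>UNIV. U)
       (\<lambda>c \<omega> k. case c of None \<Rightarrow> u k \<omega> | Some (n, M) \<Rightarrow> u' n M k \<omega>) UNIV"

definition Lp_m_approximable ::
  "'w measure \<Rightarrow> 'u measure \<Rightarrow> real \<Rightarrow> (int \<Rightarrow> 'w \<Rightarrow> 'h::separable_hilbert) \<Rightarrow> bool" where
  "Lp_m_approximable P U p Z \<longleftrightarrow>
     p \<ge> 1 \<and> (\<forall>n. Z n \<in> borel_measurable P \<and> nu P p (Z n) < \<infinity>) \<and>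
     (\<exists>f u u'.
        f \<in> borel_measurable (\<Pi>\<^sub>M k\<in>(UNIV :: nat set). U) \<and>
        prob_space.indep_vars P (\<lambda>_. U) u UNIV \<and>
        (\<forall>i j. distr P U (u i) = distr P U (u j)) \<and>
        (\<forall>n. AE \<omega> in P. Z n \<omega> = f (\<lambda>k. u (n - int k) \<omega>)) \<and>
        independent_copies P U u u' \<and>
        (\<forall>n. (\<Sum>M. nu P p (\<lambda>\<omega>. Z n \<omega> -
           f (\<lambda>k. if k \<le> Suc M then u (n - int k) \<omega> else u' n (Suc M) (n - int k) \<omega>))) < \<infinity>))"

subsection \<open>Covariances, estimators and the test statistic\<close>

text \<open>For an approximable sequence the lag-\<open>h\<close> covariance operator does not depend on the time
  index, which is taken to be \<open>1\<close>.\<close>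

definition lag_cov :: "'w measure \<Rightarrow> (int \<Rightarrow> 'w \<Rightarrow> 'h::separable_hilbert) \<Rightarrow> nat \<Rightarrow> 'h hs" where
  "lag_cov P X h = (LINT \<omega>|P. X 1 \<omega> \<otimes> X (1 + int h) \<omega>)"

definition sample_cov :: "(int \<Rightarrow> 'w \<Rightarrow> 'h::separable_hilbert) \<Rightarrow> nat \<Rightarrow> nat \<Rightarrow> 'w \<Rightarrow> 'h hs" where
  "sample_cov X h N \<omega> =
     (1 / real (N - h)) *\<^sub>R (\<Sum>n = 1..N - h. X (int n) \<omega> \<otimes> X (int n + int h) \<omega>)"

definition sep1 :: "('b::separable_hilbert ^ 's::finite) hs \<Rightarrow> (real ^ 's) hs" where
  "sep1 D = (if hs_trace D = 0 then 0 else (1 / hs_trace D) *\<^sub>R ptrace2 D)"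

definition sep2 :: "('b::separable_hilbert ^ 's::finite) hs \<Rightarrow> 'b hs" where
  "sep2 D = ptrace1 D"

definition test_stat ::
  "(int \<Rightarrow> 'w \<Rightarrow> 'b::separable_hilbert ^ 's::finite) \<Rightarrow> nat \<Rightarrow> nat \<Rightarrow> 'w \<Rightarrow> real" where
  "test_stat X h N \<omega> =
     (let D = sample_cov X h N \<omega> in real N * (norm (sep1 D \<otimes>\<^sub>o sep2 D - D))\<^sup>2)"

subsection \<open>The limiting covariance operator\<close>

definition M_map ::
  "('b::separable_hilbert ^ 's::finite) hs \<Rightarrow> ('b ^ 's) hs \<Rightarrow> (real ^ 's) hs \<times> 'b hs \<times> ('b ^ 's) hs" where
  "M_map C D =
     ((1 / hs_trace C) *\<^sub>R ptrace2 D - (hs_trace D / (hs_trace C)\<^sup>2) *\<^sub>R ptrace2 C, ptrace1 D, D)"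

definition G_map ::
  "('b::separable_hilbert ^ 's::finite) hs \<Rightarrow> (real ^ 's) hs \<times> 'b hs \<times> ('b ^ 's) hs \<Rightarrow> ('b ^ 's) hs" where
  "G_map C = (\<lambda>(A, B, D). A \<otimes>\<^sub>o sep2 C + sep1 C \<otimes>\<^sub>o B - D)"

definition centred_product ::
  "'w measure \<Rightarrow> (int \<Rightarrow> 'w \<Rightarrow> 'h::separable_hilbert) \<Rightarrow> nat \<Rightarrow> int \<Rightarrow> 'w \<Rightarrow> 'h hs" where
  "centred_product P X h n \<omega> = X n \<omega> \<otimes> X (n + int h) \<omega> - lag_cov P X h"

definition V_op ::
  "'w measure \<Rightarrow> (int \<Rightarrow> 'w \<Rightarrow> 'b::separable_hilbert ^ 's::finite) \<Rightarrow> nat \<Rightarrow> nat \<Rightarrow>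
     ((real ^ 's) hs \<times> 'b hs \<times> ('b ^ 's) hs) hs" where
  "V_op P X h i =
     (LINT \<omega>|P. M_map (lag_cov P X h) (centred_product P X h 1 \<omega>) \<otimes>
        M_map (lag_cov P X h) (centred_product P X h (1 + int i) \<omega>))"

definition W_op ::
  "'w measure \<Rightarrow> (int \<Rightarrow> 'w \<Rightarrow> 'b::separable_hilbert ^ 's::finite) \<Rightarrow> nat \<Rightarrow>
     ((real ^ 's) hs \<times> 'b hs \<times> ('b ^ 's) hs) hs" where
  "W_op P X h = V_op P X h 0 + (\<Sum>i. V_op P X h (Suc i) + hs_adjoint (V_op P X h (Suc i)))"

definition Q_op ::
  "'w measure \<Rightarrow> (int \<Rightarrow> 'w \<Rightarrow> 'b::separable_hilbert ^ 's::finite) \<Rightarrow> nat \<Rightarrow>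
     ('b ^ 's) hs \<Rightarrow> ('b ^ 's) hs" where
  "Q_op P X h =
     G_map (lag_cov P X h) \<circ> hs_apply (W_op P X h) \<circ> adjoint (G_map (lag_cov P X h))"

text \<open>\<open>\<gamma>\<close> lists every nonzero eigenvalue of \<open>Q\<close> as often as its multiplicity. How often \<open>0\<close> occurs
  is left open, so that operators of finite rank are covered. For Hilbert--Schmidt \<open>Q\<close> the
  eigenspaces involved are finite-dimensional, so that \<^const>\<open>dim\<close> is their true dimension.\<close>

definition eigenvalues_with_multiplicity ::
  "('a::real_vector \<Rightarrow> 'a) \<Rightarrow> (nat \<Rightarrow> real) \<Rightarrow> bool" where
  "eigenvalues_with_multiplicity Q \<gamma> \<longleftrightarrow>
     (\<forall>l. l \<noteq> 0 \<longrightarrow> finite {r. \<gamma> r = l} \<and> card {r. \<gamma> r = l} = dim {x. Q x = l *\<^sub>R x})"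

end

theory Submission
  imports Defs
begin

text \<open>The statistic is \<open>N\<close> times the squared norm of a nonlinear function of the sample mean of
  \<open>(Tr\<^sub>2, Tr\<^sub>1, id)\<close> applied to \<open>X\<^sub>n \<otimes> X\<^bsub>n+h\<^esub>\<close>. Under \<open>H\<^sub>0\<close> this function vanishes at the true
  mean, and its linearisation there is \<open>G \<circ> M\<close>, with a quadratic error that disappears in the limit. So only
  normalised partial sums of a weakly dependent square integrable sequence in a Hilbert space remain.
  Convergence is tested on the Laplace transforms \<open>E exp (- s T)\<close>, \<open>s \<ge> 0\<close>: these are Lipschitz in
  the \<open>L\<^sup>2\<close>-norm of the partial sums, so the sequence may be projected to finitely many eigenvectors of \<open>Q\<close>;
  randomising the frequency with an independent Gaussian vector then reduces the claim to a scalar central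
  limit theorem, in which block sums are replaced by their means given the innovations of the same block.
  All of this takes place on the product space of the innovations, to which the given process is transferred.\<close>

section \<open>Square integrable random elements and Laplace transforms\<close>

text \<open>Partial traces are not continuous for the Hilbert-Schmidt norm, so the statistic cannot
  be expanded as a function of \<open>sample_cov\<close> alone, and a trace cannot simply be pulled
  out of a Bochner integral of operators. Hence the triple is carried along as one element of a
  product Hilbert space, where it is a bounded bilinear function of the lagged pair. Dependence
  enters only through coupling: on two independent copies of the innovations, exchanging the
  coordinates in a set preserves the product measure. Covariances are thus bounded by the L2 effect
  of resampling the remote past, and the block mean is an integral over a second copy. Summability
  of these effects bounds the error of one block by a constant independent of its length, which the
  normalisation by the square root of that length removes. Block means read disjoint windows, so the
  iid central limit theorem with second moments suffices. With Laplace transforms no tightness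
  argument is required: truncating the basis changes them by an amount that is small uniformly in
  \<open>N\<close>.\<close>

definition sq_integrable :: "'w measure \<Rightarrow> ('w \<Rightarrow> 'h::separable_hilbert) \<Rightarrow> bool" where
  "sq_integrable M f \<longleftrightarrow> f \<in> borel_measurable M \<and> integrable M (\<lambda>x. (norm (f x))\<^sup>2)"

definition l2norm :: "'w measure \<Rightarrow> ('w \<Rightarrow> 'h::separable_hilbert) \<Rightarrow> real" where
  "l2norm M f = sqrt (LINT x|M. (norm (f x))\<^sup>2)"

lemma l2norm_nonneg [simp]: "0 \<le> l2norm M f"
  unfolding l2norm_def by simp

lemma l2norm_sq: "(l2norm M f)\<^sup>2 = (LINT x|M. (norm (f x))\<^sup>2)"
  unfolding l2norm_def by simp

lemma sq_integrable_measurable: "sq_integrable M f \<Longrightarrow> f \<in> borel_measurable M"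
  by (simp add: sq_integrable_def)

lemma mult_le_weighted_squares:
  fixes a b e :: real
  assumes "e > 0"
  shows "2 * (a * b) \<le> e * a\<^sup>2 + b\<^sup>2 / e"
proof -
  have "0 \<le> (e * a - b)\<^sup>2 / e" using assms by simp
  also have "\<dots> = e * a\<^sup>2 + b\<^sup>2 / e - 2 * (a * b)"
    using assms by (simp add: power2_eq_square field_simps)
  finally show ?thesis by simp
qed

lemma cauchy_schwarz_from_weighted:
  fixes C a b :: real
  assumes "a \<ge> 0" "b \<ge> 0" and C: "\<And>e. e > 0 \<Longrightarrow> 2 * C \<le> e * a\<^sup>2 + b\<^sup>2 / e"
  shows "C \<le> a * b"
proof (rule field_le_epsilon)
  fix r :: real assume "r > 0"
  define t where "t = r / (a + b + 1)"
  have t: "t > 0" using assms \<open>r > 0\<close> by (simp add: t_def)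
  define e where "e = (b + t) / (a + t)"
  have e: "e > 0" using assms t by (simp add: e_def add_nonneg_pos)
  have 1: "e * a\<^sup>2 \<le> (b + t) * a"
  proof -
    have "e * a\<^sup>2 = (b + t) * a * (a / (a + t))" by (simp add: e_def power2_eq_square)
    also have "\<dots> \<le> (b + t) * a * 1"
      using assms t by (intro mult_left_mono) (auto simp: add_nonneg_pos)
    finally show ?thesis by simp
  qed
  have 2: "b\<^sup>2 / e \<le> b * (a + t)"
  proof -
    have "b\<^sup>2 / e = b * (a + t) * (b / (b + t))" by (simp add: e_def power2_eq_square)
    also have "\<dots> \<le> b * (a + t) * 1"
      using assms t by (intro mult_left_mono) (auto simp: add_nonneg_pos)
    finally show ?thesis by simp
  qed
  have "2 * C \<le> 2 * (a * b) + t * (a + b)"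
    using C[OF e] 1 2 by (simp add: algebra_simps)
  also have "t * (a + b) \<le> t * (a + b + 1)" using t by (intro mult_left_mono) auto
  also have "\<dots> = r" using assms by (simp add: t_def)
  finally show "C \<le> a * b + r" using \<open>r > 0\<close> by simp
qed

lemma sq_integrable_mult_norm:
  assumes "sq_integrable M f" "sq_integrable M g"
  shows "integrable M (\<lambda>x. norm (f x) * norm (g x))"
    and "(LINT x|M. norm (f x) * norm (g x)) \<le> l2norm M f * l2norm M g"
proof -
  have [measurable]: "f \<in> borel_measurable M" "g \<in> borel_measurable M"
    using assms by (auto simp: sq_integrable_def)
  have i: "integrable M (\<lambda>x. (norm (f x))\<^sup>2)" "integrable M (\<lambda>x. (norm (g x))\<^sup>2)"
    using assms by (auto simp: sq_integrable_def)
  show *: "integrable M (\<lambda>x. norm (f x) * norm (g x))"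
  proof (rule Bochner_Integration.integrable_bound)
    show "integrable M (\<lambda>x. (norm (f x))\<^sup>2 + (norm (g x))\<^sup>2)" using i by simp
    have "norm (f x) * norm (g x) \<le> (norm (f x))\<^sup>2 + (norm (g x))\<^sup>2" for x
      using mult_le_weighted_squares[of 1 "norm (f x)" "norm (g x)"] mult_nonneg_nonneg[of "norm (f x)" "norm (g x)"]
      by (simp del: mult_nonneg_nonneg)
    then show "AE x in M. norm (norm (f x) * norm (g x)) \<le> norm ((norm (f x))\<^sup>2 + (norm (g x))\<^sup>2)"
      by (intro AE_I2) simp
  qed measurable
  show "(LINT x|M. norm (f x) * norm (g x)) \<le> l2norm M f * l2norm M g"
  proof (rule cauchy_schwarz_from_weighted)
    fix e :: real assume "e > 0"
    have "2 * (LINT x|M. norm (f x) * norm (g x)) = (LINT x|M. 2 * (norm (f x) * norm (g x)))" by simp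
    also have "\<dots> \<le> (LINT x|M. e * (norm (f x))\<^sup>2 + (norm (g x))\<^sup>2 / e)"
      using i * by (intro integral_mono) (auto intro: mult_le_weighted_squares[OF \<open>e > 0\<close>])
    also have "\<dots> = e * (l2norm M f)\<^sup>2 + (l2norm M g)\<^sup>2 / e"
      using i by (simp add: l2norm_sq)
    finally show "2 * (LINT x|M. norm (f x) * norm (g x)) \<le> e * (l2norm M f)\<^sup>2 + (l2norm M g)\<^sup>2 / e" .
  qed auto
qed

lemma sq_integrable_mono:
  assumes "sq_integrable M g" "f \<in> borel_measurable M" "\<And>x. x \<in> space M \<Longrightarrow> norm (f x) \<le> K * norm (g x)" "K \<ge> 0"
  shows "sq_integrable M f" "l2norm M f \<le> K * l2norm M g"
proof -
  have *: "(norm (f x))\<^sup>2 \<le> K\<^sup>2 * (norm (g x))\<^sup>2" if "x \<in> space M" for x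
    using power_mono[OF assms(3)[OF that], of 2] by (simp add: power_mult_distrib)
  have i: "integrable M (\<lambda>x. K\<^sup>2 * (norm (g x))\<^sup>2)" using assms(1) by (simp add: sq_integrable_def)
  have j: "integrable M (\<lambda>x. (norm (f x))\<^sup>2)"
    by (rule Bochner_Integration.integrable_bound[OF i]) (use * assms(2) in \<open>auto intro!: AE_I2\<close>)
  then show "sq_integrable M f" using assms(2) by (simp add: sq_integrable_def)
  have "(LINT x|M. (norm (f x))\<^sup>2) \<le> (LINT x|M. K\<^sup>2 * (norm (g x))\<^sup>2)"
    by (rule integral_mono[OF j i *])
  then have "(l2norm M f)\<^sup>2 \<le> (K * l2norm M g)\<^sup>2" by (simp add: l2norm_sq power_mult_distrib)
  then show "l2norm M f \<le> K * l2norm M g" by (rule power2_le_imp_le) (use assms(4) in simp)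
qed

lemma sq_integrable_add:
  assumes "sq_integrable M f" "sq_integrable M g"
  shows "sq_integrable M (\<lambda>x. f x + g x)" "l2norm M (\<lambda>x. f x + g x) \<le> l2norm M f + l2norm M g"
proof -
  have [measurable]: "f \<in> borel_measurable M" "g \<in> borel_measurable M"
    using assms by (auto simp: sq_integrable_def)
  have i: "integrable M (\<lambda>x. (norm (f x))\<^sup>2)" "integrable M (\<lambda>x. (norm (g x))\<^sup>2)"
    using assms by (auto simp: sq_integrable_def)
  note m = sq_integrable_mult_norm[OF assms]
  have b: "(norm (f x + g x))\<^sup>2 \<le> (norm (f x))\<^sup>2 + (norm (g x))\<^sup>2 + 2 * (norm (f x) * norm (g x))" for x
    using power_mono[OF norm_triangle_ineq[of "f x" "g x"], of 2] by (simp add: power2_sum)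
  have I: "integrable M (\<lambda>x. (norm (f x))\<^sup>2 + (norm (g x))\<^sup>2 + 2 * (norm (f x) * norm (g x)))"
    using i m(1) by simp
  have j: "integrable M (\<lambda>x. (norm (f x + g x))\<^sup>2)"
    by (rule Bochner_Integration.integrable_bound[OF I]) (use b in \<open>auto intro!: AE_I2\<close>)
  then show "sq_integrable M (\<lambda>x. f x + g x)" by (simp add: sq_integrable_def)
  have "(l2norm M (\<lambda>x. f x + g x))\<^sup>2 \<le> (LINT x|M. (norm (f x))\<^sup>2 + (norm (g x))\<^sup>2 + 2 * (norm (f x) * norm (g x)))"
    unfolding l2norm_sq by (rule integral_mono[OF j I b])
  also have "\<dots> = (l2norm M f)\<^sup>2 + (l2norm M g)\<^sup>2 + 2 * (LINT x|M. norm (f x) * norm (g x))"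
    using i m(1) by (simp add: l2norm_sq)
  also have "\<dots> \<le> (l2norm M f + l2norm M g)\<^sup>2" using m(2) by (simp add: power2_sum)
  finally show "l2norm M (\<lambda>x. f x + g x) \<le> l2norm M f + l2norm M g"
    by (rule power2_le_imp_le) simp
qed

lemma sq_integrable_zero [simp]: "sq_integrable M (\<lambda>_. 0)" "l2norm M (\<lambda>_. 0) = 0"
  by (auto simp: sq_integrable_def l2norm_def)

lemma sq_integrable_bounded_linear:
  assumes "bounded_linear L" "sq_integrable M f" "\<And>x. norm (L x) \<le> K * norm x" "K \<ge> 0"
  shows "sq_integrable M (\<lambda>x. L (f x))" "l2norm M (\<lambda>x. L (f x)) \<le> K * l2norm M f"
  using sq_integrable_mono[OF assms(2), of "\<lambda>x. L (f x)" K] assms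
    borel_measurable_continuous_onI[OF linear_continuous_on[OF assms(1)]]
  by (auto simp: sq_integrable_def)

lemma sq_integrable_scaleR:
  assumes "sq_integrable M f"
  shows "sq_integrable M (\<lambda>x. c *\<^sub>R f x)" "l2norm M (\<lambda>x. c *\<^sub>R f x) = \<bar>c\<bar> * l2norm M f"
  using assms by (auto simp: sq_integrable_def l2norm_def power_mult_distrib real_sqrt_mult)

lemma sq_integrable_uminus:
  assumes "sq_integrable M f"
  shows "sq_integrable M (\<lambda>x. - f x)" "l2norm M (\<lambda>x. - f x) = l2norm M f"
  using assms by (auto simp: sq_integrable_def l2norm_def)

lemma sq_integrable_diff:
  assumes "sq_integrable M f" "sq_integrable M g"
  shows "sq_integrable M (\<lambda>x. f x - g x)" "l2norm M (\<lambda>x. f x - g x) \<le> l2norm M f + l2norm M g"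
  using sq_integrable_add[OF assms(1) sq_integrable_uminus(1)[OF assms(2)]] sq_integrable_uminus(2)[OF assms(2)] by auto

lemma sq_integrable_sum:
  assumes "\<And>i. i \<in> I \<Longrightarrow> sq_integrable M (f i)"
  shows "sq_integrable M (\<lambda>x. \<Sum>i\<in>I. f i x)" "l2norm M (\<lambda>x. \<Sum>i\<in>I. f i x) \<le> (\<Sum>i\<in>I. l2norm M (f i))"
proof -
  have "sq_integrable M (\<lambda>x. \<Sum>i\<in>I. f i x) \<and> l2norm M (\<lambda>x. \<Sum>i\<in>I. f i x) \<le> (\<Sum>i\<in>I. l2norm M (f i))"
    using assms
  proof (induction I rule: infinite_finite_induct)
    case (insert j I)
    then have "sq_integrable M (f j)" "sq_integrable M (\<lambda>x. \<Sum>i\<in>I. f i x)"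
      "l2norm M (\<lambda>x. \<Sum>i\<in>I. f i x) \<le> (\<Sum>i\<in>I. l2norm M (f i))" by auto
    then show ?case using insert(1,2) sq_integrable_add[of M "f j" "\<lambda>x. \<Sum>i\<in>I. f i x"] by simp
  qed auto
  then show "sq_integrable M (\<lambda>x. \<Sum>i\<in>I. f i x)" "l2norm M (\<lambda>x. \<Sum>i\<in>I. f i x) \<le> (\<Sum>i\<in>I. l2norm M (f i))" by auto
qed

lemma sq_integrable_const:
  "prob_space M \<Longrightarrow> sq_integrable M (\<lambda>_. c)" "prob_space M \<Longrightarrow> l2norm M (\<lambda>_. c) = norm c"
  by (auto simp: sq_integrable_def l2norm_def prob_space.prob_space intro: finite_measure.integrable_const prob_space.finite_measure)

lemma sq_integrable_integrable:
  assumes "prob_space M" "sq_integrable M f"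
  shows "integrable M f" "(LINT x|M. norm (f x)) \<le> l2norm M f" "norm (LINT x|M. f x) \<le> l2norm M f"
proof -
  have *: "integrable M (\<lambda>x. norm (f x))" "(LINT x|M. norm (f x)) \<le> l2norm M f"
    using sq_integrable_mult_norm[OF assms(2) sq_integrable_const(1)[OF assms(1), of "1::real"]]
      sq_integrable_const(2)[OF assms(1), of "1::real"] by auto
  then show "integrable M f" "(LINT x|M. norm (f x)) \<le> l2norm M f"
    using assms(2) by (auto simp: sq_integrable_def integrable_norm_iff)
  show "norm (LINT x|M. f x) \<le> l2norm M f"
    by (rule order_trans[OF integral_norm_bound *(2)])
qed

lemma sq_integrable_bilinear:
  fixes prd :: "'a::separable_hilbert \<Rightarrow> 'b::separable_hilbert \<Rightarrow> 'c::{banach, second_countable_topology}"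
  assumes "bounded_bilinear prd" "sq_integrable M f" "sq_integrable M g"
    "\<And>x y. norm (prd x y) \<le> K * (norm x * norm y)" "K \<ge> 0"
  shows "integrable M (\<lambda>x. prd (f x) (g x))"
    "norm (LINT x|M. prd (f x) (g x)) \<le> K * (l2norm M f * l2norm M g)"
proof -
  interpret bounded_bilinear prd by fact
  have [measurable]: "f \<in> borel_measurable M" "g \<in> borel_measurable M"
    using assms by (auto simp: sq_integrable_def)
  have c: "continuous_on UNIV (\<lambda>x. prd (fst x) (snd x))"
    by (intro continuous_on continuous_on_fst continuous_on_snd continuous_on_id)
  have m: "(\<lambda>x. prd (f x) (g x)) \<in> borel_measurable M"
    using borel_measurable_continuous_Pair[OF _ _ c] by measurable
  note i = sq_integrable_mult_norm[OF assms(2,3)]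
  show I: "integrable M (\<lambda>x. prd (f x) (g x))"
    by (rule Bochner_Integration.integrable_bound[where f = "\<lambda>x. K * (norm (f x) * norm (g x))"])
      (use i m assms in \<open>auto simp: abs_mult intro!: AE_I2\<close>)
  have "norm (LINT x|M. prd (f x) (g x)) \<le> (LINT x|M. norm (prd (f x) (g x)))" by (rule integral_norm_bound)
  also have "\<dots> \<le> (LINT x|M. K * (norm (f x) * norm (g x)))"
    using I i assms(4) by (intro integral_mono) auto
  also have "\<dots> \<le> K * (l2norm M f * l2norm M g)" using i(2) assms(5) by (simp add: mult_left_mono)
  finally show "norm (LINT x|M. prd (f x) (g x)) \<le> K * (l2norm M f * l2norm M g)" .
qed

lemma sq_integrable_inner:
  assumes "sq_integrable M f" "sq_integrable M g"
  shows "integrable M (\<lambda>x. f x \<bullet> g x)" "\<bar>LINT x|M. f x \<bullet> g x\<bar> \<le> l2norm M f * l2norm M g"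
  using sq_integrable_bilinear[OF bounded_bilinear_inner assms, of 1] Cauchy_Schwarz_ineq2 by auto

text \<open>Stated for maps whose image law is the target measure itself, so that it serves shifts,
  resampling and the projections of the double space alike.\<close>

lemma sq_integrable_distr:
  assumes "distr M N T = N" "T \<in> measurable M N" "sq_integrable N f"
  shows "sq_integrable M (\<lambda>x. f (T x))" "l2norm M (\<lambda>x. f (T x)) = l2norm N f"
proof -
  have [measurable]: "f \<in> borel_measurable N" using assms by (simp add: sq_integrable_def)
  note assms(2)[measurable]
  have "integrable (distr M N T) (\<lambda>x. (norm (f x))\<^sup>2)" using assms by (simp add: sq_integrable_def)
  then show "sq_integrable M (\<lambda>x. f (T x))" by (simp add: sq_integrable_def integrable_distr_eq)
  have "(LINT x|N. (norm (f x))\<^sup>2) = (LINT x|M. (norm (f (T x)))\<^sup>2)"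
    by (subst assms(1)[symmetric]) (simp add: integral_distr)
  then show "l2norm M (\<lambda>x. f (T x)) = l2norm N f" by (simp add: l2norm_def)
qed

section \<open>Lipschitz bounds and convergence of Laplace transforms\<close>

lemma exp_minus_lipschitz:
  fixes a b :: real assumes "a \<ge> 0" "b \<ge> 0"
  shows "\<bar>exp (- a) - exp (- b)\<bar> \<le> \<bar>a - b\<bar>"
proof -
  have *: "exp (- x) - exp (- y) \<le> y - x" if "0 \<le> x" "x \<le> y" for x y :: real
  proof -
    have "exp (- x) - exp (- y) = exp (- x) * (1 - exp (- (y - x)))"
      by (simp add: algebra_simps exp_diff exp_minus field_simps)
    also have "\<dots> \<le> 1 * (y - x)"
      proof (intro mult_mono)
      have "1 + (x - y) \<le> exp (x - y)" by (rule exp_ge_add_one_self)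
      then have "1 - exp (x - y) \<le> y - x" by linarith
      then show "1 - exp (- (y - x)) \<le> y - x" by (simp only: minus_diff_eq)
    qed (use that in auto)
    finally show ?thesis by simp
  qed
  show ?thesis
  proof (cases "a \<le> b")
    case True
    then show ?thesis using *[of a b] assms by simp
  next
    case False
    then show ?thesis using *[of b a] assms by simp
  qed
qed

text \<open>The derivative \<open>- (2 * z) * exp (- z\<^sup>2)\<close> is bounded by 1, because
  \<open>\<bar>2 * z\<bar> \<le> 1 + z\<^sup>2 \<le> exp (z\<^sup>2)\<close>.\<close>

lemma gauss_lipschitz:
  fixes a b :: real
  shows "\<bar>exp (- a\<^sup>2) - exp (- b\<^sup>2)\<bar> \<le> \<bar>a - b\<bar>"
proof -
  have "\<bar>exp (- x\<^sup>2) - exp (- y\<^sup>2)\<bar> \<le> \<bar>x - y\<bar>" if "x < y" for x y :: real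
  proof -
    have "\<exists>z>x. z < y \<and> exp (- y\<^sup>2) - exp (- x\<^sup>2) = (y - x) * (- (2 * z) * exp (- z\<^sup>2))"
      by (rule MVT2[OF that]) (auto intro!: derivative_eq_intros)
    then obtain z where z: "exp (- y\<^sup>2) - exp (- x\<^sup>2) = (y - x) * (- (2 * z) * exp (- z\<^sup>2))"
      by blast
    have "\<bar>2 * z\<bar> \<le> 1 + z\<^sup>2"
      using zero_le_power2[of "\<bar>z\<bar> - 1"] by (simp add: power2_diff abs_mult)
    also have "\<dots> \<le> exp (z\<^sup>2)" by (rule exp_ge_add_one_self)
    finally have "\<bar>- (2 * z) * exp (- z\<^sup>2)\<bar> \<le> 1"
      by (simp add: abs_mult exp_minus field_simps)
    then have "\<bar>exp (- y\<^sup>2) - exp (- x\<^sup>2)\<bar> \<le> \<bar>y - x\<bar> * 1"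
      unfolding z abs_mult[of "y - x"] by (intro mult_left_mono) auto
    then show ?thesis by simp
  qed
  from this[of a b] this[of b a] show ?thesis by (cases a b rule: linorder_cases) auto
qed

text \<open>Although the exponent is quadratic, the bound is linear in \<open>x - y\<close>, with a
  constant free of \<open>x\<close> and \<open>y\<close>. A first absolute moment of the difference
  therefore controls the error of a Laplace transform.\<close>

lemma gauss_norm_lipschitz:
  fixes x y :: "'a::real_normed_vector"
  assumes "s \<ge> 0"
  shows "\<bar>exp (- s * (norm x)\<^sup>2) - exp (- s * (norm y)\<^sup>2)\<bar> \<le> sqrt s * norm (x - y)"
proof -
  have "\<bar>exp (- (sqrt s * norm x)\<^sup>2) - exp (- (sqrt s * norm y)\<^sup>2)\<bar> \<le> \<bar>sqrt s * norm x - sqrt s * norm y\<bar>"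
    by (rule gauss_lipschitz)
  also have "\<dots> = sqrt s * \<bar>norm x - norm y\<bar>"
    using assms by (simp add: right_diff_distrib[symmetric] abs_mult)
  also have "\<dots> \<le> sqrt s * norm (x - y)"
    using assms by (intro mult_left_mono norm_triangle_ineq3) auto
  finally show ?thesis using assms by (simp add: power_mult_distrib)
qed

text \<open>Under \<open>y = exp (- x)\<close> the Laplace transform at the integers becomes the moment sequence of a
  distribution on \<open>[0, 1]\<close>, which determines convergence by Weierstrass approximation; the limit gives no
  mass to \<open>y = 0\<close>.\<close>

theorem laplace_imp_weak_conv:
  fixes M :: "nat \<Rightarrow> real measure"
  assumes M: "\<And>n. real_distribution (M n)" and L: "real_distribution L"
    and pos: "\<And>n. AE x in M n. 0 \<le> x" and posL: "AE x in L. 0 \<le> x"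
    and lap: "\<And>k::nat. (\<lambda>n. LINT x|M n. exp (- real k * x)) \<longlonglongrightarrow> (LINT x|L. exp (- real k * x))"
  shows "weak_conv_m M L"
proof -
  have cont: "(\<lambda>n. LINT x|M n. g (exp (- x))) \<longlonglongrightarrow> (LINT x|L. g (exp (- x)))"
    if g: "\<And>x. isCont g x" and g1: "\<And>x. \<bar>g x\<bar> \<le> 1" for g :: "real \<Rightarrow> real"
  proof (rule LIMSEQ_I)
    fix e :: real assume "e > 0"
    have "continuous_on {0..1} g" using g by (intro continuous_at_imp_continuous_on) auto
    then obtain q where q: "real_polynomial_function q" "\<And>x. x \<in> {0..1} \<Longrightarrow> \<bar>g x - q x\<bar> < e / 4"
      using Stone_Weierstrass_real_polynomial_function[of "{0..1}" g "e / 4"] \<open>e > 0\<close> by auto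
    then obtain a d where qa: "q = (\<lambda>x. \<Sum>i\<le>d. a i * x ^ i)"
      unfolding real_polynomial_function_iff_sum by blast
    have [measurable]: "g \<in> borel_measurable borel"
      using g by (intro borel_measurable_continuous_onI continuous_at_imp_continuous_on) auto
    have int: "integrable N (\<lambda>x. exp (- real k * x))" if N: "real_distribution N" "AE x in N. 0 \<le> x" for N k
    proof -
      interpret real_distribution N by fact
      show ?thesis
        by (rule integrable_const_bound[where B = 1]) (use N(2) in auto)
    qed
    have q_eq: "(LINT x|N. q (exp (- x))) = (\<Sum>i\<le>d. a i * (LINT x|N. exp (- real i * x)))"
      and q_int: "integrable N (\<lambda>x. q (exp (- x)))"
      if N: "real_distribution N" "AE x in N. 0 \<le> x" for N
      unfolding qa using int[OF N] by (simp_all add: exp_of_nat_mult[symmetric])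
    have close: "\<bar>(LINT x|N. g (exp (- x))) - (LINT x|N. q (exp (- x)))\<bar> \<le> e / 4"
      if N: "real_distribution N" "AE x in N. 0 \<le> x" for N
    proof -
      interpret real_distribution N by fact
      have gi: "integrable N (\<lambda>x. g (exp (- x)))"
        by (rule integrable_const_bound[where B = 1]) (auto simp: g1)
      have "\<bar>(LINT x|N. g (exp (- x))) - (LINT x|N. q (exp (- x)))\<bar> = \<bar>LINT x|N. g (exp (- x)) - q (exp (- x))\<bar>"
        using gi q_int[OF N] by simp
      also have "\<dots> \<le> (LINT x|N. \<bar>g (exp (- x)) - q (exp (- x))\<bar>)" by (rule integral_abs_bound)
      also have "\<dots> \<le> (LINT x|N. e / 4)"
      proof (rule integral_mono_AE)
        show "AE x in N. \<bar>g (exp (- x)) - q (exp (- x))\<bar> \<le> e / 4"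
          using N(2)
        proof eventually_elim
          case (elim x)
          then show ?case using q(2)[of "exp (- x)"] by auto
        qed
      qed (use gi q_int[OF N] in auto)
      also have "\<dots> = e / 4" using prob_space by (simp add: space_eq_univ)
      finally show ?thesis .
    qed
    have "(\<lambda>n. LINT x|M n. q (exp (- x))) \<longlonglongrightarrow> (LINT x|L. q (exp (- x)))"
      unfolding q_eq[OF M pos] q_eq[OF L posL] by (intro tendsto_intros lap)
    then obtain n0 where n0: "\<And>n. n \<ge> n0 \<Longrightarrow> \<bar>(LINT x|M n. q (exp (- x))) - (LINT x|L. q (exp (- x)))\<bar> < e / 4"
      using LIMSEQ_D[of _ _ "e / 4"] \<open>e > 0\<close> by fastforce
    have "norm ((LINT x|M n. g (exp (- x))) - (LINT x|L. g (exp (- x)))) < e" if "n \<ge> n0" for n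
      using n0[OF that] close[OF M pos, of n] close[OF L posL] \<open>e > 0\<close> unfolding real_norm_def by linarith
    then show "\<exists>no. \<forall>n\<ge>no. norm ((LINT x|M n. g (exp (- x))) - (LINT x|L. g (exp (- x)))) < e" by blast
  qed
  define E :: "real measure \<Rightarrow> real measure" where "E N = distr N borel (\<lambda>x. exp (- x))" for N
  have rdE: "real_distribution (E N)" if "real_distribution N" for N
  proof -
    interpret real_distribution N by fact
    show ?thesis unfolding E_def by (intro real_distribution_distr) simp
  qed
  have intE: "(LINT y|E N. f y) = (LINT x|N. f (exp (- x)))"
    if "real_distribution N" "f \<in> borel_measurable borel" for f :: "real \<Rightarrow> real" and N
  proof -
    interpret real_distribution N by fact
    show ?thesis unfolding E_def using that by (intro integral_distr) auto
  qed
  have wE: "weak_conv_m (\<lambda>n. E (M n)) (E L)"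
  proof (rule integral_bdd_continuous_conv_imp_weak_conv)
    fix g :: "real \<Rightarrow> real" assume g: "\<And>x. isCont g x" "\<And>x. \<bar>g x\<bar> \<le> 1"
    then have "g \<in> borel_measurable borel"
      by (intro borel_measurable_continuous_onI continuous_at_imp_continuous_on) auto
    then show "(\<lambda>n. integral\<^sup>L (E (M n)) g) \<longlonglongrightarrow> integral\<^sup>L (E L) g"
      using cont[OF g] M L by (simp add: intE)
  qed (use rdE M L in auto)
  show ?thesis
  proof (rule integral_bdd_continuous_conv_imp_weak_conv)
    fix g :: "real \<Rightarrow> real" assume g: "\<And>x. isCont g x" "\<And>x. \<bar>g x\<bar> \<le> 1"
    have gm[measurable]: "g \<in> borel_measurable borel"
      using g by (intro borel_measurable_continuous_onI continuous_at_imp_continuous_on) auto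
    \<comment> \<open>\<open>ln\<close> is total, so \<open>f\<close> is defined, bounded and
      measurable on the whole line. It can fail to be continuous only at \<open>y \<le> 0\<close>, a
      null set for \<open>E L\<close> since \<open>exp (- x)\<close> is positive.\<close>
    define f where "f y = g (- ln y)" for y
    have fm[measurable]: "f \<in> borel_measurable borel" unfolding f_def by measurable
    have fe: "f (exp (- x)) = g x" for x by (simp add: f_def)
    have fc: "isCont f y" if "y > 0" for y
      unfolding f_def using that by (intro isCont_o2[OF _ g(1)] continuous_intros) auto
    have "emeasure (E L) {y. \<not> isCont f y} \<le> emeasure (E L) {y. y \<le> 0}"
      using fc by (intro emeasure_mono) (auto simp: E_def not_less[symmetric])
    also have "\<dots> = 0"
    proof -
      interpret L: real_distribution L by fact
      show ?thesis unfolding E_def by (subst emeasure_distr) auto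
    qed
    finally have "emeasure (E L) {y. \<not> isCont f y} = 0" by simp
    then have "(\<lambda>n. integral\<^sup>L (E (M n)) f) \<longlonglongrightarrow> integral\<^sup>L (E L) f"
      by (intro weak_conv_imp_bdd_ae_continuous_conv[where B = 1, OF rdE[OF M] rdE[OF L] wE])
        (auto simp: f_def g)
    then show "(\<lambda>n. integral\<^sup>L (M n) g) \<longlonglongrightarrow> integral\<^sup>L L g"
      using M L by (simp add: intE fe)
  qed (use M L in auto)
qed

section \<open>Functions of an iid sequence\<close>

lemma l2norm_cong_AE:
  assumes "AE x in M. f x = g x" "f \<in> borel_measurable M" "g \<in> borel_measurable M"
  shows "l2norm M f = l2norm M g" "sq_integrable M f \<longleftrightarrow> sq_integrable M g"
proof -
  note assms(2,3)[measurable]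
  have "AE x in M. (norm (f x))\<^sup>2 = (norm (g x))\<^sup>2" using assms(1) by eventually_elim simp
  then show "l2norm M f = l2norm M g" "sq_integrable M f \<longleftrightarrow> sq_integrable M g"
    unfolding l2norm_def sq_integrable_def using assms(2,3)
    by (auto intro!: arg_cong[where f = sqrt] integral_cong_AE simp: integrable_cong_AE)
qed

lemma l2norm_triangle_diff:
  assumes "sq_integrable M f" "sq_integrable M g"
  shows "l2norm M f \<le> l2norm M g + l2norm M (\<lambda>x. f x - g x)"
  using sq_integrable_add(2)[OF assms(2) sq_integrable_diff(1)[OF assms]] by simp

lemma distr_fst_pair:
  assumes "prob_space M" "prob_space N"
  shows "distr (M \<Otimes>\<^sub>M N) M fst = M"
  using prob_space.distr_pair_fst[OF assms(2), of M] by simp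

lemma distr_snd_pair:
  assumes M: "prob_space M" and N: "prob_space N"
  shows "distr (M \<Otimes>\<^sub>M N) N snd = N"
proof (rule measure_eqI)
  interpret M: prob_space M by fact
  interpret N: prob_space N by fact
  fix A assume "A \<in> sets (distr (M \<Otimes>\<^sub>M N) N snd)"
  then have A: "A \<in> sets N" by simp
  then have "snd -` A \<inter> space (M \<Otimes>\<^sub>M N) = space M \<times> A"
    using sets.sets_into_space[OF A] by (auto simp: space_pair_measure)
  then show "emeasure (distr (M \<Otimes>\<^sub>M N) N snd) A = emeasure N A"
    using A by (simp add: emeasure_distr N.emeasure_pair_measure_Times M.emeasure_space_1)
qed simp

text \<open>Integrating out \<open>y\<close> is a conditional expectation, and Jensen's inequality
  makes it a contraction in L2.\<close>

lemma sq_integrable_marginal: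
  fixes f :: "'a \<Rightarrow> 'b \<Rightarrow> 'h::separable_hilbert"
  assumes M: "prob_space M" and N: "prob_space N"
    and f: "sq_integrable (M \<Otimes>\<^sub>M N) (\<lambda>(x, y). f x y)"
  shows "AE x in M. sq_integrable N (f x)"
    and "sq_integrable M (\<lambda>x. LINT y|N. f x y)"
    and "l2norm M (\<lambda>x. LINT y|N. f x y) \<le> l2norm (M \<Otimes>\<^sub>M N) (\<lambda>(x, y). f x y)"
proof -
  interpret M: prob_space M by fact
  interpret N: prob_space N by fact
  interpret pair_sigma_finite M N ..
  have fm[measurable]: "(\<lambda>(x, y). f x y) \<in> borel_measurable (M \<Otimes>\<^sub>M N)"
    using f by (simp add: sq_integrable_def)
  have i: "integrable (M \<Otimes>\<^sub>M N) (\<lambda>(x, y). (norm (f x y))\<^sup>2)"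
    using f by (simp add: sq_integrable_def case_prod_unfold)
  show ae: "AE x in M. sq_integrable N (f x)"
    using AE_integrable_fst[OF i] AE_space
    by eventually_elim (simp add: sq_integrable_def)
  have m: "(\<lambda>x. LINT y|N. f x y) \<in> borel_measurable M" by measurable
  have b: "AE x in M. (norm (LINT y|N. f x y))\<^sup>2 \<le> (LINT y|N. (norm (f x y))\<^sup>2)"
    using ae
  proof eventually_elim
    case (elim x)
    have "norm (LINT y|N. f x y) \<le> l2norm N (f x)"
      by (rule sq_integrable_integrable[OF N elim])
    then have "(norm (LINT y|N. f x y))\<^sup>2 \<le> (l2norm N (f x))\<^sup>2" by (rule power_mono) simp
    then show ?case by (simp only: l2norm_sq)
  qed
  note J = integrable_fst[OF i]
  have I: "integrable M (\<lambda>x. (norm (LINT y|N. f x y))\<^sup>2)"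
    by (rule Bochner_Integration.integrable_bound[OF J]) (use b in \<open>auto\<close>)
  then show "sq_integrable M (\<lambda>x. LINT y|N. f x y)" using m by (simp add: sq_integrable_def)
  have "(l2norm M (\<lambda>x. LINT y|N. f x y))\<^sup>2 \<le> (LINT x|M. LINT y|N. (norm (f x y))\<^sup>2)"
    unfolding l2norm_sq by (rule integral_mono_AE[OF I J b])
  also have "\<dots> = (l2norm (M \<Otimes>\<^sub>M N) (\<lambda>(x, y). f x y))\<^sup>2"
    unfolding l2norm_sq integral_fst[OF i] by (simp add: case_prod_unfold)
  finally show "l2norm M (\<lambda>x. LINT y|N. f x y) \<le> l2norm (M \<Otimes>\<^sub>M N) (\<lambda>(x, y). f x y)"
    by (rule power2_le_imp_le) simp
qed

text \<open>Passing from \<open>K\<close> to \<open>K + 1\<close> terms adds the new second moment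
  and twice its covariance with the earlier sum. Summability of \<open>a\<close> bounds that
  covariance by \<open>b * suminf a\<close>, so the second moment grows at most linearly.\<close>

lemma l2norm_sum_weakly_dependent:
  fixes g :: "nat \<Rightarrow> 'w \<Rightarrow> 'h::separable_hilbert"
  assumes g: "\<And>j. sq_integrable M (g j)" and c: "\<And>j. l2norm M (g j) \<le> c"
    and cov: "\<And>i j. i < j \<Longrightarrow> \<bar>LINT x|M. g i x \<bullet> g j x\<bar> \<le> b * a (j - i - 1)"
    and a: "\<And>i. 0 \<le> a i" "summable a" and b: "b \<ge> 0"
  shows "(l2norm M (\<lambda>x. \<Sum>j<K. g j x))\<^sup>2 \<le> real K * (c\<^sup>2 + 2 * b * suminf a)"
proof (induction K)
  case (Suc K)
  have S: "sq_integrable M (\<lambda>x. \<Sum>j<K. g j x)" by (intro sq_integrable_sum g)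
  have i: "integrable M (\<lambda>x. (norm (\<Sum>j<K. g j x))\<^sup>2)" "integrable M (\<lambda>x. (norm (g K x))\<^sup>2)"
    using S g by (auto simp: sq_integrable_def)
  have I: "integrable M (\<lambda>x. g i x \<bullet> g K x)" for i
    by (rule sq_integrable_inner[OF g g])
  have "(LINT x|M. (\<Sum>j<K. g j x) \<bullet> g K x) = (\<Sum>j<K. LINT x|M. g j x \<bullet> g K x)"
    using I by (simp add: inner_sum_left)
  also have "\<dots> \<le> (\<Sum>j<K. b * a (K - j - 1))"
    using cov by (intro sum_mono) (metis abs_le_D1 lessThan_iff)
  also have "\<dots> = b * (\<Sum>j<K. a j)"
    by (simp add: sum_distrib_left[symmetric] sum.nat_diff_reindex[of a K, symmetric])
  also have "\<dots> \<le> b * suminf a"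
    using a b by (intro mult_left_mono sum_le_suminf) auto
  finally have cross: "(LINT x|M. (\<Sum>j<K. g j x) \<bullet> g K x) \<le> b * suminf a" .
  have "(l2norm M (\<lambda>x. \<Sum>j<Suc K. g j x))\<^sup>2
      = (LINT x|M. (norm (\<Sum>j<K. g j x))\<^sup>2 + (norm (g K x))\<^sup>2 + 2 * ((\<Sum>j<K. g j x) \<bullet> g K x))"
    unfolding l2norm_sq by (simp add: power2_norm_eq_inner inner_add inner_commute algebra_simps)
  also have "\<dots> = (l2norm M (\<lambda>x. \<Sum>j<K. g j x))\<^sup>2 + (l2norm M (g K))\<^sup>2 + 2 * (LINT x|M. (\<Sum>j<K. g j x) \<bullet> g K x)"
    using i sq_integrable_inner(1)[OF S g] by (simp add: l2norm_sq)
  also have "\<dots> \<le> real K * (c\<^sup>2 + 2 * b * suminf a) + c\<^sup>2 + 2 * (b * suminf a)"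
    using Suc cross c[of K] by (intro add_mono power_mono mult_left_mono) auto
  also have "\<dots> = real (Suc K) * (c\<^sup>2 + 2 * b * suminf a)" by (simp add: algebra_simps)
  finally show ?case .
qed (simp add: l2norm_def)

text \<open>Stolz-Cesaro for unit steps: beyond index \<open>m\<close> the increments are within
  \<open>e / 2\<close> of \<open>l\<close>, and the fixed initial error \<open>c\<close> is absorbed
  once \<open>2 * c < n * e\<close>.\<close>

lemma cesaro_increments:
  fixes a :: "nat \<Rightarrow> real"
  assumes "(\<lambda>n. a (Suc n) - a n) \<longlonglongrightarrow> l"
  shows "(\<lambda>n. a n / real n) \<longlonglongrightarrow> l"
proof (rule LIMSEQ_I)
  fix e :: real assume "e > 0"
  then obtain m where m: "\<And>n. n \<ge> m \<Longrightarrow> \<bar>a (Suc n) - a n - l\<bar> < e / 2"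
    using LIMSEQ_D[OF assms, of "e / 2"] by auto
  define c where "c = \<bar>a m - real m * l\<bar>"
  have step: "\<bar>a (m + k) - real (m + k) * l\<bar> \<le> c + real k * (e / 2)" for k
  proof (induction k)
    case (Suc k)
    have "a (m + Suc k) - real (m + Suc k) * l
        = (a (m + k) - real (m + k) * l) + (a (Suc (m + k)) - a (m + k) - l)"
      by (simp add: algebra_simps)
    then have "\<bar>a (m + Suc k) - real (m + Suc k) * l\<bar> \<le> (c + real k * (e / 2)) + e / 2"
      using Suc m[of "m + k"] by linarith
    also have "\<dots> = c + real (Suc k) * (e / 2)" by (simp add: algebra_simps)
    finally show ?case .
  qed (simp add: c_def)
  obtain n0 :: nat where n0: "2 * c / e < real n0" using reals_Archimedean2 by blast
  have "norm (a n / real n - l) < e" if n: "n \<ge> max (max m n0) 1" for n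
  proof -
    have "\<bar>a n - real n * l\<bar> \<le> c + real (n - m) * (e / 2)"
      using step[of "n - m"] n by simp
    also have "\<dots> \<le> c + real n * (e / 2)" using \<open>e > 0\<close> by (intro add_left_mono mult_right_mono) auto
    also have "\<dots> < real n * e"
    proof -
      have "2 * c / e < real n" using n0 n by simp
      then have "2 * c < real n * e" using \<open>e > 0\<close> by (simp add: pos_divide_less_eq)
      then show ?thesis by linarith
    qed
    finally have "\<bar>a n - real n * l\<bar> < real n * e" .
    moreover have "a n / real n - l = (a n - real n * l) / real n" using n by (simp add: field_simps)
    ultimately show ?thesis using n by (simp add: pos_divide_less_eq mult.commute)
  qed
  then show "\<exists>no. \<forall>n\<ge>no. norm (a n / real n - l) < e" by blast
qed

section \<open>Shifting and resampling of the innovations\<close>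

definition time_shift :: "int \<Rightarrow> (int \<Rightarrow> 'u) \<Rightarrow> int \<Rightarrow> 'u" where
  "time_shift n \<omega> = (\<lambda>i. \<omega> (n + i))"

definition resample :: "int set \<Rightarrow> (int \<Rightarrow> 'u) \<Rightarrow> (int \<Rightarrow> 'u) \<Rightarrow> int \<Rightarrow> 'u" where
  "resample A \<omega> \<omega>' = (\<lambda>i. if i \<in> A then \<omega> i else \<omega>' i)"

lemma shift_shift: "time_shift m (time_shift n \<omega>) = time_shift (n + m) \<omega>"
  by (simp add: time_shift_def add.assoc)

lemma shift_0 [simp]: "time_shift 0 \<omega> = \<omega>"
  by (simp add: time_shift_def)

lemma shift_resample: "time_shift n (resample A \<omega> \<omega>') = resample {i. n + i \<in> A} (time_shift n \<omega>) (time_shift n \<omega>')"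
  by (simp add: time_shift_def resample_def fun_eq_iff)

text \<open>\<open>\<mu>\<close> is the law of one innovation. Sequences are indexed by all integers
  so that shifts in both directions preserve the product measure.\<close>

locale iid_shift = prob_space \<mu> for \<mu> :: "'u measure"
begin

abbreviation "\<Omega> \<equiv> PiM (UNIV :: int set) (\<lambda>_. \<mu>)"
abbreviation "\<Omega>2 \<equiv> \<Omega> \<Otimes>\<^sub>M \<Omega>"

sublocale Om: product_prob_space "\<lambda>_. \<mu>" "UNIV :: int set" ..

lemma prob_Omega: "prob_space \<Omega>"
  by (intro prob_space_PiM prob_space_axioms)

sublocale Om2: pair_prob_space \<Omega> \<Omega> ..

lemma prob_Omega2: "prob_space \<Omega>2"
  by (rule Om2.prob_space_axioms)

lemma measurable_shift [measurable]: "time_shift n \<in> measurable \<Omega> \<Omega>"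
  unfolding time_shift_def by (rule measurable_PiM_single') (auto simp: space_PiM)

lemma measurable_resample [measurable]: "(\<lambda>x. resample A (fst x) (snd x)) \<in> measurable \<Omega>2 \<Omega>"
  unfolding resample_def
proof (rule measurable_PiM_single')
  fix i :: int
  show "(\<lambda>x. if i \<in> A then fst x i else snd x i) \<in> measurable \<Omega>2 \<mu>"
    by (cases "i \<in> A") auto
qed (auto simp: space_PiM space_pair_measure PiE_iff)

lemma distr_shift: "distr \<Omega> \<Omega> (time_shift n) = \<Omega>"
  using distr_PiM_reindex[of UNIV "\<lambda>_. \<mu>" "\<lambda>i::int. n + i" UNIV] prob_space_axioms
  by (simp add: time_shift_def[abs_def] restrict_def)

lemma shift_space: "\<omega> \<in> space \<Omega> \<Longrightarrow> time_shift n \<omega> \<in> space \<Omega>"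
  by (auto simp: time_shift_def space_PiM)

lemma resample_space: "\<omega> \<in> space \<Omega> \<Longrightarrow> \<omega>' \<in> space \<Omega> \<Longrightarrow> resample A \<omega> \<omega>' \<in> space \<Omega>"
  by (auto simp: resample_def space_PiM PiE_iff)

lemma coordinates_indep:
  fixes I :: "'i set"
  shows "prob_space.indep_vars (PiM UNIV (\<lambda>_::'i. \<mu>)) (\<lambda>_. \<mu>) (\<lambda>i \<omega>. \<omega> i) UNIV"
proof -
  interpret p: product_prob_space "\<lambda>_. \<mu>" "UNIV :: 'i set" ..
  show ?thesis
    by (subst p.indep_vars_iff_distr_eq_PiM') (auto simp: p.PiM_component restrict_def)
qed

text \<open>Two independent sequences are read off one family indexed by
  \<open>bool \<times> int\<close>. Exchanging coordinates between them then becomes a reindexing of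
  a single product measure.\<close>

lemma distr_split_pair:
  "distr (PiM UNIV (\<lambda>_::bool \<times> int. \<mu>)) \<Omega>2 (\<lambda>x. (\<lambda>i. x (True, i), \<lambda>i. x (False, i))) = \<Omega>2"
proof -
  let ?P = "PiM UNIV (\<lambda>_::bool \<times> int. \<mu>)"
  interpret p: product_prob_space "\<lambda>_. \<mu>" "UNIV :: (bool \<times> int) set" ..
  have d: "distr ?P \<Omega> (\<lambda>x i. x (b, i)) = \<Omega>" for b
    using distr_PiM_reindex[of UNIV "\<lambda>_. \<mu>" "\<lambda>i::int. (b, i)" UNIV] prob_space_axioms
    by (simp add: restrict_def inj_on_def)
  let ?A = "\<lambda>b::bool. {b} \<times> (UNIV :: int set)"
  have "p.indep_var (PiM (?A True) (\<lambda>_. \<mu>)) (\<lambda>\<omega>. restrict (\<lambda>i. \<omega> i) (?A True))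
      (PiM (?A False) (\<lambda>_. \<mu>)) (\<lambda>\<omega>. restrict (\<lambda>i. \<omega> i) (?A False))"
    by (rule p.indep_var_restrict[OF coordinates_indep]) auto
  then have "p.indep_var \<Omega> ((\<lambda>\<eta> i. \<eta> (True, i)) \<circ> (\<lambda>\<omega>. restrict (\<lambda>i. \<omega> i) (?A True)))
      \<Omega> ((\<lambda>\<eta> i. \<eta> (False, i)) \<circ> (\<lambda>\<omega>. restrict (\<lambda>i. \<omega> i) (?A False)))"
  proof (rule p.indep_var_compose)
    have "(\<lambda>\<eta> i. \<eta> (b, i)) \<in> measurable (PiM (?A b) (\<lambda>_. \<mu>)) \<Omega>" for b
      by (intro measurable_PiM_single' measurable_component_singleton) (auto simp: space_PiM PiE_def Pi_def)
    from this[of True] this[of False]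
    show "(\<lambda>\<eta> i. \<eta> (True, i)) \<in> measurable (PiM (?A True) (\<lambda>_. \<mu>)) \<Omega>"
      "(\<lambda>\<eta> i. \<eta> (False, i)) \<in> measurable (PiM (?A False) (\<lambda>_. \<mu>)) \<Omega>" .
  qed
  then have "p.indep_var \<Omega> (\<lambda>x i. x (True, i)) \<Omega> (\<lambda>x i. x (False, i))"
    by (simp add: o_def)
  then show ?thesis
    unfolding p.indep_var_distribution_eq d by simp
qed

text \<open>On the coordinates in \<open>A\<close> the two sequences are exchanged. On
  \<open>bool \<times> int\<close> this is the involution \<open>\<rho>\<close> that flips the first
  component exactly when the second lies in \<open>A\<close>, and a product of equal factors is
  invariant under it.\<close>

lemma distr_swap_resample:
  "distr \<Omega>2 \<Omega>2 (\<lambda>x. (resample A (snd x) (fst x), resample A (fst x) (snd x))) = \<Omega>2"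
proof -
  let ?P = "PiM UNIV (\<lambda>_::bool \<times> int. \<mu>)"
  let ?s = "\<lambda>x. (\<lambda>i::int. x (True, i) :: 'u, \<lambda>i. x (False, i))"
  define \<rho> where "\<rho> = (\<lambda>(b, i). (if i \<in> A then \<not> b else b, i))"
  have \<rho>: "distr ?P ?P (\<lambda>\<omega> n. \<omega> (\<rho> n)) = ?P"
    using distr_PiM_reindex[of UNIV "\<lambda>_. \<mu>" \<rho> UNIV] prob_space_axioms
    by (auto simp add: restrict_def inj_on_def \<rho>_def split: if_splits)
  have s: "?s \<in> measurable ?P \<Omega>2"
    by (intro measurable_Pair measurable_PiM_single') (auto simp: space_PiM)
  have r: "(\<lambda>\<omega> n. \<omega> (\<rho> n)) \<in> measurable ?P ?P"
    by (intro measurable_PiM_single') (auto simp: space_PiM)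
  have m: "(\<lambda>x. (resample A (snd x) (fst x), resample A (fst x) (snd x))) \<in> measurable \<Omega>2 \<Omega>2"
    using measurable_compose[OF measurable_pair_swap' measurable_resample[of A]]
    by (intro measurable_Pair measurable_resample) (simp add: case_prod_unfold)
  have "distr \<Omega>2 \<Omega>2 (\<lambda>x. (resample A (snd x) (fst x), resample A (fst x) (snd x)))
     = distr (distr ?P \<Omega>2 ?s) \<Omega>2 (\<lambda>x. (resample A (snd x) (fst x), resample A (fst x) (snd x)))"
    by (simp only: distr_split_pair)
  also have "\<dots> = distr ?P \<Omega>2 (?s \<circ> (\<lambda>\<omega> n. \<omega> (\<rho> n)))"
    unfolding distr_distr[OF m s]
    by (rule arg_cong[where f = "distr ?P \<Omega>2"]) (simp add: o_def resample_def \<rho>_def fun_eq_iff)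
  also have "\<dots> = distr (distr ?P ?P (\<lambda>\<omega> n. \<omega> (\<rho> n))) \<Omega>2 ?s"
    by (rule distr_distr[OF s r, symmetric])
  also have "\<dots> = \<Omega>2" by (simp only: \<rho> distr_split_pair)
  finally show ?thesis .
qed

lemma distr_resample: "distr \<Omega>2 \<Omega> (\<lambda>x. resample A (fst x) (snd x)) = \<Omega>"
proof -
  have m: "(\<lambda>x. (resample A (snd x) (fst x), resample A (fst x) (snd x))) \<in> measurable \<Omega>2 \<Omega>2"
    using measurable_compose[OF measurable_pair_swap' measurable_resample[of A]]
    by (intro measurable_Pair measurable_resample) (simp add: case_prod_unfold)
  have "distr \<Omega>2 \<Omega> (\<lambda>x. resample A (fst x) (snd x))
     = distr \<Omega>2 \<Omega> (snd \<circ> (\<lambda>x. (resample A (snd x) (fst x), resample A (fst x) (snd x))))"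
    by (simp add: o_def)
  also have "\<dots> = distr (distr \<Omega>2 \<Omega>2 (\<lambda>x. (resample A (snd x) (fst x), resample A (fst x) (snd x)))) \<Omega> snd"
    by (rule distr_distr[OF measurable_snd m, symmetric])
  also have "\<dots> = \<Omega>" by (simp only: distr_swap_resample distr_snd_pair[OF prob_Omega prob_Omega])
  finally show ?thesis .
qed

text \<open>A pointwise form of measurability with respect to the coordinates in \<open>A\<close>.
  It passes to compositions and sums without any sigma-algebra, and it allows single evaluations to
  be compared after resampling.\<close>

definition depends_on :: "int set \<Rightarrow> ((int \<Rightarrow> 'u) \<Rightarrow> 'c) \<Rightarrow> bool" where
  "depends_on A F \<longleftrightarrow> (\<forall>\<omega>\<in>space \<Omega>. \<forall>\<omega>'\<in>space \<Omega>. (\<forall>i\<in>A. \<omega> i = \<omega>' i) \<longrightarrow> F \<omega> = F \<omega>')"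

lemma depends_onD:
  assumes "depends_on A F" "\<omega> \<in> space \<Omega>" "\<omega>' \<in> space \<Omega>" "\<And>i. i \<in> A \<Longrightarrow> \<omega> i = \<omega>' i"
  shows "F \<omega> = F \<omega>'"
proof -
  have "\<forall>i\<in>A. \<omega> i = \<omega>' i" using assms(4) by (rule ballI)
  with bspec[OF bspec[OF assms(1)[unfolded depends_on_def] assms(2)] assms(3)] show ?thesis by (rule mp)
qed

lemma depends_onI:
  assumes "\<And>\<omega> \<omega>'. \<omega> \<in> space \<Omega> \<Longrightarrow> \<omega>' \<in> space \<Omega> \<Longrightarrow> (\<And>i. i \<in> A \<Longrightarrow> \<omega> i = \<omega>' i) \<Longrightarrow> F \<omega> = F \<omega>'"
  shows "depends_on A F"
  unfolding depends_on_def by (intro ballI impI, rule assms, assumption, assumption, erule bspec)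

lemma depends_on_mono:
  assumes "depends_on A F" "A \<subseteq> B"
  shows "depends_on B F"
proof (rule depends_onI)
  fix \<omega> \<omega>' assume *: "\<omega> \<in> space \<Omega>" "\<omega>' \<in> space \<Omega>" "\<And>i. i \<in> B \<Longrightarrow> \<omega> i = \<omega>' i"
  show "F \<omega> = F \<omega>'" by (rule depends_onD[OF assms(1) *(1,2)], rule *(3), rule subsetD[OF assms(2)])
qed

lemma depends_on_shift: "depends_on A F \<Longrightarrow> depends_on ((\<lambda>i. n + i) ` A) (\<lambda>\<omega>. F (time_shift n \<omega>))"
  unfolding depends_on_def[of "_ ` _"]
proof (intro ballI impI)
  fix \<omega> \<omega>' assume F: "depends_on A F"
    and "\<omega> \<in> space \<Omega>" "\<omega>' \<in> space \<Omega>" and eq: "\<forall>i\<in>(\<lambda>i. n + i) ` A. \<omega> i = \<omega>' i"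
  then have "time_shift n \<omega> \<in> space \<Omega>" "time_shift n \<omega>' \<in> space \<Omega>" by (auto intro: shift_space)
  moreover have "\<forall>i\<in>A. time_shift n \<omega> i = time_shift n \<omega>' i" using eq by (simp add: time_shift_def)
  ultimately show "F (time_shift n \<omega>) = F (time_shift n \<omega>')" by (intro depends_onD[OF F]) auto
qed

lemma depends_on_shift_past: "depends_on {..k} F \<Longrightarrow> depends_on {..n + k} (\<lambda>\<omega>. F (time_shift n \<omega>))"
  by (rule depends_on_mono[OF depends_on_shift]) auto

lemma depends_on_comp:
  assumes "depends_on A F"
  shows "depends_on A (\<lambda>\<omega>. g (F \<omega>))"
proof (rule depends_onI)
  fix \<omega> \<omega>' assume *: "\<omega> \<in> space \<Omega>" "\<omega>' \<in> space \<Omega>" "\<And>i. i \<in> A \<Longrightarrow> \<omega> i = \<omega>' i"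
  show "g (F \<omega>) = g (F \<omega>')" using depends_onD[OF assms *] by simp
qed

lemma depends_on_comp2:
  assumes "depends_on A F" "depends_on A G"
  shows "depends_on A (\<lambda>\<omega>. g (F \<omega>) (G \<omega>))"
proof (rule depends_onI)
  fix \<omega> \<omega>' assume *: "\<omega> \<in> space \<Omega>" "\<omega>' \<in> space \<Omega>" "\<And>i. i \<in> A \<Longrightarrow> \<omega> i = \<omega>' i"
  show "g (F \<omega>) (G \<omega>) = g (F \<omega>') (G \<omega>')"
    using depends_onD[OF assms(1) *] depends_onD[OF assms(2) *] by simp
qed

lemma depends_on_sum:
  assumes "\<And>i. i \<in> I \<Longrightarrow> depends_on A (F i)"
  shows "depends_on A (\<lambda>\<omega>. \<Sum>i\<in>I. F i \<omega>)"
proof (rule depends_onI)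
  fix \<omega> \<omega>' assume *: "\<omega> \<in> space \<Omega>" "\<omega>' \<in> space \<Omega>" "\<And>i. i \<in> A \<Longrightarrow> \<omega> i = \<omega>' i"
  show "(\<Sum>i\<in>I. F i \<omega>) = (\<Sum>i\<in>I. F i \<omega>')"
    by (rule sum.cong[OF refl depends_onD[OF assms *]])
qed

text \<open>Each \<open>g j\<close> factors through the restriction to its own window: the missing
  coordinates are filled in from one fixed sequence \<open>\<omega>0\<close>. Restrictions to
  disjoint windows are independent.\<close>

lemma indep_vars_disjoint_windows:
  fixes g :: "nat \<Rightarrow> (int \<Rightarrow> 'u) \<Rightarrow> real"
  assumes g: "\<And>j. g j \<in> borel_measurable \<Omega>" "\<And>j. depends_on (K j) (g j)"
    and K: "disjoint_family K"
  shows "prob_space.indep_vars \<Omega> (\<lambda>_. borel) g UNIV"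
proof -
  obtain \<omega>0 where \<omega>0: "\<omega>0 \<in> space \<Omega>" using Om.not_empty by blast
  define c where "c j \<eta> = (\<lambda>i. if i \<in> K j then \<eta> i else \<omega>0 i)" for j and \<eta> :: "int \<Rightarrow> 'u"
  have c: "c j \<in> measurable (PiM (K j) (\<lambda>_. \<mu>)) \<Omega>" for j
    unfolding c_def
  proof (rule measurable_PiM_single')
    fix i :: int
    show "(\<lambda>\<eta>. if i \<in> K j then \<eta> i else \<omega>0 i) \<in> measurable (PiM (K j) (\<lambda>_. \<mu>)) \<mu>"
      using \<omega>0 by (cases "i \<in> K j") (auto simp: space_PiM PiE_iff)
  qed (use \<omega>0 in \<open>auto simp: space_PiM PiE_def Pi_def\<close>)
  have "Om.indep_vars (\<lambda>j. PiM (K j) (\<lambda>_. \<mu>)) (\<lambda>j \<omega>. restrict (\<lambda>i. \<omega> i) (K j)) UNIV"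
    by (rule Om.indep_vars_restrict[OF coordinates_indep]) (use K in auto)
  then have ind: "Om.indep_vars (\<lambda>_. borel) (\<lambda>j \<omega>. g j (c j (restrict (\<lambda>i. \<omega> i) (K j)))) UNIV"
    by (rule Om.indep_vars_compose2) (intro measurable_compose[OF c g(1)])
  have "g j (c j (restrict \<omega> (K j))) = g j \<omega>" if "\<omega> \<in> space \<Omega>" for j \<omega>
    by (rule depends_onD[OF g(2)]) (use that \<omega>0 in \<open>auto simp: c_def space_PiM PiE_iff\<close>)
  then have eq: "(\<lambda>\<omega>. g j (c j (restrict (\<lambda>i. \<omega> i) (K j)))) -` B \<inter> space \<Omega> = g j -` B \<inter> space \<Omega>" for j B
    by auto
  show ?thesis
    using ind g(1) unfolding Om.indep_vars_def eq by simp
qed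

end

section \<open>Covariance bounds by decoupling\<close>

context iid_shift
begin

lemma sq_integrable_fst:
  assumes "sq_integrable \<Omega> F"
  shows "sq_integrable \<Omega>2 (\<lambda>x. F (fst x))" "l2norm \<Omega>2 (\<lambda>x. F (fst x)) = l2norm \<Omega> F"
  using sq_integrable_distr[OF distr_fst_pair[OF prob_Omega prob_Omega] measurable_fst assms] by auto

lemma sq_integrable_resample:
  assumes "sq_integrable \<Omega> F"
  shows "sq_integrable \<Omega>2 (\<lambda>x. F (resample A (fst x) (snd x)))"
    "l2norm \<Omega>2 (\<lambda>x. F (resample A (fst x) (snd x))) = l2norm \<Omega> F"
  using sq_integrable_distr[OF distr_resample measurable_resample assms] by auto

lemma sq_integrable_shift:
  assumes "sq_integrable \<Omega> F"
  shows "sq_integrable \<Omega> (\<lambda>\<omega>. F (time_shift n \<omega>))" "l2norm \<Omega> (\<lambda>\<omega>. F (time_shift n \<omega>)) = l2norm \<Omega> F"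
  using sq_integrable_distr[OF distr_shift measurable_shift assms] by auto

lemma integral_shift:
  fixes F :: "(int \<Rightarrow> 'u) \<Rightarrow> 'h::{banach, second_countable_topology}"
  assumes [measurable]: "F \<in> borel_measurable \<Omega>"
  shows "(LINT \<omega>|\<Omega>. F (time_shift n \<omega>)) = (LINT \<omega>|\<Omega>. F \<omega>)"
proof -
  have "(LINT \<omega>|\<Omega>. F \<omega>) = (LINT \<omega>|distr \<Omega> \<Omega> (time_shift n). F \<omega>)" by (simp only: distr_shift)
  also have "\<dots> = (LINT \<omega>|\<Omega>. F (time_shift n \<omega>))" by (rule integral_distr) measurable
  finally show ?thesis by simp
qed

text \<open>\<open>G\<close> does not notice an exchange of the coordinates in \<open>A\<close>.
  After the exchange \<open>G\<close> reads one sequence and \<open>F\<close> the other, so by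
  Fubini the inner integral is \<open>prd (G x)\<close> at the mean of \<open>F\<close>, which is
  zero.\<close>

lemma integral_decoupled_eq_0:
  fixes G :: "(int \<Rightarrow> 'u) \<Rightarrow> 'a::separable_hilbert" and F :: "(int \<Rightarrow> 'u) \<Rightarrow> 'b::separable_hilbert"
    and prd :: "'a \<Rightarrow> 'b \<Rightarrow> 'c::{banach, second_countable_topology}"
  assumes prd: "bounded_bilinear prd"
    and G: "sq_integrable \<Omega> G" "depends_on C G" and F: "sq_integrable \<Omega> F" "(LINT \<omega>|\<Omega>. F \<omega>) = 0"
    and CA: "C \<inter> A = {}"
  shows "(LINT x|\<Omega>2. prd (G (fst x)) (F (resample A (fst x) (snd x)))) = 0"
proof -
  interpret bounded_bilinear prd by fact
  obtain K where K: "\<And>x y. norm (prd x y) \<le> norm x * norm y * K" "K \<ge> 0" using nonneg_bounded by blast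
  have [measurable]: "G \<in> borel_measurable \<Omega>" "F \<in> borel_measurable \<Omega>"
    using G F by (auto simp: sq_integrable_def)
  let ?s = "\<lambda>x. (resample A (snd x) (fst x), resample A (fst x) (snd x))"
  have m: "?s \<in> measurable \<Omega>2 \<Omega>2"
    using measurable_compose[OF measurable_pair_swap' measurable_resample[of A]]
    by (intro measurable_Pair measurable_resample) (simp add: case_prod_unfold)
  have F2: "sq_integrable \<Omega>2 (\<lambda>x. F (snd x))"
    using sq_integrable_distr(1)[OF distr_snd_pair[OF prob_Omega prob_Omega] measurable_snd F(1)] .
  have i: "integrable \<Omega>2 (\<lambda>x. prd (G (fst x)) (F (snd x)))"
    by (rule sq_integrable_bilinear(1)[OF prd sq_integrable_fst(1)[OF G(1)] F2, of K])
      (use K in \<open>auto simp: mult.commute mult.left_commute\<close>)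
  have "(LINT x|\<Omega>2. prd (G (fst x)) (F (resample A (fst x) (snd x))))
      = (LINT x|\<Omega>2. (\<lambda>y. prd (G (fst y)) (F (snd y))) (?s x))"
  proof (rule Bochner_Integration.integral_cong[OF refl])
    fix x assume "x \<in> space \<Omega>2"
    then have x: "fst x \<in> space \<Omega>" "snd x \<in> space \<Omega>" by (auto simp: space_pair_measure)
    have "G (fst x) = G (resample A (snd x) (fst x))"
      by (rule depends_onD[OF G(2)]) (use x CA resample_space[OF x(2,1), of A] in \<open>auto simp: resample_def\<close>)
    then show "prd (G (fst x)) (F (resample A (fst x) (snd x))) = (\<lambda>y. prd (G (fst y)) (F (snd y))) (?s x)"
      by simp
  qed
  also have "\<dots> = (LINT y|distr \<Omega>2 \<Omega>2 ?s. prd (G (fst y)) (F (snd y)))"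
    by (rule integral_distr[OF m, symmetric]) (use i in simp)
  also have "\<dots> = (LINT y|\<Omega>2. prd (G (fst y)) (F (snd y)))"
    by (simp only: distr_swap_resample)
  also have "\<dots> = (LINT x|\<Omega>. LINT y|\<Omega>. prd (G x) (F y))"
    using Om2.integral_fst'[OF i] by simp
  also have "\<dots> = (LINT x|\<Omega>. 0)"
  proof (rule Bochner_Integration.integral_cong[OF refl])
    fix x
    have "(LINT y|\<Omega>. prd (G x) (F y)) = prd (G x) (LINT y|\<Omega>. F y)"
      by (rule integral_bounded_linear[OF bounded_linear_right sq_integrable_integrable(1)[OF prob_Omega F(1)]])
    then show "(LINT y|\<Omega>. prd (G x) (F y)) = 0" by (simp add: F zero_right)
  qed
  finally show ?thesis by simp
qed

text \<open>The decoupled integral vanishes and may be subtracted. What remains is linear in the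
  change of \<open>F\<close> when all coordinates outside \<open>A\<close>, in particular those read
  by \<open>G\<close>, are replaced by an independent copy. A general product \<open>prd\<close>
  covers scalar and operator-valued covariances alike.\<close>

lemma integral_bilinear_resample_bound:
  fixes G :: "(int \<Rightarrow> 'u) \<Rightarrow> 'a::separable_hilbert" and F :: "(int \<Rightarrow> 'u) \<Rightarrow> 'b::separable_hilbert"
    and prd :: "'a \<Rightarrow> 'b \<Rightarrow> 'c::{banach, second_countable_topology}"
  assumes prd: "bounded_bilinear prd" "\<And>x y. norm (prd x y) \<le> norm x * norm y"
    and G: "sq_integrable \<Omega> G" "depends_on C G" and F: "sq_integrable \<Omega> F" "(LINT \<omega>|\<Omega>. F \<omega>) = 0"
    and CA: "C \<inter> A = {}"
  shows "norm (LINT \<omega>|\<Omega>. prd (G \<omega>) (F \<omega>))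
    \<le> l2norm \<Omega> G * l2norm \<Omega>2 (\<lambda>x. F (fst x) - F (resample A (fst x) (snd x)))"
proof -
  interpret bounded_bilinear prd by fact
  have prd1: "norm (prd x y) \<le> 1 * (norm x * norm y)" for x y using prd(2) by simp
  have [measurable]: "(\<lambda>\<omega>. prd (G \<omega>) (F \<omega>)) \<in> borel_measurable \<Omega>"
    using sq_integrable_bilinear(1)[OF prd(1) G(1) F(1) prd1] by simp
  note G1 = sq_integrable_fst[OF G(1)] and F1 = sq_integrable_fst[OF F(1)] and F2 = sq_integrable_resample[OF F(1), of A]
  have "(LINT \<omega>|\<Omega>. prd (G \<omega>) (F \<omega>)) = (LINT \<omega>|distr \<Omega>2 \<Omega> fst. prd (G \<omega>) (F \<omega>))"
    by (simp only: distr_fst_pair[OF prob_Omega prob_Omega])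
  also have "\<dots> = (LINT x|\<Omega>2. prd (G (fst x)) (F (fst x)))" by (rule integral_distr) measurable
  also have "\<dots> = (LINT x|\<Omega>2. prd (G (fst x)) (F (fst x))) - (LINT x|\<Omega>2. prd (G (fst x)) (F (resample A (fst x) (snd x))))"
    using integral_decoupled_eq_0[OF prd(1) G F CA] by simp
  also have "\<dots> = (LINT x|\<Omega>2. prd (G (fst x)) (F (fst x) - F (resample A (fst x) (snd x))))"
    unfolding diff_right
    by (rule Bochner_Integration.integral_diff[symmetric])
      (rule sq_integrable_bilinear(1)[OF prd(1) G1(1) F1(1) prd1] sq_integrable_bilinear(1)[OF prd(1) G1(1) F2(1) prd1]; simp)+
  finally have eq: "(LINT \<omega>|\<Omega>. prd (G \<omega>) (F \<omega>)) =
    (LINT x|\<Omega>2. prd (G (fst x)) (F (fst x) - F (resample A (fst x) (snd x))))" .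
  show ?thesis
    unfolding eq using sq_integrable_bilinear(2)[OF prd(1) G1(1) sq_integrable_diff(1)[OF F1(1) F2(1)] prd1] G1(2) by simp
qed

text \<open>The coupling of m-approximability at time 0: the innovations from time
  \<open>- r\<close> on are kept, the earlier ones come from an independent copy. It is measured in
  L2 because \<open>F\<close> will be built from products of two variables with fourth
  moments.\<close>

definition dep_coef :: "((int \<Rightarrow> 'u) \<Rightarrow> 'h::separable_hilbert) \<Rightarrow> nat \<Rightarrow> real" where
  "dep_coef F r = l2norm \<Omega>2 (\<lambda>x. F (fst x) - F (resample {- int r..} (fst x) (snd x)))"

lemma dep_coef_nonneg [simp]: "0 \<le> dep_coef F r" by (simp add: dep_coef_def)

lemma measurable_shift_pair: "(\<lambda>x. (time_shift n (fst x), time_shift n (snd x))) \<in> measurable \<Omega>2 \<Omega>2"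
  by measurable

lemma distr_shift_pair: "distr \<Omega>2 \<Omega>2 (\<lambda>x. (time_shift n (fst x), time_shift n (snd x))) = \<Omega>2"
proof -
  have "sigma_finite_measure (distr \<Omega> \<Omega> (time_shift n))"
    unfolding distr_shift by (rule prob_space_imp_sigma_finite[OF prob_Omega])
  then have "distr \<Omega> \<Omega> (time_shift n) \<Otimes>\<^sub>M distr \<Omega> \<Omega> (time_shift n) = distr \<Omega>2 \<Omega>2 (\<lambda>(x, y). (time_shift n x, time_shift n y))"
    by (intro pair_measure_distr) measurable
  then show ?thesis by (simp add: distr_shift case_prod_unfold)
qed

text \<open>Shifting both copies preserves the double product measure, and seen from time
  \<open>n\<close> the kept half-line \<open>{n - r..}\<close> is \<open>{- r..}\<close>.\<close>

lemma l2norm_shift_resample: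
  assumes "sq_integrable \<Omega> F"
  shows "l2norm \<Omega>2 (\<lambda>x. F (time_shift n (fst x)) - F (time_shift n (resample {n - int r..} (fst x) (snd x)))) = dep_coef F r"
proof -
  have e: "{i. n + i \<in> {n - int r..}} = {- int r..}" by auto
  show ?thesis
    unfolding dep_coef_def shift_resample e
    using sq_integrable_distr(2)[OF distr_shift_pair measurable_shift_pair
        sq_integrable_diff(1)[OF sq_integrable_fst(1)[OF assms] sq_integrable_resample(1)[OF assms]]]
    by simp
qed

text \<open>The stationary sequence that is meant is \<open>F (time_shift n \<omega>)\<close>;
  dependence on \<open>{..0}\<close> makes it causal.\<close>

definition stationary_input :: "((int \<Rightarrow> 'u) \<Rightarrow> 'h::separable_hilbert) \<Rightarrow> bool" where
  "stationary_input F \<longleftrightarrow> sq_integrable \<Omega> F \<and> depends_on {..0} F \<and> (LINT \<omega>|\<Omega>. F \<omega>) = 0 \<and> summable (dep_coef F)"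

lemma stationary_inputD:
  assumes "stationary_input F"
  shows "sq_integrable \<Omega> F" "depends_on {..0} F" "(LINT \<omega>|\<Omega>. F \<omega>) = 0" "summable (dep_coef F)"
    "F \<in> borel_measurable \<Omega>" "sq_integrable \<Omega> (\<lambda>\<omega>. F (time_shift n \<omega>))" "depends_on {..n} (\<lambda>\<omega>. F (time_shift n \<omega>))"
    "(LINT \<omega>|\<Omega>. F (time_shift n \<omega>)) = 0" "l2norm \<Omega> (\<lambda>\<omega>. F (time_shift n \<omega>)) = l2norm \<Omega> F"
proof -
  show *: "sq_integrable \<Omega> F" "depends_on {..0} F" "(LINT \<omega>|\<Omega>. F \<omega>) = 0" "summable (dep_coef F)"
    using assms by (auto simp: stationary_input_def)
  then show m: "F \<in> borel_measurable \<Omega>" by (simp add: sq_integrable_def)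
  show "sq_integrable \<Omega> (\<lambda>\<omega>. F (time_shift n \<omega>))" "l2norm \<Omega> (\<lambda>\<omega>. F (time_shift n \<omega>)) = l2norm \<Omega> F"
    using sq_integrable_shift[OF *(1)] by auto
  show "depends_on {..n} (\<lambda>\<omega>. F (time_shift n \<omega>))" using depends_on_shift_past[OF *(2), of n] by simp
  show "(LINT \<omega>|\<Omega>. F (time_shift n \<omega>)) = 0" using integral_shift[OF m] *(3) by simp
qed

lemma stationary_input_bounded_linear:
  fixes F :: "(int \<Rightarrow> 'u) \<Rightarrow> 'h::separable_hilbert" and L :: "'h \<Rightarrow> 'k::separable_hilbert"
  assumes F: "stationary_input F" and L: "bounded_linear L" "\<And>x. norm (L x) \<le> K * norm x" "K \<ge> 0"
  shows "stationary_input (\<lambda>\<omega>. L (F \<omega>))" "dep_coef (\<lambda>\<omega>. L (F \<omega>)) r \<le> K * dep_coef F r"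
proof -
  interpret L: bounded_linear L by fact
  note F' = stationary_inputD[OF F]
  have d: "dep_coef (\<lambda>\<omega>. L (F \<omega>)) r \<le> K * dep_coef F r" for r
    unfolding dep_coef_def L.diff[symmetric]
    by (intro sq_integrable_bounded_linear(2)[OF L(1) _ L(2,3)] sq_integrable_diff sq_integrable_fst sq_integrable_resample F'(1))
  then show "dep_coef (\<lambda>\<omega>. L (F \<omega>)) r \<le> K * dep_coef F r" .
  have "summable (dep_coef (\<lambda>\<omega>. L (F \<omega>)))"
    by (rule summable_comparison_test[OF _ summable_mult[OF F'(4), of K]]) (use d in auto)
  then show "stationary_input (\<lambda>\<omega>. L (F \<omega>))"
    unfolding stationary_input_def
    using sq_integrable_bounded_linear(1)[OF L(1) F'(1) L(2,3)] depends_on_comp[OF F'(2), of L]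
      integral_bounded_linear[OF L(1) sq_integrable_integrable(1)[OF prob_Omega F'(1)]] F'(3)
    by (simp add: L.zero)
qed

text \<open>Everything up to time \<open>i\<close> is resampled, so the variable at time
  \<open>j\<close> keeps the innovations from \<open>i + 1 = j - (j - i - 1)\<close> on. This is
  where the index \<open>j - i - 1\<close> comes from.\<close>

lemma lagged_bilinear_bound:
  fixes G :: "(int \<Rightarrow> 'u) \<Rightarrow> 'a::separable_hilbert" and F :: "(int \<Rightarrow> 'u) \<Rightarrow> 'b::separable_hilbert"
    and prd :: "'a \<Rightarrow> 'b \<Rightarrow> 'c::{banach, second_countable_topology}"
  assumes prd: "bounded_bilinear prd" "\<And>x y. norm (prd x y) \<le> norm x * norm y"
    and G: "stationary_input G" and F: "stationary_input F" and ij: "i < j"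
  shows "norm (LINT \<omega>|\<Omega>. prd (G (time_shift (int i) \<omega>)) (F (time_shift (int j) \<omega>))) \<le> l2norm \<Omega> G * dep_coef F (j - i - 1)"
proof -
  have e: "{int i + 1..} = {int j - int (j - i - 1)..}" using ij by auto
  have "{..int i} \<inter> {int i + 1..} = {}" by auto
  from integral_bilinear_resample_bound[OF prd stationary_inputD(6,7)[OF G, of "int i"] stationary_inputD(6,8)[OF F, of "int j"] this]
  show ?thesis
    by (simp only: stationary_inputD(9)[OF G] e l2norm_shift_resample[OF stationary_inputD(1)[OF F]])
qed

lemma l2norm_partial_sum:
  fixes F :: "(int \<Rightarrow> 'u) \<Rightarrow> 'a::separable_hilbert"
  assumes F: "stationary_input F"
  shows "(l2norm \<Omega> (\<lambda>\<omega>. \<Sum>j<N. F (time_shift (int j) \<omega>)))\<^sup>2 \<le> real N * ((l2norm \<Omega> F)\<^sup>2 + 2 * l2norm \<Omega> F * suminf (dep_coef F))"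
proof (rule l2norm_sum_weakly_dependent)
  fix i j :: nat assume "i < j"
  have "norm (x \<bullet> y) \<le> norm x * norm y" for x y :: 'a using Cauchy_Schwarz_ineq2 by simp
  from lagged_bilinear_bound[OF bounded_bilinear_inner this F F \<open>i < j\<close>]
  show "\<bar>LINT x|\<Omega>. F (time_shift (int i) x) \<bullet> F (time_shift (int j) x)\<bar> \<le> l2norm \<Omega> F * dep_coef F (j - i - 1)"
    by simp
qed (use stationary_inputD[OF F] in auto)

end

section \<open>Scalar central limit theorem\<close>

lemma iexp_lipschitz: "cmod (iexp a - iexp b) \<le> \<bar>a - b\<bar>"
proof -
  have "iexp a - iexp b = iexp b * (iexp (a - b) - 1)"
    by (simp add: algebra_simps exp_diff exp_minus field_simps exp_add[symmetric] of_real_diff)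
  then have "cmod (iexp a - iexp b) = cmod (iexp (a - b) - 1)" by (simp add: norm_mult)
  also have "\<dots> \<le> \<bar>a - b\<bar>" using iexp_approx1[of "a - b" 0] by simp
  finally show ?thesis .
qed

lemma norm_mult_le: "norm (x * y :: real) \<le> norm x * norm y"
  by (simp add: abs_mult)

lemma integral_iexp_close:
  fixes f g :: "'w \<Rightarrow> real"
  assumes "prob_space M" "sq_integrable M f" "sq_integrable M g"
  shows "cmod ((CLINT x|M. iexp (f x)) - (CLINT x|M. iexp (g x))) \<le> l2norm M (\<lambda>x. f x - g x)"
proof -
  interpret prob_space M by fact
  have [measurable]: "f \<in> borel_measurable M" "g \<in> borel_measurable M"
    using assms by (auto simp: sq_integrable_def)
  note d = sq_integrable_diff(1)[OF assms(2,3)]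
  have i: "integrable M (\<lambda>x. iexp (f x))" "integrable M (\<lambda>x. iexp (g x))"
    by (auto intro!: integrable_iexp)
  have "cmod ((CLINT x|M. iexp (f x)) - (CLINT x|M. iexp (g x))) = cmod (CLINT x|M. iexp (f x) - iexp (g x))"
    using i by simp
  also have "\<dots> \<le> (LINT x|M. cmod (iexp (f x) - iexp (g x)))" by (rule integral_norm_bound)
  also have "\<dots> \<le> (LINT x|M. norm (f x - g x))"
    using i sq_integrable_integrable(1)[OF assms(1) d] by (intro integral_mono) (auto simp: iexp_lipschitz)
  also have "\<dots> \<le> l2norm M (\<lambda>x. f x - g x)" by (rule sq_integrable_integrable(2)[OF assms(1) d])
  finally show ?thesis .
qed

lemma l2norm_cong: "(\<And>x. x \<in> space M \<Longrightarrow> f x = g x) \<Longrightarrow> l2norm M f = l2norm M g"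
  unfolding l2norm_def by (auto intro!: arg_cong[where f = sqrt] Bochner_Integration.integral_cong)

context iid_shift
begin

definition partial_sum :: "((int \<Rightarrow> 'u) \<Rightarrow> 'h::real_vector) \<Rightarrow> nat \<Rightarrow> (int \<Rightarrow> 'u) \<Rightarrow> 'h" where
  "partial_sum F N \<omega> = (\<Sum>n<N. F (time_shift (int n) \<omega>))"

text \<open>The long-run variance: by \<open>second_moment_limit\<close> it is the limit of the
  second moment of a partial sum divided by its length.\<close>

definition lrv :: "((int \<Rightarrow> 'u) \<Rightarrow> real) \<Rightarrow> real" where
  "lrv F = (LINT \<omega>|\<Omega>. (F \<omega>)\<^sup>2) + 2 * (\<Sum>i. LINT \<omega>|\<Omega>. F \<omega> * F (time_shift (int (Suc i)) \<omega>))"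

lemma sq_integrable_partial_sum:
  assumes "stationary_input F"
  shows "sq_integrable \<Omega> (partial_sum F N)"
  unfolding partial_sum_def by (intro sq_integrable_sum stationary_inputD(6)[OF assms])

lemma autocov_summable:
  fixes F :: "(int \<Rightarrow> 'u) \<Rightarrow> real"
  assumes F: "stationary_input F"
  shows "summable (\<lambda>i. LINT \<omega>|\<Omega>. F \<omega> * F (time_shift (int (Suc i)) \<omega>))"
proof (rule summable_comparison_test)
  have "norm (LINT \<omega>|\<Omega>. F \<omega> * F (time_shift (int (Suc i)) \<omega>)) \<le> l2norm \<Omega> F * dep_coef F i" for i
    using lagged_bilinear_bound[OF bounded_bilinear_mult norm_mult_le F F, of 0 "Suc i"] by simp
  then show "\<exists>N. \<forall>n\<ge>N. norm (LINT \<omega>|\<Omega>. F \<omega> * F (time_shift (int (Suc n)) \<omega>)) \<le> l2norm \<Omega> F * dep_coef F n"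
    by blast
  show "summable (\<lambda>n. l2norm \<Omega> F * dep_coef F n)" using stationary_inputD(4)[OF F] by (rule summable_mult)
qed

text \<open>By stationarity, step \<open>N\<close> increases the second moment of the partial sum by
  the variance of one term plus twice the sum of the autocovariances \<open>c i\<close> over
  \<open>i < N\<close>. These increments converge to \<open>lrv F\<close>, hence so do their
  averages.\<close>

lemma second_moment_limit:
  fixes F :: "(int \<Rightarrow> 'u) \<Rightarrow> real"
  assumes F: "stationary_input F"
  shows "(\<lambda>N. (l2norm \<Omega> (partial_sum F N))\<^sup>2 / real N) \<longlonglongrightarrow> lrv F"
proof (rule cesaro_increments)
  define c where "c i = (LINT \<omega>|\<Omega>. F \<omega> * F (time_shift (int (Suc i)) \<omega>))" for i
  note F' = stationary_inputD[OF F]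
  have [measurable]: "F \<in> borel_measurable \<Omega>" by (rule F'(5))
  have cov: "(LINT \<omega>|\<Omega>. F (time_shift (int j) \<omega>) * F (time_shift (int N) \<omega>)) = c (N - Suc j)" if "j < N" for j N
  proof -
    have "(LINT \<omega>|\<Omega>. F \<omega> * F (time_shift (int (N - j)) \<omega>))
        = (LINT \<omega>|\<Omega>. F (time_shift (int j) \<omega>) * F (time_shift (int (N - j)) (time_shift (int j) \<omega>)))"
      by (rule integral_shift[symmetric]) measurable
    then show ?thesis using that by (simp add: c_def shift_shift Suc_diff_Suc of_nat_diff)
  qed
  have S2: "sq_integrable \<Omega> (partial_sum F N)" for N by (rule sq_integrable_partial_sum[OF F])
  have "(l2norm \<Omega> (partial_sum F (Suc N)))\<^sup>2 - (l2norm \<Omega> (partial_sum F N))\<^sup>2 = (LINT \<omega>|\<Omega>. (F \<omega>)\<^sup>2) + 2 * (\<Sum>i<N. c i)" for N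
  proof -
    let ?y = "\<lambda>j \<omega>. F (time_shift (int j) \<omega>)"
    have I: "integrable \<Omega> (\<lambda>\<omega>. ?y j \<omega> * ?y N \<omega>)" for j
      using sq_integrable_inner(1)[OF F'(6) F'(6)] by simp
    have "(LINT \<omega>|\<Omega>. partial_sum F N \<omega> * ?y N \<omega>) = (\<Sum>j<N. c (N - Suc j))"
      unfolding partial_sum_def sum_distrib_right using I cov by simp
    also have "\<dots> = (\<Sum>i<N. c i)" by (rule sum.nat_diff_reindex)
    finally have cross: "(LINT \<omega>|\<Omega>. partial_sum F N \<omega> * ?y N \<omega>) = (\<Sum>i<N. c i)" .
    have i: "integrable \<Omega> (\<lambda>\<omega>. (partial_sum F N \<omega>)\<^sup>2)" "integrable \<Omega> (\<lambda>\<omega>. (?y N \<omega>)\<^sup>2)"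
      "integrable \<Omega> (\<lambda>\<omega>. partial_sum F N \<omega> * ?y N \<omega>)"
      using S2[of N] F'(6)[of "int N"] sq_integrable_inner(1)[OF S2 F'(6)] by (auto simp: sq_integrable_def)
    have "(l2norm \<Omega> (partial_sum F (Suc N)))\<^sup>2 = (LINT \<omega>|\<Omega>. (partial_sum F N \<omega>)\<^sup>2 + (?y N \<omega>)\<^sup>2 + 2 * (partial_sum F N \<omega> * ?y N \<omega>))"
      unfolding l2norm_sq by (simp add: partial_sum_def power2_sum mult.assoc)
    also have "\<dots> = (l2norm \<Omega> (partial_sum F N))\<^sup>2 + (LINT \<omega>|\<Omega>. (?y N \<omega>)\<^sup>2) + 2 * (\<Sum>i<N. c i)"
      using i by (simp add: l2norm_sq cross)
    also have "(LINT \<omega>|\<Omega>. (?y N \<omega>)\<^sup>2) = (LINT \<omega>|\<Omega>. (F \<omega>)\<^sup>2)"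
      by (rule integral_shift[of "\<lambda>\<omega>. (F \<omega>)\<^sup>2"]) measurable
    finally show ?thesis by simp
  qed
  moreover have "(\<lambda>N. (LINT \<omega>|\<Omega>. (F \<omega>)\<^sup>2) + 2 * (\<Sum>i<N. c i)) \<longlonglongrightarrow> lrv F"
    unfolding lrv_def c_def by (intro tendsto_intros summable_LIMSEQ autocov_summable[OF F])
  ultimately show "(\<lambda>n. (l2norm \<Omega> (partial_sum F (Suc n)))\<^sup>2 - (l2norm \<Omega> (partial_sum F n))\<^sup>2) \<longlonglongrightarrow> lrv F"
    by simp
qed

text \<open>The conditional expectation of the block sum given the innovations at times
  \<open>\<ge> 0\<close>, written as an integral over an independent past. As the block sum ends at
  time \<open>p - 1\<close>, only the window \<open>{0..<p}\<close> matters.\<close>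

definition block_mean :: "((int \<Rightarrow> 'u) \<Rightarrow> real) \<Rightarrow> nat \<Rightarrow> (int \<Rightarrow> 'u) \<Rightarrow> real" where
  "block_mean F p \<omega> = (LINT \<omega>'|\<Omega>. partial_sum F p (resample {0..} \<omega> \<omega>'))"

context
  fixes F :: "(int \<Rightarrow> 'u) \<Rightarrow> real" and p :: nat
  assumes F: "stationary_input F" and p: "p \<ge> 1"
begin

lemma depends_on_partial_sum: "depends_on {..<int p} (partial_sum F p)"
  unfolding partial_sum_def
proof (rule depends_on_sum)
  fix i assume "i \<in> {..<p}"
  then show "depends_on {..<int p} (\<lambda>\<omega>. F (time_shift (int i) \<omega>))"
    by (intro depends_on_mono[OF stationary_inputD(7)[OF F]]) auto
qed

lemma sq_integrable_block_mean: "sq_integrable \<Omega> (block_mean F p)"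
  unfolding block_mean_def
  by (rule sq_integrable_marginal(2)[OF prob_Omega prob_Omega])
    (use sq_integrable_resample(1)[OF sq_integrable_partial_sum[OF F]] in \<open>simp add: case_prod_unfold\<close>)

lemma depends_on_block_mean: "depends_on {0..<int p} (block_mean F p)"
proof (rule depends_onI)
  fix \<omega> \<eta> assume w: "\<omega> \<in> space \<Omega>" "\<eta> \<in> space \<Omega>" and eq: "\<And>i. i \<in> {0..<int p} \<Longrightarrow> \<omega> i = \<eta> i"
  show "block_mean F p \<omega> = block_mean F p \<eta>"
    unfolding block_mean_def
  proof (rule Bochner_Integration.integral_cong[OF refl])
    fix \<omega>' assume w': "\<omega>' \<in> space \<Omega>"
    show "partial_sum F p (resample {0..} \<omega> \<omega>') = partial_sum F p (resample {0..} \<eta> \<omega>')"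
    proof (rule depends_onD[OF depends_on_partial_sum])
      fix i assume "i \<in> {..<int p}"
      then show "resample {0..} \<omega> \<omega>' i = resample {0..} \<eta> \<omega>' i"
        using eq[of i] by (simp add: resample_def)
    qed (use w w' in \<open>auto intro: resample_space\<close>)
  qed
qed

lemma integral_partial_sum: "(LINT \<omega>|\<Omega>. partial_sum F p \<omega>) = 0"
  unfolding partial_sum_def
  using sq_integrable_integrable(1)[OF prob_Omega stationary_inputD(6)[OF F]] stationary_inputD(8)[OF F] by simp

lemma integral_block_mean: "(LINT \<omega>|\<Omega>. block_mean F p \<omega>) = 0"
proof -
  note S = sq_integrable_partial_sum[OF F, of p]
  have i: "integrable \<Omega>2 (\<lambda>x. partial_sum F p (resample {0..} (fst x) (snd x)))"
    by (rule sq_integrable_integrable(1)[OF prob_Omega2 sq_integrable_resample(1)[OF S]])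
  have [measurable]: "partial_sum F p \<in> borel_measurable \<Omega>" using S by (simp add: sq_integrable_def)
  have "(LINT \<omega>|\<Omega>. block_mean F p \<omega>) = (LINT x|\<Omega>2. partial_sum F p (resample {0..} (fst x) (snd x)))"
    unfolding block_mean_def using Om2.integral_fst'[OF i] by simp
  also have "\<dots> = (LINT \<omega>|distr \<Omega>2 \<Omega> (\<lambda>x. resample {0..} (fst x) (snd x)). partial_sum F p \<omega>)"
    by (rule integral_distr[symmetric]) measurable
  also have "\<dots> = 0" by (simp only: distr_resample integral_partial_sum)
  finally show ?thesis .
qed

definition "block_error \<omega> = partial_sum F p \<omega> - block_mean F p \<omega>"

lemma sq_integrable_block_error: "sq_integrable \<Omega> block_error"
  unfolding block_error_def[abs_def]
  by (rule sq_integrable_diff(1)[OF sq_integrable_partial_sum[OF F] sq_integrable_block_mean])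

lemma depends_on_block_error: "depends_on {..<int p} block_error"
  unfolding block_error_def[abs_def]
  by (rule depends_on_comp2[where g = "(-)", OF depends_on_partial_sum depends_on_mono[OF depends_on_block_mean]]) auto

lemma integral_block_error: "(LINT \<omega>|\<Omega>. block_error \<omega>) = 0"
  unfolding block_error_def
  using sq_integrable_integrable(1)[OF prob_Omega sq_integrable_partial_sum[OF F]]
    sq_integrable_integrable(1)[OF prob_Omega sq_integrable_block_mean] integral_partial_sum integral_block_mean by simp

text \<open>The summand at time \<open>m + r\<close> keeps the innovations from
  \<open>m - k = (m + r) - (k + r)\<close> on, so its own coefficient has index
  \<open>k + r\<close>: later summands feel the resampled past less.\<close>

lemma l2norm_partial_sum_resample:
  "l2norm \<Omega>2 (\<lambda>x. partial_sum F p (time_shift (int m) (fst x))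
      - partial_sum F p (time_shift (int m) (resample {int m - int k..} (fst x) (snd x)))) \<le> (\<Sum>r<p. dep_coef F (k + r))"
proof -
  have "l2norm \<Omega>2 (\<lambda>x. partial_sum F p (time_shift (int m) (fst x)) - partial_sum F p (time_shift (int m) (resample {int m - int k..} (fst x) (snd x))))
     = l2norm \<Omega>2 (\<lambda>x. \<Sum>r<p. F (time_shift (int (m + r)) (fst x)) - F (time_shift (int (m + r)) (resample {int (m + r) - int (k + r)..} (fst x) (snd x))))"
    by (simp add: partial_sum_def shift_shift sum_subtractf)
  also have "\<dots> \<le> (\<Sum>r<p. l2norm \<Omega>2 (\<lambda>x. F (time_shift (int (m + r)) (fst x)) - F (time_shift (int (m + r)) (resample {int (m + r) - int (k + r)..} (fst x) (snd x)))))"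
    by (intro sq_integrable_sum(2) sq_integrable_diff sq_integrable_fst(1)[OF stationary_inputD(6)[OF F]]
        sq_integrable_resample(1)[OF stationary_inputD(6)[OF F]])
  also have "\<dots> = (\<Sum>r<p. dep_coef F (k + r))"
    by (intro sum.cong refl l2norm_shift_resample stationary_inputD[OF F])
  finally show ?thesis .
qed

text \<open>The error is the mean, over the second sequence, of the change of the block sum when its
  past is resampled; Jensen's inequality bounds it by the sum of the coefficients. The bound does
  not depend on the block length \<open>p\<close>.\<close>

lemma l2norm_block_error: "l2norm \<Omega> block_error \<le> suminf (dep_coef F)"
proof -
  let ?S = "partial_sum F p"
  note S = sq_integrable_partial_sum[OF F, of p]
  have S2: "sq_integrable \<Omega>2 (\<lambda>(x, y). ?S (resample {0..} x y))"
    using sq_integrable_resample(1)[OF S] by (simp add: case_prod_unfold)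
  have D2: "sq_integrable \<Omega>2 (\<lambda>(x, y). ?S x - ?S (resample {0..} x y))"
    using sq_integrable_diff(1)[OF sq_integrable_fst(1)[OF S] sq_integrable_resample(1)[OF S]]
    by (simp add: case_prod_unfold)
  have "AE x in \<Omega>. block_error x = (LINT y|\<Omega>. ?S x - ?S (resample {0..} x y))"
    using sq_integrable_marginal(1)[OF prob_Omega prob_Omega S2]
  proof eventually_elim
    case (elim x)
    then show ?case
      using sq_integrable_integrable(1)[OF prob_Omega elim] prob_space.prob_space[OF prob_Omega]
      by (simp add: block_error_def block_mean_def)
  qed
  then have "l2norm \<Omega> block_error = l2norm \<Omega> (\<lambda>x. LINT y|\<Omega>. ?S x - ?S (resample {0..} x y))"
    by (rule l2norm_cong_AE(1))
      (use sq_integrable_block_error sq_integrable_marginal(2)[OF prob_Omega prob_Omega D2] in \<open>auto simp: sq_integrable_def\<close>)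
  also have "\<dots> \<le> l2norm \<Omega>2 (\<lambda>(x, y). ?S x - ?S (resample {0..} x y))"
    by (rule sq_integrable_marginal(3)[OF prob_Omega prob_Omega D2])
  also have "\<dots> \<le> (\<Sum>r<p. dep_coef F r)"
    using l2norm_partial_sum_resample[of 0 0] by (simp add: case_prod_unfold)
  also have "\<dots> \<le> suminf (dep_coef F)"
    by (intro sum_le_suminf stationary_inputD[OF F]) auto
  finally show ?thesis .
qed

text \<open>The norm of one block error and the summed covariance coefficients are bounded by the
  same \<open>\<Delta> = suminf (dep_coef F)\<close>, whence
  \<open>\<Delta>\<^sup>2 + 2 * \<Delta> * \<Delta>\<close> per block. Per unit of time this is of
  order \<open>1 / p\<close>.\<close>

lemma l2norm_sum_block_error:
  "(l2norm \<Omega> (\<lambda>\<omega>. \<Sum>j<K. block_error (time_shift (int (j * p)) \<omega>)))\<^sup>2 \<le> real K * (3 * (suminf (dep_coef F))\<^sup>2)"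
proof -
  define \<Delta> where "\<Delta> = suminf (dep_coef F)"
  \<comment> \<open>The coefficient series cut into consecutive groups of length \<open>p\<close>;
    regrouping keeps the total \<open>\<Delta>\<close>.\<close>
  define a where "a k = (\<Sum>r<p. dep_coef F (k * p + r))" for k
  have "dep_coef F sums \<Delta>" unfolding \<Delta>_def using stationary_inputD(4)[OF F] by (rule summable_sums)
  then have "(\<lambda>n. sum (dep_coef F) {n * p..<n * p + p}) sums \<Delta>"
    by (rule sums_group) (use p in simp)
  moreover have "sum (dep_coef F) {n * p..<n * p + p} = a n" for n
    using sum.shift_bounds_nat_ivl[of "dep_coef F" 0 "n * p" p] by (simp add: a_def lessThan_atLeast0 add.commute)
  ultimately have a: "a sums \<Delta>" by simp
  have e_int: "(LINT \<omega>|\<Omega>. block_error (time_shift n \<omega>)) = 0" for n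
    using integral_shift[OF sq_integrable_measurable[OF sq_integrable_block_error]] integral_block_error by simp
  note e_sq = sq_integrable_shift[OF sq_integrable_block_error]
  have "(l2norm \<Omega> (\<lambda>\<omega>. \<Sum>j<K. block_error (time_shift (int (j * p)) \<omega>)))\<^sup>2 \<le> real K * (\<Delta>\<^sup>2 + 2 * \<Delta> * suminf a)"
  proof (rule l2norm_sum_weakly_dependent)
    show "sq_integrable \<Omega> (\<lambda>\<omega>. block_error (time_shift (int (j * p)) \<omega>))" for j by (rule e_sq)
    show "l2norm \<Omega> (\<lambda>\<omega>. block_error (time_shift (int (j * p)) \<omega>)) \<le> \<Delta>" for j
      using l2norm_block_error by (simp only: e_sq \<Delta>_def)
    show "0 \<le> a i" for i unfolding a_def by (intro sum_nonneg) simp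
    show "summable a" using a by (rule sums_summable)
    show "\<Delta> \<ge> 0" unfolding \<Delta>_def by (intro suminf_nonneg stationary_inputD[OF F]) auto
    fix i j :: nat assume ij: "i < j"
    \<comment> \<open>Everything before the end of block \<open>i\<close> is resampled, which leaves
      the \<open>j - i - 1\<close> full blocks preceding block \<open>j\<close> intact.\<close>
    define A where "A = {int (i * p) + int p..}"
    have ijp: "(j - i - 1) * p + (i + 1) * p = j * p"
      using ij by (simp only: add_mult_distrib[symmetric]) simp
    have A: "A = {int (j * p) - int ((j - i - 1) * p)..}"
      unfolding A_def using arg_cong[OF ijp, of int] by (simp add: algebra_simps)
    have C: "depends_on {..<int (i * p) + int p} (\<lambda>\<omega>. block_error (time_shift (int (i * p)) \<omega>))"
      by (rule depends_on_mono[OF depends_on_shift[OF depends_on_block_error]]) auto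
    have CA: "{..<int (i * p) + int p} \<inter> A = {}" by (auto simp: A_def)
    have "\<bar>LINT x|\<Omega>. block_error (time_shift (int (i * p)) x) \<bullet> block_error (time_shift (int (j * p)) x)\<bar>
       \<le> l2norm \<Omega> (\<lambda>\<omega>. block_error (time_shift (int (i * p)) \<omega>)) *
         l2norm \<Omega>2 (\<lambda>x. block_error (time_shift (int (j * p)) (fst x)) - block_error (time_shift (int (j * p)) (resample A (fst x) (snd x))))"
      using integral_bilinear_resample_bound[OF bounded_bilinear_mult norm_mult_le e_sq(1) C e_sq(1) e_int CA] by simp
    also have "l2norm \<Omega>2 (\<lambda>x. block_error (time_shift (int (j * p)) (fst x)) - block_error (time_shift (int (j * p)) (resample A (fst x) (snd x))))
      = l2norm \<Omega>2 (\<lambda>x. partial_sum F p (time_shift (int (j * p)) (fst x)) - partial_sum F p (time_shift (int (j * p)) (resample A (fst x) (snd x))))"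
    proof (rule l2norm_cong)
      fix x assume "x \<in> space \<Omega>2"
      then have x: "fst x \<in> space \<Omega>" "snd x \<in> space \<Omega>" by (auto simp: space_pair_measure)
      \<comment> \<open>The block mean reads only its own block, which lies in \<open>A\<close>.
        Hence resampling changes the error exactly as it changes the block sum.\<close>
      have "block_mean F p (time_shift (int (j * p)) (fst x)) = block_mean F p (time_shift (int (j * p)) (resample A (fst x) (snd x)))"
      proof (rule depends_onD[OF depends_on_block_mean])
        fix k assume "k \<in> {0..<int p}"
        moreover have "0 \<le> int ((j - i - 1) * p)" by (rule of_nat_0_le_iff)
        ultimately have "int (j * p) + k \<in> A" by (simp add: A del: of_nat_mult)
        then show "time_shift (int (j * p)) (fst x) k = time_shift (int (j * p)) (resample A (fst x) (snd x)) k"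
          by (simp add: time_shift_def resample_def)
      qed (use x in \<open>auto intro!: shift_space resample_space\<close>)
      then show "block_error (time_shift (int (j * p)) (fst x)) - block_error (time_shift (int (j * p)) (resample A (fst x) (snd x)))
        = partial_sum F p (time_shift (int (j * p)) (fst x)) - partial_sum F p (time_shift (int (j * p)) (resample A (fst x) (snd x)))"
        by (simp add: block_error_def)
    qed
    also have "\<dots> \<le> a (j - i - 1)" unfolding A a_def by (rule l2norm_partial_sum_resample)
    finally have "\<bar>LINT x|\<Omega>. block_error (time_shift (int (i * p)) x) \<bullet> block_error (time_shift (int (j * p)) x)\<bar>
       \<le> l2norm \<Omega> (\<lambda>\<omega>. block_error (time_shift (int (i * p)) \<omega>)) * a (j - i - 1)" by (simp add: mult_left_mono)
    also have "\<dots> \<le> \<Delta> * a (j - i - 1)"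
      using l2norm_block_error e_sq(2) unfolding a_def \<Delta>_def by (intro mult_right_mono sum_nonneg) auto
    finally show "\<bar>LINT x|\<Omega>. block_error (time_shift (int (i * p)) x) \<bullet> block_error (time_shift (int (j * p)) x)\<bar> \<le> \<Delta> * a (j - i - 1)" .
  qed
  also have "\<dots> = real K * (3 * \<Delta>\<^sup>2)" using sums_unique[OF a] by (simp add: power2_eq_square)
  finally show ?thesis by (simp add: \<Delta>_def)
qed

lemma block_mean_clt:
  "(\<lambda>K. CLINT \<omega>|\<Omega>. iexp (t * ((\<Sum>j<K. block_mean F p (time_shift (int (j * p)) \<omega>)) / sqrt (real K))))
     \<longlonglongrightarrow> exp (- (t\<^sup>2 * (l2norm \<Omega> (block_mean F p))\<^sup>2) / 2)"
proof -
  define b where "b j \<omega> = block_mean F p (time_shift (int (j * p)) \<omega>)" for j \<omega>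
  have sq: "sq_integrable \<Omega> (b j)" and l2: "l2norm \<Omega> (b j) = l2norm \<Omega> (block_mean F p)" for j
    unfolding b_def by (intro sq_integrable_shift sq_integrable_block_mean)+
  have bm [measurable]: "b j \<in> borel_measurable \<Omega>" for j using sq by (simp add: sq_integrable_def)
  have bmm [measurable]: "block_mean F p \<in> borel_measurable \<Omega>" using sq_integrable_block_mean by (simp add: sq_integrable_def)
  show ?thesis
  proof (cases "l2norm \<Omega> (block_mean F p) = 0")
    \<comment> \<open>The iid central limit theorem requires a positive variance. For variance zero
      the sums vanish in L2, and the characteristic function is constantly 1.\<close>
    case True
    have "(CLINT \<omega>|\<Omega>. iexp (t * ((\<Sum>j<K. b j \<omega>) / sqrt (real K)))) = 1" for K
    proof -
      let ?f = "\<lambda>\<omega>. t * ((\<Sum>j<K. b j \<omega>) / sqrt (real K))"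
      have S: "sq_integrable \<Omega> (\<lambda>\<omega>. \<Sum>j<K. b j \<omega>)" "l2norm \<Omega> (\<lambda>\<omega>. \<Sum>j<K. b j \<omega>) \<le> 0"
        using sq_integrable_sum[of "{..<K}" \<Omega> b] sq l2 True by auto
      have "sq_integrable \<Omega> ?f" "l2norm \<Omega> ?f = 0"
        using sq_integrable_scaleR[OF S(1), of "t / sqrt (real K)"] S(2)
          l2norm_nonneg[of \<Omega> "\<lambda>\<omega>. \<Sum>j<K. b j \<omega>"] by auto
      then show ?thesis
        using integral_iexp_close[OF prob_Omega, of ?f "\<lambda>_. 0"] prob_space.prob_space[OF prob_Omega] by simp
    qed
    then show ?thesis using True by (simp add: b_def)
  next
    case False
    define \<sigma> where "\<sigma> = l2norm \<Omega> (block_mean F p)"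
    have \<sigma>: "\<sigma> > 0" using False l2norm_nonneg[of \<Omega> "block_mean F p"] unfolding \<sigma>_def by linarith
    have mean: "(LINT \<omega>|\<Omega>. b j \<omega>) = 0" for j
      unfolding b_def using integral_shift[OF bmm] integral_block_mean by simp
    have ind: "Om.indep_vars (\<lambda>_. borel) b UNIV"
    proof (rule indep_vars_disjoint_windows[OF bm])
      show "depends_on {int (j * p)..<int (j * p) + int p} (b j)" for j
        unfolding b_def by (rule depends_on_mono[OF depends_on_shift[OF depends_on_block_mean]]) auto
      have *: "j = k" if "int (j * p) \<le> x" "x < int (j * p) + int p" "int (k * p) \<le> x" "x < int (k * p) + int p" for j k x
      proof -
        have "int (j * p) < int ((k + 1) * p)" "int (k * p) < int ((j + 1) * p)" using that by simp_all
        then have "j * p < (k + 1) * p" "k * p < (j + 1) * p" by (simp_all only: of_nat_less_iff)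
        then have "j < k + 1" "k < j + 1" by (simp_all only: mult_less_cancel2)
        then show "j = k" by simp
      qed
      show "disjoint_family (\<lambda>j. {int (j * p)..<int (j * p) + int p})"
        unfolding disjoint_family_on_def
      proof (intro ballI impI equals0I)
        fix j k x assume "j \<noteq> k"
          and "x \<in> {int (j * p)..<int (j * p) + int p} \<inter> {int (k * p)..<int (k * p) + int p}"
        then show False using *[of j x k] by (simp del: of_nat_mult)
      qed
    qed
    have "weak_conv_m (\<lambda>n. distr \<Omega> borel (\<lambda>x. (\<Sum>i<n. b i x) / sqrt (n * \<sigma>\<^sup>2))) std_normal_distribution"
    proof (rule Om.central_limit_theorem_zero_mean[OF ind mean \<sigma>])
      show "integrable \<Omega> (\<lambda>x. (b n x)\<^sup>2)" for n using sq[of n] by (simp add: sq_integrable_def)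
      show "Om.variance (b n) = \<sigma>\<^sup>2" for n
        using mean l2norm_sq[of \<Omega> "b n"] l2[of n] by (simp add: \<sigma>_def)
      show "distr \<Omega> borel (b n) = distr \<Omega> borel (block_mean F p)" for n
      proof -
        have "distr \<Omega> borel (b n) = distr (distr \<Omega> \<Omega> (time_shift (int (n * p)))) borel (block_mean F p)"
          unfolding b_def by (subst distr_distr) (auto simp: o_def)
        then show ?thesis by (simp only: distr_shift)
      qed
    qed
    \<comment> \<open>The theorem normalises by \<open>sqrt (n * \<sigma>\<^sup>2)\<close>, so the
      frequency \<open>t\<close> becomes \<open>t * \<sigma>\<close>.\<close>
    then have "(\<lambda>n. char (distr \<Omega> borel (\<lambda>x. (\<Sum>i<n. b i x) / sqrt (n * \<sigma>\<^sup>2))) (t * \<sigma>)) \<longlonglongrightarrow> char std_normal_distribution (t * \<sigma>)"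
      by (intro levy_continuity1) (auto intro!: Om.real_distribution_distr real_dist_normal_dist)
    moreover have "char (distr \<Omega> borel (\<lambda>x. (\<Sum>i<n. b i x) / sqrt (n * \<sigma>\<^sup>2))) (t * \<sigma>)
      = (CLINT \<omega>|\<Omega>. iexp (t * ((\<Sum>j<n. b j \<omega>) / sqrt (real n))))" for n
      unfolding char_def using \<sigma> by (subst integral_distr) (auto simp: real_sqrt_mult)
    ultimately show ?thesis
      by (simp add: char_std_normal_distribution b_def \<sigma>_def power_mult_distrib)
  qed
qed

lemma partial_sum_blocks:
  "partial_sum F (K * p) \<omega> = (\<Sum>j<K. partial_sum F p (time_shift (int (j * p)) \<omega>))"
proof -
  have "partial_sum F p (time_shift (int (j * p)) \<omega>) = (\<Sum>n\<in>{j * p..<j * p + p}. F (time_shift (int n) \<omega>))" for j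
    using sum.shift_bounds_nat_ivl[of "\<lambda>n. F (time_shift (int n) \<omega>)" 0 "j * p" p]
    by (simp add: partial_sum_def lessThan_atLeast0 shift_shift add.commute)
  then show ?thesis
    unfolding partial_sum_def[of F "K * p"] sum.nat_group[symmetric] by simp
qed

text \<open>One summand for each source of error: the fewer than \<open>p\<close> terms after the
  last complete block, the change of normalisation from \<open>N\<close> to \<open>K * p\<close>,
  and the block errors. The first two vanish as \<open>N\<close> grows with \<open>p\<close> fixed;
  the third is free of \<open>N\<close> and small for large \<open>p\<close>.\<close>

lemma partial_sum_approx_by_blocks:
  assumes N: "N \<ge> p"
  defines "K \<equiv> N div p"
  shows "l2norm \<Omega> (\<lambda>\<omega>. partial_sum F N \<omega> / sqrt (real N) - (\<Sum>j<K. block_mean F p (time_shift (int (j * p)) \<omega>)) / sqrt (real (K * p)))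
    \<le> real p * l2norm \<Omega> F / sqrt (real N)
      + real p / real N * sqrt ((l2norm \<Omega> F)\<^sup>2 + 2 * l2norm \<Omega> F * suminf (dep_coef F))
      + sqrt 3 * suminf (dep_coef F) / sqrt (real p)"
proof -
  define c where "c = (l2norm \<Omega> F)\<^sup>2 + 2 * l2norm \<Omega> F * suminf (dep_coef F)"
  have \<Delta>: "0 \<le> suminf (dep_coef F)" by (intro suminf_nonneg stationary_inputD[OF F]) auto
  have c: "c \<ge> 0" unfolding c_def using \<Delta> by simp
  have K: "K \<ge> 1" "K * p \<le> N" "N < K * p + p"
  proof -
    show "K \<ge> 1" unfolding K_def using div_le_mono[OF N, of p] p by simp
    have "K * p + N mod p = N" unfolding K_def by (rule div_mult_mod_eq)
    moreover have "N mod p < p" using p by simp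
    ultimately show "K * p \<le> N" "N < K * p + p" by linarith+
  qed
  define T where "T \<omega> = (\<Sum>j<K. block_mean F p (time_shift (int (j * p)) \<omega>))" for \<omega>
  define R where "R \<omega> = (\<Sum>n\<in>{K * p..<N}. F (time_shift (int n) \<omega>))" for \<omega>
  have R: "sq_integrable \<Omega> R" "l2norm \<Omega> R \<le> real p * l2norm \<Omega> F"
  proof -
    show "sq_integrable \<Omega> R" unfolding R_def by (intro sq_integrable_sum stationary_inputD(6)[OF F])
    have "l2norm \<Omega> R \<le> (\<Sum>n\<in>{K * p..<N}. l2norm \<Omega> (\<lambda>\<omega>. F (time_shift (int n) \<omega>)))"
      unfolding R_def by (intro sq_integrable_sum stationary_inputD(6)[OF F])
    also have "\<dots> = real (N - K * p) * l2norm \<Omega> F" by (simp add: stationary_inputD(9)[OF F])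
    also have "\<dots> \<le> real p * l2norm \<Omega> F" using K by (intro mult_right_mono of_nat_mono) auto
    finally show "l2norm \<Omega> R \<le> real p * l2norm \<Omega> F" .
  qed
  have SR: "partial_sum F N \<omega> = partial_sum F (K * p) \<omega> + R \<omega>" for \<omega>
    unfolding partial_sum_def R_def using K sum.atLeastLessThan_concat[of 0 "K * p" N "\<lambda>n. F (time_shift (int n) \<omega>)"]
    by (simp add: lessThan_atLeast0)
  note S = sq_integrable_partial_sum[OF F, of "K * p"]
  have l2S: "l2norm \<Omega> (partial_sum F (K * p)) \<le> sqrt (real (K * p)) * sqrt c"
    unfolding real_sqrt_mult[symmetric] c_def
    by (rule real_le_rsqrt) (use l2norm_partial_sum[OF F, of "K * p"] in \<open>simp add: partial_sum_def[abs_def]\<close>)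
  have E: "partial_sum F (K * p) \<omega> - T \<omega> = (\<Sum>j<K. block_error (time_shift (int (j * p)) \<omega>))" for \<omega>
    unfolding partial_sum_blocks T_def block_error_def by (simp add: sum_subtractf)
  have E1: "sq_integrable \<Omega> (\<lambda>\<omega>. partial_sum F (K * p) \<omega> - T \<omega>)"
    unfolding E by (intro sq_integrable_sum sq_integrable_shift sq_integrable_block_error)
  have E2: "l2norm \<Omega> (\<lambda>\<omega>. partial_sum F (K * p) \<omega> - T \<omega>) \<le> sqrt (real K) * (sqrt 3 * suminf (dep_coef F))"
  proof -
    have "l2norm \<Omega> (\<lambda>\<omega>. partial_sum F (K * p) \<omega> - T \<omega>) \<le> sqrt (real K * (3 * (suminf (dep_coef F))\<^sup>2))"
      unfolding E by (rule real_le_rsqrt[OF l2norm_sum_block_error])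
    then show ?thesis using \<Delta> by (simp add: real_sqrt_mult)
  qed
  have Np: "real N > 0" "real (K * p) > 0" using N p K by auto
  define d where "d = 1 / sqrt (real N) - 1 / sqrt (real (K * p))"
  have d: "\<bar>d\<bar> * sqrt (real (K * p)) \<le> real p / real N"
  proof -
    \<comment> \<open>\<open>q\<close> is the share of the terms lying in complete blocks. The
      relative change of normalisation is \<open>1 - sqrt q \<le> 1 - q\<close>, which is at most
      \<open>p / N\<close>.\<close>
    define q where "q = real (K * p) / real N"
    have q: "0 < q" unfolding q_def using Np(2,1) by (rule divide_pos_pos)
    have q1: "q \<le> 1" unfolding q_def divide_le_eq_1_pos[OF Np(1)] using K(2) by (rule of_nat_mono)
    have "sqrt (real N) \<ge> sqrt (real (K * p))" using K(2) by (simp del: of_nat_mult)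
    then have "1 / sqrt (real N) \<le> 1 / sqrt (real (K * p))" using Np by (intro divide_left_mono) auto
    then have "\<bar>d\<bar> = 1 / sqrt (real (K * p)) - 1 / sqrt (real N)" by (simp add: d_def)
    then have "\<bar>d\<bar> * sqrt (real (K * p)) = 1 - sqrt q"
      using Np by (simp add: q_def left_diff_distrib real_sqrt_divide del: of_nat_mult)
    also have "\<dots> \<le> 1 - q"
    proof -
      have "q * q \<le> q * 1" using q q1 by (intro mult_left_mono) auto
      then have "q \<le> sqrt q" by (intro real_le_rsqrt) (simp add: power2_eq_square)
      then show ?thesis by simp
    qed
    also have "1 - q = (real N - real (K * p)) / real N" using Np by (simp add: q_def diff_divide_distrib)
    also have "\<dots> \<le> real p / real N"
    proof (intro divide_right_mono)
      have "real N < real (K * p + p)" using K(3) by (simp only: of_nat_less_iff)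
      then show "real N - real (K * p) \<le> real p" by (simp del: of_nat_mult)
    qed simp
    finally show ?thesis .
  qed
  have eq: "partial_sum F N \<omega> / sqrt (real N) - T \<omega> / sqrt (real (K * p))
      = (1 / sqrt (real N)) *\<^sub>R R \<omega> + d *\<^sub>R partial_sum F (K * p) \<omega> + (1 / sqrt (real (K * p))) *\<^sub>R (partial_sum F (K * p) \<omega> - T \<omega>)" for \<omega>
    unfolding SR d_def by (simp add: add_divide_distrib left_diff_distrib diff_divide_distrib)
  have "l2norm \<Omega> (\<lambda>\<omega>. partial_sum F N \<omega> / sqrt (real N) - T \<omega> / sqrt (real (K * p)))
    \<le> l2norm \<Omega> (\<lambda>\<omega>. (1 / sqrt (real N)) *\<^sub>R R \<omega>) + l2norm \<Omega> (\<lambda>\<omega>. d *\<^sub>R partial_sum F (K * p) \<omega>)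
      + l2norm \<Omega> (\<lambda>\<omega>. (1 / sqrt (real (K * p))) *\<^sub>R (partial_sum F (K * p) \<omega> - T \<omega>))"
    unfolding eq
    using sq_integrable_add[OF sq_integrable_add(1)[OF sq_integrable_scaleR(1)[OF R(1)] sq_integrable_scaleR(1)[OF S]]
        sq_integrable_scaleR(1)[OF E1], of "1 / sqrt (real N)" d "1 / sqrt (real (K * p))"]
      sq_integrable_add(2)[OF sq_integrable_scaleR(1)[OF R(1)] sq_integrable_scaleR(1)[OF S], of "1 / sqrt (real N)" d]
    by linarith
  also have "\<dots> = l2norm \<Omega> R / sqrt (real N) + \<bar>d\<bar> * l2norm \<Omega> (partial_sum F (K * p))
      + l2norm \<Omega> (\<lambda>\<omega>. partial_sum F (K * p) \<omega> - T \<omega>) / sqrt (real (K * p))"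
    unfolding sq_integrable_scaleR(2)[OF R(1)] sq_integrable_scaleR(2)[OF S] sq_integrable_scaleR(2)[OF E1] by simp
  also have "\<dots> \<le> real p * l2norm \<Omega> F / sqrt (real N) + real p / real N * sqrt c + sqrt 3 * suminf (dep_coef F) / sqrt (real p)"
  proof (intro add_mono)
    show "l2norm \<Omega> R / sqrt (real N) \<le> real p * l2norm \<Omega> F / sqrt (real N)"
      using R(2) by (intro divide_right_mono) auto
    have "\<bar>d\<bar> * l2norm \<Omega> (partial_sum F (K * p)) \<le> \<bar>d\<bar> * (sqrt (real (K * p)) * sqrt c)"
      by (intro mult_left_mono l2S) auto
    also have "\<dots> = (\<bar>d\<bar> * sqrt (real (K * p))) * sqrt c" by simp
    also have "\<dots> \<le> real p / real N * sqrt c" using d c by (intro mult_right_mono) auto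
    finally show "\<bar>d\<bar> * l2norm \<Omega> (partial_sum F (K * p)) \<le> real p / real N * sqrt c" .
    have "l2norm \<Omega> (\<lambda>\<omega>. partial_sum F (K * p) \<omega> - T \<omega>) / sqrt (real (K * p))
      \<le> sqrt (real K) * (sqrt 3 * suminf (dep_coef F)) / sqrt (real (K * p))"
      using E2 by (intro divide_right_mono) auto
    also have "\<dots> = sqrt 3 * suminf (dep_coef F) / sqrt (real p)"
      using K(1) by (simp add: real_sqrt_mult)
    finally show "l2norm \<Omega> (\<lambda>\<omega>. partial_sum F (K * p) \<omega> - T \<omega>) / sqrt (real (K * p)) \<le> sqrt 3 * suminf (dep_coef F) / sqrt (real p)" .
  qed
  finally show ?thesis by (simp add: T_def c_def)
qed

end

text \<open>The norms of block sum and block mean differ by at most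
  \<open>suminf (dep_coef F)\<close>, whatever \<open>p\<close> is. Division by
  \<open>sqrt p\<close> makes this vanish, so the variance of the block mean per unit of time has
  the limit already known for partial sums.\<close>

lemma block_length_limit:
  assumes F: "stationary_input F"
  shows "(\<lambda>p. (l2norm \<Omega> (block_mean F p))\<^sup>2 / real p) \<longlonglongrightarrow> lrv F"
proof -
  define S where "S p = l2norm \<Omega> (partial_sum F p) / sqrt (real p)" for p
  define B where "B p = l2norm \<Omega> (block_mean F p) / sqrt (real p)" for p
  have "(\<lambda>p. sqrt ((l2norm \<Omega> (partial_sum F p))\<^sup>2 / real p)) \<longlonglongrightarrow> sqrt (lrv F)"
    by (intro tendsto_intros second_moment_limit F)
  then have S: "S \<longlonglongrightarrow> sqrt (lrv F)" by (simp add: S_def[abs_def] real_sqrt_divide)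
  have "lrv F \<ge> 0" by (rule LIMSEQ_le_const[OF second_moment_limit[OF F]]) auto
  have "(\<lambda>p. B p - S p) \<longlonglongrightarrow> 0"
  proof (rule Lim_null_comparison)
    show "\<forall>\<^sub>F p in sequentially. norm (B p - S p) \<le> suminf (dep_coef F) / sqrt (real p)"
    proof (rule eventually_sequentiallyI)
      fix p :: nat assume p: "1 \<le> p"
      note a = sq_integrable_partial_sum[OF F, of p] and b = sq_integrable_block_mean[OF F p]
        and e = sq_integrable_block_error[OF F p]
      have 1: "l2norm \<Omega> (partial_sum F p) \<le> l2norm \<Omega> (block_mean F p) + l2norm \<Omega> (block_error F p)"
        using l2norm_triangle_diff[OF a b] by (simp add: block_error_def[OF F p, abs_def])
      have 2: "l2norm \<Omega> (block_mean F p) \<le> l2norm \<Omega> (partial_sum F p) + l2norm \<Omega> (block_error F p)"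
        using sq_integrable_diff(2)[OF a e] by (simp add: block_error_def[OF F p])
      have "\<bar>l2norm \<Omega> (block_mean F p) - l2norm \<Omega> (partial_sum F p)\<bar> \<le> suminf (dep_coef F)"
        using 1 2 l2norm_block_error[OF F p] by linarith
      then have "\<bar>l2norm \<Omega> (block_mean F p) - l2norm \<Omega> (partial_sum F p)\<bar> / sqrt (real p) \<le> suminf (dep_coef F) / sqrt (real p)"
        by (rule divide_right_mono) simp
      then show "norm (B p - S p) \<le> suminf (dep_coef F) / sqrt (real p)"
        by (simp add: B_def S_def diff_divide_distrib[symmetric])
    qed
    show "(\<lambda>p. suminf (dep_coef F) / sqrt (real p)) \<longlonglongrightarrow> 0"
      by (intro tendsto_divide_0[OF tendsto_const] filterlim_at_top_imp_at_infinity
          filterlim_compose[OF sqrt_at_top filterlim_real_sequentially])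
  qed
  from tendsto_add[OF this S] have "B \<longlonglongrightarrow> sqrt (lrv F)" by simp
  from tendsto_power[OF this, of 2] show ?thesis
    using \<open>lrv F \<ge> 0\<close> by (simp add: B_def power_divide)
qed

text \<open>The two limits are taken in succession: \<open>p\<close> is fixed first, so large that
  the block errors and the replacement of \<open>v p\<close> by \<open>lrv F\<close> cost less than
  \<open>e / 4\<close> each, and only then does \<open>N\<close> tend to infinity.\<close>

theorem central_limit_characteristic:
  assumes F: "stationary_input F"
  shows "(\<lambda>N. CLINT \<omega>|\<Omega>. iexp (t * (partial_sum F N \<omega> / sqrt (real N)))) \<longlonglongrightarrow> exp (- (t\<^sup>2 * lrv F) / 2)"
proof (rule LIMSEQ_I)
  fix e :: real assume "e > 0"
  define \<phi> where "\<phi> N = (CLINT \<omega>|\<Omega>. iexp (t * (partial_sum F N \<omega> / sqrt (real N))))" for N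
  define \<Delta> where "\<Delta> = suminf (dep_coef F)"
  define v where "v p = (l2norm \<Omega> (block_mean F p))\<^sup>2 / real p" for p
  have "(\<lambda>p. exp (- (t\<^sup>2 * v p) / 2)) \<longlonglongrightarrow> exp (- (t\<^sup>2 * lrv F) / 2)"
    unfolding v_def by (intro tendsto_intros block_length_limit F) simp
  from tendstoD[OF this, of "e / 4"] have ev1: "\<forall>\<^sub>F p in sequentially. \<bar>exp (- (t\<^sup>2 * v p) / 2) - exp (- (t\<^sup>2 * lrv F) / 2)\<bar> < e / 4"
    using \<open>e > 0\<close> by (simp add: dist_real_def)
  have "(\<lambda>p. \<bar>t\<bar> * (sqrt 3 * \<Delta> / sqrt (real p))) \<longlonglongrightarrow> \<bar>t\<bar> * 0"
    by (intro tendsto_intros tendsto_divide_0[OF tendsto_const] filterlim_at_top_imp_at_infinity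
        filterlim_compose[OF sqrt_at_top filterlim_real_sequentially])
  then have ev2: "\<forall>\<^sub>F p in sequentially. \<bar>t\<bar> * (sqrt 3 * \<Delta> / sqrt (real p)) < e / 4"
    using \<open>e > 0\<close> by (intro order_tendstoD(2)) auto
  obtain p where p: "p \<ge> 1" and p1: "\<bar>exp (- (t\<^sup>2 * v p) / 2) - exp (- (t\<^sup>2 * lrv F) / 2)\<bar> < e / 4"
    and p2: "\<bar>t\<bar> * (sqrt 3 * \<Delta> / sqrt (real p)) < e / 4"
    using eventually_happens[OF eventually_conj[OF eventually_ge_at_top[of 1] eventually_conj[OF ev1 ev2]]] by auto
  define T where "T K \<omega> = (\<Sum>j<K. block_mean F p (time_shift (int (j * p)) \<omega>))" for K \<omega>
  define \<psi> where "\<psi> K = (CLINT \<omega>|\<Omega>. iexp (t / sqrt (real p) * (T K \<omega> / sqrt (real K))))" for K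
  have "\<psi> \<longlonglongrightarrow> exp (- ((t / sqrt (real p))\<^sup>2 * (l2norm \<Omega> (block_mean F p))\<^sup>2) / 2)"
    unfolding \<psi>_def T_def by (rule block_mean_clt[OF F p])
  also have "(t / sqrt (real p))\<^sup>2 * (l2norm \<Omega> (block_mean F p))\<^sup>2 = t\<^sup>2 * v p"
    by (simp add: v_def power_divide)
  finally have \<psi>: "\<psi> \<longlonglongrightarrow> exp (- (t\<^sup>2 * v p) / 2)" .
  have "filterlim (\<lambda>N. N div p) at_top sequentially"
    unfolding filterlim_at_top
  proof
    fix k
    show "\<forall>\<^sub>F N in sequentially. k \<le> N div p"
    proof (rule eventually_sequentiallyI[of "k * p"])
      fix N assume "k * p \<le> N"
      then show "k \<le> N div p" using div_le_mono[of "k * p" N p] p by simp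
    qed
  qed
  from tendstoD[OF filterlim_compose[OF \<psi> this], of "e / 4"]
  have ev3: "\<forall>\<^sub>F N in sequentially. cmod (\<psi> (N div p) - exp (- (t\<^sup>2 * v p) / 2)) < e / 4"
    using \<open>e > 0\<close> by (simp add: dist_norm)
  define c where "c = sqrt ((l2norm \<Omega> F)\<^sup>2 + 2 * l2norm \<Omega> F * \<Delta>)"
  have "(\<lambda>N. \<bar>t\<bar> * (real p * l2norm \<Omega> F / sqrt (real N) + real p / real N * c)) \<longlonglongrightarrow> \<bar>t\<bar> * (0 + 0 * c)"
    by (intro tendsto_intros tendsto_divide_0[OF tendsto_const] filterlim_at_top_imp_at_infinity
        filterlim_compose[OF sqrt_at_top filterlim_real_sequentially] filterlim_real_sequentially)
  then have ev4: "\<forall>\<^sub>F N in sequentially. \<bar>t\<bar> * (real p * l2norm \<Omega> F / sqrt (real N) + real p / real N * c) < e / 4"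
    using \<open>e > 0\<close> by (intro order_tendstoD(2)) auto
  have "\<forall>\<^sub>F N in sequentially. cmod (\<phi> N - exp (- (t\<^sup>2 * lrv F) / 2)) < e"
    using ev3 ev4 eventually_ge_at_top[of p]
  proof eventually_elim
    case (elim N)
    note S = sq_integrable_partial_sum[OF F, of N]
    have T: "sq_integrable \<Omega> (T (N div p))"
      unfolding T_def by (intro sq_integrable_sum sq_integrable_shift sq_integrable_block_mean[OF F p])
    let ?f = "\<lambda>\<omega>. partial_sum F N \<omega> / sqrt (real N)"
    let ?g = "\<lambda>\<omega>. T (N div p) \<omega> / sqrt (real (N div p * p))"
    have f: "sq_integrable \<Omega> ?f" using sq_integrable_scaleR(1)[OF S, of "1 / sqrt (real N)"] by simp
    have g: "sq_integrable \<Omega> ?g" using sq_integrable_scaleR(1)[OF T, of "1 / sqrt (real (N div p * p))"] by simp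
    have "cmod (\<phi> N - \<psi> (N div p)) = cmod ((CLINT \<omega>|\<Omega>. iexp (t *\<^sub>R ?f \<omega>)) - (CLINT \<omega>|\<Omega>. iexp (t *\<^sub>R ?g \<omega>)))"
      unfolding \<phi>_def \<psi>_def by (simp add: real_sqrt_mult mult.commute)
    also have "\<dots> \<le> l2norm \<Omega> (\<lambda>\<omega>. t *\<^sub>R ?f \<omega> - t *\<^sub>R ?g \<omega>)"
      by (intro integral_iexp_close prob_Omega sq_integrable_scaleR f g)
    also have "\<dots> = \<bar>t\<bar> * l2norm \<Omega> (\<lambda>\<omega>. ?f \<omega> - ?g \<omega>)"
      using sq_integrable_scaleR(2)[OF sq_integrable_diff(1)[OF f g], of t] by (simp add: right_diff_distrib)
    also have "\<dots> \<le> \<bar>t\<bar> * (real p * l2norm \<Omega> F / sqrt (real N) + real p / real N * c + sqrt 3 * \<Delta> / sqrt (real p))"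
      using partial_sum_approx_by_blocks[OF F p elim(3)]
      unfolding T_def c_def \<Delta>_def by (intro mult_left_mono) auto
    also have "\<dots> < e / 4 + e / 4"
      using elim(2) p2 unfolding distrib_left[of "\<bar>t\<bar>" "_ + _"] by linarith
    finally have a1: "cmod (\<phi> N - \<psi> (N div p)) < e / 2" by simp
    have "cmod (exp (- (t\<^sup>2 * v p) / 2) - exp (- (t\<^sup>2 * lrv F) / 2)) < e / 4"
      using p1 by (simp only: of_real_diff[symmetric] norm_of_real)
    then have "cmod (\<psi> (N div p) - exp (- (t\<^sup>2 * lrv F) / 2)) < e / 4 + e / 4"
      using elim(1) norm_triangle_lt[of "\<psi> (N div p) - exp (- (t\<^sup>2 * v p) / 2)" "exp (- (t\<^sup>2 * v p) / 2) - exp (- (t\<^sup>2 * lrv F) / 2)" "e / 4 + e / 4"]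
      by simp
    then show ?case
      using a1 norm_triangle_lt[of "\<phi> N - \<psi> (N div p)" "\<psi> (N div p) - exp (- (t\<^sup>2 * lrv F) / 2)" e] by simp
  qed
  then show "\<exists>no. \<forall>N\<ge>no. norm ((CLINT \<omega>|\<Omega>. iexp (t * (partial_sum F N \<omega> / sqrt (real N)))) - complex_of_real (exp (- (t\<^sup>2 * lrv F) / 2))) < e"
    unfolding eventually_sequentially \<phi>_def by simp
qed

end

section \<open>Spectral theorem for trace class operators\<close>

definition orthonormal :: "'a::real_inner set \<Rightarrow> bool" where
  "orthonormal B \<longleftrightarrow> (\<forall>x\<in>B. norm x = 1) \<and> pairwise orthogonal B"

lemma orthonormal_inner:
  "orthonormal B \<Longrightarrow> x \<in> B \<Longrightarrow> y \<in> B \<Longrightarrow> x \<bullet> y = (if x = y then 1 else 0)"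
  by (auto simp: orthonormal_def pairwise_def orthogonal_def power2_norm_eq_inner[symmetric])

lemma orthonormal_mono: "orthonormal B \<Longrightarrow> A \<subseteq> B \<Longrightarrow> orthonormal A"
  unfolding orthonormal_def pairwise_def by (meson subsetD)

lemma orthonormal_basis_orthonormal: "orthonormal_basis B \<Longrightarrow> orthonormal B"
  by (simp add: orthonormal_basis_def orthonormal_def)

lemma orthonormal_insert:
  assumes "orthonormal B" "norm z = 1" "\<And>b. b \<in> B \<Longrightarrow> z \<bullet> b = 0"
  shows "orthonormal (insert z B)"
  using assms unfolding orthonormal_def by (auto simp: pairwise_insert orthogonal_def inner_commute)

lemma orthonormal_residual:
  assumes "orthonormal G" "finite G"
  shows "b \<in> G \<Longrightarrow> (x - (\<Sum>c\<in>G. (x \<bullet> c) *\<^sub>R c)) \<bullet> b = 0"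
    and "(norm (x - (\<Sum>c\<in>G. (x \<bullet> c) *\<^sub>R c)))\<^sup>2 = (norm x)\<^sup>2 - (\<Sum>c\<in>G. (x \<bullet> c)\<^sup>2)"
proof -
  let ?y = "\<Sum>c\<in>G. (x \<bullet> c) *\<^sub>R c"
  have yb: "?y \<bullet> b = x \<bullet> b" if "b \<in> G" for b
  proof -
    have "?y \<bullet> b = (\<Sum>c\<in>G. if c = b then x \<bullet> c else 0)"
      unfolding inner_sum_left using orthonormal_inner[OF assms(1) _ that] by (intro sum.cong) auto
    then show ?thesis using assms(2) that by simp
  qed
  then show "b \<in> G \<Longrightarrow> (x - ?y) \<bullet> b = 0" by (simp add: inner_diff_left)
  have xy: "x \<bullet> ?y = (\<Sum>c\<in>G. (x \<bullet> c)\<^sup>2)" by (simp add: inner_sum_right power2_eq_square)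
  have "?y \<bullet> ?y = (\<Sum>c\<in>G. (x \<bullet> c) * (?y \<bullet> c))" by (simp add: inner_sum_right)
  also have "\<dots> = (\<Sum>c\<in>G. (x \<bullet> c)\<^sup>2)" by (intro sum.cong) (simp_all add: yb power2_eq_square)
  finally have yy: "?y \<bullet> ?y = (\<Sum>c\<in>G. (x \<bullet> c)\<^sup>2)" .
  show "(norm (x - ?y))\<^sup>2 = (norm x)\<^sup>2 - (\<Sum>c\<in>G. (x \<bullet> c)\<^sup>2)"
    unfolding power2_norm_eq_inner inner_diff_left inner_diff_right inner_commute[of ?y x] xy yy by simp
qed

lemma bessel_finite: "orthonormal G \<Longrightarrow> finite G \<Longrightarrow> (\<Sum>c\<in>G. (x \<bullet> c)\<^sup>2) \<le> (norm x)\<^sup>2"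
  using orthonormal_residual(2)[of G x] zero_le_power2[of "norm (x - (\<Sum>c\<in>G. (x \<bullet> c) *\<^sub>R c))"] by linarith

lemma orthonormal_extend_basis:
  fixes B1 :: "'a::separable_hilbert set"
  assumes "orthonormal B1"
  shows "\<exists>B. orthonormal_basis B \<and> B1 \<subseteq> B"
proof -
  \<comment> \<open>Only the added vectors vary in the Zorn argument, so the union of the empty
    chain, \<open>{}\<close>, is admissible.\<close>
  define \<A> where "\<A> = {B :: 'a set. orthonormal (B1 \<union> B)}"
  have "\<exists>M\<in>\<A>. \<forall>X\<in>\<A>. M \<subseteq> X \<longrightarrow> X = M"
  proof (rule subset_Zorn')
    fix C assume C: "subset.chain \<A> C"
    then have CA: "C \<subseteq> \<A>" and total: "\<And>X Y. X \<in> C \<Longrightarrow> Y \<in> C \<Longrightarrow> X \<subseteq> Y \<or> Y \<subseteq> X"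
      by (auto simp: subset_chain_def)
    have on: "orthonormal (B1 \<union> Y)" if "Y \<in> C" for Y using CA that by (auto simp: \<A>_def)
    have "orthogonal x y" if xy: "x \<in> B1 \<union> \<Union>C" "y \<in> B1 \<union> \<Union>C" "x \<noteq> y" for x y
    proof -
      have "(x \<in> B1 \<and> y \<in> B1) \<or> (\<exists>Y\<in>C. x \<in> B1 \<union> Y \<and> y \<in> B1 \<union> Y)"
      proof (cases "x \<in> \<Union>C \<and> y \<in> \<Union>C")
        case True
        then obtain X Y where "X \<in> C" "Y \<in> C" "x \<in> X" "y \<in> Y" by blast
        then show ?thesis using total[of X Y] by blast
      next
        case False
        then show ?thesis using xy by blast
      qed
      then show ?thesis using assms on xy(3) by (auto simp: orthonormal_def pairwise_def)
    qed
    moreover have "norm x = 1" if "x \<in> B1 \<union> \<Union>C" for x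
      using that assms on by (auto simp: orthonormal_def)
    ultimately show "\<Union>C \<in> \<A>" unfolding \<A>_def orthonormal_def by (simp add: pairwise_def)
  qed
  then obtain M where M: "M \<in> \<A>" and max: "\<And>X. X \<in> \<A> \<Longrightarrow> M \<subseteq> X \<Longrightarrow> X = M" by metis
  define B where "B = B1 \<union> M"
  have B: "orthonormal B" using M by (simp add: \<A>_def B_def)
  have "x = 0" if x: "\<forall>b\<in>B. x \<bullet> b = 0" for x
  proof (rule ccontr)
    assume "x \<noteq> 0"
    define z where "z = (1 / norm x) *\<^sub>R x"
    have nz: "norm z = 1" using \<open>x \<noteq> 0\<close> by (simp add: z_def)
    have "orthonormal (insert z B)" using B nz x by (intro orthonormal_insert) (auto simp: z_def)
    then have "insert z M \<in> \<A>" by (simp add: \<A>_def B_def)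
    then have "z \<in> B" using max[of "insert z M"] by (auto simp: B_def)
    then have "z \<bullet> z = 0" using x by (auto simp: z_def)
    then show False using nz by simp
  qed
  then have "closure (span B) = UNIV"
    using B by (intro closure_span_orthonormal) (auto simp: orthonormal_def)
  then show ?thesis using B unfolding orthonormal_basis_def orthonormal_def B_def by blast
qed

text \<open>\<open>T\<close> is the Hilbert-Schmidt limit of finite-rank truncations, which map the
  unit ball into compact sets. The Hilbert-Schmidt norm dominates the operator norm, so the image of
  the ball under \<open>T\<close> is totally bounded.\<close>

lemma hs_compact:
  fixes T :: "'a::separable_hilbert hs"
  shows "compact (closure (hs_apply T ` cball 0 1))"
proof -
  let ?S = "hs_apply T ` cball 0 1"
  have "\<exists>k. finite k \<and> closure ?S \<subseteq> (\<Union>x\<in>k. ball x e)" if "e > 0" for e :: real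
  proof -
  have "((\<lambda>F. \<Sum>(b, c)\<in>F. (b \<bullet> hs_apply T c) *\<^sub>R (b \<otimes> c)) \<longlongrightarrow> T) (finite_subsets_at_top (some_onb \<times> some_onb))"
    using hs_expansion[OF some_onb some_onb, of T] by (simp add: has_sum_def)
  then have "\<forall>\<^sub>F F in finite_subsets_at_top (some_onb \<times> some_onb). dist (\<Sum>(b, c)\<in>F. (b \<bullet> hs_apply T c) *\<^sub>R (b \<otimes> c)) T < e / 4"
    using \<open>e > 0\<close> by (intro tendstoD) auto
  from eventually_happens'[OF finite_subsets_at_top_neq_bot eventually_conj[OF this eventually_finite_subsets_at_top_weakI[of _ "\<lambda>F. finite F \<and> F \<subseteq> some_onb \<times> some_onb"]]]
  obtain G :: "('a \<times> 'a) set" where G: "finite G" "G \<subseteq> some_onb \<times> some_onb"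
    and TG: "norm (T - (\<Sum>(b, c)\<in>G. (b \<bullet> hs_apply T c) *\<^sub>R (b \<otimes> c))) < e / 4"
    by (auto simp: dist_norm norm_minus_commute)
  have fin: "\<exists>C. compact C \<and> (\<forall>x\<in>cball 0 1. hs_apply (\<Sum>(b, c)\<in>H. (b \<bullet> hs_apply T c) *\<^sub>R (b \<otimes> c)) x \<in> C)"
    if "finite H" "H \<subseteq> some_onb \<times> some_onb" for H :: "('a \<times> 'a) set"
    using that
  proof (induction H rule: finite_induct)
    case empty
    show ?case by (intro exI[of _ "{0}"]) (simp add: hs_apply_simps)
  next
    case (insert h H)
    then obtain C where C: "compact C" "\<forall>x\<in>cball 0 1. hs_apply (\<Sum>(b, c)\<in>H. (b \<bullet> hs_apply T c) *\<^sub>R (b \<otimes> c)) x \<in> C"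
      by auto
    obtain b c where h: "h = (b, c)" by (cases h)
    define m where "m = b \<bullet> hs_apply T c"
    define D where "D = (\<lambda>t. t *\<^sub>R m *\<^sub>R b) ` {-1..1::real}"
    have D: "compact D" unfolding D_def by (intro compact_continuous_image continuous_intros) auto
    have "hs_apply (\<Sum>(b, c)\<in>insert h H. (b \<bullet> hs_apply T c) *\<^sub>R (b \<otimes> c)) x \<in> {u + v |u v. u \<in> D \<and> v \<in> C}"
      if x: "x \<in> cball 0 1" for x
    proof -
      have "norm c = 1" using insert h some_onb_norm by auto
      then have "\<bar>c \<bullet> x\<bar> \<le> 1" using Cauchy_Schwarz_ineq2[of c x] x by simp
      then have "m *\<^sub>R (c \<bullet> x) *\<^sub>R b \<in> D" unfolding D_def by (intro image_eqI[of _ _ "c \<bullet> x"]) (auto simp: mult.commute)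
      moreover have "hs_apply (\<Sum>(b, c)\<in>insert h H. (b \<bullet> hs_apply T c) *\<^sub>R (b \<otimes> c)) x
          = m *\<^sub>R (c \<bullet> x) *\<^sub>R b + hs_apply (\<Sum>(b, c)\<in>H. (b \<bullet> hs_apply T c) *\<^sub>R (b \<otimes> c)) x"
        using insert(1,2) by (simp add: h m_def hs_apply_simps)
      ultimately show ?thesis using C(2) x by blast
    qed
    moreover have "compact {u + v |u v. u \<in> D \<and> v \<in> C}" using compact_sums[OF D C(1)] .
    ultimately show ?case by blast
  qed
  define R where "R = (\<Sum>(b, c)\<in>G. (b \<bullet> hs_apply T c) *\<^sub>R (b \<otimes> c))"
  obtain C where C: "compact C" "\<And>x. x \<in> cball 0 1 \<Longrightarrow> hs_apply R x \<in> C"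
    using fin[OF G] unfolding R_def by auto
  from C(1) obtain k where k: "finite k" "C \<subseteq> (\<Union>x\<in>k. ball x (e / 4))"
    unfolding compact_eq_totally_bounded using \<open>e > 0\<close> by (meson divide_pos_pos zero_less_numeral)
  \<comment> \<open>Closed balls of radius \<open>e / 2\<close> are used since their finite union is
    closed and so contains the closure as well; it still fits into open balls of radius
    \<open>e\<close>.\<close>
  have "?S \<subseteq> (\<Union>x\<in>k. cball x (e / 2))"
  proof
    fix y assume "y \<in> ?S"
    then obtain x where x: "x \<in> cball 0 1" "y = hs_apply T x" by auto
    obtain z where z: "z \<in> k" "dist z (hs_apply R x) < e / 4" using C(2)[OF x(1)] k(2) by auto
    have "norm (hs_apply (T - R) x) \<le> norm (T - R) * norm x" by (rule norm_hs_apply_le)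
    also have "\<dots> \<le> (e / 4) * 1" using TG x(1) \<open>e > 0\<close> unfolding R_def by (intro mult_mono) auto
    finally have "dist y (hs_apply R x) \<le> e / 4" by (simp add: x dist_norm hs_apply_simps)
    then have "dist z y \<le> e / 2" using z(2) dist_triangle2[of z y "hs_apply R x"] by linarith
    then show "y \<in> (\<Union>x\<in>k. cball x (e / 2))" using z(1) by auto
  qed
  then have "closure ?S \<subseteq> (\<Union>x\<in>k. cball x (e / 2))"
    using k(1) by (intro closure_minimal closed_UN) auto
  also have "\<dots> \<subseteq> (\<Union>x\<in>k. ball x e)" using \<open>e > 0\<close> by fastforce
  finally show ?thesis using k(1) by blast
  qed
  then show ?thesis by (simp add: compact_eq_totally_bounded complete_eq_closed)
qed

text \<open>Trace class is expressed by a common bound for the diagonal sums over finite orthonormal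
  sets. This is what Bessel's inequality yields for a long-run covariance, before \<open>Q\<close>
  is known to be Hilbert-Schmidt.\<close>

locale trace_class_psd =
  fixes Q :: "'a::separable_hilbert \<Rightarrow> 'a" and K :: real
  assumes bl: "bounded_linear Q" and sym: "Q x \<bullet> y = x \<bullet> Q y" and psd: "0 \<le> Q x \<bullet> x"
    and trace_bound: "finite G \<Longrightarrow> orthonormal G \<Longrightarrow> (\<Sum>b\<in>G. Q b \<bullet> b) \<le> K"
begin

sublocale bounded_linear Q by (rule bl)

lemma form_cauchy_schwarz: "(Q x \<bullet> y)\<^sup>2 \<le> (Q x \<bullet> x) * (Q y \<bullet> y)"
proof -
  have quad: "0 \<le> t\<^sup>2 * (Q y \<bullet> y) + 2 * t * (Q x \<bullet> y) + Q x \<bullet> x" for t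
  proof -
    have "0 \<le> Q (x + t *\<^sub>R y) \<bullet> (x + t *\<^sub>R y)" by (rule psd)
    also have "\<dots> = t\<^sup>2 * (Q y \<bullet> y) + 2 * t * (Q x \<bullet> y) + Q x \<bullet> x"
      using sym[of y x] by (simp add: add scale inner_add_left inner_add_right inner_commute power2_eq_square algebra_simps)
    finally show ?thesis .
  qed
  show ?thesis
  proof (cases "Q y \<bullet> y = 0")
    case True
    have "Q x \<bullet> y = 0"
    proof (rule ccontr)
      assume "Q x \<bullet> y \<noteq> 0"
      \<comment> \<open>For \<open>Q y \<bullet> y = 0\<close> the quadratic is affine in
        \<open>t\<close>, and at this \<open>t\<close> it takes the value
        \<open>- 1\<close>.\<close>
      then show False using quad[of "- (Q x \<bullet> x + 1) / (2 * (Q x \<bullet> y))"] True by (simp add: field_simps)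
    qed
    then show ?thesis using True by simp
  next
    case False
    then have pos: "Q y \<bullet> y > 0" using psd[of y] by simp
    define a b c where "a = Q y \<bullet> y" and "b = Q x \<bullet> y" and "c = Q x \<bullet> x"
    have "0 \<le> (- b / a)\<^sup>2 * a + 2 * (- b / a) * b + c" using quad unfolding a_def b_def c_def .
    also have "\<dots> = c - b\<^sup>2 / a" using pos by (simp add: a_def[symmetric] power2_eq_square field_simps)
    finally have "b\<^sup>2 / a \<le> c" by simp
    then have "b\<^sup>2 \<le> c * a" using pos by (simp add: a_def[symmetric] pos_divide_le_eq)
    then show ?thesis by (simp add: a_def b_def c_def)
  qed
qed

text \<open>Cauchy-Schwarz for the form, applied to \<open>x\<close> and \<open>Q x\<close>. The
  bound on the form is required only at \<open>Q x\<close>, so that on an invariant subspace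
  \<open>m\<close> may be the supremum of the form there.\<close>

lemma norm_sq_le_form:
  assumes "Q (Q x) \<bullet> Q x \<le> m * (norm (Q x))\<^sup>2"
  shows "(norm (Q x))\<^sup>2 \<le> m * (Q x \<bullet> x)"
proof (cases "Q x = 0")
  case False
  define n where "n = (norm (Q x))\<^sup>2"
  have n: "n > 0" using False by (simp add: n_def)
  have "n\<^sup>2 \<le> (Q x \<bullet> x) * (Q (Q x) \<bullet> Q x)"
    using form_cauchy_schwarz[of x "Q x"] by (simp add: n_def power2_norm_eq_inner)
  also have "\<dots> \<le> (Q x \<bullet> x) * (m * n)" unfolding n_def by (intro mult_left_mono assms psd)
  finally have "n * n \<le> (m * (Q x \<bullet> x)) * n" by (simp add: power2_eq_square mult.commute mult.left_commute)
  then have "n \<le> m * (Q x \<bullet> x)" using n by (rule mult_right_le_imp_le)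
  then show ?thesis by (simp only: n_def)
qed simp

lemma form_bound: "\<exists>m>0. \<forall>x. Q x \<bullet> x \<le> m * (norm x)\<^sup>2"
proof -
  obtain m where m: "m > 0" "\<And>x. norm (Q x) \<le> norm x * m" using pos_bounded by blast
  have "Q x \<bullet> x \<le> m * (norm x)\<^sup>2" for x
  proof -
    have "Q x \<bullet> x \<le> norm (Q x) * norm x" by (rule norm_cauchy_schwarz)
    also have "\<dots> \<le> (norm x * m) * norm x" by (intro mult_right_mono m) auto
    finally show ?thesis by (simp add: power2_eq_square mult_ac)
  qed
  then show ?thesis using m(1) by blast
qed

text \<open>Squared norms are dominated by a multiple of the diagonal of the form, whose sums the
  trace bound controls. This makes \<open>hs_compact\<close> applicable.\<close>

lemma is_hilbert_schmidt: "hilbert_schmidt Q"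
  unfolding hilbert_schmidt_def
proof (intro conjI bl nonneg_bdd_above_summable_on)
  obtain m where m: "m > 0" "\<And>x. Q x \<bullet> x \<le> m * (norm x)\<^sup>2" using form_bound by blast
  show "bdd_above (sum (\<lambda>b. (norm (Q b))\<^sup>2) ` {F. F \<subseteq> some_onb \<and> finite F})"
  proof (rule bdd_aboveI2)
    fix F :: "'a set" assume F: "F \<in> {F. F \<subseteq> some_onb \<and> finite F}"
    have "(\<Sum>b\<in>F. (norm (Q b))\<^sup>2) \<le> (\<Sum>b\<in>F. m * (Q b \<bullet> b))"
      by (intro sum_mono norm_sq_le_form m)
    also have "\<dots> = m * (\<Sum>b\<in>F. Q b \<bullet> b)" by (simp add: sum_distrib_left)
    also have "\<dots> \<le> m * K"
      using F m orthonormal_basis_orthonormal[OF some_onb]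
      by (intro mult_left_mono trace_bound) (auto intro: orthonormal_mono)
    finally show "(\<Sum>b\<in>F. (norm (Q b))\<^sup>2) \<le> m * K" .
  qed
qed simp

text \<open>The supremum \<open>l\<close> of the form on the unit sphere of \<open>V\<close> is
  positive, and along a maximising sequence \<open>Q (f n) - l *\<^sub>R f n\<close> tends to zero,
  by \<open>norm_sq_le_form\<close> with \<open>m = l\<close>. Compactness makes
  \<open>Q (f n)\<close> converge along a subsequence, and then so does \<open>f n\<close>, as
  \<open>l\<close> is not zero.\<close>

lemma eigenvector_on_invariant_subspace:
  assumes V: "subspace V" "closed V" "\<And>x. x \<in> V \<Longrightarrow> Q x \<in> V"
    and x0: "x0 \<in> V" "Q x0 \<noteq> 0"
  shows "\<exists>l x. l > 0 \<and> x \<in> V \<and> norm x = 1 \<and> Q x = l *\<^sub>R x"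
proof -
  obtain m where m: "m > 0" "\<And>x. Q x \<bullet> x \<le> m * (norm x)\<^sup>2" using form_bound by blast
  define S where "S = (\<lambda>x. Q x \<bullet> x) ` {x\<in>V. norm x = 1}"
  have bdd: "bdd_above S" unfolding S_def by (rule bdd_aboveI2[of _ _ m]) (metis (mono_tags, lifting) m(2) mem_Collect_eq mult.right_neutral one_power2)
  define l where "l = Sup S"
  have le: "Q x \<bullet> x \<le> l * (norm x)\<^sup>2" if "x \<in> V" for x
  proof (cases "x = 0")
    case False
    define z where "z = (1 / norm x) *\<^sub>R x"
    have "z \<in> V" "norm z = 1" using that False subspace_scale[OF V(1)] by (auto simp: z_def)
    then have "Q z \<bullet> z \<le> l" unfolding l_def by (intro cSup_upper bdd) (auto simp: S_def)
    moreover have "Q z \<bullet> z = (Q x \<bullet> x) / (norm x)\<^sup>2" by (simp add: z_def scale power2_eq_square)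
    ultimately show ?thesis using False by (simp add: pos_divide_le_eq)
  qed (simp add: zero)
  have "Q x0 \<bullet> x0 > 0"
    using norm_sq_le_form[of x0 m] m x0(2) psd[of x0] by (metis less_eq_real_def mult_zero_right not_less zero_less_power zero_less_norm_iff)
  moreover have "x0 \<noteq> 0" using x0(2) zero by auto
  ultimately have l: "l > 0"
    using le[OF x0(1)] by (intro zero_less_mult_pos2[of l "(norm x0)\<^sup>2"]) auto
  have ne: "S \<noteq> {}"
  proof -
    have "(1 / norm x0) *\<^sub>R x0 \<in> {x\<in>V. norm x = 1}" using x0(1) \<open>x0 \<noteq> 0\<close> subspace_scale[OF V(1)] by auto
    then show ?thesis unfolding S_def by blast
  qed
  have "\<exists>x. x \<in> V \<and> norm x = 1 \<and> l - 1 / real (Suc n) < Q x \<bullet> x" for n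
  proof -
    have "l - 1 / real (Suc n) < Sup S" by (simp add: l_def)
    then obtain y where "y \<in> S" "l - 1 / real (Suc n) < y" using less_cSup_iff[OF ne bdd] by blast
    then show ?thesis by (auto simp: S_def)
  qed
  then obtain f where f: "\<And>n. f n \<in> V" "\<And>n. norm (f n) = 1" "\<And>n. l - 1 / real (Suc n) < Q (f n) \<bullet> f n"
    by metis
  have "hs_apply (Abs_hs Q) = Q" using is_hilbert_schmidt by (simp add: Abs_hs_inverse)
  then have "seq_compact (closure (Q ` cball 0 1))"
    using hs_compact[of "Abs_hs Q"] by (simp add: compact_eq_seq_compact_metric)
  moreover have "\<forall>n. Q (f n) \<in> closure (Q ` cball 0 1)"
    using f(2) closure_subset by (force intro!: subsetD[OF closure_subset])
  ultimately obtain y \<rho> where \<rho>: "strict_mono (\<rho> :: nat \<Rightarrow> nat)" "((\<lambda>n. Q (f n)) \<circ> \<rho>) \<longlonglongrightarrow> y"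
    using seq_compactE[of "closure (Q ` cball 0 1)" "\<lambda>n. Q (f n)"] by blast
  have bound: "norm (Q (f n) - l *\<^sub>R f n) \<le> sqrt (l * (1 / real (Suc n)))" for n
  proof (rule real_le_rsqrt)
    have a: "(norm (Q (f n)))\<^sup>2 \<le> l * (Q (f n) \<bullet> f n)"
      by (rule norm_sq_le_form) (use le V(3) f(1) in blast)
    have "(norm (Q (f n) - l *\<^sub>R f n))\<^sup>2 = (norm (Q (f n)))\<^sup>2 - 2 * l * (Q (f n) \<bullet> f n) + l\<^sup>2 * (f n \<bullet> f n)"
      unfolding power2_norm_eq_inner by (simp add: inner_diff_left inner_diff_right inner_commute power2_eq_square algebra_simps)
    also have "f n \<bullet> f n = 1" using f(2)[of n] by (simp add: power2_norm_eq_inner[symmetric])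
    finally have "(norm (Q (f n) - l *\<^sub>R f n))\<^sup>2 \<le> l * (l - Q (f n) \<bullet> f n)"
      using a by (simp add: power2_eq_square algebra_simps)
    also have "\<dots> \<le> l * (1 / real (Suc n))" using f(3)[of n] l by (intro mult_left_mono) auto
    finally show "(norm (Q (f n) - l *\<^sub>R f n))\<^sup>2 \<le> l * (1 / real (Suc n))" .
  qed
  have "(\<lambda>n. Q (f n) - l *\<^sub>R f n) \<longlonglongrightarrow> 0"
  proof (rule Lim_null_comparison)
    have "(\<lambda>n. sqrt (l * (1 / real (Suc n)))) \<longlonglongrightarrow> sqrt (l * 0)"
      by (intro tendsto_intros LIMSEQ_inverse_real_of_nat[unfolded inverse_eq_divide])
    then show "(\<lambda>n. sqrt (l * (1 / real (Suc n)))) \<longlonglongrightarrow> 0" by simp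
  qed (use bound in auto)
  then have "((\<lambda>n. Q (f n) - l *\<^sub>R f n) \<circ> \<rho>) \<longlonglongrightarrow> 0" by (rule LIMSEQ_subseq_LIMSEQ[OF _ \<rho>(1)])
  from tendsto_diff[OF \<rho>(2) this] have "(\<lambda>n. l *\<^sub>R f (\<rho> n)) \<longlonglongrightarrow> y" by (simp add: o_def)
  from tendsto_scaleR[OF tendsto_const[of "1 / l"] this]
  have fl: "(\<lambda>n. f (\<rho> n)) \<longlonglongrightarrow> (1 / l) *\<^sub>R y" using l by simp
  define x where "x = (1 / l) *\<^sub>R y"
  have "x \<in> V" unfolding x_def by (rule closed_sequentially[OF V(2) _ fl]) (use f in auto)
  moreover have "norm x = 1"
    using LIMSEQ_unique[OF tendsto_norm[OF fl, unfolded f(2)] tendsto_const] by (simp only: x_def)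
  moreover have "(\<lambda>n. Q (f (\<rho> n))) \<longlonglongrightarrow> Q x" unfolding x_def by (rule tendsto[OF fl])
  then have "Q x = y" using \<rho>(2) LIMSEQ_unique by (auto simp: o_def)
  then have "Q x = l *\<^sub>R x" using l by (simp add: x_def)
  ultimately show ?thesis using l by blast
qed

lemma subspace_eigenspace: "subspace {x. Q x = l *\<^sub>R x}"
  by (simp add: subspace_def zero add scale algebra_simps)

text \<open>An orthonormal set of \<open>n\<close> eigenvectors has diagonal sum
  \<open>n * l \<le> K\<close>, so there is a largest one, and maximality makes it span the
  eigenspace. For negative \<open>l\<close> positivity leaves only the empty set.\<close>

lemma eigenspace_orthonormal_basis:
  assumes "l \<noteq> 0"
  shows "\<exists>B. finite B \<and> orthonormal B \<and> span B = {x. Q x = l *\<^sub>R x} \<and> card B = dim {x. Q x = l *\<^sub>R x}"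
proof -
  define E where "E = {x. Q x = l *\<^sub>R x}"
  define ok where "ok n \<longleftrightarrow> (\<exists>B. finite B \<and> B \<subseteq> E \<and> orthonormal B \<and> card B = n)" for n
  have bound: "real n * l \<le> K \<and> (n > 0 \<longrightarrow> l > 0)" if "ok n" for n
  proof -
    from that obtain B where B: "finite B" "B \<subseteq> E" "orthonormal B" "card B = n" by (auto simp: ok_def)
    have q: "Q b \<bullet> b = l" if "b \<in> B" for b
      using B that by (auto simp: E_def orthonormal_def power2_norm_eq_inner[symmetric])
    then have "(\<Sum>b\<in>B. Q b \<bullet> b) = real n * l" using B by simp
    moreover have "l > 0" if n: "n > 0"
    proof -
      obtain b where "b \<in> B" using B n by (metis card.empty ex_in_conv less_irrefl)
      then show ?thesis using q psd[of b] assms by force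
    qed
    ultimately show ?thesis using trace_bound[OF B(1,3)] by simp
  qed
  have ok0: "ok 0" unfolding ok_def by (intro exI[of _ "{}"]) (simp add: orthonormal_def)
  have le: "n \<le> nat \<lceil>\<bar>K / l\<bar>\<rceil>" if "ok n" for n
  proof (cases "n = 0")
    case False
    then have l: "l > 0" and "real n * l \<le> K" using bound[OF that] by auto
    then have "real n \<le> K / l" by (simp add: pos_le_divide_eq)
    then show ?thesis by linarith
  qed simp
  obtain n where n: "ok n" "\<And>m. ok m \<Longrightarrow> m \<le> n"
    using Nat.ex_has_greatest_nat[of ok 0 "nat \<lceil>\<bar>K / l\<bar>\<rceil>"] ok0 le by blast
  then obtain B where B: "finite B" "B \<subseteq> E" "orthonormal B" "card B = n" by (auto simp: ok_def)
  have sub: "subspace E" unfolding E_def by (rule subspace_eigenspace)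
  have "E \<subseteq> span B"
  proof
    fix x assume x: "x \<in> E"
    define y where "y = x - (\<Sum>c\<in>B. (x \<bullet> c) *\<^sub>R c)"
    have yE: "y \<in> E" unfolding y_def using B x
      by (intro subspace_diff[OF sub] subspace_sum[OF sub] subspace_scale[OF sub]) auto
    have yB: "y \<bullet> b = 0" if "b \<in> B" for b unfolding y_def by (rule orthonormal_residual(1)[OF B(3,1) that])
    have "y = 0"
    proof (rule ccontr)
      assume y: "y \<noteq> 0"
      define z where "z = (1 / norm y) *\<^sub>R y"
      have z: "norm z = 1" "z \<in> E" "\<And>b. b \<in> B \<Longrightarrow> z \<bullet> b = 0"
        using y yE yB subspace_scale[OF sub] by (auto simp: z_def)
      have "z \<notin> B"
      proof
        assume "z \<in> B"
        then have "z \<bullet> z = 0" by (rule z(3))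
        then show False using z(1) by simp
      qed
      then have "ok (Suc n)"
        unfolding ok_def using B z orthonormal_insert[OF B(3) z(1,3)] by (intro exI[of _ "insert z B"]) auto
      then show False using n(2) by fastforce
    qed
    then have "x = (\<Sum>c\<in>B. (x \<bullet> c) *\<^sub>R c)" by (simp add: y_def)
    also have "\<dots> \<in> span B" by (intro span_sum span_scale span_base)
    finally show "x \<in> span B" .
  qed
  then have span: "span B = E" using B(2) sub span_minimal by blast
  have "0 \<notin> B" using B(3) by (auto simp: orthonormal_def)
  then have "independent B" using B(3) by (intro pairwise_orthogonal_independent) (auto simp: orthonormal_def)
  then have "dim E = card B" using span dim_span_eq_card_independent by metis
  then show ?thesis using B span unfolding E_def by (intro exI[of _ B]) auto
qed

text \<open>For each nonzero \<open>l\<close> the indices with \<open>\<gamma> r = l\<close> are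
  matched bijectively with an orthonormal basis of the eigenspace; the counting condition on
  \<open>\<gamma>\<close> permits this. Indices with \<open>\<gamma> r = 0\<close> carry no vector:
  the kernel is represented by the other elements of \<open>B\<close>.\<close>

theorem eigenbasis:
  assumes \<gamma>: "eigenvalues_with_multiplicity Q \<gamma>"
  obtains B and e :: "nat \<Rightarrow> 'a" where "orthonormal_basis B"
    "inj_on e {r. \<gamma> r \<noteq> 0}" "e ` {r. \<gamma> r \<noteq> 0} \<subseteq> B"
    "\<And>r. \<gamma> r \<noteq> 0 \<Longrightarrow> Q (e r) = \<gamma> r *\<^sub>R e r"
    "\<And>b. b \<in> B \<Longrightarrow> b \<notin> e ` {r. \<gamma> r \<noteq> 0} \<Longrightarrow> Q b = 0"
    "\<And>r. 0 \<le> \<gamma> r" "summable \<gamma>"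
proof -
  have "\<forall>l. \<exists>B. l \<noteq> 0 \<longrightarrow> finite B \<and> orthonormal B \<and> span B = {x. Q x = l *\<^sub>R x} \<and> card B = dim {x. Q x = l *\<^sub>R x}"
    using eigenspace_orthonormal_basis by blast
  then obtain Bl where Bl: "\<And>l. l \<noteq> 0 \<Longrightarrow> finite (Bl l) \<and> orthonormal (Bl l) \<and> span (Bl l) = {x. Q x = l *\<^sub>R x} \<and> card (Bl l) = dim {x. Q x = l *\<^sub>R x}"
    by metis
  have "\<forall>l. \<exists>g. l \<noteq> 0 \<longrightarrow> bij_betw g {r. \<gamma> r = l} (Bl l)"
  proof
    fix l
    show "\<exists>g. l \<noteq> 0 \<longrightarrow> bij_betw g {r. \<gamma> r = l} (Bl l)"
    proof (cases "l = 0")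
      case False
      then have "finite {r. \<gamma> r = l}" "card {r. \<gamma> r = l} = card (Bl l)" "finite (Bl l)"
        using \<gamma> Bl[OF False] by (auto simp: eigenvalues_with_multiplicity_def)
      then show ?thesis using finite_same_card_bij by blast
    qed simp
  qed
  then obtain g where g: "\<And>l. l \<noteq> 0 \<Longrightarrow> bij_betw (g l) {r. \<gamma> r = l} (Bl l)" by metis
  define e where "e r = g (\<gamma> r) r" for r
  define R where "R = {r. \<gamma> r \<noteq> 0}"
  have eB: "e r \<in> Bl (\<gamma> r)" if "\<gamma> r \<noteq> 0" for r
    using g[OF that] unfolding e_def bij_betw_def by blast
  have eQ: "Q (e r) = \<gamma> r *\<^sub>R e r" if "\<gamma> r \<noteq> 0" for r
    using Bl[OF that] eB[OF that] span_base[of "e r" "Bl (\<gamma> r)"] by auto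
  have en: "norm (e r) = 1" if "\<gamma> r \<noteq> 0" for r
    using Bl[OF that] eB[OF that] by (auto simp: orthonormal_def)
  have orth: "e r \<bullet> e s = 0" if "\<gamma> r \<noteq> 0" "\<gamma> s \<noteq> 0" "r \<noteq> s" for r s
  proof (cases "\<gamma> r = \<gamma> s")
    case True
    have "e r \<noteq> e s"
      using g[OF that(1)] that(3) True unfolding e_def bij_betw_def inj_on_def by auto
    then show ?thesis
      using orthonormal_inner[of "Bl (\<gamma> r)" "e r" "e s"] Bl[OF that(1)] eB[OF that(1)] eB[OF that(2)] True by auto
  next
    case False
    have "\<gamma> r * (e r \<bullet> e s) = \<gamma> s * (e r \<bullet> e s)"
      using sym[of "e r" "e s"] eQ[OF that(1)] eQ[OF that(2)] by simp
    then show ?thesis using False by simp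
  qed
  have inj: "inj_on e R"
  proof (rule inj_onI, rule ccontr)
    fix r s assume *: "r \<in> R" "s \<in> R" "e r = e s" "r \<noteq> s"
    then have "e r \<bullet> e r = 0" using orth[of r s] by (auto simp: R_def)
    then show False using en[of r] * by (auto simp: R_def)
  qed
  have on: "orthonormal (e ` R)"
    unfolding orthonormal_def pairwise_def orthogonal_def using en orth by (auto simp: R_def)
  obtain B where B: "orthonormal_basis B" "e ` R \<subseteq> B" using orthonormal_extend_basis[OF on] by blast
  have nonneg: "0 \<le> \<gamma> r" for r
  proof (cases "\<gamma> r = 0")
    case False
    then show ?thesis using psd[of "e r"] eQ[OF False] en[OF False] by (simp add: power2_norm_eq_inner[symmetric])
  qed simp
  have "(\<Sum>r<n. \<gamma> r) \<le> K" for n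
  proof -
    define J where "J = {r. r < n \<and> \<gamma> r \<noteq> 0}"
    have J: "finite J" "J \<subseteq> R" by (auto simp: J_def R_def)
    have "(\<Sum>r<n. \<gamma> r) = (\<Sum>r\<in>J. \<gamma> r)"
      by (rule sum.mono_neutral_right) (auto simp: J_def)
    also have "\<dots> = (\<Sum>r\<in>J. Q (e r) \<bullet> e r)"
      using eQ en by (intro sum.cong) (auto simp: J_def power2_norm_eq_inner[symmetric])
    also have "\<dots> = (\<Sum>b\<in>e ` J. Q b \<bullet> b)"
      by (rule sum.reindex[symmetric, unfolded o_def, OF inj_on_subset[OF inj J(2)]])
    also have "\<dots> \<le> K" using J by (intro trace_bound orthonormal_mono[OF on]) auto
    finally show ?thesis .
  qed
  then have summ: "summable \<gamma>" using nonneg by (intro summableI_nonneg_bounded) auto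
  \<comment> \<open>The vectors orthogonal to all \<open>e r\<close> form a closed invariant
    subspace. If \<open>Q\<close> did not vanish on it, it would contain an eigenvector for some
    \<open>l > 0\<close>, orthogonal to the very eigenspace in which it lies.\<close>
  have ker: "Q x = 0" if x: "\<And>r. r \<in> R \<Longrightarrow> x \<bullet> e r = 0" for x
  proof (rule ccontr)
    assume "Q x \<noteq> 0"
    define V where "V = {x. \<forall>r\<in>R. x \<bullet> e r = 0}"
    have 1: "subspace V" by (simp add: V_def subspace_def inner_add_left)
    have Veq: "V = (\<Inter>r\<in>R. {x. x \<bullet> e r = 0})" by (auto simp: V_def)
    have 2: "closed V" unfolding Veq by (intro closed_INT ballI closed_Collect_eq continuous_intros)
    have 3: "Q y \<in> V" if "y \<in> V" for y
      using that eQ by (auto simp: V_def R_def sym)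
    have "x \<in> V" using x by (simp add: V_def)
    from eigenvector_on_invariant_subspace[OF 1 2 3 this \<open>Q x \<noteq> 0\<close>]
    obtain l z where l: "l > 0" and z: "z \<in> V" "norm z = 1" "Q z = l *\<^sub>R z" by blast
    have "z \<in> span (Bl l)" using Bl[of l] l z(3) by auto
    moreover have "orthogonal z b" if "b \<in> Bl l" for b
    proof -
      have "b \<in> g l ` {r. \<gamma> r = l}" using g[of l] l that by (auto simp: bij_betw_def)
      then obtain r where r: "\<gamma> r = l" "b = g l r" by auto
      then have "b = e r" "r \<in> R" using l by (auto simp: e_def R_def)
      then show ?thesis using z(1) by (auto simp: V_def orthogonal_def)
    qed
    ultimately have "orthogonal z z" using orthogonal_to_span by blast
    then show False using z(2) by (simp add: orthogonal_def)
  qed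
  have "Q b = 0" if "b \<in> B" "b \<notin> e ` R" for b
    using that B orthonormal_inner[OF orthonormal_basis_orthonormal[OF B(1)] that(1)] by (intro ker) (metis image_eqI subsetD)
  then show ?thesis using that[of B e, OF B(1)] inj B(2) eQ nonneg summ unfolding R_def by blast
qed

end

section \<open>Gaussian limits in Hilbert space\<close>

lemma bounded_linear_residual:
  fixes G :: "'a::real_inner set"
  assumes "orthonormal G" "finite G"
  shows "bounded_linear (\<lambda>x. x - (\<Sum>b\<in>G. (x \<bullet> b) *\<^sub>R b))"
    and "norm (x - (\<Sum>b\<in>G. (x \<bullet> b) *\<^sub>R b)) \<le> 1 * norm x"
proof -
  show "bounded_linear (\<lambda>x. x - (\<Sum>b\<in>G. (x \<bullet> b) *\<^sub>R b))"
    by (intro bounded_linear_sub bounded_linear_ident bounded_linear_sum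
        bounded_linear_scaleR_const bounded_linear_inner_left)
  have "(norm (x - (\<Sum>b\<in>G. (x \<bullet> b) *\<^sub>R b)))\<^sup>2 \<le> (norm x)\<^sup>2"
    unfolding orthonormal_residual(2)[OF assms] by (simp add: sum_nonneg)
  then show "norm (x - (\<Sum>b\<in>G. (x \<bullet> b) *\<^sub>R b)) \<le> 1 * norm x"
    by (simp add: power2_le_iff_abs_le)
qed

text \<open>Dominated convergence works along a sequence, so the basis is exhausted by the finite
  sets of an enumeration. As the residual decreases when the set grows, the bound passes to every
  finite set containing one of them.\<close>

lemma l2norm_basis_tail:
  fixes F :: "'w \<Rightarrow> 'h::separable_hilbert"
  assumes B: "orthonormal_basis B" and F: "sq_integrable M F" and e: "e > 0"
  shows "\<exists>G0. finite G0 \<and> G0 \<subseteq> B \<and>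
    (\<forall>G. finite G \<longrightarrow> G0 \<subseteq> G \<longrightarrow> G \<subseteq> B \<longrightarrow> l2norm M (\<lambda>\<omega>. F \<omega> - (\<Sum>b\<in>G. (F \<omega> \<bullet> b) *\<^sub>R b)) \<le> e)"
proof -
  define G where "G n = {b\<in>B. to_nat_on B b \<le> n}" for n
  have cB: "countable B" using countable_orthonormal_basis[OF B] .
  have inj: "inj_on (to_nat_on B) B" using cB by (rule inj_on_to_nat_on)
  have fG: "finite (G n)" for n
  proof (rule finite_imageD)
    show "finite (to_nat_on B ` G n)" by (rule finite_subset[of _ "{..n}"]) (auto simp: G_def)
    show "inj_on (to_nat_on B) (G n)" by (rule inj_on_subset[OF inj]) (auto simp: G_def)
  qed
  have GB: "G n \<subseteq> B" for n by (auto simp: G_def)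
  have on: "orthonormal H" if "H \<subseteq> B" for H using orthonormal_mono[OF orthonormal_basis_orthonormal[OF B] that] .
  have lim: "filterlim G (finite_subsets_at_top B) sequentially"
    unfolding filterlim_finite_subsets_at_top
  proof (intro allI impI)
    fix X assume X: "finite X \<and> X \<subseteq> B"
    show "\<forall>\<^sub>F y in sequentially. finite (G y) \<and> X \<subseteq> G y \<and> G y \<subseteq> B"
    proof (rule eventually_sequentiallyI[of "Max (insert 0 (to_nat_on B ` X))"])
      fix n assume n: "Max (insert 0 (to_nat_on B ` X)) \<le> n"
      have "to_nat_on B x \<le> n" if "x \<in> X" for x
        using X that n by (intro order_trans[OF Max_ge n]) auto
      then show "finite (G n) \<and> X \<subseteq> G n \<and> G n \<subseteq> B" using X fG GB by (auto simp: G_def)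
    qed
  qed
  have [measurable]: "F \<in> borel_measurable M" using F by (simp add: sq_integrable_def)
  let ?res = "\<lambda>H \<omega>. F \<omega> - (\<Sum>b\<in>H. (F \<omega> \<bullet> b) *\<^sub>R b)"
  have pt: "(\<lambda>n. (norm (?res (G n) \<omega>))\<^sup>2) \<longlonglongrightarrow> 0" for \<omega>
  proof -
    have "(\<lambda>n. \<Sum>b\<in>G n. (F \<omega> \<bullet> b)\<^sup>2) \<longlonglongrightarrow> (norm (F \<omega>))\<^sup>2"
      using filterlim_compose[OF orthonormal_basis_expansion(2)[OF B, of "F \<omega>", unfolded has_sum_def] lim] by simp
    from tendsto_diff[OF tendsto_const[of "(norm (F \<omega>))\<^sup>2"] this]
    show ?thesis by (simp add: orthonormal_residual(2)[OF on[OF GB] fG])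
  qed
  have le: "(norm (?res H \<omega>))\<^sup>2 \<le> (norm (F \<omega>))\<^sup>2" if "finite H" "H \<subseteq> B" for H \<omega>
    unfolding orthonormal_residual(2)[OF on[OF that(2)] that(1)] by (simp add: sum_nonneg)
  have "(\<lambda>n. LINT \<omega>|M. (norm (?res (G n) \<omega>))\<^sup>2) \<longlonglongrightarrow> (LINT \<omega>|M. 0)"
  proof (rule integral_dominated_convergence[where w = "\<lambda>\<omega>. (norm (F \<omega>))\<^sup>2"])
    show "integrable M (\<lambda>\<omega>. (norm (F \<omega>))\<^sup>2)" using F by (simp add: sq_integrable_def)
  qed (use pt le fG GB in auto)
  then have "(\<lambda>n. sqrt (LINT \<omega>|M. (norm (?res (G n) \<omega>))\<^sup>2)) \<longlonglongrightarrow> sqrt 0" by (intro tendsto_intros) simp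
  then have "(\<lambda>n. l2norm M (?res (G n))) \<longlonglongrightarrow> 0" by (simp add: l2norm_def)
  then have "\<forall>\<^sub>F n in sequentially. l2norm M (?res (G n)) < e" using e by (rule order_tendstoD(2))
  then obtain n where n: "l2norm M (?res (G n)) < e" by (auto simp: eventually_sequentially)
  have "l2norm M (?res H) \<le> e" if H: "finite H" "G n \<subseteq> H" "H \<subseteq> B" for H
  proof -
    have "l2norm M (?res H) \<le> 1 * l2norm M (?res (G n))"
    proof (rule sq_integrable_mono(2))
      show "sq_integrable M (?res (G n))"
        by (rule sq_integrable_bounded_linear(1)[OF bounded_linear_residual(1)[OF on[OF GB] fG] F bounded_linear_residual(2)[OF on[OF GB] fG]]) simp
      fix \<omega>
      have "(norm (?res H \<omega>))\<^sup>2 \<le> (norm (?res (G n) \<omega>))\<^sup>2"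
        unfolding orthonormal_residual(2)[OF on[OF H(3)] H(1)] orthonormal_residual(2)[OF on[OF GB] fG]
        using H(1,2) by (intro diff_left_mono sum_mono2) auto
      then show "norm (?res H \<omega>) \<le> 1 * norm (?res (G n) \<omega>)" by (simp add: power2_le_iff_abs_le)
    qed auto
    then show ?thesis using n by simp
  qed
  then show ?thesis using fG[of n] GB[of n] by blast
qed

lemma gaussian_characteristic:
  fixes Z :: "nat \<Rightarrow> 'z \<Rightarrow> real"
  assumes P': "prob_space P'" and ind: "prob_space.indep_vars P' (\<lambda>_. borel) Z UNIV"
    and Z: "\<And>r. distr P' borel (Z r) = std_normal_distribution" and J: "finite J"
  shows "(CLINT \<omega>|P'. iexp (\<Sum>j\<in>J. a j * Z j \<omega>)) = exp (- (\<Sum>j\<in>J. (a j)\<^sup>2) / 2)"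
proof -
  interpret prob_space P' by fact
  have [measurable]: "Z j \<in> borel_measurable P'" for j using ind by (auto simp: indep_vars_def)
  have "indep_vars (\<lambda>_. borel) (\<lambda>j \<omega>. a j * Z j \<omega>) J"
    by (rule indep_vars_compose2[OF indep_vars_subset[OF ind]]) auto
  then have "char (distr P' borel (\<lambda>\<omega>. \<Sum>j\<in>J. a j * Z j \<omega>)) 1 = (\<Prod>j\<in>J. char (distr P' borel (\<lambda>\<omega>. a j * Z j \<omega>)) 1)"
    by (rule char_distr_sum)
  also have "\<dots> = (\<Prod>j\<in>J. complex_of_real (exp (- (a j)\<^sup>2 / 2)))"
  proof (intro prod.cong refl)
    fix j
    have "char (distr P' borel (\<lambda>\<omega>. a j * Z j \<omega>)) 1 = char (distr P' borel (Z j)) (a j)"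
      unfolding char_def by (simp add: integral_distr)
    then show "char (distr P' borel (\<lambda>\<omega>. a j * Z j \<omega>)) 1 = complex_of_real (exp (- (a j)\<^sup>2 / 2))"
      by (simp add: Z char_std_normal_distribution)
  qed
  also have "\<dots> = exp (- (\<Sum>j\<in>J. (a j)\<^sup>2) / 2)"
    using J by (simp add: exp_sum[symmetric] sum_negf sum_divide_distrib of_real_exp flip: of_real_prod)
  also have "char (distr P' borel (\<lambda>\<omega>. \<Sum>j\<in>J. a j * Z j \<omega>)) 1 = (CLINT \<omega>|P'. iexp (\<Sum>j\<in>J. a j * Z j \<omega>))"
    unfolding char_def by (simp add: integral_distr)
  finally show ?thesis .
qed

lemma std_normal_second_moment:
  assumes "Z \<in> borel_measurable P'" "distr P' borel Z = std_normal_distribution"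
  shows "integrable P' (\<lambda>\<omega>. (Z \<omega>)\<^sup>2)" "(LINT \<omega>|P'. (Z \<omega>)\<^sup>2) = 1"
proof -
  note assms(1)[measurable]
  have *: "integrable std_normal_distribution (\<lambda>x. x\<^sup>2)" "(LINT x|std_normal_distribution. x\<^sup>2) = 1"
    using std_normal_distribution_even_moments[of 1] by (auto simp: has_bochner_integral_iff fact_2)
  show "integrable P' (\<lambda>\<omega>. (Z \<omega>)\<^sup>2)" using *(1) unfolding assms(2)[symmetric] by (simp add: integrable_distr_eq)
  show "(LINT \<omega>|P'. (Z \<omega>)\<^sup>2) = 1" using *(2) unfolding assms(2)[symmetric] by (simp add: integral_distr)
qed

text \<open>The expected value of the series is \<open>suminf \<gamma>\<close>, since each square
  has mean 1. Convergence has to be known because \<open>suminf\<close> of a divergent series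
  carries no information.\<close>

lemma weighted_chi_square_summable:
  fixes Z :: "nat \<Rightarrow> 'z \<Rightarrow> real"
  assumes Zm: "\<And>r. Z r \<in> borel_measurable P'" and Z: "\<And>r. distr P' borel (Z r) = std_normal_distribution"
    and \<gamma>: "\<And>r. 0 \<le> \<gamma> r" "summable \<gamma>"
  shows "AE \<omega> in P'. summable (\<lambda>r. \<gamma> r * (Z r \<omega>)\<^sup>2)"
proof -
  note Zm[measurable]
  have n1: "(\<integral>\<^sup>+\<omega>. ennreal (\<gamma> r * (Z r \<omega>)\<^sup>2) \<partial>P') = ennreal (\<gamma> r)" for r
    using std_normal_second_moment[OF Zm Z] \<gamma>(1) by (subst nn_integral_eq_integral) auto
  have "(\<integral>\<^sup>+\<omega>. (\<Sum>r. ennreal (\<gamma> r * (Z r \<omega>)\<^sup>2)) \<partial>P') = (\<Sum>r. ennreal (\<gamma> r))"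
    by (subst nn_integral_suminf) (auto simp: n1)
  also have "\<dots> \<noteq> \<infinity>" using \<gamma> by (simp add: ennreal_suminf_neq_top)
  finally have "AE \<omega> in P'. (\<Sum>r. ennreal (\<gamma> r * (Z r \<omega>)\<^sup>2)) \<noteq> \<infinity>"
    by (intro nn_integral_PInf_AE) auto
  then show ?thesis
    by eventually_elim (use \<gamma>(1) in \<open>auto intro!: summable_suminf_not_top\<close>)
qed

context iid_shift
begin

lemma partial_sum_bounded_linear:
  "bounded_linear L \<Longrightarrow> partial_sum (\<lambda>\<omega>. L (F \<omega>)) N \<omega> = L (partial_sum F N \<omega>)"
  unfolding partial_sum_def by (simp add: linear_sum[OF bounded_linear.linear])

lemma stationary_input_inner:
  assumes "stationary_input F"
  shows "stationary_input (\<lambda>\<omega>. F \<omega> \<bullet> x)"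
  by (rule stationary_input_bounded_linear(1)[OF assms bounded_linear_inner_left, of x "norm x"])
    (use Cauchy_Schwarz_ineq2 in \<open>auto simp: mult.commute\<close>)

lemma partial_sum_inner: "partial_sum (\<lambda>\<omega>. F \<omega> \<bullet> x) N \<omega> = partial_sum F N \<omega> \<bullet> x"
  by (rule partial_sum_bounded_linear[OF bounded_linear_inner_left])

text \<open>An upper bound for the second moment of a partial sum per term, and thereby for the
  trace of the long-run covariance. It tends to zero with \<open>l2norm \<Omega> F\<close> as long
  as the sum of the coefficients stays bounded.\<close>

definition lrv_bound :: "((int \<Rightarrow> 'u) \<Rightarrow> 'h::separable_hilbert) \<Rightarrow> real" where
  "lrv_bound F = (l2norm \<Omega> F)\<^sup>2 + 2 * l2norm \<Omega> F * suminf (dep_coef F)"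

lemma partial_sum_bound:
  "stationary_input F \<Longrightarrow> (l2norm \<Omega> (partial_sum F N))\<^sup>2 \<le> real N * lrv_bound F"
  using l2norm_partial_sum[of F N] by (simp add: lrv_bound_def partial_sum_def[abs_def])

text \<open>Bessel's inequality is applied to the partial sums, before the limit is taken, so no
  covariance operator has to be available.\<close>

lemma lrv_trace_bound:
  fixes F :: "(int \<Rightarrow> 'u) \<Rightarrow> 'h::separable_hilbert"
  assumes F: "stationary_input F" and G: "orthonormal G" "finite G"
  shows "(\<Sum>b\<in>G. lrv (\<lambda>\<omega>. F \<omega> \<bullet> b)) \<le> lrv_bound F"
proof (rule LIMSEQ_le_const2)
  show "(\<lambda>N. \<Sum>b\<in>G. (l2norm \<Omega> (partial_sum (\<lambda>\<omega>. F \<omega> \<bullet> b) N))\<^sup>2 / real N) \<longlonglongrightarrow> (\<Sum>b\<in>G. lrv (\<lambda>\<omega>. F \<omega> \<bullet> b))"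
    by (intro tendsto_sum second_moment_limit stationary_input_inner F)
  have "(\<Sum>b\<in>G. (l2norm \<Omega> (partial_sum (\<lambda>\<omega>. F \<omega> \<bullet> b) N))\<^sup>2 / real N) \<le> lrv_bound F" if "N \<ge> 1" for N
  proof -
    have i: "integrable \<Omega> (\<lambda>\<omega>. (partial_sum F N \<omega> \<bullet> b)\<^sup>2)" for b
      using sq_integrable_partial_sum[OF stationary_input_inner[OF F, of b], of N]
      by (simp add: sq_integrable_def partial_sum_inner)
    have "(\<Sum>b\<in>G. (l2norm \<Omega> (partial_sum (\<lambda>\<omega>. F \<omega> \<bullet> b) N))\<^sup>2) = (LINT \<omega>|\<Omega>. (\<Sum>b\<in>G. (partial_sum F N \<omega> \<bullet> b)\<^sup>2))"
      using i by (simp add: l2norm_sq partial_sum_inner)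
    also have "\<dots> \<le> (l2norm \<Omega> (partial_sum F N))\<^sup>2"
      unfolding l2norm_sq using i sq_integrable_partial_sum[OF F, of N]
      by (intro integral_mono bessel_finite G) (auto simp: sq_integrable_def)
    also have "\<dots> \<le> real N * lrv_bound F" by (rule partial_sum_bound[OF F])
    finally show ?thesis using that by (simp add: sum_divide_distrib[symmetric] pos_divide_le_eq mult.commute)
  qed
  then show "\<exists>M. \<forall>N\<ge>M. (\<Sum>b\<in>G. (l2norm \<Omega> (partial_sum (\<lambda>\<omega>. F \<omega> \<bullet> b) N))\<^sup>2 / real N) \<le> lrv_bound F" by blast
qed

text \<open>Writing \<open>exp (- s * \<Sum> x\<^sub>j\<^sup>2)\<close> as the mean of \<open>exp (i * sqrt (2 * s) * \<Sum> x\<^sub>j * Z\<^sub>j)\<close> over independent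
  standard normal \<open>Z\<^sub>j\<close> reduces the multivariate limit to the scalar one for each fixed value of \<open>Z\<close>.\<close>

lemma finite_dimensional_laplace_limit:
  fixes F :: "(int \<Rightarrow> 'u) \<Rightarrow> 'h::separable_hilbert" and Z :: "nat \<Rightarrow> 'z \<Rightarrow> real"
  assumes F: "stationary_input F"
    and P': "prob_space P'" and ind: "prob_space.indep_vars P' (\<lambda>_. borel) Z UNIV"
    and Z: "\<And>r. distr P' borel (Z r) = std_normal_distribution"
    and J: "finite J" and diag: "\<And>a. lrv (\<lambda>\<omega>. F \<omega> \<bullet> (\<Sum>j\<in>J. a j *\<^sub>R v j)) = (\<Sum>j\<in>J. (a j)\<^sup>2 * q j)" and s: "s \<ge> 0"
  shows "(\<lambda>N. LINT \<omega>|\<Omega>. exp (- s * (\<Sum>j\<in>J. (partial_sum F N \<omega> \<bullet> v j)\<^sup>2) / real N))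
    \<longlonglongrightarrow> (LINT \<omega>|P'. exp (- s * (\<Sum>j\<in>J. q j * (Z j \<omega>)\<^sup>2)))"
proof -
  interpret P': prob_space P' by fact
  have Zm[measurable]: "Z j \<in> borel_measurable P'" for j using ind by (auto simp: P'.indep_vars_def)
  have Fm[measurable]: "partial_sum F N \<in> borel_measurable \<Omega>" for N
    using sq_integrable_partial_sum[OF F] by (simp add: sq_integrable_def)
  interpret PP: pair_prob_space \<Omega> P' ..
  define w where "w \<eta> = (\<Sum>j\<in>J. (sqrt (2 * s) * Z j \<eta>) *\<^sub>R v j)" for \<eta>
  have wm[measurable]: "w \<in> borel_measurable P'" unfolding w_def by measurable
  define X where "X N \<omega> \<eta> = iexp (1 * ((partial_sum F N \<omega> \<bullet> w \<eta>) / sqrt (real N)))" for N \<omega> \<eta>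
  have Xm[measurable]: "(\<lambda>(\<omega>, \<eta>). X N \<omega> \<eta>) \<in> borel_measurable (\<Omega> \<Otimes>\<^sub>M P')" for N
    unfolding X_def by measurable
  have Xi: "integrable (\<Omega> \<Otimes>\<^sub>M P') (\<lambda>(\<omega>, \<eta>). X N \<omega> \<eta>)" for N
    by (rule PP.P.integrable_const_bound[where B = 1]) (auto simp: X_def case_prod_unfold)
  have 1: "complex_of_real (LINT \<omega>|\<Omega>. exp (- s * (\<Sum>j\<in>J. (partial_sum F N \<omega> \<bullet> v j)\<^sup>2) / real N))
      = (CLINT \<eta>|P'. CLINT \<omega>|\<Omega>. X N \<omega> \<eta>)" for N
  proof -
    have "(CLINT \<eta>|P'. X N \<omega> \<eta>) = exp (- s * (\<Sum>j\<in>J. (partial_sum F N \<omega> \<bullet> v j)\<^sup>2) / real N)" for \<omega>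
    proof -
      define a where "a j = sqrt (2 * s) * (partial_sum F N \<omega> \<bullet> v j) / sqrt (real N)" for j
      have "(partial_sum F N \<omega> \<bullet> w \<eta>) / sqrt (real N) = (\<Sum>j\<in>J. a j * Z j \<eta>)" for \<eta>
        by (simp add: w_def a_def inner_sum_right sum_divide_distrib mult_ac)
      then have "(CLINT \<eta>|P'. X N \<omega> \<eta>) = (CLINT \<eta>|P'. iexp (\<Sum>j\<in>J. a j * Z j \<eta>))" by (simp add: X_def)
      also have "\<dots> = exp (- (\<Sum>j\<in>J. (a j)\<^sup>2) / 2)" by (rule gaussian_characteristic[OF P' ind Z J])
      also have "(\<Sum>j\<in>J. (a j)\<^sup>2) = 2 * (s * (\<Sum>j\<in>J. (partial_sum F N \<omega> \<bullet> v j)\<^sup>2) / real N)"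
        using s by (simp add: a_def power_divide power_mult_distrib sum_divide_distrib[symmetric] sum_distrib_left[symmetric])
      finally show ?thesis by simp
    qed
    then have "(CLINT \<omega>|\<Omega>. CLINT \<eta>|P'. X N \<omega> \<eta>) = complex_of_real (LINT \<omega>|\<Omega>. exp (- s * (\<Sum>j\<in>J. (partial_sum F N \<omega> \<bullet> v j)\<^sup>2) / real N))"
      by simp
    then show ?thesis using PP.Fubini_integral[OF Xi, of N] by simp
  qed
  have 2: "(\<lambda>N. CLINT \<omega>|\<Omega>. X N \<omega> \<eta>) \<longlonglongrightarrow> complex_of_real (exp (- s * (\<Sum>j\<in>J. q j * (Z j \<eta>)\<^sup>2)))" for \<eta>
  proof -
    have "lrv (\<lambda>\<omega>. F \<omega> \<bullet> w \<eta>) = 2 * (s * (\<Sum>j\<in>J. q j * (Z j \<eta>)\<^sup>2))"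
      unfolding w_def diag using s by (simp add: power_mult_distrib sum_distrib_left mult_ac)
    then show ?thesis
      using central_limit_characteristic[OF stationary_input_inner[OF F, of "w \<eta>"], of 1]
      by (simp add: X_def partial_sum_inner)
  qed
  have "(\<lambda>N. CLINT \<eta>|P'. CLINT \<omega>|\<Omega>. X N \<omega> \<eta>) \<longlonglongrightarrow> (CLINT \<eta>|P'. complex_of_real (exp (- s * (\<Sum>j\<in>J. q j * (Z j \<eta>)\<^sup>2))))"
  proof (rule integral_dominated_convergence[where w = "\<lambda>_. 1"])
    show "AE \<eta> in P'. norm (CLINT \<omega>|\<Omega>. X N \<omega> \<eta>) \<le> 1" for N
    proof (intro AE_I2)
      fix \<eta>
      have "norm (CLINT \<omega>|\<Omega>. X N \<omega> \<eta>) \<le> (LINT \<omega>|\<Omega>. norm (X N \<omega> \<eta>))" by (rule integral_norm_bound)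
      then show "norm (CLINT \<omega>|\<Omega>. X N \<omega> \<eta>) \<le> 1"
        by (simp add: X_def prob_space.prob_space[OF prob_Omega])
    qed
  qed (use 2 in auto)
  then have "(\<lambda>N. complex_of_real (LINT \<omega>|\<Omega>. exp (- s * (\<Sum>j\<in>J. (partial_sum F N \<omega> \<bullet> v j)\<^sup>2) / real N)))
    \<longlonglongrightarrow> complex_of_real (LINT \<omega>|P'. exp (- s * (\<Sum>j\<in>J. q j * (Z j \<omega>)\<^sup>2)))"
    unfolding 1 by (simp del: of_real_exp)
  then show ?thesis by (simp only: tendsto_of_real_iff)
qed

text \<open>The residual of the projection is again a stationary input: its coefficients do not
  exceed those of \<open>F\<close>, and its norm is at most \<open>\<eta>\<close>. So the second
  moments of its normalised partial sums are small uniformly in \<open>N\<close>, although the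
  coefficients need not be small.\<close>

lemma laplace_truncation_error:
  fixes F :: "(int \<Rightarrow> 'u) \<Rightarrow> 'h::separable_hilbert"
  assumes F: "stationary_input F" and G: "orthonormal G" "finite G" and s: "s \<ge> 0" and N: "N \<ge> 1"
    and \<eta>: "l2norm \<Omega> (\<lambda>\<omega>. F \<omega> - (\<Sum>b\<in>G. (F \<omega> \<bullet> b) *\<^sub>R b)) \<le> \<eta>"
  shows "\<bar>(LINT \<omega>|\<Omega>. exp (- s * (norm (partial_sum F N \<omega>))\<^sup>2 / real N))
      - (LINT \<omega>|\<Omega>. exp (- s * (\<Sum>b\<in>G. (partial_sum F N \<omega> \<bullet> b)\<^sup>2) / real N))\<bar>
    \<le> s * (\<eta>\<^sup>2 + 2 * \<eta> * suminf (dep_coef F))"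
proof -
  define L where "L x = x - (\<Sum>b\<in>G. (x \<bullet> b) *\<^sub>R b)" for x :: 'h
  have L: "bounded_linear L" "\<And>x. norm (L x) \<le> 1 * norm x"
    unfolding L_def[abs_def] using bounded_linear_residual[OF G] by auto
  have Fm[measurable]: "partial_sum F N \<in> borel_measurable \<Omega>"
    using sq_integrable_partial_sum[OF F] by (simp add: sq_integrable_def)
  note LF = stationary_input_bounded_linear[OF F L, simplified]
  have \<eta>': "l2norm \<Omega> (\<lambda>\<omega>. L (F \<omega>)) \<le> \<eta>" using \<eta> by (simp add: L_def)
  have \<eta>0: "0 \<le> \<eta>" using order_trans[OF l2norm_nonneg \<eta>'] .
  have "suminf (dep_coef (\<lambda>\<omega>. L (F \<omega>))) \<le> suminf (dep_coef F)"
    by (intro suminf_le LF(2) stationary_inputD(4)[OF F] stationary_inputD(4)[OF LF(1)])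
  moreover have "0 \<le> suminf (dep_coef (\<lambda>\<omega>. L (F \<omega>)))"
    by (intro suminf_nonneg stationary_inputD(4)[OF LF(1)]) simp
  ultimately have lb: "lrv_bound (\<lambda>\<omega>. L (F \<omega>)) \<le> \<eta>\<^sup>2 + 2 * \<eta> * suminf (dep_coef F)"
    unfolding lrv_bound_def using \<eta>' \<eta>0 by (intro add_mono power_mono mult_mono) auto
  let ?S = "partial_sum F N"
  have eq: "(norm (L x))\<^sup>2 = (norm x)\<^sup>2 - (\<Sum>b\<in>G. (x \<bullet> b)\<^sup>2)" for x
    unfolding L_def by (rule orthonormal_residual(2)[OF G])
  have pw: "\<bar>exp (- s * (norm x)\<^sup>2 / real N) - exp (- s * (\<Sum>b\<in>G. (x \<bullet> b)\<^sup>2) / real N)\<bar> \<le> s / real N * (norm (L x))\<^sup>2" for x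
  proof -
    have "\<bar>exp (- (s * (norm x)\<^sup>2 / real N)) - exp (- (s * (\<Sum>b\<in>G. (x \<bullet> b)\<^sup>2) / real N))\<bar>
       \<le> \<bar>s * (norm x)\<^sup>2 / real N - s * (\<Sum>b\<in>G. (x \<bullet> b)\<^sup>2) / real N\<bar>"
      using s by (intro exp_minus_lipschitz) (auto simp: sum_nonneg)
    also have "s * (norm x)\<^sup>2 / real N - s * (\<Sum>b\<in>G. (x \<bullet> b)\<^sup>2) / real N = s / real N * (norm (L x))\<^sup>2"
      unfolding eq by (simp add: right_diff_distrib diff_divide_distrib)
    finally show ?thesis using s by (simp add: abs_mult)
  qed
  have LS: "sq_integrable \<Omega> (\<lambda>\<omega>. L (?S \<omega>))" "(l2norm \<Omega> (\<lambda>\<omega>. L (?S \<omega>)))\<^sup>2 \<le> real N * lrv_bound (\<lambda>\<omega>. L (F \<omega>))"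
    using sq_integrable_partial_sum[OF LF(1), of N] partial_sum_bound[OF LF(1), of N]
    by (simp_all add: partial_sum_bounded_linear[OF L(1)] cong: l2norm_cong) (simp_all add: partial_sum_bounded_linear[OF L(1), abs_def])
  have i1: "integrable \<Omega> (\<lambda>\<omega>. exp (- s * (norm (?S \<omega>))\<^sup>2 / real N))"
    by (rule Om.integrable_const_bound[where B = 1]) (use s in auto)
  have i2: "integrable \<Omega> (\<lambda>\<omega>. exp (- s * (\<Sum>b\<in>G. (?S \<omega> \<bullet> b)\<^sup>2) / real N))"
    by (rule Om.integrable_const_bound[where B = 1]) (use s in \<open>auto simp: sum_nonneg\<close>)
  have i3: "integrable \<Omega> (\<lambda>\<omega>. s / real N * (norm (L (?S \<omega>)))\<^sup>2)" using LS(1) by (simp add: sq_integrable_def)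
  have "\<bar>(LINT \<omega>|\<Omega>. exp (- s * (norm (?S \<omega>))\<^sup>2 / real N)) - (LINT \<omega>|\<Omega>. exp (- s * (\<Sum>b\<in>G. (?S \<omega> \<bullet> b)\<^sup>2) / real N))\<bar>
    = \<bar>LINT \<omega>|\<Omega>. exp (- s * (norm (?S \<omega>))\<^sup>2 / real N) - exp (- s * (\<Sum>b\<in>G. (?S \<omega> \<bullet> b)\<^sup>2) / real N)\<bar>"
    by (subst Bochner_Integration.integral_diff[OF i1 i2]) simp
  also have "\<dots> \<le> (LINT \<omega>|\<Omega>. \<bar>exp (- s * (norm (?S \<omega>))\<^sup>2 / real N) - exp (- s * (\<Sum>b\<in>G. (?S \<omega> \<bullet> b)\<^sup>2) / real N)\<bar>)"
    by (rule integral_abs_bound)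
  also have "\<dots> \<le> (LINT \<omega>|\<Omega>. s / real N * (norm (L (?S \<omega>)))\<^sup>2)"
    by (intro integral_mono i3 pw integrable_abs Bochner_Integration.integrable_diff i1 i2)
  also have "\<dots> = s / real N * (l2norm \<Omega> (\<lambda>\<omega>. L (?S \<omega>)))\<^sup>2" by (simp add: l2norm_sq)
  also have "\<dots> \<le> s / real N * (real N * (\<eta>\<^sup>2 + 2 * \<eta> * suminf (dep_coef F)))"
    using s by (intro mult_left_mono order_trans[OF LS(2)] lb) auto
  also have "\<dots> = s * (\<eta>\<^sup>2 + 2 * \<eta> * suminf (dep_coef F))" using N by simp
  finally show ?thesis .
qed

text \<open>Three errors of size \<open>\<epsilon> / 3\<close>: truncation of the basis, uniformly
  in \<open>N\<close>; truncation of the limiting series at \<open>k\<close>; and the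
  finite-dimensional limit in \<open>N\<close>. One finite set of basis vectors has to serve the
  first two.\<close>

theorem hilbert_laplace_limit:
  fixes F :: "(int \<Rightarrow> 'u) \<Rightarrow> 'h::separable_hilbert" and Z :: "nat \<Rightarrow> 'z \<Rightarrow> real"
  assumes F: "stationary_input F"
    and P': "prob_space P'" and ind: "prob_space.indep_vars P' (\<lambda>_. borel) Z UNIV"
    and Z: "\<And>r. distr P' borel (Z r) = std_normal_distribution"
    and Q: "bounded_linear Q" "\<And>x y. Q x \<bullet> y = x \<bullet> Q y" "\<And>x. Q x \<bullet> x = lrv (\<lambda>\<omega>. F \<omega> \<bullet> x)"
    and \<gamma>: "eigenvalues_with_multiplicity Q \<gamma>" and s: "s \<ge> 0"
  shows "(\<lambda>N. LINT \<omega>|\<Omega>. exp (- s * (norm (partial_sum F N \<omega>))\<^sup>2 / real N))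
    \<longlonglongrightarrow> (LINT \<omega>|P'. exp (- s * (\<Sum>r. \<gamma> r * (Z r \<omega>)\<^sup>2)))"
    and "\<And>r. 0 \<le> \<gamma> r" "summable \<gamma>"
proof -
  interpret P': prob_space P' by fact
  have Zm[measurable]: "Z j \<in> borel_measurable P'" for j using ind by (auto simp: P'.indep_vars_def)
  interpret tc: trace_class_psd Q "lrv_bound F"
  proof (rule trace_class_psd.intro)
    show "0 \<le> Q x \<bullet> x" for x
      unfolding Q(3) by (rule LIMSEQ_le_const[OF second_moment_limit[OF stationary_input_inner[OF F]]]) auto
    show "(\<Sum>b\<in>G. Q b \<bullet> b) \<le> lrv_bound F" if "finite G" "orthonormal G" for G
      unfolding Q(3) by (rule lrv_trace_bound[OF F that(2,1)])
    show "bounded_linear Q" by (rule Q(1))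
    show "Q x \<bullet> y = x \<bullet> Q y" for x y by (rule Q(2))
  qed
  obtain B e where B: "orthonormal_basis B" and inj: "inj_on e {r. \<gamma> r \<noteq> 0}" and eB: "e ` {r. \<gamma> r \<noteq> 0} \<subseteq> B"
    and eQ: "\<And>r. \<gamma> r \<noteq> 0 \<Longrightarrow> Q (e r) = \<gamma> r *\<^sub>R e r"
    and ker: "\<And>b. b \<in> B \<Longrightarrow> b \<notin> e ` {r. \<gamma> r \<noteq> 0} \<Longrightarrow> Q b = 0"
    and \<gamma>0: "\<And>r. 0 \<le> \<gamma> r" and \<gamma>s: "summable \<gamma>"
    by (rule tc.eigenbasis[OF \<gamma>], rule that)
  show "\<And>r. 0 \<le> \<gamma> r" "summable \<gamma>" by (fact \<gamma>0 \<gamma>s)+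
  define c where "c k = (LINT \<omega>|P'. exp (- s * (\<Sum>r<k. \<gamma> r * (Z r \<omega>)\<^sup>2)))" for k
  define cinf where "cinf = (LINT \<omega>|P'. exp (- s * (\<Sum>r. \<gamma> r * (Z r \<omega>)\<^sup>2)))"
  have c: "c \<longlonglongrightarrow> cinf"
    unfolding c_def cinf_def
  proof (rule integral_dominated_convergence[where w = "\<lambda>_. 1"])
    show "AE \<omega> in P'. (\<lambda>k. exp (- s * (\<Sum>r<k. \<gamma> r * (Z r \<omega>)\<^sup>2))) \<longlonglongrightarrow> exp (- s * (\<Sum>r. \<gamma> r * (Z r \<omega>)\<^sup>2))"
      using weighted_chi_square_summable[OF Zm Z \<gamma>0 \<gamma>s]
      by eventually_elim (intro tendsto_intros summable_LIMSEQ)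
    show "AE \<omega> in P'. norm (exp (- s * (\<Sum>r<k. \<gamma> r * (Z r \<omega>)\<^sup>2))) \<le> 1" for k
      using s \<gamma>0 by (intro AE_I2) (simp add: sum_nonneg)
  qed auto
  show "(\<lambda>N. LINT \<omega>|\<Omega>. exp (- s * (norm (partial_sum F N \<omega>))\<^sup>2 / real N)) \<longlonglongrightarrow> cinf"
  proof (rule LIMSEQ_I)
    fix \<epsilon> :: real assume \<epsilon>: "\<epsilon> > 0"
    have "(\<lambda>\<eta>. s * (\<eta>\<^sup>2 + 2 * \<eta> * suminf (dep_coef F))) \<midarrow>0\<rightarrow> s * (0\<^sup>2 + 2 * 0 * suminf (dep_coef F))"
      by (intro tendsto_intros)
    then have "(\<lambda>\<eta>. s * (\<eta>\<^sup>2 + 2 * \<eta> * suminf (dep_coef F))) \<midarrow>0\<rightarrow> 0" by simp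
    then have "\<forall>\<^sub>F \<eta> in at 0. s * (\<eta>\<^sup>2 + 2 * \<eta> * suminf (dep_coef F)) < \<epsilon> / 3"
      using \<epsilon> by (intro order_tendstoD(2)) auto
    then have "\<forall>\<^sub>F \<eta> in at_right 0. s * (\<eta>\<^sup>2 + 2 * \<eta> * suminf (dep_coef F)) < \<epsilon> / 3"
      unfolding eventually_at_split by simp
    then obtain \<eta> where \<eta>: "\<eta> > 0" "s * (\<eta>\<^sup>2 + 2 * \<eta> * suminf (dep_coef F)) < \<epsilon> / 3"
      unfolding eventually_at_right_field using dense[of 0] by (metis (no_types))
    obtain G0 where G0: "finite G0" "G0 \<subseteq> B"
      and tail: "\<And>G. finite G \<Longrightarrow> G0 \<subseteq> G \<Longrightarrow> G \<subseteq> B \<Longrightarrow> l2norm \<Omega> (\<lambda>\<omega>. F \<omega> - (\<Sum>b\<in>G. (F \<omega> \<bullet> b) *\<^sub>R b)) \<le> \<eta>"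
      using l2norm_basis_tail[OF B stationary_inputD(1)[OF F] \<eta>(1)] by blast
    define R where "R k = {r. r < k \<and> \<gamma> r \<noteq> 0}" for k :: nat
    \<comment> \<open>\<open>k0\<close> exceeds the index of every eigenvector that occurs in
      \<open>G0\<close>.\<close>
    have "\<exists>k. finite (the_inv_into {r. \<gamma> r \<noteq> 0} e ` (G0 \<inter> e ` {r. \<gamma> r \<noteq> 0})) \<and>
       the_inv_into {r. \<gamma> r \<noteq> 0} e ` (G0 \<inter> e ` {r. \<gamma> r \<noteq> 0}) \<subseteq> {..<k}"
      using G0(1) finite_nat_iff_bounded by blast
    then obtain k0 where k0: "the_inv_into {r. \<gamma> r \<noteq> 0} e ` (G0 \<inter> e ` {r. \<gamma> r \<noteq> 0}) \<subseteq> {..<k0}" by blast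
    have "\<forall>\<^sub>F k in sequentially. \<bar>c k - cinf\<bar> < \<epsilon> / 3 \<and> k \<ge> k0"
      using tendstoD[OF c, of "\<epsilon> / 3"] \<epsilon> by (intro eventually_conj eventually_ge_at_top) (simp add: dist_real_def)
    then obtain k where k: "\<bar>c k - cinf\<bar> < \<epsilon> / 3" "k \<ge> k0" by (auto simp: eventually_sequentially)
    \<comment> \<open>The other vectors of \<open>G0\<close> lie in the kernel of
      \<open>Q\<close>.\<close>
    define KG where "KG = G0 - e ` {r. \<gamma> r \<noteq> 0}"
    have KG: "finite KG" "KG \<subseteq> B" using G0 by (auto simp: KG_def)
    have "finite {k..<k + card KG}" "finite KG" "card {k..<k + card KG} = card KG" using KG by auto
    then obtain g where g: "bij_betw g {k..<k + card KG} KG" using finite_same_card_bij by metis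
    \<comment> \<open>Eigenvectors keep their own index \<open>r < k\<close>, so that they meet the
      right \<open>Z r\<close>; kernel vectors receive fresh indices from \<open>k\<close> on, with
      eigenvalue \<open>qq j = 0\<close>.\<close>
    define J where "J = R k \<union> {k..<k + card KG}"
    define v where "v j = (if j < k then e j else g j)" for j
    define qq where "qq j = (if j < k then \<gamma> j else 0)" for j
    have Rk: "finite (R k)" "R k \<subseteq> {r. \<gamma> r \<noteq> 0}" "R k \<subseteq> {..<k}" by (auto simp: R_def)
    have J: "finite J" using Rk by (auto simp: J_def)
    have vQ: "Q (v j) = qq j *\<^sub>R v j" if "j \<in> J" for j
    proof (cases "j < k")
      case True
      then show ?thesis using that eQ[of j] by (auto simp: J_def R_def v_def qq_def)
    next
      case False
      then have "g j \<in> KG" using that g by (auto simp: J_def R_def bij_betw_def)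
      then show ?thesis using ker[of "g j"] KG False by (auto simp: v_def qq_def KG_def)
    qed
    define G where "G = v ` J"
    have injv: "inj_on v J"
    proof -
      have a: "v ` R k \<subseteq> e ` {r. \<gamma> r \<noteq> 0}" using Rk by (auto simp: v_def)
      have b: "v ` {k..<k + card KG} = KG" using g by (auto simp: v_def bij_betw_def)
      have "inj_on v (R k)"
        using inj_on_subset[OF inj Rk(2)] Rk(3) by (auto simp: inj_on_def v_def)
      moreover have "inj_on v {k..<k + card KG}"
        using g by (auto simp: inj_on_def v_def bij_betw_def)
      ultimately show ?thesis
        unfolding J_def inj_on_Un using a b by (auto simp: KG_def)
    qed
    have GB: "G \<subseteq> B" "finite G"
    proof -
      have "v ` {k..<k + card KG} = KG" using g by (auto simp: v_def bij_betw_def)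
      moreover have "v ` R k \<subseteq> B" using Rk eB by (auto simp: v_def)
      ultimately show "G \<subseteq> B" using KG by (auto simp: G_def J_def image_Un)
      show "finite G" using J by (simp add: G_def)
    qed
    have G0G: "G0 \<subseteq> G"
    proof
      fix b assume b: "b \<in> G0"
      show "b \<in> G"
      proof (cases "b \<in> e ` {r. \<gamma> r \<noteq> 0}")
        case True
        then obtain r where r: "\<gamma> r \<noteq> 0" "b = e r" by auto
        have "the_inv_into {r. \<gamma> r \<noteq> 0} e b = r" using r the_inv_into_f_f[OF inj] by auto
        then have "r < k0" using k0 b True by force
        then have "r \<in> R k" using k(2) r by (simp add: R_def)
        then show ?thesis using r Rk(3) unfolding G_def J_def by (intro image_eqI[of _ _ r]) (auto simp: v_def)
      next
        case False
        then have "b \<in> g ` {k..<k + card KG}" using b bij_betw_imp_surj_on[OF g] by (simp add: KG_def)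
        then obtain j where "j \<in> {k..<k + card KG}" "b = g j" by (rule imageE)
        then show ?thesis unfolding G_def J_def by (intro image_eqI[of _ _ j]) (auto simp: v_def)
      qed
    qed
    have on: "orthonormal G" using orthonormal_mono[OF orthonormal_basis_orthonormal[OF B] GB(1)] .
    have vv: "v i \<bullet> v j = (if i = j then 1 else 0)" if "i \<in> J" "j \<in> J" for i j
      using orthonormal_inner[OF on, of "v i" "v j"] that injv by (auto simp: G_def inj_on_def)
    have diag: "lrv (\<lambda>\<omega>. F \<omega> \<bullet> (\<Sum>j\<in>J. a j *\<^sub>R v j)) = (\<Sum>j\<in>J. (a j)\<^sup>2 * qq j)" for a
    proof -
      have Qs: "Q (\<Sum>j\<in>J. a j *\<^sub>R v j) = (\<Sum>j\<in>J. (a j * qq j) *\<^sub>R v j)"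
        using vQ by (simp add: tc.sum tc.scale)
      have "(\<Sum>j\<in>J. (a j * qq j) *\<^sub>R v j) \<bullet> (\<Sum>j\<in>J. a j *\<^sub>R v j)
          = (\<Sum>i\<in>J. \<Sum>j\<in>J. if i = j then (a i * qq i) * a j else 0)"
        unfolding inner_sum_left inner_sum_right by (intro sum.cong refl) (simp add: vv)
      also have "\<dots> = (\<Sum>j\<in>J. (a j)\<^sup>2 * qq j)" using J by (simp add: power2_eq_square mult_ac)
      finally show ?thesis using Q(3)[of "\<Sum>j\<in>J. a j *\<^sub>R v j"] Qs by simp
    qed
    have qZ: "(\<Sum>j\<in>J. qq j * (Z j \<omega>)\<^sup>2) = (\<Sum>r<k. \<gamma> r * (Z r \<omega>)\<^sup>2)" for \<omega>
    proof -
      have "(\<Sum>j\<in>J. qq j * (Z j \<omega>)\<^sup>2) = (\<Sum>j\<in>R k. qq j * (Z j \<omega>)\<^sup>2)"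
        using J by (intro sum.mono_neutral_right) (auto simp: J_def qq_def R_def)
      also have "\<dots> = (\<Sum>j\<in>R k. \<gamma> j * (Z j \<omega>)\<^sup>2)" using Rk(3) by (intro sum.cong) (auto simp: qq_def)
      also have "\<dots> = (\<Sum>r<k. \<gamma> r * (Z r \<omega>)\<^sup>2)" by (intro sum.mono_neutral_left) (auto simp: R_def)
      finally show ?thesis .
    qed
    have sumG: "(\<Sum>b\<in>G. (x \<bullet> b)\<^sup>2) = (\<Sum>j\<in>J. (x \<bullet> v j)\<^sup>2)" for x
      unfolding G_def by (simp add: sum.reindex[OF injv])
    have "(\<lambda>N. LINT \<omega>|\<Omega>. exp (- s * (\<Sum>b\<in>G. (partial_sum F N \<omega> \<bullet> b)\<^sup>2) / real N)) \<longlonglongrightarrow> c k"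
      using finite_dimensional_laplace_limit[OF F P' ind Z J diag s] unfolding sumG c_def qZ .
    from tendstoD[OF this, of "\<epsilon> / 3"]
    have ev: "\<forall>\<^sub>F N in sequentially. \<bar>(LINT \<omega>|\<Omega>. exp (- s * (\<Sum>b\<in>G. (partial_sum F N \<omega> \<bullet> b)\<^sup>2) / real N)) - c k\<bar> < \<epsilon> / 3"
      using \<epsilon> by (simp add: dist_real_def)
    have "\<forall>\<^sub>F N in sequentially. norm ((LINT \<omega>|\<Omega>. exp (- s * (norm (partial_sum F N \<omega>))\<^sup>2 / real N)) - cinf) < \<epsilon>"
      using ev eventually_ge_at_top[of 1]
    proof eventually_elim
      case (elim N)
      show ?case
        using laplace_truncation_error[OF F on GB(2) s elim(2) tail[OF GB(2) G0G GB(1)]] elim(1) k(1) \<eta>(2)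
        unfolding real_norm_def by linarith
    qed
    then show "\<exists>no. \<forall>N\<ge>no. norm ((LINT \<omega>|\<Omega>. exp (- s * (norm (partial_sum F N \<omega>))\<^sup>2 / real N)) - cinf) < \<epsilon>"
      unfolding eventually_sequentially .
  qed
qed

end

section \<open>Traces of rank-one operators and their limits\<close>

text \<open>A finite partial sum is the integral with \<open>X\<close> replaced by its projection;
  \<open>l2norm_basis_tail\<close> and Cauchy-Schwarz bound the rest. The convergence is
  unconditional, as the trace series demand.\<close>

lemma parseval_expectation:
  fixes X Y :: "'w \<Rightarrow> 'h::separable_hilbert"
  assumes B: "orthonormal_basis B" and X: "sq_integrable M X" and Y: "sq_integrable M Y"
  shows "((\<lambda>b. LINT \<omega>|M. (X \<omega> \<bullet> b) * (Y \<omega> \<bullet> b)) has_sum (LINT \<omega>|M. X \<omega> \<bullet> Y \<omega>)) B"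
proof -
  have on: "orthonormal H" if "H \<subseteq> B" for H using orthonormal_mono[OF orthonormal_basis_orthonormal[OF B] that] .
  have sqi: "sq_integrable M (\<lambda>\<omega>. W \<omega> \<bullet> b)" if "sq_integrable M W" for W b
    by (rule sq_integrable_bounded_linear(1)[OF bounded_linear_inner_left that, of b "norm b"])
      (use Cauchy_Schwarz_ineq2 in \<open>auto simp: mult.commute\<close>)
  have I: "integrable M (\<lambda>\<omega>. (X \<omega> \<bullet> b) * (Y \<omega> \<bullet> b))" for b
    using sq_integrable_inner(1)[OF sqi[OF X] sqi[OF Y], of b b] by simp
  show ?thesis
    unfolding has_sum_def tendsto_iff eventually_finite_subsets_at_top
  proof (intro allI impI)
    fix e :: real assume "e > 0"
    define e' where "e' = e / (2 * (l2norm M Y + 1))"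
    have e': "e' > 0" using \<open>e > 0\<close> by (simp add: e'_def add_nonneg_pos)
    obtain G0 where G0: "finite G0" "G0 \<subseteq> B"
      and tail: "\<And>G. finite G \<Longrightarrow> G0 \<subseteq> G \<Longrightarrow> G \<subseteq> B \<Longrightarrow> l2norm M (\<lambda>\<omega>. X \<omega> - (\<Sum>b\<in>G. (X \<omega> \<bullet> b) *\<^sub>R b)) \<le> e'"
      using l2norm_basis_tail[OF B X e'] by blast
    have "dist (\<Sum>b\<in>G. LINT \<omega>|M. (X \<omega> \<bullet> b) * (Y \<omega> \<bullet> b)) (LINT \<omega>|M. X \<omega> \<bullet> Y \<omega>) < e"
      if G: "finite G" "G0 \<subseteq> G" "G \<subseteq> B" for G
    proof -
      let ?R = "\<lambda>\<omega>. X \<omega> - (\<Sum>b\<in>G. (X \<omega> \<bullet> b) *\<^sub>R b)"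
      have R: "sq_integrable M ?R"
        by (rule sq_integrable_bounded_linear(1)[OF bounded_linear_residual(1)[OF on[OF G(3)] G(1)] X bounded_linear_residual(2)[OF on[OF G(3)] G(1)]]) simp
      have "(LINT \<omega>|M. X \<omega> \<bullet> Y \<omega>) - (\<Sum>b\<in>G. LINT \<omega>|M. (X \<omega> \<bullet> b) * (Y \<omega> \<bullet> b))
          = (LINT \<omega>|M. X \<omega> \<bullet> Y \<omega> - (\<Sum>b\<in>G. (X \<omega> \<bullet> b) * (Y \<omega> \<bullet> b)))"
        using I sq_integrable_inner(1)[OF X Y] by simp
      also have "\<dots> = (LINT \<omega>|M. ?R \<omega> \<bullet> Y \<omega>)"
        by (simp add: inner_diff_left inner_sum_left) (simp add: inner_commute)
      finally have "dist (\<Sum>b\<in>G. LINT \<omega>|M. (X \<omega> \<bullet> b) * (Y \<omega> \<bullet> b)) (LINT \<omega>|M. X \<omega> \<bullet> Y \<omega>) = \<bar>LINT \<omega>|M. ?R \<omega> \<bullet> Y \<omega>\<bar>"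
        by (simp add: dist_real_def abs_minus_commute)
      also have "\<dots> \<le> l2norm M ?R * l2norm M Y" by (rule sq_integrable_inner(2)[OF R Y])
      also have "\<dots> \<le> e' * (l2norm M Y + 1)" using tail[OF G] e' by (intro mult_mono) auto
      also have "\<dots> = e / 2"
      proof -
        have "e / (2 * m) * m = e / 2" if "m > 0" for m :: real using that by simp
        from this[of "l2norm M Y + 1"] show ?thesis
          using add_nonneg_pos[OF l2norm_nonneg[of M Y] zero_less_one] by (simp only: e'_def)
      qed
      also have "\<dots> < e" using \<open>e > 0\<close> by simp
      finally show ?thesis .
    qed
    then show "\<exists>G0. finite G0 \<and> G0 \<subseteq> B \<and> (\<forall>G. finite G \<and> G0 \<subseteq> G \<and> G \<subseteq> B \<longrightarrow>
        dist (\<Sum>b\<in>G. LINT \<omega>|M. (X \<omega> \<bullet> b) * (Y \<omega> \<bullet> b)) (LINT \<omega>|M. X \<omega> \<bullet> Y \<omega>) < e)"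
      using G0 by blast
  qed
qed

lemma bounded_bilinear_outer: "bounded_bilinear (\<otimes>)"
proof (rule bounded_bilinear.intro)
  show "\<exists>K. \<forall>a b. norm (a \<otimes> b :: 'a hs) \<le> norm a * norm b * K" by (intro exI[of _ 1]) (simp add: norm_outer)
qed (auto intro!: hs_eqI simp: hs_apply_simps inner_add_left scaleR_add_left scaleR_add_right)

text \<open>In the basis of the vectors \<open>axis i b\<close> the squared norm of the tensor
  product factorises into the squared norms of \<open>A\<close> and \<open>B\<close>.\<close>

lemma bounded_bilinear_op_tensor:
  "bounded_bilinear ((\<otimes>\<^sub>o) :: (real ^ 's::finite) hs \<Rightarrow> 'b::separable_hilbert hs \<Rightarrow> ('b ^ 's) hs)"
  and norm_op_tensor_le: "norm ((A :: (real ^ 's) hs) \<otimes>\<^sub>o (B :: 'b hs)) \<le> norm A * norm B"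
proof -
  have le: "norm ((A :: (real ^ 's) hs) \<otimes>\<^sub>o (B :: 'b hs)) \<le> norm A * norm B" for A B
  proof -
    define D where "D = (\<lambda>(i, b). axis i b :: 'b ^ 's) ` (UNIV \<times> some_onb)"
    have D: "orthonormal_basis D" unfolding D_def by (rule orthonormal_basis_axis[OF some_onb])
    \<comment> \<open>\<open>{1}\<close> is a basis of the real line, so the coordinate vectors of
      \<open>real ^ 's\<close> become an instance of \<open>orthonormal_basis_axis\<close>.\<close>
    have one: "orthonormal_basis {1 :: real}"
      by (rule orthonormal_basis_def[THEN iffD2]) (auto simp: pairwise_def span_singleton intro!: exI[of _ "_ :: real"] closure_subset[THEN subsetD])
    define C where "C = (\<lambda>(i, b). axis i b :: real ^ 's) ` (UNIV \<times> {1})"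
    have C: "orthonormal_basis C" unfolding C_def by (rule orthonormal_basis_axis[OF one])
    have Ceq: "C = range (\<lambda>i. axis i 1)" by (auto simp: C_def)
    have injC: "inj (\<lambda>i. axis i 1 :: real ^ 's)" by (auto intro!: injI simp: axis_eq_axis)
    have injD: "inj_on (\<lambda>(i, b). axis i b :: 'b ^ 's) (UNIV \<times> some_onb)"
    proof -
      have "b \<noteq> 0" if "b \<in> some_onb" for b :: 'b using some_onb_norm[OF that] by auto
      then show ?thesis by (auto intro!: inj_onI simp: axis_eq_axis)
    qed
    have sA: "(\<Sum>i\<in>UNIV. (norm (hs_apply A (axis i 1)))\<^sup>2) = (norm A)\<^sup>2"
      using has_sum_unique[OF has_sum_finite hs_norm_has_sum[OF C, of A]] by (simp add: Ceq sum.reindex[OF injC])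
    have ap: "hs_apply (A \<otimes>\<^sub>o B) (axis i b) = vec_tensor (hs_apply A (axis i 1)) (hs_apply B b)" for i b
      using hs_apply_op_tensor[of A B "axis i 1" b] by (simp add: vec_tensor_axis)
    have nv: "(norm (vec_tensor u v))\<^sup>2 = (norm u)\<^sup>2 * (norm v)\<^sup>2" for u :: "real ^ 's" and v :: 'b
      by (simp add: power2_norm_eq_inner inner_vec_tensor)
    have "((\<lambda>x. (norm (hs_apply (A \<otimes>\<^sub>o B) x))\<^sup>2) has_sum (norm (A \<otimes>\<^sub>o B))\<^sup>2) D" by (rule hs_norm_has_sum[OF D])
    define f where "f = (\<lambda>(i, b). (norm (hs_apply A (axis i 1)))\<^sup>2 * (norm (hs_apply B b))\<^sup>2)"
    note \<open>((\<lambda>x. (norm (hs_apply (A \<otimes>\<^sub>o B) x))\<^sup>2) has_sum (norm (A \<otimes>\<^sub>o B))\<^sup>2) D\<close>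
    then have "(f has_sum (norm (A \<otimes>\<^sub>o B))\<^sup>2) (UNIV \<times> some_onb)"
      unfolding D_def has_sum_reindex[OF injD] by (simp add: o_def case_prod_unfold ap nv f_def)
    moreover have "((\<lambda>b. f (i, b)) has_sum ((norm (hs_apply A (axis i 1)))\<^sup>2 * (norm B)\<^sup>2)) some_onb" for i
      unfolding f_def by (simp add: has_sum_cmult_right[OF hs_norm_has_sum[OF some_onb]])
    ultimately have "((\<lambda>i. (norm (hs_apply A (axis i 1)))\<^sup>2 * (norm B)\<^sup>2) has_sum (norm (A \<otimes>\<^sub>o B))\<^sup>2) UNIV"
      by (rule has_sum_SigmaD)
    then have "(norm (A \<otimes>\<^sub>o B))\<^sup>2 = (\<Sum>i\<in>UNIV. (norm (hs_apply A (axis i 1)))\<^sup>2 * (norm B)\<^sup>2)"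
      by (rule has_sum_unique[OF _ has_sum_finite]) simp
    also have "\<dots> = (norm A * norm B)\<^sup>2" by (simp add: sum_distrib_right[symmetric] sA power_mult_distrib)
    finally show ?thesis by (rule power2_le_imp_le[OF eq_refl]) simp
  qed
  then show "norm ((A :: (real ^ 's) hs) \<otimes>\<^sub>o (B :: 'b hs)) \<le> norm A * norm B" .
  have vt: "vec_tensor (u + u') v = vec_tensor u v + vec_tensor u' v" "vec_tensor u (v + v') = vec_tensor u v + vec_tensor u v'"
    "vec_tensor (c *\<^sub>R u) v = c *\<^sub>R vec_tensor u v" "vec_tensor u (c *\<^sub>R v) = c *\<^sub>R vec_tensor u v"
    for u u' :: "real ^ 's" and v v' :: 'b and c
    by (simp_all add: vec_tensor_def vec_eq_iff scaleR_add_left scaleR_add_right)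
  show "bounded_bilinear ((\<otimes>\<^sub>o) :: (real ^ 's) hs \<Rightarrow> 'b hs \<Rightarrow> ('b ^ 's) hs)"
  proof (rule bounded_bilinear.intro)
    show "\<exists>K. \<forall>a b. norm ((a :: (real ^ 's) hs) \<otimes>\<^sub>o (b :: 'b hs)) \<le> norm a * norm b * K"
      using le by (intro exI[of _ 1]) simp
  qed (auto intro!: hs_eq_vec_tensorI simp: hs_apply_op_tensor hs_apply_simps vt)
qed

section \<open>Closed forms of the partial traces of rank-one operators\<close>

lemma finite_orthonormal_vec:
  fixes B :: "(real ^ 's::finite) set"
  assumes "orthonormal B"
  shows "finite B"
proof -
  have "0 \<notin> B" using assms by (auto simp: orthonormal_def)
  then have "independent B" using assms by (intro pairwise_orthogonal_independent) (auto simp: orthonormal_def)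
  then show ?thesis by (rule finiteI_independent)
qed

lemma finite_some_onb: "finite (some_onb :: (real ^ 's::finite) set)"
  by (rule finite_orthonormal_vec[OF orthonormal_basis_orthonormal[OF some_onb]])

lemma parseval_some_onb_vec: "(\<Sum>u\<in>some_onb. (u \<bullet> a) * (u \<bullet> b)) = a \<bullet> (b :: real ^ 's::finite)"
proof -
  have "((\<lambda>u. ((a \<bullet> u) *\<^sub>R u) \<bullet> b) has_sum (a \<bullet> b)) some_onb"
    by (rule has_sum_bounded_linear[OF bounded_linear_inner_left orthonormal_basis_expansion(1)[OF some_onb]])
  from has_sum_unique[OF has_sum_finite[OF finite_some_onb] this] show ?thesis
    by (simp add: inner_commute)
qed

lemma hs_trace_vec: "hs_trace (A :: (real ^ 's::finite) hs) = (\<Sum>b\<in>some_onb. b \<bullet> hs_apply A b)"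
  unfolding hs_trace_def by (simp add: finite_some_onb)

lemma bounded_linear_hs_trace_vec: "bounded_linear (hs_trace :: (real ^ 's::finite) hs \<Rightarrow> real)"
  unfolding hs_trace_vec[abs_def]
  by (intro bounded_linear_sum bounded_linear_compose[OF bounded_linear_inner_right bounded_linear_hs_apply_left])

lemma hs_trace_outer_vec: "hs_trace (x \<otimes> y :: (real ^ 's::finite) hs) = x \<bullet> y"
  unfolding hs_trace_vec using parseval_some_onb_vec[of y x] by (simp add: inner_commute)

text \<open>The partial trace \<open>ptrace2 (x \<otimes> y)\<close> in closed form. Unlike the
  series defining \<open>ptrace2\<close>, the matrix of inner products of the blocks is visibly
  bounded and bilinear.\<close>

definition block_gram :: "'b::separable_hilbert ^ 's::finite \<Rightarrow> 'b ^ 's \<Rightarrow> (real ^ 's) hs" where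
  "block_gram x y = (\<Sum>i\<in>UNIV. \<Sum>k\<in>UNIV. (x $ i \<bullet> y $ k) *\<^sub>R (axis i 1 \<otimes> axis k 1))"

text \<open>Likewise \<open>ptrace1 (x \<otimes> y)\<close>; both identities follow from
  \<open>has_traces_outer\<close>.\<close>

definition block_outer :: "'b::separable_hilbert ^ 's::finite \<Rightarrow> 'b ^ 's \<Rightarrow> 'b hs" where
  "block_outer x y = (\<Sum>i\<in>UNIV. x $ i \<otimes> y $ i)"

text \<open>The partial inner product with \<open>u\<close>, adjoint to
  \<open>v \<mapsto> vec_tensor u v\<close>.\<close>

definition contract :: "real ^ 's::finite \<Rightarrow> 'b::separable_hilbert ^ 's \<Rightarrow> 'b" where
  "contract u x = (\<Sum>i\<in>UNIV. (u $ i) *\<^sub>R (x $ i))"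

lemma bounded_bilinear_block_gram:
  "bounded_bilinear (block_gram :: 'b::separable_hilbert ^ 's::finite \<Rightarrow> 'b ^ 's \<Rightarrow> (real ^ 's) hs)"
proof (rule bounded_bilinear.intro)
  show "\<exists>K. \<forall>x y. norm (block_gram x y :: (real ^ 's) hs) \<le> norm (x :: 'b ^ 's) * norm y * K"
  proof (intro exI allI)
    fix x y :: "'b ^ 's"
    have "norm (block_gram x y) \<le> (\<Sum>i\<in>UNIV. \<Sum>k\<in>UNIV. norm ((x $ i \<bullet> y $ k) *\<^sub>R (axis i 1 \<otimes> axis k 1 :: (real ^ 's) hs)))"
      unfolding block_gram_def by (intro order_trans[OF norm_sum] sum_mono norm_sum)
    also have "\<dots> \<le> (\<Sum>i\<in>(UNIV::'s set). \<Sum>k\<in>(UNIV::'s set). norm x * norm y)"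
    proof (intro sum_mono)
      fix i k
      have "norm ((x $ i \<bullet> y $ k) *\<^sub>R (axis i 1 \<otimes> axis k 1 :: (real ^ 's) hs)) = \<bar>x $ i \<bullet> y $ k\<bar>"
        by (simp add: norm_outer norm_axis)
      also have "\<dots> \<le> norm (x $ i) * norm (y $ k)" by (rule Cauchy_Schwarz_ineq2)
      also have "\<dots> \<le> norm x * norm y" by (intro mult_mono Finite_Cartesian_Product.norm_nth_le) auto
      finally show "norm ((x $ i \<bullet> y $ k) *\<^sub>R (axis i 1 \<otimes> axis k 1 :: (real ^ 's) hs)) \<le> norm x * norm y" .
    qed
    also have "\<dots> = norm x * norm y * (real CARD('s) * real CARD('s))" by simp
    finally show "norm (block_gram x y) \<le> norm x * norm y * (real CARD('s) * real CARD('s))" .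
  qed
qed (simp_all add: block_gram_def inner_add_left inner_add_right scaleR_add_left sum.distrib scaleR_sum_right)

lemma bounded_bilinear_block_outer:
  "bounded_bilinear (block_outer :: 'b::separable_hilbert ^ 's::finite \<Rightarrow> 'b ^ 's \<Rightarrow> 'b hs)"
proof (rule bounded_bilinear.intro)
  interpret o: bounded_bilinear "(\<otimes>) :: 'b \<Rightarrow> 'b \<Rightarrow> 'b hs" by (rule bounded_bilinear_outer)
  show "\<exists>K. \<forall>x y. norm (block_outer x y) \<le> norm (x :: 'b ^ 's) * norm y * K"
  proof (intro exI allI)
    fix x y :: "'b ^ 's"
    have "norm (block_outer x y) \<le> (\<Sum>i\<in>UNIV. norm (x $ i \<otimes> y $ i))" unfolding block_outer_def by (rule norm_sum)
    also have "\<dots> \<le> (\<Sum>i\<in>(UNIV::'s set). norm x * norm y)"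
      unfolding norm_outer by (intro sum_mono mult_mono Finite_Cartesian_Product.norm_nth_le) auto
    also have "\<dots> = norm x * norm y * real CARD('s)" by simp
    finally show "norm (block_outer x y) \<le> norm x * norm y * real CARD('s)" .
  qed
  fix x x' y y' :: "'b ^ 's" and c :: real
  show "block_outer (x + x') y = block_outer x y + block_outer x' y" by (simp add: block_outer_def o.add_left sum.distrib)
  show "block_outer x (y + y') = block_outer x y + block_outer x y'" by (simp add: block_outer_def o.add_right sum.distrib)
  show "block_outer (c *\<^sub>R x) y = c *\<^sub>R block_outer x y" by (simp add: block_outer_def o.scaleR_left scaleR_sum_right)
  show "block_outer x (c *\<^sub>R y) = c *\<^sub>R block_outer x y" by (simp add: block_outer_def o.scaleR_right scaleR_sum_right)
qed

lemma bounded_linear_contract: "bounded_linear (contract u)"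
  unfolding contract_def[abs_def]
  by (intro bounded_linear_sum bounded_linear_const_scaleR bounded_linear_vec_nth)

lemma inner_vec_tensor_left: "vec_tensor u v \<bullet> x = contract u x \<bullet> v"
  by (simp add: vec_tensor_def inner_vec_def contract_def inner_sum_left inner_commute[of v])

lemma hs_apply_sum: "hs_apply (\<Sum>i\<in>I. T i) x = (\<Sum>i\<in>I. hs_apply (T i) x)"
  by (rule linear_sum[OF bounded_linear.linear[OF bounded_linear_hs_apply_left]])

lemma block_gram_form: "u \<bullet> hs_apply (block_gram x y) u' = contract u x \<bullet> contract u' y"
proof -
  have "contract u x \<bullet> contract u' y = (\<Sum>i\<in>UNIV. \<Sum>k\<in>UNIV. u $ i * (u' $ k * (x $ i \<bullet> y $ k)))"
    unfolding contract_def inner_sum_left unfolding inner_sum_right by (simp add: sum_distrib_left mult.left_commute)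
  then show ?thesis
    by (simp add: block_gram_def hs_apply_sum hs_apply_simps inner_sum_right inner_axis inner_axis' mult_ac)
qed

lemma hs_trace_block_gram:
  fixes x y :: "'b::separable_hilbert ^ 's::finite"
  shows "hs_trace (block_gram x y) = x \<bullet> y"
proof -
  interpret t: bounded_linear "hs_trace :: (real ^ 's) hs \<Rightarrow> real" by (rule bounded_linear_hs_trace_vec)
  have "hs_trace (block_gram x y) = (\<Sum>i\<in>UNIV. \<Sum>k\<in>UNIV. (x $ i \<bullet> y $ k) * (axis i 1 \<bullet> (axis k 1 :: real ^ 's)))"
    by (simp add: block_gram_def t.sum t.scale hs_trace_outer_vec)
  also have "\<dots> = (\<Sum>i\<in>UNIV. \<Sum>k\<in>UNIV. if k = i then x $ i \<bullet> y $ k else 0)"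
    by (intro sum.cong refl) (simp add: inner_axis_axis)
  also have "\<dots> = x \<bullet> y" by (simp add: inner_vec_def)
  finally show ?thesis .
qed

lemma block_outer_form: "(\<Sum>u\<in>some_onb. (contract u x \<bullet> v) * (contract u y \<bullet> w)) = v \<bullet> hs_apply (block_outer x y) w"
proof -
  have c: "contract u x \<bullet> v = u \<bullet> (\<chi> i. x $ i \<bullet> v)" for u x v
    by (simp add: contract_def inner_sum_left inner_vec_def)
  show ?thesis
    unfolding c parseval_some_onb_vec
    by (simp add: inner_vec_def block_outer_def hs_apply_sum inner_sum_right inner_commute mult_ac)
qed

text \<open>The defining series of \<^const>\<open>ptrace1\<close>, \<^const>\<open>ptrace2\<close> and \<^const>\<open>hs_trace\<close> converge at \<open>T\<close> with the
  recorded values. Unlike the three functions themselves, this relation is linear without further conditions.\<close>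

definition has_traces :: "('b::separable_hilbert ^ 's::finite) hs \<Rightarrow> (real ^ 's) hs \<Rightarrow> 'b hs \<Rightarrow> bool" where
  "has_traces T A B \<longleftrightarrow>
     (\<forall>u u'. ((\<lambda>v. vec_tensor u v \<bullet> hs_apply T (vec_tensor u' v)) has_sum (u \<bullet> hs_apply A u')) some_onb) \<and>
     ((\<lambda>b. b \<bullet> hs_apply T b) has_sum hs_trace A) some_onb \<and>
     (\<forall>v w. (\<Sum>u\<in>some_onb. vec_tensor u v \<bullet> hs_apply T (vec_tensor u w)) = v \<bullet> hs_apply B w)"

lemma has_traces_imp:
  assumes "has_traces T A B"
  shows "ptrace2 T = A" "ptrace1 T = B" "hs_trace T = hs_trace A"
proof -
  show "hs_trace T = hs_trace A"
    using assms unfolding has_traces_def hs_trace_def[of T] by (auto intro: infsumI)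
  have 2: "(\<Sum>\<^sub>\<infinity>v\<in>some_onb. vec_tensor u v \<bullet> hs_apply T (vec_tensor u' v)) = u \<bullet> hs_apply A u'" for u u'
    using assms by (auto simp: has_traces_def intro: infsumI)
  have 1: "(\<Sum>\<^sub>\<infinity>u\<in>some_onb. vec_tensor u v \<bullet> hs_apply T (vec_tensor u w)) = v \<bullet> hs_apply B w" for v w
    using assms by (simp add: has_traces_def finite_some_onb)
  show "ptrace2 T = A" unfolding ptrace2_def 2 by (intro infsumI hs_expansion some_onb)
  show "ptrace1 T = B" unfolding ptrace1_def 1 by (intro infsumI hs_expansion some_onb)
qed

lemma has_traces_add:
  assumes "has_traces T A B" "has_traces T' A' B'"
  shows "has_traces (T + T') (A + A') (B + B')"
proof -
  interpret t: bounded_linear "hs_trace :: (real ^ 'b) hs \<Rightarrow> real" by (rule bounded_linear_hs_trace_vec)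
  show ?thesis
    using assms unfolding has_traces_def hs_apply_simps inner_add_right t.add sum.distrib
    by (auto intro: has_sum_add)
qed

lemma has_traces_scaleR:
  assumes "has_traces T A B"
  shows "has_traces (c *\<^sub>R T) (c *\<^sub>R A) (c *\<^sub>R B)"
proof -
  interpret t: bounded_linear "hs_trace :: (real ^ 'b) hs \<Rightarrow> real" by (rule bounded_linear_hs_trace_vec)
  show ?thesis
    using assms unfolding has_traces_def hs_apply_simps inner_scaleR_right t.scale
    by (auto simp: sum_distrib_left[symmetric] intro: has_sum_cmult_right)
qed

lemma has_traces_zero: "has_traces 0 0 0"
  by (simp add: has_traces_def hs_apply_simps hs_trace_vec)

lemma has_traces_sum:
  "(\<And>i. i \<in> I \<Longrightarrow> has_traces (T i) (A i) (B i)) \<Longrightarrow> has_traces (\<Sum>i\<in>I. T i) (\<Sum>i\<in>I. A i) (\<Sum>i\<in>I. B i)"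
  by (induction I rule: infinite_finite_induct) (auto simp: has_traces_zero intro!: has_traces_add)

lemma has_traces_diff:
  "has_traces T A B \<Longrightarrow> has_traces T' A' B' \<Longrightarrow> has_traces (T - T') (A - A') (B - B')"
  using has_traces_add[OF _ has_traces_scaleR[of T' A' B' "- 1"], of T A B] by simp

lemma sq_integrable_bilinear_integrable:
  fixes prd :: "'a::separable_hilbert \<Rightarrow> 'b::separable_hilbert \<Rightarrow> 'c::{banach, second_countable_topology}"
  assumes "bounded_bilinear prd" "sq_integrable M f" "sq_integrable M g"
  shows "integrable M (\<lambda>x. prd (f x) (g x))"
proof -
  obtain K where "K \<ge> 0" "\<And>x y. norm (prd x y) \<le> norm x * norm y * K"
    using bounded_bilinear.nonneg_bounded[OF assms(1)] by blast
  then show ?thesis using assms by (intro sq_integrable_bilinear(1)[OF assms, of K]) (auto simp: mult_ac)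
qed

text \<open>A trace is not continuous for the Hilbert-Schmidt norm, so linearity alone does not move
  it through the integral. Square integrability does: every diagonal entry is an expectation of a
  product of coordinates, and \<open>parseval_expectation\<close> sums these entries.\<close>

lemma has_traces_expectation:
  fixes X Y :: "'w \<Rightarrow> 'b::separable_hilbert ^ 's::finite"
  assumes X: "sq_integrable M X" and Y: "sq_integrable M Y"
  shows "has_traces (LINT \<omega>|M. X \<omega> \<otimes> Y \<omega>) (LINT \<omega>|M. block_gram (X \<omega>) (Y \<omega>)) (LINT \<omega>|M. block_outer (X \<omega>) (Y \<omega>))"
proof -
  note iO = sq_integrable_bilinear_integrable[OF bounded_bilinear_outer X Y]
    and iG = sq_integrable_bilinear_integrable[OF bounded_bilinear_block_gram X Y]
    and iB = sq_integrable_bilinear_integrable[OF bounded_bilinear_block_outer X Y]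
  have form: "a \<bullet> hs_apply (LINT \<omega>|M. T \<omega>) c = (LINT \<omega>|M. a \<bullet> hs_apply (T \<omega>) c)" if "integrable M T"
    for T :: "'w \<Rightarrow> 'k::separable_hilbert hs" and a c
    by (rule integral_bounded_linear[symmetric, OF bounded_linear_compose[OF bounded_linear_inner_right bounded_linear_hs_apply_left] that])
  have sqc: "sq_integrable M (\<lambda>\<omega>. contract u (W \<omega>))" if "sq_integrable M W" for u and W :: "'w \<Rightarrow> 'b ^ 's"
  proof -
    obtain K where "K \<ge> 0" "\<And>x :: 'b ^ 's. norm (contract u x) \<le> norm x * K"
      using bounded_linear.nonneg_bounded[OF bounded_linear_contract[of u]] by blast
    then show ?thesis
      by (intro sq_integrable_bounded_linear(1)[OF bounded_linear_contract that, where K = K]) (auto simp: mult.commute)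
  qed
  show ?thesis
    unfolding has_traces_def
  proof (intro conjI allI)
    fix u u' :: "real ^ 's"
    have "((\<lambda>v. LINT \<omega>|M. (contract u (X \<omega>) \<bullet> v) * (contract u' (Y \<omega>) \<bullet> v)) has_sum
        (LINT \<omega>|M. contract u (X \<omega>) \<bullet> contract u' (Y \<omega>))) some_onb"
      by (rule parseval_expectation[OF some_onb sqc[OF X] sqc[OF Y]])
    then show "((\<lambda>v. vec_tensor u v \<bullet> hs_apply (LINT \<omega>|M. X \<omega> \<otimes> Y \<omega>) (vec_tensor u' v)) has_sum
        (u \<bullet> hs_apply (LINT \<omega>|M. block_gram (X \<omega>) (Y \<omega>)) u')) some_onb"
      unfolding form[OF iO] form[OF iG] block_gram_form
      by (simp add: inner_vec_tensor_left inner_commute[of "Y _"] mult.commute)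
  next
    have "((\<lambda>b. LINT \<omega>|M. (X \<omega> \<bullet> b) * (Y \<omega> \<bullet> b)) has_sum (LINT \<omega>|M. X \<omega> \<bullet> Y \<omega>)) some_onb"
      by (rule parseval_expectation[OF some_onb X Y])
    moreover have "hs_trace (LINT \<omega>|M. block_gram (X \<omega>) (Y \<omega>)) = (LINT \<omega>|M. X \<omega> \<bullet> Y \<omega>)"
      by (subst integral_bounded_linear[OF bounded_linear_hs_trace_vec iG, symmetric]) (simp add: hs_trace_block_gram)
    ultimately show "((\<lambda>b. b \<bullet> hs_apply (LINT \<omega>|M. X \<omega> \<otimes> Y \<omega>) b) has_sum hs_trace (LINT \<omega>|M. block_gram (X \<omega>) (Y \<omega>))) some_onb"
      unfolding form[OF iO] by (simp add: inner_commute mult.commute)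
  next
    fix v w :: 'b
    have i: "integrable M (\<lambda>\<omega>. vec_tensor u v \<bullet> hs_apply (X \<omega> \<otimes> Y \<omega>) (vec_tensor u w))" for u
      by (rule integrable_bounded_linear[OF bounded_linear_compose[OF bounded_linear_inner_right bounded_linear_hs_apply_left] iO])
    have "(\<Sum>u\<in>some_onb. vec_tensor u v \<bullet> hs_apply (LINT \<omega>|M. X \<omega> \<otimes> Y \<omega>) (vec_tensor u w))
      = (LINT \<omega>|M. (\<Sum>u\<in>some_onb. vec_tensor u v \<bullet> hs_apply (X \<omega> \<otimes> Y \<omega>) (vec_tensor u w)))"
      unfolding form[OF iO] using i by simp
    also have "\<dots> = (LINT \<omega>|M. v \<bullet> hs_apply (block_outer (X \<omega>) (Y \<omega>)) w)"
      by (simp add: block_outer_form[symmetric] inner_vec_tensor_left inner_commute[of "Y _"] mult.commute)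
    finally show "(\<Sum>u\<in>some_onb. vec_tensor u v \<bullet> hs_apply (LINT \<omega>|M. X \<omega> \<otimes> Y \<omega>) (vec_tensor u w))
      = v \<bullet> hs_apply (LINT \<omega>|M. block_outer (X \<omega>) (Y \<omega>)) w" by (simp only: form[OF iB])
  qed
qed

lemma has_traces_outer:
  fixes x y :: "'b::separable_hilbert ^ 's::finite"
  shows "has_traces (x \<otimes> y) (block_gram x y) (block_outer x y)"
proof -
  \<comment> \<open>A fixed pair of vectors is a random pair on a one-point space.\<close>
  have "sq_integrable (count_space {()}) (\<lambda>_. z)" for z :: "'b ^ 's"
    by (simp add: sq_integrable_def integrable_count_space)
  from has_traces_expectation[OF this this, of x y] show ?thesis
    by (simp add: lebesgue_integral_count_space_finite)
qed

section \<open>Fourth moments and lagged products\<close>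

text \<open>The usual norm of L4, expressed through \<open>l2norm\<close> of the squared norm so
  that the L2 estimates apply.\<close>

definition l4norm :: "'w measure \<Rightarrow> ('w \<Rightarrow> 'h::separable_hilbert) \<Rightarrow> real" where
  "l4norm M g = sqrt (l2norm M (\<lambda>\<omega>. (norm (g \<omega>))\<^sup>2))"

definition fourth_integrable :: "'w measure \<Rightarrow> ('w \<Rightarrow> 'h::separable_hilbert) \<Rightarrow> bool" where
  "fourth_integrable M g \<longleftrightarrow> g \<in> borel_measurable M \<and> sq_integrable M (\<lambda>\<omega>. (norm (g \<omega>))\<^sup>2)"

lemma l4norm_nonneg [simp]: "0 \<le> l4norm M g"
  by (simp add: l4norm_def)

lemma fourth_integrable_diff:
  assumes "fourth_integrable M f" "fourth_integrable M g"
  shows "fourth_integrable M (\<lambda>\<omega>. f \<omega> - g \<omega>)"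
proof -
  have [measurable]: "f \<in> borel_measurable M" "g \<in> borel_measurable M"
    using assms by (auto simp: fourth_integrable_def)
  have "sq_integrable M (\<lambda>\<omega>. (norm (f \<omega> - g \<omega>))\<^sup>2)"
  proof (rule sq_integrable_mono(1)[where K = 1])
    show "sq_integrable M (\<lambda>\<omega>. 2 *\<^sub>R (norm (f \<omega>))\<^sup>2 + 2 *\<^sub>R (norm (g \<omega>))\<^sup>2)"
      using assms by (intro sq_integrable_add sq_integrable_scaleR) (auto simp: fourth_integrable_def)
    show "norm ((norm (f \<omega> - g \<omega>))\<^sup>2) \<le> 1 * norm (2 *\<^sub>R (norm (f \<omega>))\<^sup>2 + 2 *\<^sub>R (norm (g \<omega>))\<^sup>2)" for \<omega>
      using norm_add_sq_le[of "f \<omega>" "- g \<omega>"] by simp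
  qed auto
  then show ?thesis by (simp add: fourth_integrable_def)
qed

lemma fourth_integrable_distr:
  assumes "distr M N T = N" "T \<in> measurable M N" "fourth_integrable N f"
  shows "fourth_integrable M (\<lambda>x. f (T x))" "l4norm M (\<lambda>x. f (T x)) = l4norm N f"
proof -
  have [measurable]: "f \<in> borel_measurable N" using assms by (simp add: fourth_integrable_def)
  note assms(2)[measurable]
  show "fourth_integrable M (\<lambda>x. f (T x))" "l4norm M (\<lambda>x. f (T x)) = l4norm N f"
    using sq_integrable_distr[OF assms(1,2), of "\<lambda>x. (norm (f x))\<^sup>2"] assms(3)
    by (auto simp: fourth_integrable_def l4norm_def)
qed

lemma fourth_integrable_sq_integrable:
  assumes "prob_space M" "fourth_integrable M f"
  shows "sq_integrable M f"
proof -
  have f: "f \<in> borel_measurable M" "sq_integrable M (\<lambda>\<omega>. (norm (f \<omega>))\<^sup>2)"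
    using assms(2) by (auto simp: fourth_integrable_def)
  from sq_integrable_integrable(1)[OF assms(1) f(2)] f(1) show ?thesis by (simp add: sq_integrable_def)
qed

text \<open>Cauchy-Schwarz for the squared norms. Here fourth moments of the process become second
  moments of products.\<close>

lemma fourth_integrable_bilinear:
  fixes prd :: "'a::separable_hilbert \<Rightarrow> 'b::separable_hilbert \<Rightarrow> 'c::separable_hilbert"
  assumes prd: "bounded_bilinear prd" "\<And>x y. norm (prd x y) \<le> norm x * norm y * K" "K \<ge> 0"
    and f: "fourth_integrable M f" and g: "fourth_integrable M g"
  shows "sq_integrable M (\<lambda>\<omega>. prd (f \<omega>) (g \<omega>))" "l2norm M (\<lambda>\<omega>. prd (f \<omega>) (g \<omega>)) \<le> K * (l4norm M f * l4norm M g)"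
proof -
  interpret bounded_bilinear prd by fact
  have [measurable]: "f \<in> borel_measurable M" "g \<in> borel_measurable M"
    using f g by (auto simp: fourth_integrable_def)
  have c: "continuous_on UNIV (\<lambda>x. prd (fst x) (snd x))"
    by (intro continuous_on continuous_on_fst continuous_on_snd continuous_on_id)
  have m: "(\<lambda>x. prd (f x) (g x)) \<in> borel_measurable M"
    using borel_measurable_continuous_Pair[OF _ _ c] by measurable
  have fg: "sq_integrable M (\<lambda>\<omega>. (norm (f \<omega>))\<^sup>2)" "sq_integrable M (\<lambda>\<omega>. (norm (g \<omega>))\<^sup>2)"
    using f g by (auto simp: fourth_integrable_def)
  note i = sq_integrable_mult_norm[OF fg]
  have le: "(norm (prd (f \<omega>) (g \<omega>)))\<^sup>2 \<le> K\<^sup>2 * ((norm (f \<omega>))\<^sup>2 * (norm (g \<omega>))\<^sup>2)" for \<omega>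
    using power_mono[OF prd(2), of _ _ 2] by (simp add: power_mult_distrib mult_ac)
  have I: "integrable M (\<lambda>\<omega>. (norm (prd (f \<omega>) (g \<omega>)))\<^sup>2)"
    by (rule Bochner_Integration.integrable_bound[where f = "\<lambda>\<omega>. K\<^sup>2 * ((norm (f \<omega>))\<^sup>2 * (norm (g \<omega>))\<^sup>2)"])
      (use i m le in \<open>auto intro!: AE_I2\<close>)
  then show "sq_integrable M (\<lambda>\<omega>. prd (f \<omega>) (g \<omega>))" using m by (simp add: sq_integrable_def)
  have "(l2norm M (\<lambda>\<omega>. prd (f \<omega>) (g \<omega>)))\<^sup>2 \<le> (LINT \<omega>|M. K\<^sup>2 * ((norm (f \<omega>))\<^sup>2 * (norm (g \<omega>))\<^sup>2))"
    unfolding l2norm_sq using I i le by (intro integral_mono) auto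
  also have "\<dots> \<le> K\<^sup>2 * (l2norm M (\<lambda>\<omega>. (norm (f \<omega>))\<^sup>2) * l2norm M (\<lambda>\<omega>. (norm (g \<omega>))\<^sup>2))"
    using i(2) by (simp add: mult_left_mono)
  also have "\<dots> = (K * (l4norm M f * l4norm M g))\<^sup>2" by (simp add: l4norm_def power_mult_distrib)
  finally show "l2norm M (\<lambda>\<omega>. prd (f \<omega>) (g \<omega>)) \<le> K * (l4norm M f * l4norm M g)"
    by (rule power2_le_imp_le) (use prd(3) in simp)
qed

context iid_shift
begin

text \<open>The approximation error of \<open>Lp_m_approximable\<close> for \<open>p = 4\<close> at
  time 0, expressed on the double product space.\<close>

definition fourth_dep_coef :: "((int \<Rightarrow> 'u) \<Rightarrow> 'h::separable_hilbert) \<Rightarrow> nat \<Rightarrow> real" where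
  "fourth_dep_coef F r = l4norm \<Omega>2 (\<lambda>x. F (fst x) - F (resample {- int r..} (fst x) (snd x)))"

lemma fourth_integrable_pair:
  assumes "fourth_integrable \<Omega> F"
  shows "fourth_integrable \<Omega>2 (\<lambda>x. F (time_shift n (fst x)))"
    "l4norm \<Omega>2 (\<lambda>x. F (time_shift n (fst x))) = l4norm \<Omega> F"
    "fourth_integrable \<Omega>2 (\<lambda>x. F (time_shift n (resample A (fst x) (snd x))))"
    "l4norm \<Omega>2 (\<lambda>x. F (time_shift n (resample A (fst x) (snd x)))) = l4norm \<Omega> F"
proof -
  note s = fourth_integrable_distr[OF distr_shift measurable_shift assms, of n]
  show "fourth_integrable \<Omega>2 (\<lambda>x. F (time_shift n (fst x)))" "l4norm \<Omega>2 (\<lambda>x. F (time_shift n (fst x))) = l4norm \<Omega> F"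
    using fourth_integrable_distr[OF distr_fst_pair[OF prob_Omega prob_Omega] measurable_fst s(1)] s(2) by auto
  show "fourth_integrable \<Omega>2 (\<lambda>x. F (time_shift n (resample A (fst x) (snd x))))"
    "l4norm \<Omega>2 (\<lambda>x. F (time_shift n (resample A (fst x) (snd x)))) = l4norm \<Omega> F"
    using fourth_integrable_distr[OF distr_resample measurable_resample s(1)] s(2) by auto
qed

lemma l4norm_shift_resample:
  assumes F: "fourth_integrable \<Omega> F"
  shows "l4norm \<Omega>2 (\<lambda>x. F (time_shift n (fst x)) - F (time_shift n (resample {n - int r..} (fst x) (snd x)))) = fourth_dep_coef F r"
proof -
  have e: "{i. n + i \<in> {n - int r..}} = {- int r..}" by auto
  have d: "fourth_integrable \<Omega>2 (\<lambda>x. F (fst x) - F (resample {- int r..} (fst x) (snd x)))"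
    using fourth_integrable_diff[OF fourth_integrable_pair(1,3)[OF F, of 0]] by simp
  show ?thesis
    unfolding fourth_dep_coef_def shift_resample e
    using fourth_integrable_distr(2)[OF distr_shift_pair measurable_shift_pair d] by simp
qed

text \<open>The change of a product splits as \<open>prd (a - a') b + prd a' (b - b')\<close>, and
  each part is a small fourth-moment norm times a fixed one. The factor at time \<open>- h\<close>
  keeps only \<open>r - h\<close> steps of its own past, hence the shifted coefficient and the
  restriction to \<open>r \<ge> h\<close>. Taking the lag backwards keeps the product
  causal.\<close>

lemma stationary_input_lagged_product:
  fixes x0 :: "(int \<Rightarrow> 'u) \<Rightarrow> 'h::separable_hilbert" and prd :: "'h \<Rightarrow> 'h \<Rightarrow> 'c::separable_hilbert"
    and h :: nat
  assumes prd: "bounded_bilinear prd"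
    and x: "fourth_integrable \<Omega> x0" "depends_on {..0} x0" "summable (fourth_dep_coef x0)"
  defines "p \<equiv> \<lambda>\<omega>. prd (x0 (time_shift (- int h) \<omega>)) (x0 \<omega>)"
  shows "sq_integrable \<Omega> p" "stationary_input (\<lambda>\<omega>. p \<omega> - (LINT \<omega>'|\<Omega>. p \<omega>'))"
proof -
  interpret bounded_bilinear prd by fact
  obtain K where K: "\<And>x y. norm (prd x y) \<le> norm x * norm y * K" "K \<ge> 0" using nonneg_bounded by blast
  define c where "c = (LINT \<omega>'|\<Omega>. p \<omega>')"
  have s: "fourth_integrable \<Omega> (\<lambda>\<omega>. x0 (time_shift n \<omega>))" for n
    by (rule fourth_integrable_distr[OF distr_shift measurable_shift x(1)])
  show sqp: "sq_integrable \<Omega> p"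
    unfolding p_def by (rule fourth_integrable_bilinear(1)[OF prd K s x(1)])
  have sq: "sq_integrable \<Omega> (\<lambda>\<omega>. p \<omega> - c)"
    by (intro sq_integrable_diff sqp sq_integrable_const prob_Omega)
  have dep: "depends_on {..0} (\<lambda>\<omega>. p \<omega> - c)"
  proof -
    have "depends_on {..0} (\<lambda>\<omega>. x0 (time_shift (- int h) \<omega>))"
      by (rule depends_on_mono[OF depends_on_shift_past[OF x(2)]]) auto
    from depends_on_comp2[OF this x(2), of "\<lambda>a b. prd a b - c"] show ?thesis by (simp add: p_def)
  qed
  have mean: "(LINT \<omega>|\<Omega>. p \<omega> - c) = 0"
    using sq_integrable_integrable(1)[OF prob_Omega sqp] prob_space.prob_space[OF prob_Omega] by (simp add: c_def)
  have bound: "dep_coef (\<lambda>\<omega>. p \<omega> - c) r \<le> K * l4norm \<Omega> x0 * (fourth_dep_coef x0 (r - h) + fourth_dep_coef x0 r)"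
    if r: "r \<ge> h" for r
  proof -
    let ?A = "{- int r..}"
    let ?a = "\<lambda>x. x0 (time_shift (- int h) (fst x))" and ?b = "\<lambda>x. x0 (time_shift 0 (fst x))"
    let ?a' = "\<lambda>x. x0 (time_shift (- int h) (resample ?A (fst x) (snd x)))"
    let ?b' = "\<lambda>x. x0 (time_shift 0 (resample ?A (fst x) (snd x)))"
    have A: "?A = {- int h - int (r - h)..}" "?A = {0 - int r..}" using r by auto
    note i = fourth_integrable_pair[OF x(1)]
    note da = fourth_integrable_diff[OF i(1,3), of "- int h" "- int h" ?A]
      and db = fourth_integrable_diff[OF i(1,3), of 0 0 ?A]
    note t1 = fourth_integrable_bilinear[OF prd K da i(1)[of 0]] and t2 = fourth_integrable_bilinear[OF prd K i(3)[of "- int h" ?A] db]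
    have la: "l4norm \<Omega>2 (\<lambda>x. ?a x - ?a' x) = fourth_dep_coef x0 (r - h)"
      using l4norm_shift_resample[OF x(1), of "- int h" "r - h"] unfolding A(1) .
    have lb: "l4norm \<Omega>2 (\<lambda>x. ?b x - ?b' x) = fourth_dep_coef x0 r"
      using l4norm_shift_resample[OF x(1), of 0 r] unfolding A(2) .
    have eq: "(p (fst x) - c) - (p (resample ?A (fst x) (snd x)) - c)
        = prd (?a x - ?a' x) (?b x) + prd (?a' x) (?b x - ?b' x)" for x
      by (simp add: p_def diff_left diff_right)
    have "dep_coef (\<lambda>\<omega>. p \<omega> - c) r \<le> l2norm \<Omega>2 (\<lambda>x. prd (?a x - ?a' x) (?b x)) + l2norm \<Omega>2 (\<lambda>x. prd (?a' x) (?b x - ?b' x))"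
      unfolding dep_coef_def eq by (rule sq_integrable_add(2)[OF t1(1) t2(1)])
    also have "\<dots> \<le> K * (fourth_dep_coef x0 (r - h) * l4norm \<Omega> x0) + K * (l4norm \<Omega> x0 * fourth_dep_coef x0 r)"
      using add_mono[OF t1(2) t2(2)] unfolding la lb i(2,4) .
    finally show ?thesis by (simp add: algebra_simps)
  qed
  have "summable (\<lambda>r. fourth_dep_coef x0 (r - h))"
    using x(3) by (subst summable_iff_shift[of _ h, symmetric]) simp
  then have "summable (\<lambda>r. K * l4norm \<Omega> x0 * (fourth_dep_coef x0 (r - h) + fourth_dep_coef x0 r))"
    using x(3) by (intro summable_mult summable_add)
  then have "summable (dep_coef (\<lambda>\<omega>. p \<omega> - c))"
    by (rule summable_comparison_test'[where N = h]) (use bound in simp)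
  then show "stationary_input (\<lambda>\<omega>. p \<omega> - (LINT \<omega>'|\<Omega>. p \<omega>'))"
    using sq dep mean unfolding stationary_input_def c_def by simp
qed

section \<open>Long-run covariance operators\<close>

definition autocov_op :: "((int \<Rightarrow> 'u) \<Rightarrow> 'k::separable_hilbert) \<Rightarrow> nat \<Rightarrow> 'k hs" where
  "autocov_op F i = (LINT \<omega>|\<Omega>. F \<omega> \<otimes> F (time_shift (int i) \<omega>))"

definition lrv_op :: "((int \<Rightarrow> 'u) \<Rightarrow> 'k::separable_hilbert) \<Rightarrow> 'k hs" where
  "lrv_op F = autocov_op F 0 + (\<Sum>i. autocov_op F (Suc i) + hs_adjoint (autocov_op F (Suc i)))"

lemma inner_hs_adjoint: "y \<bullet> hs_apply (hs_adjoint T) z = hs_apply T y \<bullet> z"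
  by transfer (simp add: hilbert_schmidt_def adjoint_hilbert(1))

text \<open>The operator series converges absolutely by \<open>lagged_bilinear_bound\<close> for the
  product \<open>\<otimes>\<close>; this allows the form to be evaluated term by term.\<close>

lemma lrv_op_form:
  fixes F :: "(int \<Rightarrow> 'u) \<Rightarrow> 'k::separable_hilbert"
  assumes F: "stationary_input F"
  defines "c \<equiv> \<lambda>y z i. LINT \<omega>|\<Omega>. (F \<omega> \<bullet> y) * (F (time_shift (int i) \<omega>) \<bullet> z)"
  shows "y \<bullet> hs_apply (lrv_op F) z = c y z 0 + (\<Sum>i. c y z (Suc i) + c z y (Suc i))"
proof -
  note F' = stationary_inputD[OF F]
  have iO: "integrable \<Omega> (\<lambda>\<omega>. F \<omega> \<otimes> F (time_shift n \<omega>))" for n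
    by (rule sq_integrable_bilinear_integrable[OF bounded_bilinear_outer F'(1) F'(6)])
  have form: "y \<bullet> hs_apply (autocov_op F i) z = c y z i" for y z i
    unfolding autocov_op_def c_def
    by (subst integral_bounded_linear[symmetric, OF bounded_linear_compose[OF bounded_linear_inner_right bounded_linear_hs_apply_left] iO])
      (simp add: inner_commute mult.commute)
  have form': "y \<bullet> hs_apply (hs_adjoint (autocov_op F i)) z = c z y i" for y z i
    unfolding inner_hs_adjoint by (simp add: form[symmetric] inner_commute)
  have n1: "norm (autocov_op F (Suc i)) \<le> l2norm \<Omega> F * dep_coef F i" for i
    using lagged_bilinear_bound[OF bounded_bilinear_outer _ F F, of 0 "Suc i"] by (simp add: norm_outer autocov_op_def)
  \<comment> \<open>Written as an integral with the factors exchanged, the adjoint obeys the same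
    lagged bound for the flipped product.\<close>
  have adj: "hs_adjoint (autocov_op F i) = (LINT \<omega>|\<Omega>. F (time_shift (int i) \<omega>) \<otimes> F \<omega>)" for i
  proof (rule hs_eqI, rule vector_eq_ldot[THEN iffD1], rule allI)
    fix z y
    have i': "integrable \<Omega> (\<lambda>\<omega>. F (time_shift (int i) \<omega>) \<otimes> F \<omega>)"
      by (rule sq_integrable_bilinear_integrable[OF bounded_bilinear_outer F'(6) F'(1)])
    show "y \<bullet> hs_apply (hs_adjoint (autocov_op F i)) z = y \<bullet> hs_apply (LINT \<omega>|\<Omega>. F (time_shift (int i) \<omega>) \<otimes> F \<omega>) z"
      unfolding form' c_def
      by (subst integral_bounded_linear[symmetric, OF bounded_linear_compose[OF bounded_linear_inner_right bounded_linear_hs_apply_left] i'])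
        (simp add: inner_commute mult.commute)
  qed
  have n2: "norm (hs_adjoint (autocov_op F (Suc i))) \<le> l2norm \<Omega> F * dep_coef F i" for i
    using lagged_bilinear_bound[OF bounded_bilinear.flip[OF bounded_bilinear_outer] _ F F, of 0 "Suc i"]
    by (simp add: norm_outer adj mult.commute)
  have summ: "summable (\<lambda>i. autocov_op F (Suc i) + hs_adjoint (autocov_op F (Suc i)))"
  proof (rule summable_norm_cancel, rule summable_comparison_test')
    show "summable (\<lambda>i. 2 * (l2norm \<Omega> F * dep_coef F i))" by (intro summable_mult F'(4))
    show "norm (norm (autocov_op F (Suc i) + hs_adjoint (autocov_op F (Suc i)))) \<le> 2 * (l2norm \<Omega> F * dep_coef F i)" if "i \<ge> 0" for i
      using norm_triangle_ineq[of "autocov_op F (Suc i)" "hs_adjoint (autocov_op F (Suc i))"] n1[of i] n2[of i] by simp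
  qed
  interpret L: bounded_linear "\<lambda>T. y \<bullet> hs_apply T z"
    by (rule bounded_linear_compose[OF bounded_linear_inner_right bounded_linear_hs_apply_left])
  show ?thesis
    unfolding lrv_op_def L.add L.suminf[OF summ] form form' ..
qed

lemma lrv_op_symmetric:
  assumes F: "stationary_input F"
  shows "y \<bullet> hs_apply (lrv_op F) z = hs_apply (lrv_op F) y \<bullet> z"
  unfolding inner_commute[of _ z] lrv_op_form[OF F] by (simp add: mult.commute add.commute)

lemma lrv_op_diagonal:
  assumes F: "stationary_input F"
  shows "y \<bullet> hs_apply (lrv_op F) y = lrv (\<lambda>\<omega>. F \<omega> \<bullet> y)"
proof -
  have "summable (\<lambda>i. LINT \<omega>|\<Omega>. (F \<omega> \<bullet> y) * (F (time_shift (int (Suc i)) \<omega>) \<bullet> y))"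
    using autocov_summable[OF stationary_input_inner[OF F, of y]] .
  from suminf_mult[OF this, of 2] show ?thesis
    unfolding lrv_op_form[OF F] lrv_def by (simp add: power2_eq_square)
qed

end

section \<open>Linearisation of the statistic\<close>

text \<open>\<open>A0\<close>, \<open>B0\<close> and \<open>C\<close> stand for the partial traces of the lag covariance and for the lag covariance itself;
  \<open>(p, b, d)\<close> is the deviation of the corresponding sample quantities.\<close>

definition stat_deviation ::
  "(real ^ 's::finite) hs \<times> 'b::separable_hilbert hs \<times> ('b ^ 's) hs \<Rightarrow>
   (real ^ 's) hs \<times> 'b hs \<times> ('b ^ 's) hs \<Rightarrow> ('b ^ 's) hs" where
  "stat_deviation = (\<lambda>(A0, B0, C) (p, b, d).
     (if hs_trace (A0 + p) = 0 then 0 else (1 / hs_trace (A0 + p)) *\<^sub>R (A0 + p)) \<otimes>\<^sub>o (B0 + b) - (C + d))"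

text \<open>The derivative of \<open>A \<mapsto> (1 / hs_trace A) *\<^sub>R A\<close> at
  \<open>A0\<close>, with the further components \<open>k\<close> passed on unchanged. On triples of
  traces it is \<open>M_map\<close>.\<close>

definition trace_linearisation :: "(real ^ 's::finite) hs \<Rightarrow> (real ^ 's) hs \<times> 'k \<Rightarrow> (real ^ 's) hs \<times> 'k" where
  "trace_linearisation A0 = (\<lambda>(p, k). ((1 / hs_trace A0) *\<^sub>R p - (hs_trace p / (hs_trace A0)\<^sup>2) *\<^sub>R A0, k))"

text \<open>The derivative of \<open>A \<otimes>\<^sub>o B - D\<close> at the normalised
  \<open>A0\<close> and \<open>B0\<close>; it is \<open>G_map\<close>.\<close>

definition product_linearisation ::
  "(real ^ 's::finite) hs \<Rightarrow> 'b::separable_hilbert hs \<Rightarrow> (real ^ 's) hs \<times> 'b hs \<times> ('b ^ 's) hs \<Rightarrow> ('b ^ 's) hs" where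
  "product_linearisation A0 B0 = (\<lambda>(A, B, D). A \<otimes>\<^sub>o B0 + ((1 / hs_trace A0) *\<^sub>R A0) \<otimes>\<^sub>o B - D)"

lemma bounded_linear_trace_linearisation:
  "bounded_linear (trace_linearisation A0 :: (real ^ 's::finite) hs \<times> 'k::real_normed_vector \<Rightarrow> _)"
  unfolding trace_linearisation_def case_prod_unfold
  by (intro bounded_linear_Pair bounded_linear_sub bounded_linear_const_scaleR bounded_linear_fst bounded_linear_snd
      bounded_linear_scaleR_const bounded_linear_divide[THEN bounded_linear_compose]
      bounded_linear_compose[OF bounded_linear_hs_trace_vec])

lemma bounded_linear_product_linearisation:
  "bounded_linear (product_linearisation A0 (B0 :: 'b::separable_hilbert hs) :: _ \<Rightarrow> ('b ^ 's::finite) hs)"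
  unfolding product_linearisation_def case_prod_unfold
  by (intro bounded_linear_sub bounded_linear_add bounded_linear_fst bounded_linear_snd
      bounded_linear_compose[OF bounded_bilinear.bounded_linear_left[OF bounded_bilinear_op_tensor]]
      bounded_linear_compose[OF bounded_bilinear.bounded_linear_right[OF bounded_bilinear_op_tensor]]
      bounded_linear_compose[OF bounded_linear_fst bounded_linear_snd]
      bounded_linear_compose[OF bounded_linear_snd bounded_linear_snd])

text \<open>The factorisation of \<open>C\<close> cancels the constant term. Besides the first-order
  part there remains \<open>r \<otimes>\<^sub>o B0 + (m + r) \<otimes>\<^sub>o b\<close>, where
  \<open>m\<close> is the linear part and \<open>r\<close> the quadratic remainder of the normalised
  first component.\<close>

lemma stat_deviation_linearisation:
  fixes A0 :: "(real ^ 's::finite) hs" and B0 :: "'b::separable_hilbert hs"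
  assumes \<tau>: "hs_trace A0 \<noteq> 0" and C: "C = ((1 / hs_trace A0) *\<^sub>R A0) \<otimes>\<^sub>o B0"
  shows "\<exists>\<rho>>0. \<exists>c\<ge>0. \<forall>k. norm k \<le> \<rho> \<longrightarrow>
    norm (stat_deviation (A0, B0, C) k - product_linearisation A0 B0 (trace_linearisation A0 k)) \<le> c * (norm k)\<^sup>2"
proof -
  interpret t: bounded_linear "hs_trace :: (real ^ 's) hs \<Rightarrow> real" by (rule bounded_linear_hs_trace_vec)
  interpret T: bounded_bilinear "(\<otimes>\<^sub>o) :: (real ^ 's) hs \<Rightarrow> 'b hs \<Rightarrow> ('b ^ 's) hs" by (rule bounded_bilinear_op_tensor)
  obtain M where M: "M > 0" "\<And>p :: (real ^ 's) hs. norm (hs_trace p) \<le> norm p * M" using t.pos_bounded by blast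
  define \<tau> where "\<tau> = hs_trace A0"
  have \<tau>0: "\<tau> \<noteq> 0" using assms(1) by (simp add: \<tau>_def)
  \<comment> \<open>\<open>M\<close> bounds the trace functional, so within radius
    \<open>\<rho>\<close> the trace moves away from \<open>\<tau>\<close> by at most
    \<open>\<bar>\<tau>\<bar> / 2\<close>: the denominators stay away from zero, and the default
    value 0 in \<open>stat_deviation\<close> does not occur.\<close>
  define \<rho> where "\<rho> = \<bar>\<tau>\<bar> / (2 * M)"
  have \<rho>: "\<rho> > 0" using \<tau>0 M by (simp add: \<rho>_def)
  define c1 where "c1 = 2 * M / \<tau>\<^sup>2 + 2 * M\<^sup>2 / \<bar>\<tau>\<bar> ^ 3 * norm A0"
  define c2 where "c2 = 1 / \<bar>\<tau>\<bar> + M / \<tau>\<^sup>2 * norm A0"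
  define c where "c = c1 * norm B0 + (c1 * \<rho> + c2)"
  have c0: "c1 \<ge> 0" "c2 \<ge> 0" using M by (auto simp: c1_def c2_def)
  then have "c \<ge> 0" using \<rho> by (simp add: c_def)
  moreover have "norm (stat_deviation (A0, B0, C) k - product_linearisation A0 B0 (trace_linearisation A0 k)) \<le> c * (norm k)\<^sup>2"
    if k: "norm k \<le> \<rho>" for k
  proof -
    obtain p b d where kp: "k = (p, b, d)" by (cases k)
    define n where "n = norm k"
    have n: "0 \<le> n" "n \<le> \<rho>" using k by (auto simp: n_def)
    have pn: "norm p \<le> n" using norm_fst_le[of p "(b, d)"] by (simp add: n_def kp)
    have bn: "norm b \<le> n"
      using norm_snd_le[of "(b, d)" p] norm_fst_le[of b d] by (simp add: n_def kp)
    define t where "t = hs_trace p"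
    have "\<bar>t\<bar> \<le> norm p * M" using M(2)[of p] by (simp add: t_def)
    also have "\<dots> \<le> n * M" using pn M(1) by (intro mult_right_mono) auto
    finally have tn: "\<bar>t\<bar> \<le> M * n" by (simp add: mult.commute)
    also have "M * n \<le> \<bar>\<tau>\<bar> / 2"
    proof -
      have "M * n \<le> M * \<rho>" using n M by (intro mult_left_mono) auto
      then show ?thesis using M by (simp add: \<rho>_def)
    qed
    finally have t2: "\<bar>t\<bar> \<le> \<bar>\<tau>\<bar> / 2" .
    have \<sigma>: "\<bar>\<tau> + t\<bar> \<ge> \<bar>\<tau>\<bar> / 2" using t2 by linarith
    then have \<sigma>0: "\<tau> + t \<noteq> 0" using \<tau>0 by auto
    have inv: "1 / \<bar>\<tau> + t\<bar> \<le> 2 / \<bar>\<tau>\<bar>" using \<sigma> \<tau>0 \<sigma>0 by (simp add: field_simps)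
    define m where "m = (1 / \<tau>) *\<^sub>R p - (t / \<tau>\<^sup>2) *\<^sub>R A0"
    \<comment> \<open>The exact remainders of \<open>1 / (\<tau> + t)\<close> after the constant and
      after the linear term in \<open>t\<close>.\<close>
    define u v where "u = - (t / (\<tau> * (\<tau> + t)))" and "v = t\<^sup>2 / (\<tau>\<^sup>2 * (\<tau> + t))"
    define r where "r = u *\<^sub>R p + v *\<^sub>R A0"
    have co1: "1 / (\<tau> + t) = 1 / \<tau> + u"
    proof -
      have "1 / \<tau> = (\<tau> + t) / (\<tau> * (\<tau> + t))" using \<sigma>0 by simp
      then have "1 / \<tau> + u = ((\<tau> + t) - t) / (\<tau> * (\<tau> + t))"
        unfolding u_def by (simp only: diff_divide_distrib add_uminus_conv_diff)
      then show ?thesis using \<tau>0 by simp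
    qed
    have co2: "1 / (\<tau> + t) = 1 / \<tau> - t / \<tau>\<^sup>2 + v"
    proof -
      define \<sigma> where "\<sigma> = \<tau> + t"
      have \<sigma>n: "\<sigma> \<noteq> 0" using \<sigma>0 by (simp add: \<sigma>_def)
      have "1 / \<tau> = \<tau> * \<sigma> / (\<tau>\<^sup>2 * \<sigma>)" "t / \<tau>\<^sup>2 = t * \<sigma> / (\<tau>\<^sup>2 * \<sigma>)"
        using \<tau>0 \<sigma>n by (simp_all add: power2_eq_square)
      then have "1 / \<tau> - t / \<tau>\<^sup>2 + t\<^sup>2 / (\<tau>\<^sup>2 * \<sigma>) = (\<tau> * \<sigma> - t * \<sigma> + t\<^sup>2) / (\<tau>\<^sup>2 * \<sigma>)"
        by (simp only: add_divide_distrib diff_divide_distrib)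
      also have "\<tau> * \<sigma> - t * \<sigma> + t\<^sup>2 = \<tau>\<^sup>2" by (simp add: \<sigma>_def power2_eq_square algebra_simps)
      also have "\<tau>\<^sup>2 / (\<tau>\<^sup>2 * \<sigma>) = 1 / \<sigma>" using \<tau>0 by simp
      finally show ?thesis by (simp add: v_def \<sigma>_def)
    qed
    have main: "(1 / (\<tau> + t)) *\<^sub>R (A0 + p) = (1 / \<tau>) *\<^sub>R A0 + m + r"
    proof -
      have "(1 / (\<tau> + t)) *\<^sub>R (A0 + p) = (1 / (\<tau> + t)) *\<^sub>R A0 + (1 / (\<tau> + t)) *\<^sub>R p" by (rule scaleR_add_right)
      also have "(1 / (\<tau> + t)) *\<^sub>R A0 = (1 / \<tau>) *\<^sub>R A0 - (t / \<tau>\<^sup>2) *\<^sub>R A0 + v *\<^sub>R A0"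
        unfolding co2 by (simp only: scaleR_add_left scaleR_diff_left)
      also have "(1 / (\<tau> + t)) *\<^sub>R p = (1 / \<tau>) *\<^sub>R p + u *\<^sub>R p"
        unfolding co1 by (simp only: scaleR_add_left)
      finally show ?thesis by (simp add: m_def r_def)
    qed
    have tr: "hs_trace (A0 + p) = \<tau> + t" by (simp add: t.add \<tau>_def t_def)
    have dev: "stat_deviation (A0, B0, C) k - product_linearisation A0 B0 (trace_linearisation A0 k) = r \<otimes>\<^sub>o B0 + (m + r) \<otimes>\<^sub>o b"
      unfolding kp stat_deviation_def product_linearisation_def trace_linearisation_def C
      using \<sigma>0 by (simp add: tr main \<tau>_def[symmetric] t_def[symmetric] m_def[symmetric] T.add_left T.add_right)
    have un: "\<bar>u\<bar> \<le> 2 * M / \<tau>\<^sup>2 * n"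
    proof -
      have "\<bar>u\<bar> = \<bar>t\<bar> * (1 / \<bar>\<tau>\<bar>) * (1 / \<bar>\<tau> + t\<bar>)" by (simp add: u_def abs_mult)
      also have "\<dots> \<le> (M * n) * (1 / \<bar>\<tau>\<bar>) * (2 / \<bar>\<tau>\<bar>)"
        using tn inv M n by (intro mult_mono) auto
      also have "\<dots> = 2 * M / \<tau>\<^sup>2 * n" by (simp add: power2_eq_square abs_mult[symmetric])
      finally show ?thesis .
    qed
    have vn: "\<bar>v\<bar> \<le> 2 * M\<^sup>2 / \<bar>\<tau>\<bar> ^ 3 * n\<^sup>2"
    proof -
      have "\<bar>v\<bar> = \<bar>t\<bar>\<^sup>2 * (1 / \<tau>\<^sup>2) * (1 / \<bar>\<tau> + t\<bar>)" by (simp add: v_def abs_mult)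
      also have "\<dots> \<le> (M * n)\<^sup>2 * (1 / \<tau>\<^sup>2) * (2 / \<bar>\<tau>\<bar>)"
        using tn inv M n by (intro mult_mono power_mono) auto
      also have "\<dots> = 2 * M\<^sup>2 / \<bar>\<tau>\<bar> ^ 3 * n\<^sup>2"
        using \<tau>0 by (simp add: power3_eq_cube power2_eq_square abs_mult[symmetric])
      finally show ?thesis .
    qed
    have rn: "norm r \<le> c1 * n\<^sup>2"
    proof -
      have "norm r \<le> \<bar>u\<bar> * norm p + \<bar>v\<bar> * norm A0"
        unfolding r_def using norm_triangle_ineq[of "u *\<^sub>R p" "v *\<^sub>R A0"] by simp
      also have "\<dots> \<le> (2 * M / \<tau>\<^sup>2 * n) * n + (2 * M\<^sup>2 / \<bar>\<tau>\<bar> ^ 3 * n\<^sup>2) * norm A0"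
        using un vn pn n M by (intro add_mono mult_mono) auto
      also have "\<dots> = c1 * n\<^sup>2" by (simp add: c1_def power2_eq_square algebra_simps)
      finally show ?thesis .
    qed
    have mn: "norm m \<le> c2 * n"
    proof -
      have "norm m \<le> 1 / \<bar>\<tau>\<bar> * norm p + \<bar>t\<bar> / \<tau>\<^sup>2 * norm A0"
        unfolding m_def using norm_triangle_ineq4[of "(1 / \<tau>) *\<^sub>R p" "(t / \<tau>\<^sup>2) *\<^sub>R A0"] by simp
      also have "\<dots> \<le> 1 / \<bar>\<tau>\<bar> * n + (M * n) / \<tau>\<^sup>2 * norm A0"
        using pn tn by (intro add_mono mult_left_mono mult_right_mono divide_right_mono) auto
      also have "\<dots> = c2 * n" by (simp add: c2_def algebra_simps)
      finally show ?thesis .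
    qed
    have "norm (m + r) \<le> c2 * n + c1 * n\<^sup>2" using norm_triangle_ineq[of m r] mn rn by linarith
    also have "c1 * n\<^sup>2 \<le> c1 * \<rho> * n"
      using n c0 mult_right_mono[OF n(2) n(1)] by (simp add: power2_eq_square mult.assoc mult_left_mono)
    finally have mr: "norm (m + r) \<le> (c1 * \<rho> + c2) * n" by (simp add: algebra_simps)
    have "norm (r \<otimes>\<^sub>o B0 + (m + r) \<otimes>\<^sub>o b) \<le> norm r * norm B0 + norm (m + r) * norm b"
      by (intro order_trans[OF norm_triangle_ineq] add_mono norm_op_tensor_le)
    also have "\<dots> \<le> (c1 * n\<^sup>2) * norm B0 + ((c1 * \<rho> + c2) * n) * n"
      using rn mr bn n c0 \<rho> by (intro add_mono mult_mono) auto
    also have "\<dots> = c * n\<^sup>2" by (simp add: c_def power2_eq_square algebra_simps)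
    finally show ?thesis unfolding dev n_def .
  qed
  ultimately show ?thesis using \<rho> by blast
qed

lemma borel_measurable_stat_deviation:
  "stat_deviation (A0 :: (real ^ 's::finite) hs, B0 :: 'b::separable_hilbert hs, C) \<in> borel_measurable borel"
proof -
  have c: "continuous_on UNIV (\<lambda>x. (fst x :: (real ^ 's) hs) \<otimes>\<^sub>o (snd x :: 'b hs))"
    by (intro bounded_bilinear.continuous_on[OF bounded_bilinear_op_tensor] continuous_on_fst continuous_on_snd continuous_on_id)
  have mt: "(\<lambda>k :: (real ^ 's) hs \<times> 'b hs \<times> ('b ^ 's) hs. hs_trace (A0 + fst k)) \<in> borel_measurable borel"
    by (intro borel_measurable_continuous_onI bounded_linear.continuous_on[OF bounded_linear_hs_trace_vec] continuous_intros)
  have m: "(\<lambda>k :: (real ^ 's) hs \<times> 'b hs \<times> ('b ^ 's) hs. A0 + fst k) \<in> borel_measurable borel"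
    "(\<lambda>k :: (real ^ 's) hs \<times> 'b hs \<times> ('b ^ 's) hs. B0 + fst (snd k)) \<in> borel_measurable borel"
    "(\<lambda>k :: (real ^ 's) hs \<times> 'b hs \<times> ('b ^ 's) hs. C + snd (snd k)) \<in> borel_measurable borel"
    by (intro borel_measurable_continuous_onI continuous_intros)+
  have "{k :: (real ^ 's) hs \<times> 'b hs \<times> ('b ^ 's) hs. hs_trace (A0 + fst k) = 0} \<in> sets borel"
    using measurable_sets[OF mt, of "{0}"] by (simp add: vimage_def)
  then have "(\<lambda>k :: (real ^ 's) hs \<times> 'b hs \<times> ('b ^ 's) hs.
      if hs_trace (A0 + fst k) = 0 then 0 else (1 / hs_trace (A0 + fst k)) *\<^sub>R (A0 + fst k)) \<in> borel_measurable borel"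
    by (intro measurable_If borel_measurable_scaleR borel_measurable_divide mt m borel_measurable_const) simp
  then have "(\<lambda>k :: (real ^ 's) hs \<times> 'b hs \<times> ('b ^ 's) hs.
      (if hs_trace (A0 + fst k) = 0 then 0 else (1 / hs_trace (A0 + fst k)) *\<^sub>R (A0 + fst k)) \<otimes>\<^sub>o (B0 + fst (snd k))) \<in> borel_measurable borel"
    by (rule borel_measurable_continuous_Pair[OF _ m(2) c])
  from borel_measurable_diff[OF this m(3)] show ?thesis
    unfolding stat_deviation_def case_prod_unfold prod.sel .
qed

section \<open>The statistic on the canonical space\<close>

text \<open>The random element whose sample mean determines the statistic. The partial traces are
  recorded beside \<open>x \<otimes> y\<close> because they do not depend on it
  continuously.\<close>

definition traces :: "'b::separable_hilbert ^ 's::finite \<Rightarrow> 'b ^ 's \<Rightarrow> (real ^ 's) hs \<times> 'b hs \<times> ('b ^ 's) hs" where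
  "traces x y = (block_gram x y, block_outer x y, x \<otimes> y)"

lemma bounded_bilinear_Pair:
  assumes "bounded_bilinear f" "bounded_bilinear g"
  shows "bounded_bilinear (\<lambda>x y. (f x y, g x y))"
proof -
  interpret f: bounded_bilinear f by fact
  interpret g: bounded_bilinear g by fact
  obtain K where K: "\<And>x y. norm (f x y) \<le> norm x * norm y * K" using f.bounded by blast
  obtain L where L: "\<And>x y. norm (g x y) \<le> norm x * norm y * L" using g.bounded by blast
  show ?thesis
  proof (rule bounded_bilinear.intro)
    show "\<exists>K. \<forall>x y. norm (f x y, g x y) \<le> norm x * norm y * K"
    proof (intro exI allI)
      fix x y
      have "norm (f x y, g x y) \<le> norm (f x y) + norm (g x y)" by (rule norm_Pair_le)
      also have "\<dots> \<le> norm x * norm y * K + norm x * norm y * L" by (intro add_mono K L)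
      finally show "norm (f x y, g x y) \<le> norm x * norm y * (K + L)" by (simp add: distrib_left)
    qed
  qed (simp_all add: f.add_left f.add_right g.add_left g.add_right f.scaleR_left f.scaleR_right g.scaleR_left g.scaleR_right)
qed

lemma bounded_bilinear_traces:
  "bounded_bilinear (traces :: 'b::separable_hilbert ^ 's::finite \<Rightarrow> 'b ^ 's \<Rightarrow> _)"
  unfolding traces_def[abs_def]
  by (intro bounded_bilinear_Pair bounded_bilinear_block_gram bounded_bilinear_block_outer bounded_bilinear_outer)

text \<open>Links the recorded components to actual partial traces of the third one. It holds for
  single observations, sample means and the true mean, and differences keep it.\<close>

definition consistent_traces :: "(real ^ 's::finite) hs \<times> 'b::separable_hilbert hs \<times> ('b ^ 's) hs \<Rightarrow> bool" where
  "consistent_traces v \<longleftrightarrow> has_traces (snd (snd v)) (fst v) (fst (snd v))"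

lemma consistent_traces_simps:
  "consistent_traces v \<Longrightarrow> consistent_traces w \<Longrightarrow> consistent_traces (v - w)"
  "consistent_traces v \<Longrightarrow> consistent_traces (c *\<^sub>R v)"
  "consistent_traces (traces x y)"
  by (auto simp: consistent_traces_def traces_def has_traces_diff has_traces_scaleR has_traces_outer)

lemma consistent_traces_sum: "(\<And>i. i \<in> I \<Longrightarrow> consistent_traces (f i)) \<Longrightarrow> consistent_traces (\<Sum>i\<in>I. f i)"
  by (auto simp: consistent_traces_def fst_sum snd_sum intro!: has_traces_sum)

lemma M_map_traces:
  assumes "consistent_traces v"
  shows "M_map (snd (snd v)) (x \<otimes> y - snd (snd v)) = trace_linearisation (fst v) (traces x y - v)"
proof -
  have D: "x \<otimes> y - snd (snd v) = snd (snd (traces x y - v))" by (simp add: traces_def)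
  have "consistent_traces (traces x y - v)" by (intro consistent_traces_simps assms)
  note t = has_traces_imp[OF this[unfolded consistent_traces_def]]
  show ?thesis
    unfolding M_map_def D t has_traces_imp[OF assms[unfolded consistent_traces_def]] trace_linearisation_def case_prod_unfold by (simp add: prod_eq_iff)
qed

text \<open>The deviation depends only on the sum of its two arguments, so the statistic, a function
  of the sample mean, may be expanded around the true mean.\<close>

lemma stat_deviation_add: "stat_deviation m k = stat_deviation 0 (m + k)"
  by (cases m, cases k) (simp add: stat_deviation_def zero_prod_def)

lemma test_stat_traces:
  fixes X :: "int \<Rightarrow> 'w \<Rightarrow> 'b::separable_hilbert ^ 's::finite"
  shows "test_stat X h N \<omega> = real N * (norm (stat_deviation 0
    ((1 / real (N - h)) *\<^sub>R (\<Sum>n<N - h. traces (X (int (Suc n)) \<omega>) (X (int (Suc n) + int h) \<omega>)))))\<^sup>2"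
proof -
  define k where "k = (1 / real (N - h)) *\<^sub>R (\<Sum>n<N - h. traces (X (int (Suc n)) \<omega>) (X (int (Suc n) + int h) \<omega>))"
  have "consistent_traces k"
    unfolding k_def by (intro consistent_traces_simps consistent_traces_sum)
  note t = has_traces_imp[OF this[unfolded consistent_traces_def]]
  have D: "sample_cov X h N \<omega> = snd (snd k)"
    unfolding k_def sample_cov_def by (simp add: snd_sum traces_def sum.atLeast1_atMost_eq)
  have "sep1 (sample_cov X h N \<omega>) \<otimes>\<^sub>o sep2 (sample_cov X h N \<omega>) - sample_cov X h N \<omega> = stat_deviation 0 k"
    unfolding D sep1_def sep2_def t stat_deviation_def case_prod_unfold by (simp add: zero_prod_def)
  then show ?thesis unfolding test_stat_def Let_def k_def by simp
qed

lemma borel_measurable_traces: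
  fixes f g :: "'w \<Rightarrow> 'b::separable_hilbert ^ 's::finite"
  assumes "f \<in> borel_measurable M" "g \<in> borel_measurable M"
  shows "(\<lambda>\<omega>. traces (f \<omega>) (g \<omega>)) \<in> borel_measurable M"
  by (rule borel_measurable_continuous_Pair[OF assms])
    (intro bounded_bilinear.continuous_on[OF bounded_bilinear_traces] continuous_on_fst continuous_on_snd continuous_on_id)

lemma borel_measurable_test_stat:
  fixes X :: "int \<Rightarrow> 'w \<Rightarrow> 'b::separable_hilbert ^ 's::finite"
  assumes "\<And>n. X n \<in> borel_measurable M"
  shows "test_stat X h N \<in> borel_measurable M"
proof -
  have [measurable]: "(\<lambda>\<omega>. (1 / real (N - h)) *\<^sub>R (\<Sum>n<N - h. traces (X (int (Suc n)) \<omega>) (X (int (Suc n) + int h) \<omega>))) \<in> borel_measurable M"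
    by (intro borel_measurable_scaleR borel_measurable_sum borel_measurable_const borel_measurable_traces assms)
  have [measurable]: "stat_deviation (0 :: (real ^ 's) hs \<times> 'b hs \<times> ('b ^ 's) hs) \<in> borel_measurable borel"
    unfolding zero_prod_def by (rule borel_measurable_stat_deviation)
  show ?thesis unfolding test_stat_traces[abs_def] by measurable
qed

section \<open>The canonical process, its traces and the limiting operator\<close>

context iid_shift
begin

context
  fixes x0 :: "(int \<Rightarrow> 'u) \<Rightarrow> 'b::separable_hilbert ^ 's::finite" and h :: nat
  assumes x: "fourth_integrable \<Omega> x0" "depends_on {..0} x0" "summable (fourth_dep_coef x0)"
begin

definition "proc n \<omega> = x0 (time_shift n \<omega>)"

text \<open>The lagged pair ends at time 0, so only innovations up to time 0 enter. The pair at
  times \<open>n\<close> and \<open>n + h\<close> appears after a shift by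
  \<open>n + h\<close>.\<close>

definition "lag_traces \<omega> = traces (x0 (time_shift (- int h) \<omega>)) (x0 \<omega>)"

definition "mean_traces = (LINT \<omega>|\<Omega>. lag_traces \<omega>)"

definition "fluctuation \<omega> = lag_traces \<omega> - mean_traces"

abbreviation "A0 \<equiv> fst mean_traces"
abbreviation "B0 \<equiv> fst (snd mean_traces)"
abbreviation "C0 \<equiv> snd (snd mean_traces)"

lemma sq_integrable_lag_traces: "sq_integrable \<Omega> lag_traces"
  using stationary_input_lagged_product(1)[OF bounded_bilinear_traces x, of h] by (simp add: lag_traces_def[abs_def])

lemma stationary_fluctuation: "stationary_input fluctuation"
  using stationary_input_lagged_product(2)[OF bounded_bilinear_traces x, of h]
  by (simp add: lag_traces_def[abs_def] mean_traces_def fluctuation_def[abs_def])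

lemma integrable_lag_traces: "integrable \<Omega> lag_traces"
  by (rule sq_integrable_integrable(1)[OF prob_Omega sq_integrable_lag_traces])

lemma measurable_lag_traces: "lag_traces \<in> borel_measurable \<Omega>"
  using sq_integrable_lag_traces by (rule sq_integrable_measurable)

lemma lag_traces_shift: "lag_traces (time_shift (n + int h) \<omega>) = traces (proc n \<omega>) (proc (n + int h) \<omega>)"
  by (simp add: lag_traces_def proc_def shift_shift)

lemma lag_cov_proc: "lag_cov \<Omega> proc h = C0"
proof -
  have "lag_cov \<Omega> proc h = (LINT \<omega>|\<Omega>. snd (snd (lag_traces (time_shift (1 + int h) \<omega>))))"
    unfolding lag_traces_shift lag_cov_def traces_def by simp
  also have "\<dots> = (LINT \<omega>|\<Omega>. snd (snd (lag_traces \<omega>)))"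
    by (rule integral_shift, rule measurable_compose[OF measurable_lag_traces])
      (intro borel_measurable_continuous_onI continuous_intros)
  also have "\<dots> = C0"
    unfolding mean_traces_def
    by (rule integral_bounded_linear[OF bounded_linear_compose[OF bounded_linear_snd bounded_linear_snd] integrable_lag_traces])
  finally show ?thesis .
qed

lemma consistent_mean_traces: "consistent_traces mean_traces"
proof -
  have "sq_integrable \<Omega> (\<lambda>\<omega>. x0 (time_shift (- int h) \<omega>))" "sq_integrable \<Omega> x0"
    using fourth_integrable_sq_integrable[OF prob_Omega x(1)] by (auto intro: sq_integrable_shift)
  note t = has_traces_expectation[OF this]
  have "A0 = (LINT \<omega>|\<Omega>. fst (lag_traces \<omega>))" "B0 = (LINT \<omega>|\<Omega>. fst (snd (lag_traces \<omega>)))" "C0 = (LINT \<omega>|\<Omega>. snd (snd (lag_traces \<omega>)))"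
    unfolding mean_traces_def
    by (rule integral_bounded_linear[OF bounded_linear_fst integrable_lag_traces, symmetric]
        integral_bounded_linear[OF bounded_linear_compose[OF bounded_linear_fst bounded_linear_snd] integrable_lag_traces, symmetric]
        integral_bounded_linear[OF bounded_linear_compose[OF bounded_linear_snd bounded_linear_snd] integrable_lag_traces, symmetric])+
  then show ?thesis using t unfolding consistent_traces_def lag_traces_def traces_def by simp
qed

lemmas mean_traces_values = has_traces_imp[OF consistent_mean_traces[unfolded consistent_traces_def]]

lemma M_map_proc:
  "M_map (lag_cov \<Omega> proc h) (centred_product \<Omega> proc h n \<omega>) = trace_linearisation A0 (fluctuation (time_shift (n + int h) \<omega>))"
  unfolding centred_product_def lag_cov_proc M_map_traces[OF consistent_mean_traces] fluctuation_def lag_traces_shift ..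

definition "linear_traces \<omega> = trace_linearisation A0 (fluctuation \<omega>)"

lemma stationary_linear_traces: "stationary_input linear_traces"
proof -
  obtain K where "K \<ge> 0" "\<And>v. norm (trace_linearisation A0 v :: (real ^ 's) hs \<times> 'b hs \<times> ('b ^ 's) hs) \<le> norm v * K"
    using bounded_linear.nonneg_bounded[OF bounded_linear_trace_linearisation[of A0]] by blast
  then show ?thesis
    unfolding linear_traces_def[abs_def]
    by (intro stationary_input_bounded_linear(1)[OF stationary_fluctuation bounded_linear_trace_linearisation, where K = K])
      (auto simp: mult.commute)
qed

text \<open>All the products occur at times moved by \<open>1 + h\<close>, and stationarity removes
  this common shift under the integral.\<close>

lemma W_op_proc: "W_op \<Omega> proc h = lrv_op linear_traces"
proof -
  note L = stationary_inputD[OF stationary_linear_traces]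
  have "V_op \<Omega> proc h i = autocov_op linear_traces i" for i
  proof -
    have i: "integrable \<Omega> (\<lambda>\<omega>. linear_traces \<omega> \<otimes> linear_traces (time_shift (int i) \<omega>))"
      by (rule sq_integrable_bilinear_integrable[OF bounded_bilinear_outer L(1) L(6)])
    have "V_op \<Omega> proc h i = (LINT \<omega>|\<Omega>. linear_traces (time_shift (1 + int h) \<omega>) \<otimes> linear_traces (time_shift (int i) (time_shift (1 + int h) \<omega>)))"
      unfolding V_op_def M_map_proc linear_traces_def shift_shift by (simp add: add_ac)
    also have "\<dots> = autocov_op linear_traces i"
      unfolding autocov_op_def by (rule integral_shift[of "\<lambda>\<omega>. linear_traces \<omega> \<otimes> linear_traces (time_shift (int i) \<omega>)"]) (use i in simp)
    finally show ?thesis .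
  qed
  then show ?thesis unfolding W_op_def lrv_op_def by simp
qed

lemma test_stat_proc:
  assumes N: "N > h"
  shows "test_stat proc h N \<omega> = real N * (norm (stat_deviation mean_traces
    ((1 / real (N - h)) *\<^sub>R partial_sum fluctuation (N - h) (time_shift (1 + int h) \<omega>))))\<^sup>2"
proof -
  define m where "m = N - h"
  have m: "m > 0" using N by (simp add: m_def)
  define k where "k = (1 / real m) *\<^sub>R partial_sum fluctuation m (time_shift (1 + int h) \<omega>)"
  have "mean_traces + k = (1 / real m) *\<^sub>R (\<Sum>n<m. lag_traces (time_shift (int n) (time_shift (1 + int h) \<omega>)))"
    using m unfolding k_def partial_sum_def fluctuation_def
    by (simp add: sum_subtractf scaleR_diff_right real_vector.scale_sum_right[symmetric] sum_constant_scaleR)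
  also have "(\<Sum>n<m. lag_traces (time_shift (int n) (time_shift (1 + int h) \<omega>)))
      = (\<Sum>n<m. traces (proc (int (Suc n)) \<omega>) (proc (int (Suc n) + int h) \<omega>))"
    using lag_traces_shift[of "int (Suc _)" \<omega>] by (intro sum.cong refl) (simp add: shift_shift add_ac)
  finally have mk: "mean_traces + k = (1 / real m) *\<^sub>R (\<Sum>n<m. traces (proc (int (Suc n)) \<omega>) (proc (int (Suc n) + int h) \<omega>))" .
  then show ?thesis
    unfolding test_stat_traces m_def[symmetric] k_def[symmetric] stat_deviation_add[of mean_traces] by simp
qed

text \<open>The linearised deviation caused by one observation. By \<open>Q_op_proc\<close> its
  long-run variances are the quadratic form of \<open>Q_op\<close>.\<close>

definition "limit_input \<omega> = product_linearisation A0 B0 (linear_traces \<omega>)"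

lemma stationary_limit_input: "stationary_input limit_input"
proof -
  obtain K where "K \<ge> 0" "\<And>v. norm (product_linearisation A0 B0 v :: ('b ^ 's) hs) \<le> norm v * K"
    using bounded_linear.nonneg_bounded[OF bounded_linear_product_linearisation[of A0 B0]] by blast
  then show ?thesis
    unfolding limit_input_def[abs_def]
    by (intro stationary_input_bounded_linear(1)[OF stationary_linear_traces bounded_linear_product_linearisation, where K = K])
      (auto simp: mult.commute)
qed

context
  assumes \<tau>: "hs_trace (lag_cov \<Omega> proc h) \<noteq> 0"
begin

lemma G_map_proc: "G_map (lag_cov \<Omega> proc h) = product_linearisation A0 B0"
  using \<tau> unfolding G_map_def product_linearisation_def sep1_def sep2_def lag_cov_proc mean_traces_values by simp

text \<open>Moving \<open>G_map\<close> across the inner product turns the form of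
  \<open>Q_op\<close> into that of \<open>W_op\<close> at adjoint vectors, and the same step inside
  the expectation leads back to projections of \<open>limit_input\<close>.\<close>

lemma Q_op_proc:
  shows "bounded_linear (Q_op \<Omega> proc h)" "Q_op \<Omega> proc h u \<bullet> v = u \<bullet> Q_op \<Omega> proc h v"
    "Q_op \<Omega> proc h u \<bullet> u = lrv (\<lambda>\<omega>. limit_input \<omega> \<bullet> u)"
proof -
  let ?G = "product_linearisation A0 B0 :: _ \<Rightarrow> ('b ^ 's) hs"
  have Q: "Q_op \<Omega> proc h u = ?G (hs_apply (lrv_op linear_traces) (adjoint ?G u))" for u
    by (simp add: Q_op_def G_map_proc W_op_proc)
  note G = bounded_linear_product_linearisation[of A0 B0]
  note adj = adjoint_hilbert[OF G]
  show "bounded_linear (Q_op \<Omega> proc h)"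
    unfolding Q[abs_def] by (intro bounded_linear_compose[OF G] bounded_linear_compose[OF hs_apply_bounded_linear] adj(2))
  have form: "Q_op \<Omega> proc h u \<bullet> v = hs_apply (lrv_op linear_traces) (adjoint ?G u) \<bullet> adjoint ?G v" for u v
    unfolding Q adj(1) ..
  show "Q_op \<Omega> proc h u \<bullet> v = u \<bullet> Q_op \<Omega> proc h v"
    unfolding form inner_commute[of u] using lrv_op_symmetric[OF stationary_linear_traces] by (simp add: inner_commute)
  have "Q_op \<Omega> proc h u \<bullet> u = lrv (\<lambda>\<omega>. linear_traces \<omega> \<bullet> adjoint ?G u)"
    unfolding form by (subst inner_commute) (rule lrv_op_diagonal[OF stationary_linear_traces])
  then show "Q_op \<Omega> proc h u \<bullet> u = lrv (\<lambda>\<omega>. limit_input \<omega> \<bullet> u)"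
    unfolding adj(1) limit_input_def .
qed

text \<open>The statistic is compared with normalised partial sums of \<open>limit_input\<close>.
  The mean of the \<open>N - h\<close> fluctuations has second moment of order \<open>1 / N\<close>,
  so the quadratic remainder, multiplied by \<open>sqrt N\<close>, still vanishes.\<close>

theorem laplace_limit_proc:
  fixes Z :: "nat \<Rightarrow> 'z \<Rightarrow> real"
  assumes H0: "lag_cov \<Omega> proc h = sep1 (lag_cov \<Omega> proc h) \<otimes>\<^sub>o sep2 (lag_cov \<Omega> proc h)"
    and \<gamma>: "eigenvalues_with_multiplicity (Q_op \<Omega> proc h) \<gamma>"
    and P': "prob_space P'" and ind: "prob_space.indep_vars P' (\<lambda>_. borel) Z UNIV"
    and Z: "\<And>r. distr P' borel (Z r) = std_normal_distribution" and s: "s \<ge> 0"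
  shows "(\<lambda>N. LINT \<omega>|\<Omega>. exp (- s * test_stat proc h N \<omega>)) \<longlonglongrightarrow> (LINT \<omega>|P'. exp (- s * (\<Sum>r. \<gamma> r * (Z r \<omega>)\<^sup>2)))"
    and "\<And>r. 0 \<le> \<gamma> r" "summable \<gamma>"
proof -
  note lim = hilbert_laplace_limit[OF stationary_limit_input P' ind Z Q_op_proc \<gamma> s]
  show "\<And>r. 0 \<le> \<gamma> r" "summable \<gamma>" by (fact lim(2,3))+
  let ?G = "\<lambda>v. product_linearisation A0 B0 (trace_linearisation A0 v) :: ('b ^ 's) hs"
  have GL: "bounded_linear ?G" by (rule bounded_linear_compose[OF bounded_linear_product_linearisation bounded_linear_trace_linearisation])
  interpret GL: bounded_linear ?G by (rule GL)
  obtain g where g: "g \<ge> 0" "\<And>v. norm (?G v) \<le> norm v * g" using GL.nonneg_bounded by blast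
  have \<tau>A: "hs_trace A0 \<noteq> 0" using \<tau> by (simp add: lag_cov_proc mean_traces_values)
  have CA: "C0 = ((1 / hs_trace A0) *\<^sub>R A0) \<otimes>\<^sub>o B0"
    using H0 \<tau>A unfolding lag_cov_proc sep1_def sep2_def mean_traces_values by simp
  obtain \<rho> c where \<rho>: "\<rho> > 0" and c: "c \<ge> 0"
    and dev: "\<And>k. norm k \<le> \<rho> \<Longrightarrow> norm (stat_deviation mean_traces k - ?G k) \<le> c * (norm k)\<^sup>2"
    using stat_deviation_linearisation[OF \<tau>A CA] by auto
  define L where "L m = (LINT \<omega>|\<Omega>. exp (- s * (norm (partial_sum limit_input m \<omega>))\<^sup>2 / real m))" for m
  define T where "T N = (LINT \<omega>|\<Omega>. exp (- s * test_stat proc h N \<omega>))" for N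
  define b where "b = lrv_bound fluctuation"
  have b: "b \<ge> 0"
    unfolding b_def lrv_bound_def
    by (intro add_nonneg_nonneg mult_nonneg_nonneg suminf_nonneg stationary_inputD(4)[OF stationary_fluctuation]) auto
  \<comment> \<open>From left to right: the quadratic remainder, deviations beyond the radius
    \<open>\<rho>\<close>, and the factor \<open>N\<close> in place of \<open>N - h\<close>. The
    lower bound on \<open>N\<close> gives \<open>N \<le> 2 * (N - h)\<close>.\<close>
  have diff: "\<bar>T N - L (N - h)\<bar> \<le> (sqrt s * sqrt (real N) * c + 1 / \<rho>\<^sup>2) * (2 * b / real N) + sqrt s * sqrt (real h) * g * sqrt (2 * b / real N)"
    if N: "N \<ge> 2 * h + 2" for N
  proof -
    define m where "m = N - h"
    have m: "m > 0" "N > h" "real N \<le> 2 * real m" "m \<le> N" using N by (auto simp: m_def)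
    define \<kappa> where "\<kappa> \<omega> = (1 / real m) *\<^sub>R partial_sum fluctuation m \<omega>" for \<omega>
    define D where "D v = stat_deviation mean_traces v" for v
    have sqS: "sq_integrable \<Omega> (partial_sum fluctuation m)" by (rule sq_integrable_partial_sum[OF stationary_fluctuation])
    have sq\<kappa>: "sq_integrable \<Omega> \<kappa>" unfolding \<kappa>_def[abs_def] by (rule sq_integrable_scaleR(1)[OF sqS])
    have \<kappa>2: "(l2norm \<Omega> \<kappa>)\<^sup>2 \<le> 2 * b / real N"
    proof -
      have "(l2norm \<Omega> \<kappa>)\<^sup>2 = (l2norm \<Omega> (partial_sum fluctuation m))\<^sup>2 / (real m)\<^sup>2"
        unfolding \<kappa>_def[abs_def] sq_integrable_scaleR(2)[OF sqS] by (simp add: power_mult_distrib power_divide)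
      also have "\<dots> \<le> (real m * b) / (real m)\<^sup>2"
        unfolding b_def by (intro divide_right_mono partial_sum_bound stationary_fluctuation) simp
      also have "\<dots> = b / real m" using m by (simp add: power2_eq_square)
      also have "\<dots> \<le> 2 * b / real N"
        using m b mult_left_mono[OF m(3) b] by (simp add: field_simps)
      finally show ?thesis .
    qed
    have \<kappa>1: "(LINT \<omega>|\<Omega>. norm (\<kappa> \<omega>)) \<le> sqrt (2 * b / real N)"
      using sq_integrable_integrable(2)[OF prob_Omega sq\<kappa>] real_le_rsqrt[OF \<kappa>2] by linarith
    have [measurable]: "\<kappa> \<in> borel_measurable \<Omega>" using sq\<kappa> by (simp add: sq_integrable_def)
    have Dm[measurable]: "D \<in> borel_measurable borel"
      using borel_measurable_stat_deviation[of A0 B0 C0] by (simp add: D_def[abs_def])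
    have [measurable]: "?G \<in> borel_measurable borel"
      by (intro borel_measurable_continuous_onI linear_continuous_on GL)
    have T: "T N = (LINT \<omega>|\<Omega>. exp (- s * (real N * (norm (D (\<kappa> \<omega>)))\<^sup>2)))"
    proof -
      have "T N = (LINT \<omega>|\<Omega>. (\<lambda>\<omega>. exp (- s * (real N * (norm (D (\<kappa> \<omega>)))\<^sup>2))) (time_shift (1 + int h) \<omega>))"
        unfolding T_def test_stat_proc[OF m(2)] D_def \<kappa>_def m_def ..
      also have "\<dots> = (LINT \<omega>|\<Omega>. exp (- s * (real N * (norm (D (\<kappa> \<omega>)))\<^sup>2)))"
        by (rule integral_shift) measurable
      finally show ?thesis .
    qed
    have Leq: "L m = (LINT \<omega>|\<Omega>. exp (- s * (real m * (norm (?G (\<kappa> \<omega>)))\<^sup>2)))"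
    proof -
      have "partial_sum limit_input m \<omega> = real m *\<^sub>R ?G (\<kappa> \<omega>)" for \<omega>
        using m partial_sum_bounded_linear[OF GL, of fluctuation m \<omega>]
        by (simp add: limit_input_def[abs_def] linear_traces_def \<kappa>_def GL.scale)
      then show ?thesis using m unfolding L_def by (simp add: power_mult_distrib power2_eq_square mult_ac)
    qed
    have pw: "\<bar>exp (- s * (real N * (norm (D v))\<^sup>2)) - exp (- s * (real m * (norm (?G v))\<^sup>2))\<bar>
        \<le> (sqrt s * sqrt (real N) * c + 1 / \<rho>\<^sup>2) * (norm v)\<^sup>2 + sqrt s * sqrt (real h) * g * norm v" for v
    proof (cases "norm v \<le> \<rho>")
      case True
      have "\<bar>exp (- s * (norm (sqrt (real N) *\<^sub>R D v))\<^sup>2) - exp (- s * (norm (sqrt (real m) *\<^sub>R ?G v))\<^sup>2)\<bar>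
          \<le> sqrt s * norm (sqrt (real N) *\<^sub>R D v - sqrt (real m) *\<^sub>R ?G v)"
        by (rule gauss_norm_lipschitz[OF s])
      also have "sqrt (real N) *\<^sub>R D v - sqrt (real m) *\<^sub>R ?G v = sqrt (real N) *\<^sub>R (D v - ?G v) + (sqrt (real N) - sqrt (real m)) *\<^sub>R ?G v"
        by (simp add: scaleR_diff_right scaleR_diff_left)
      also have "norm \<dots> \<le> sqrt (real N) * (c * (norm v)\<^sup>2) + sqrt (real h) * (g * norm v)"
      proof (rule order_trans[OF norm_triangle_ineq], unfold norm_scaleR, intro add_mono mult_mono)
        show "norm (D v - ?G v) \<le> c * (norm v)\<^sup>2" unfolding D_def by (rule dev[OF True])
        show "norm (?G v) \<le> g * norm v" using g(2)[of v] by (simp add: mult.commute)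
        have "real N = real m + real h" using m by (simp add: m_def)
        then have "sqrt (real N) \<le> sqrt (real m) + sqrt (real h)" using sqrt_add_le_add_sqrt[of "real m" "real h"] by simp
        then show "\<bar>sqrt (real N) - sqrt (real m)\<bar> \<le> sqrt (real h)" using m by simp
      qed (use c in auto)
      finally have "\<bar>exp (- s * (norm (sqrt (real N) *\<^sub>R D v))\<^sup>2) - exp (- s * (norm (sqrt (real m) *\<^sub>R ?G v))\<^sup>2)\<bar>
          \<le> sqrt s * (sqrt (real N) * (c * (norm v)\<^sup>2) + sqrt (real h) * (g * norm v))"
        using s by (simp add: mult_left_mono)
      also have "\<dots> = sqrt s * sqrt (real N) * c * (norm v)\<^sup>2 + sqrt s * sqrt (real h) * g * norm v"
        by (simp add: distrib_left mult_ac)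
      also have "\<dots> \<le> (sqrt s * sqrt (real N) * c + 1 / \<rho>\<^sup>2) * (norm v)\<^sup>2 + sqrt s * sqrt (real h) * g * norm v"
        by (intro add_right_mono mult_right_mono) auto
      finally show ?thesis by (simp add: power_mult_distrib)
    next
      \<comment> \<open>Outside the radius both exponentials are only known to lie in
        \<open>[0, 1]\<close>. As in Chebyshev's inequality, 1 is then at most
        \<open>(norm v)\<^sup>2 / \<rho>\<^sup>2\<close>.\<close>
      case False
      then have "\<rho>\<^sup>2 \<le> (norm v)\<^sup>2" using \<rho> by (intro power_mono) auto
      then have "1 \<le> 1 / \<rho>\<^sup>2 * (norm v)\<^sup>2" using \<rho> by (simp add: field_simps)
      moreover have "\<bar>exp (- s * (real N * (norm (D v))\<^sup>2)) - exp (- s * (real m * (norm (?G v))\<^sup>2))\<bar> \<le> 1"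
      proof -
        have e: "0 \<le> exp (- s * (real n * q\<^sup>2)) \<and> exp (- s * (real n * q\<^sup>2)) \<le> 1" for n q using s by simp
        show ?thesis using e[of N "norm (D v)"] e[of m "norm (?G v)"] by linarith
      qed
      moreover have "0 \<le> sqrt s * sqrt (real N) * c * (norm v)\<^sup>2" "0 \<le> sqrt s * sqrt (real h) * g * norm v"
        using s c g by auto
      ultimately show ?thesis unfolding distrib_right by linarith
    qed
    have i1: "integrable \<Omega> (\<lambda>\<omega>. exp (- s * (real N * (norm (D (\<kappa> \<omega>)))\<^sup>2)))"
      by (rule Om.integrable_const_bound[where B = 1]) (use s in auto)
    have i2: "integrable \<Omega> (\<lambda>\<omega>. exp (- s * (real m * (norm (?G (\<kappa> \<omega>)))\<^sup>2)))"
      by (rule Om.integrable_const_bound[where B = 1]) (use s in auto)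
    have i3: "integrable \<Omega> (\<lambda>\<omega>. (norm (\<kappa> \<omega>))\<^sup>2)" "integrable \<Omega> (\<lambda>\<omega>. norm (\<kappa> \<omega>))"
      using sq\<kappa> sq_integrable_integrable(1)[OF prob_Omega sq\<kappa>] by (auto simp: sq_integrable_def)
    have "\<bar>T N - L m\<bar> = \<bar>LINT \<omega>|\<Omega>. exp (- s * (real N * (norm (D (\<kappa> \<omega>)))\<^sup>2)) - exp (- s * (real m * (norm (?G (\<kappa> \<omega>)))\<^sup>2))\<bar>"
      unfolding T Leq by (subst Bochner_Integration.integral_diff[OF i1 i2]) simp
    also have "\<dots> \<le> (LINT \<omega>|\<Omega>. \<bar>exp (- s * (real N * (norm (D (\<kappa> \<omega>)))\<^sup>2)) - exp (- s * (real m * (norm (?G (\<kappa> \<omega>)))\<^sup>2))\<bar>)"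
      by (rule integral_abs_bound)
    also have "\<dots> \<le> (LINT \<omega>|\<Omega>. (sqrt s * sqrt (real N) * c + 1 / \<rho>\<^sup>2) * (norm (\<kappa> \<omega>))\<^sup>2 + sqrt s * sqrt (real h) * g * norm (\<kappa> \<omega>))"
      by (intro integral_mono pw integrable_abs Bochner_Integration.integrable_diff Bochner_Integration.integrable_add
          integrable_mult_right i1 i2 i3)
    also have "\<dots> = (sqrt s * sqrt (real N) * c + 1 / \<rho>\<^sup>2) * (l2norm \<Omega> \<kappa>)\<^sup>2 + sqrt s * sqrt (real h) * g * (LINT \<omega>|\<Omega>. norm (\<kappa> \<omega>))"
      using i3 by (simp add: l2norm_sq)
    also have "\<dots> \<le> (sqrt s * sqrt (real N) * c + 1 / \<rho>\<^sup>2) * (2 * b / real N) + sqrt s * sqrt (real h) * g * sqrt (2 * b / real N)"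
      using \<kappa>1 \<kappa>2 s c g by (intro add_mono mult_left_mono) auto
    finally show ?thesis by (simp add: m_def)
  qed
  have "(\<lambda>N. T N - L (N - h)) \<longlonglongrightarrow> 0"
  proof (rule Lim_null_comparison)
    show "\<forall>\<^sub>F N in sequentially. norm (T N - L (N - h)) \<le>
        (sqrt s * sqrt (real N) * c + 1 / \<rho>\<^sup>2) * (2 * b / real N) + sqrt s * sqrt (real h) * g * sqrt (2 * b / real N)"
      by (rule eventually_sequentiallyI[of "2 * h + 2"]) (use diff in simp)
    have inv: "(\<lambda>N. 1 / sqrt (real N)) \<longlonglongrightarrow> 0"
      by (intro tendsto_divide_0[OF tendsto_const] filterlim_at_top_imp_at_infinity
          filterlim_compose[OF sqrt_at_top filterlim_real_sequentially])
    have "(\<lambda>N. sqrt s * c * (2 * b) * (1 / sqrt (real N)) + 1 / \<rho>\<^sup>2 * (2 * b) * (1 / sqrt (real N))\<^sup>2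
        + sqrt s * sqrt (real h) * g * sqrt (2 * b) * (1 / sqrt (real N)))
        \<longlonglongrightarrow> sqrt s * c * (2 * b) * 0 + 1 / \<rho>\<^sup>2 * (2 * b) * 0\<^sup>2 + sqrt s * sqrt (real h) * g * sqrt (2 * b) * 0"
      by (intro tendsto_intros inv)
    moreover have "sqrt s * c * (2 * b) * (1 / sqrt (real N)) + 1 / \<rho>\<^sup>2 * (2 * b) * (1 / sqrt (real N))\<^sup>2
        + sqrt s * sqrt (real h) * g * sqrt (2 * b) * (1 / sqrt (real N))
      = (sqrt s * sqrt (real N) * c + 1 / \<rho>\<^sup>2) * (2 * b / real N) + sqrt s * sqrt (real h) * g * sqrt (2 * b / real N)" for N
    proof -
      have "sqrt (real N) / real N = 1 / sqrt (real N)" by (cases "N = 0") (simp_all add: real_div_sqrt field_simps)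
      then have e1: "sqrt s * sqrt (real N) * c * (2 * b / real N) = sqrt s * c * (2 * b) * (1 / sqrt (real N))"
        by (metis (no_types, opaque_lifting) mult.assoc mult.commute times_divide_eq_right)
      have e2: "sqrt (2 * b / real N) = sqrt (2 * b) * (1 / sqrt (real N))" by (simp add: real_sqrt_divide)
      have e3: "(1 / sqrt (real N))\<^sup>2 = 1 / real N" by (simp add: power_divide)
      have e4: "(sqrt s * sqrt (real N) * c + 1 / \<rho>\<^sup>2) * (2 * b / real N)
          = sqrt s * sqrt (real N) * c * (2 * b / real N) + 1 / \<rho>\<^sup>2 * (2 * b) * (1 / real N)"
        unfolding distrib_right by simp
      show ?thesis unfolding e2 e3 e4 e1 by (simp only: mult.assoc)
    qed
    ultimately show "(\<lambda>N. (sqrt s * sqrt (real N) * c + 1 / \<rho>\<^sup>2) * (2 * b / real N) + sqrt s * sqrt (real h) * g * sqrt (2 * b / real N)) \<longlonglongrightarrow> 0"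
      by simp
  qed
  moreover have "(\<lambda>N. L (N - h)) \<longlonglongrightarrow> (LINT \<omega>|P'. exp (- s * (\<Sum>r. \<gamma> r * (Z r \<omega>)\<^sup>2)))"
  proof (rule LIMSEQ_offset[of _ h])
    show "(\<lambda>n. L (n + h - h)) \<longlonglongrightarrow> (LINT \<omega>|P'. exp (- s * (\<Sum>r. \<gamma> r * (Z r \<omega>)\<^sup>2)))"
      using lim(1) by (simp add: L_def)
  qed
  ultimately have "(\<lambda>N. (T N - L (N - h)) + L (N - h)) \<longlonglongrightarrow> 0 + (LINT \<omega>|P'. exp (- s * (\<Sum>r. \<gamma> r * (Z r \<omega>)\<^sup>2)))"
    by (rule tendsto_add)
  then show "(\<lambda>N. LINT \<omega>|\<Omega>. exp (- s * test_stat proc h N \<omega>)) \<longlonglongrightarrow> (LINT \<omega>|P'. exp (- s * (\<Sum>r. \<gamma> r * (Z r \<omega>)\<^sup>2)))"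
    by (simp add: T_def)
qed

end

end

end

section \<open>Transfer to the given process\<close>

text \<open>\<open>\<Psi>\<close> preserves measure, so the fourth moments of \<open>W\<close> and
  \<open>G\<close> agree. The exponent \<open>1 / 4\<close> becomes two square roots, as in
  \<open>l4norm\<close>, and finiteness of \<open>nu\<close> excludes its infinite branch.\<close>

lemma nu_4_finite:
  fixes W :: "'w \<Rightarrow> 'h::separable_hilbert" and G :: "'v \<Rightarrow> 'h"
  assumes \<Psi>: "\<Psi> \<in> measurable P Q" "distr P Q \<Psi> = Q" and G: "G \<in> borel_measurable Q"
    and W: "W \<in> borel_measurable P" "AE \<omega> in P. W \<omega> = G (\<Psi> \<omega>)" "nu P 4 W < \<infinity>"
  shows "fourth_integrable Q G" "nu P 4 W = ennreal (l4norm Q G)"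
proof -
  note [measurable] = \<Psi>(1) G W(1)
  have p4: "norm x powr 4 = (norm x) ^ 4" for x :: 'h by (subst powr_numeral) simp_all
  have int: "integrable P (\<lambda>\<omega>. norm (W \<omega>) ^ 4)"
    using W(3) unfolding nu_def p4 by (auto split: if_splits)
  have ae: "AE \<omega> in P. norm (W \<omega>) ^ 4 = norm (G (\<Psi> \<omega>)) ^ 4" using W(2) by eventually_elim simp
  have "integrable P (\<lambda>\<omega>. norm (G (\<Psi> \<omega>)) ^ 4)"
    using integrable_cong_AE[OF _ _ ae] int by simp
  then have iQ: "integrable Q (\<lambda>x. norm (G x) ^ 4)"
    using integrable_distr_eq[OF \<Psi>(1), of "\<lambda>x. norm (G x) ^ 4"] unfolding \<Psi>(2) by simp
  have n4: "(norm ((norm y)\<^sup>2))\<^sup>2 = norm y ^ 4" for y :: 'h by (simp flip: power_mult)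
  show "fourth_integrable Q G"
    unfolding fourth_integrable_def sq_integrable_def n4 using iQ by simp
  have "(LINT \<omega>|P. norm (W \<omega>) ^ 4) = (LINT \<omega>|P. norm (G (\<Psi> \<omega>)) ^ 4)"
    by (rule integral_cong_AE) (use ae in simp_all)
  also have "\<dots> = (LINT x|Q. norm (G x) ^ 4)"
    using integral_distr[OF \<Psi>(1), of "\<lambda>x. norm (G x) ^ 4"] unfolding \<Psi>(2) by simp
  finally have I: "(LINT \<omega>|P. norm (W \<omega>) ^ 4) = (LINT x|Q. norm (G x) ^ 4)" .
  have "y powr (1 / 4) = sqrt (sqrt y)" if "y \<ge> 0" for y :: real
    using that powr_powr[of y "1 / 2" "1 / 2"] by (simp add: powr_half_sqrt)
  then show "nu P 4 W = ennreal (l4norm Q G)"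
    using int unfolding nu_def p4 I l4norm_def l2norm_def n4 by simp
qed

lemma (in prob_space) iid_distr_PiM:
  assumes ind: "indep_vars (\<lambda>_. U) u (UNIV :: 'i set)" and id: "\<And>i. distr M U (u i) = \<mu>"
  shows "(\<lambda>\<omega> i. u i \<omega>) \<in> measurable M (PiM UNIV (\<lambda>_. \<mu>))"
    and "distr M (PiM UNIV (\<lambda>_. \<mu>)) (\<lambda>\<omega> i. u i \<omega>) = PiM UNIV (\<lambda>_. \<mu>)"
proof -
  have rv: "random_variable U (u i)" for i using ind by (auto simp: indep_vars_def)
  \<comment> \<open>\<open>\<mu>\<close> and \<open>U\<close> share their measurable sets but are
    different measures; for measurability their products are interchangeable.\<close>
  have sets: "sets (PiM UNIV (\<lambda>_ :: 'i. \<mu>)) = sets (PiM UNIV (\<lambda>_. U))"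
    by (intro sets_PiM_cong refl) (simp flip: id[of undefined])
  have "(\<lambda>\<omega> i. u i \<omega>) \<in> measurable M (PiM UNIV (\<lambda>_. U))"
    by (rule measurable_PiM_single') (use rv in \<open>auto dest: measurable_space\<close>)
  then show "(\<lambda>\<omega> i. u i \<omega>) \<in> measurable M (PiM UNIV (\<lambda>_. \<mu>))"
    by (simp cong: measurable_cong_sets add: measurable_cong_sets[OF refl sets])
  have "distr M (PiM UNIV (\<lambda>_. \<mu>)) (\<lambda>\<omega> i. u i \<omega>) = distr M (PiM UNIV (\<lambda>_. U)) (\<lambda>\<omega>. \<lambda>i\<in>UNIV. u i \<omega>)"
    by (rule distr_cong) (auto simp: sets)
  also have "\<dots> = PiM UNIV (\<lambda>_. \<mu>)"
    using indep_vars_iff_distr_eq_PiM'[THEN iffD1, OF _ rv ind] unfolding id by simp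
  finally show "distr M (PiM UNIV (\<lambda>_. \<mu>)) (\<lambda>\<omega> i. u i \<omega>) = PiM UNIV (\<lambda>_. \<mu>)" .
qed

text \<open>Of the whole family of copies only \<open>u\<close> and a single copy are extracted: two
  independent sequences of equal law, hence jointly distributed as the double product
  measure.\<close>

lemma (in prob_space) distr_independent_copies:
  fixes u :: "int \<Rightarrow> 'a \<Rightarrow> 'u" and n :: int and m :: nat
  assumes ind: "indep_vars (\<lambda>_. U) u UNIV" and id: "\<And>i. distr M U (u i) = \<mu>"
    and cop: "independent_copies M U u u'"
  defines "\<Omega> \<equiv> PiM (UNIV :: int set) (\<lambda>_. \<mu>)"
  shows "(\<lambda>\<omega>. (\<lambda>i. u i \<omega>, \<lambda>i. u' n m i \<omega>)) \<in> measurable M (\<Omega> \<Otimes>\<^sub>M \<Omega>)"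
    and "distr M (\<Omega> \<Otimes>\<^sub>M \<Omega>) (\<lambda>\<omega>. (\<lambda>i. u i \<omega>, \<lambda>i. u' n m i \<omega>)) = \<Omega> \<Otimes>\<^sub>M \<Omega>"
proof -
  note law = iid_distr_PiM[OF ind id, folded \<Omega>_def]
  let ?K = "\<lambda>c \<omega> k. case c of None \<Rightarrow> u k \<omega> | Some (n, m) \<Rightarrow> u' n m k \<omega>"
  have sets: "sets (PiM UNIV (\<lambda>_. U)) = sets \<Omega>"
    unfolding \<Omega>_def by (intro sets_PiM_cong refl) (simp flip: id[of undefined])
  have iv: "indep_vars (\<lambda>_. PiM UNIV (\<lambda>_. U)) ?K UNIV" using cop by (simp add: independent_copies_def)
  have *: "indep_var (PiM {None} (\<lambda>_. PiM UNIV (\<lambda>_. U))) (\<lambda>\<omega>. restrict (\<lambda>c. ?K c \<omega>) {None})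
      (PiM {Some (n, m)} (\<lambda>_. PiM UNIV (\<lambda>_. U))) (\<lambda>\<omega>. restrict (\<lambda>c. ?K c \<omega>) {Some (n, m)})"
    by (rule indep_var_restrict[OF iv]) auto
  have "indep_var \<Omega> ((\<lambda>g. g None) \<circ> (\<lambda>\<omega>. restrict (\<lambda>c. ?K c \<omega>) {None}))
      \<Omega> ((\<lambda>g. g (Some (n, m))) \<circ> (\<lambda>\<omega>. restrict (\<lambda>c. ?K c \<omega>) {Some (n, m)}))"
    by (rule indep_var_compose[OF *]) (auto simp: measurable_cong_sets[OF refl sets[symmetric]] intro!: measurable_component_singleton)
  then have "indep_var \<Omega> (\<lambda>\<omega> i. u i \<omega>) \<Omega> (\<lambda>\<omega> i. u' n m i \<omega>)" by (simp add: comp_def)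
  then have rv: "random_variable \<Omega> (\<lambda>\<omega> i. u' n m i \<omega>)"
    and d: "distr M \<Omega> (\<lambda>\<omega> i. u i \<omega>) \<Otimes>\<^sub>M distr M \<Omega> (\<lambda>\<omega> i. u' n m i \<omega>) = distr M (\<Omega> \<Otimes>\<^sub>M \<Omega>) (\<lambda>\<omega>. (\<lambda>i. u i \<omega>, \<lambda>i. u' n m i \<omega>))"
    unfolding indep_var_distribution_eq by auto
  show "(\<lambda>\<omega>. (\<lambda>i. u i \<omega>, \<lambda>i. u' n m i \<omega>)) \<in> measurable M (\<Omega> \<Otimes>\<^sub>M \<Omega>)"
    by (rule measurable_Pair[OF law(1) rv])
  have "distr M \<Omega> (\<lambda>\<omega> i. u' n m i \<omega>) = distr M (PiM UNIV (\<lambda>_. U)) (\<lambda>\<omega> i. u' n m i \<omega>)"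
    by (rule distr_cong) (simp_all add: sets)
  also have "\<dots> = distr M (PiM UNIV (\<lambda>_. U)) (\<lambda>\<omega> i. u i \<omega>)" using cop by (simp add: independent_copies_def)
  also have "\<dots> = distr M \<Omega> (\<lambda>\<omega> i. u i \<omega>)" by (rule distr_cong) (simp_all add: sets)
  finally show "distr M (\<Omega> \<Otimes>\<^sub>M \<Omega>) (\<lambda>\<omega>. (\<lambda>i. u i \<omega>, \<lambda>i. u' n m i \<omega>)) = \<Omega> \<Otimes>\<^sub>M \<Omega>"
    using d law(2) by simp
qed

text \<open>The passage to the product space is by law alone. The paths of \<open>X\<close> and of
  the canonical process have the same distribution, and the coupling of \<open>X 0\<close> with one
  copy is \<open>resample\<close> under the joint law of the two sequences.\<close>

lemma L4_m_approximable_canonical: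
  fixes X :: "int \<Rightarrow> 'w \<Rightarrow> 'h::separable_hilbert" and U :: "'u measure"
  assumes P: "prob_space P" and appr: "Lp_m_approximable P U 4 X"
  obtains \<mu> :: "'u measure" and x0 :: "(int \<Rightarrow> 'u) \<Rightarrow> 'h" where "iid_shift \<mu>"
    "fourth_integrable (PiM UNIV (\<lambda>_. \<mu>)) x0" "iid_shift.depends_on \<mu> {..0} x0" "summable (iid_shift.fourth_dep_coef \<mu> x0)"
    "distr P (PiM UNIV (\<lambda>_. borel)) (\<lambda>\<omega> n. X n \<omega>)
      = distr (PiM UNIV (\<lambda>_. \<mu>)) (PiM UNIV (\<lambda>_. borel)) (\<lambda>\<omega> n. x0 (time_shift n \<omega>))"
proof -
  interpret P: prob_space P by (rule P)
  obtain f u u' where f: "f \<in> borel_measurable (PiM (UNIV :: nat set) (\<lambda>_. U))"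
    and ind: "P.indep_vars (\<lambda>_. U) u UNIV" and id: "\<And>i j. distr P U (u i) = distr P U (u j)"
    and Xf: "\<And>n. AE \<omega> in P. X n \<omega> = f (\<lambda>k. u (n - int k) \<omega>)" and cop: "independent_copies P U u u'"
    and sm: "\<And>n. (\<Sum>M. nu P 4 (\<lambda>\<omega>. X n \<omega> - f (\<lambda>k. if k \<le> Suc M then u (n - int k) \<omega> else u' n (Suc M) (n - int k) \<omega>))) < \<infinity>"
    using appr unfolding Lp_m_approximable_def by blast
  have X: "X n \<in> borel_measurable P" "nu P 4 (X n) < \<infinity>" for n
    using appr by (auto simp: Lp_m_approximable_def)
  define \<mu> where "\<mu> = distr P U (u 0)"
  have id\<mu>: "distr P U (u i) = \<mu>" for i unfolding \<mu>_def by (rule id)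
  have u: "u i \<in> measurable P U" for i using ind by (auto simp: P.indep_vars_def)
  interpret I: iid_shift \<mu>
    unfolding iid_shift_def \<mu>_def by (rule P.prob_space_distr[OF u])
  let ?\<Omega> = "PiM (UNIV :: int set) (\<lambda>_. \<mu>)"
  have s\<mu>: "sets \<mu> = sets U" by (simp add: \<mu>_def)
  define x0 where "x0 \<omega> = f (\<lambda>k. \<omega> (- int k))" for \<omega> :: "int \<Rightarrow> 'u"
  have fm: "f \<in> borel_measurable (PiM (UNIV :: nat set) (\<lambda>_. \<mu>))"
    using f by (simp add: measurable_cong_sets[OF sets_PiM_cong[OF refl s\<mu>] refl])
  have "(\<lambda>\<omega>. \<lambda>k. \<omega> (- int k)) \<in> measurable ?\<Omega> (PiM (UNIV :: nat set) (\<lambda>_. \<mu>))"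
    by (rule measurable_PiM_single') (auto simp: space_PiM)
  then have x0m: "x0 \<in> borel_measurable ?\<Omega>" unfolding x0_def[abs_def] by (rule measurable_compose[OF _ fm])
  note \<Phi> = P.iid_distr_PiM[OF ind id\<mu>]
  have X0: "AE \<omega> in P. X n \<omega> = x0 (time_shift n (\<lambda>i. u i \<omega>))" for n
    using Xf[of n] by (simp add: x0_def time_shift_def)
  have four: "fourth_integrable ?\<Omega> x0"
    by (rule nu_4_finite(1)[OF \<Phi> x0m X(1)[of 0] _ X(2)]) (use X0[of 0] in \<open>simp add: time_shift_def\<close>)
  have dep: "I.depends_on {..0} x0"
  proof (rule I.depends_onI)
    fix \<omega> \<omega>' :: "int \<Rightarrow> 'u" assume "\<And>i. i \<in> {..0} \<Longrightarrow> \<omega> i = \<omega>' i"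
    then have "(\<lambda>k. \<omega> (- int k)) = (\<lambda>k. \<omega>' (- int k))" by auto
    then show "x0 \<omega> = x0 \<omega>'" by (simp add: x0_def)
  qed
  \<comment> \<open>Keeping \<open>u (0 - int k)\<close> for \<open>k \<le> Suc m\<close> means
    keeping the coordinates from \<open>- int (Suc m)\<close> on, so the indices agree.\<close>
  have coef: "nu P 4 (\<lambda>\<omega>. X 0 \<omega> - f (\<lambda>k. if k \<le> Suc m then u (0 - int k) \<omega> else u' 0 (Suc m) (0 - int k) \<omega>))
      = ennreal (I.fourth_dep_coef x0 (Suc m))" for m
  proof -
    let ?Y = "\<lambda>\<omega>. f (\<lambda>k. if k \<le> Suc m then u (0 - int k) \<omega> else u' 0 (Suc m) (0 - int k) \<omega>)"
    let ?\<Psi> = "\<lambda>\<omega>. (\<lambda>i. u i \<omega>, \<lambda>i. u' 0 (Suc m) i \<omega>)"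
    note \<Psi> = P.distr_independent_copies[OF ind id\<mu> cop, of 0 "Suc m"]
    have Y: "?Y \<omega> = x0 (resample {- int (Suc m)..} (fst (?\<Psi> \<omega>)) (snd (?\<Psi> \<omega>)))" for \<omega>
      unfolding x0_def resample_def by (intro arg_cong[of _ _ f] ext) auto
    have R: "(\<lambda>x. x0 (resample {- int (Suc m)..} (fst x) (snd x))) \<in> borel_measurable (?\<Omega> \<Otimes>\<^sub>M ?\<Omega>)"
      by (rule measurable_compose[OF I.measurable_resample x0m])
    have Ym: "?Y \<in> borel_measurable P" unfolding Y by (rule measurable_compose[OF \<Psi>(1) R])
    have fin: "nu P 4 (\<lambda>\<omega>. X 0 \<omega> - ?Y \<omega>) < \<infinity>" using ennreal_suminf_lessD[OF sm[of 0], of m] by simp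
    show ?thesis
      unfolding I.fourth_dep_coef_def
    proof (rule nu_4_finite(2)[OF \<Psi> _ _ _ fin])
      show "(\<lambda>x. x0 (fst x) - x0 (resample {- int (Suc m)..} (fst x) (snd x))) \<in> borel_measurable (?\<Omega> \<Otimes>\<^sub>M ?\<Omega>)"
        by (intro borel_measurable_diff R measurable_compose[OF measurable_fst x0m])
      show "(\<lambda>\<omega>. X 0 \<omega> - ?Y \<omega>) \<in> borel_measurable P" by (intro borel_measurable_diff X Ym)
      show "AE \<omega> in P. X 0 \<omega> - ?Y \<omega> = x0 (fst (?\<Psi> \<omega>)) - x0 (resample {- int (Suc m)..} (fst (?\<Psi> \<omega>)) (snd (?\<Psi> \<omega>)))"
        unfolding Y using X0[of 0] by eventually_elim (simp add: time_shift_def)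
    qed
  qed
  have "summable (\<lambda>m. I.fourth_dep_coef x0 (Suc m))"
  proof (rule summable_suminf_not_top)
    show "(\<Sum>m. ennreal (I.fourth_dep_coef x0 (Suc m))) \<noteq> top" using sm[of 0] unfolding coef by auto
  qed (simp add: I.fourth_dep_coef_def)
  \<comment> \<open>The approximability series starts at \<open>M = 1\<close>; the missing
    coefficient of index 0 does not affect summability.\<close>
  then have summ: "summable (I.fourth_dep_coef x0)" by (simp only: summable_Suc_iff)
  have shm: "(\<lambda>\<omega> n. x0 (time_shift n \<omega>)) \<in> measurable ?\<Omega> (PiM UNIV (\<lambda>_. borel))"
    by (rule measurable_PiM_single') (use measurable_compose[OF I.measurable_shift x0m] in auto)
  have Xm: "(\<lambda>\<omega> n. X n \<omega>) \<in> measurable P (PiM UNIV (\<lambda>_. borel))"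
    by (rule measurable_PiM_single') (use X in auto)
  \<comment> \<open>There are countably many times, so one null set serves the whole path.\<close>
  have "AE \<omega> in P. \<forall>n. X n \<omega> = x0 (time_shift n (\<lambda>i. u i \<omega>))" using X0 by (simp add: AE_all_countable)
  then have "AE \<omega> in P. (\<lambda>n. X n \<omega>) = (\<lambda>n. x0 (time_shift n (\<lambda>i. u i \<omega>)))" by eventually_elim auto
  then have "distr P (PiM UNIV (\<lambda>_. borel)) (\<lambda>\<omega> n. X n \<omega>)
      = distr P (PiM UNIV (\<lambda>_. borel)) (\<lambda>\<omega> n. x0 (time_shift n (\<lambda>i. u i \<omega>)))"
    by (intro distr_cong_AE refl Xm measurable_compose[OF \<Phi>(1) shm])
  also have "\<dots> = distr (distr P ?\<Omega> (\<lambda>\<omega> i. u i \<omega>)) (PiM UNIV (\<lambda>_. borel)) (\<lambda>\<omega> n. x0 (time_shift n \<omega>))"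
    by (subst distr_distr[OF shm \<Phi>(1)]) (simp add: comp_def)
  finally have law: "distr P (PiM UNIV (\<lambda>_. borel)) (\<lambda>\<omega> n. X n \<omega>)
      = distr ?\<Omega> (PiM UNIV (\<lambda>_. borel)) (\<lambda>\<omega> n. x0 (time_shift n \<omega>))" unfolding \<Phi>(2) .
  show thesis by (rule that[OF I.iid_shift_axioms four dep summ law])
qed

section \<open>Quantities determined by the law of the process\<close>

context iid_shift
begin

context
  fixes x0 :: "(int \<Rightarrow> 'u) \<Rightarrow> 'b::separable_hilbert ^ 's::finite" and h :: nat
    and P :: "'w measure" and X :: "int \<Rightarrow> 'w \<Rightarrow> 'b ^ 's"
  assumes x: "fourth_integrable \<Omega> x0" "depends_on {..0} x0" "summable (fourth_dep_coef x0)"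
    and X: "\<And>n. X n \<in> borel_measurable P"
    and law: "distr P (PiM UNIV (\<lambda>_. borel)) (\<lambda>\<omega> n. X n \<omega>) = distr \<Omega> (PiM UNIV (\<lambda>_. borel)) (\<lambda>\<omega> n. x0 (time_shift n \<omega>))"
begin

lemma integral_process_eq:
  fixes F :: "(int \<Rightarrow> 'b ^ 's) \<Rightarrow> 'c::{banach, second_countable_topology}"
  assumes F: "F \<in> borel_measurable (PiM UNIV (\<lambda>_. borel))"
  shows "(LINT \<omega>|P. F (\<lambda>n. X n \<omega>)) = (LINT \<omega>|\<Omega>. F (\<lambda>n. proc x0 n \<omega>))"
proof -
  have x0: "x0 \<in> borel_measurable \<Omega>" using x(1) by (simp add: fourth_integrable_def)
  have 1: "(\<lambda>\<omega> n. X n \<omega>) \<in> measurable P (PiM UNIV (\<lambda>_. borel))"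
    by (rule measurable_PiM_single') (use X in auto)
  have 2: "(\<lambda>\<omega> n. proc x0 n \<omega>) \<in> measurable \<Omega> (PiM UNIV (\<lambda>_. borel))"
    unfolding proc_def[OF x]
    by (rule measurable_PiM_single') (use measurable_compose[OF measurable_shift x0] in auto)
  show ?thesis
    unfolding integral_distr[OF 1 F, symmetric] law proc_def[OF x]
    by (rule integral_distr[OF 2[unfolded proc_def[OF x]] F])
qed

lemma lag_cov_process_eq: "lag_cov P X h = lag_cov \<Omega> (proc x0) h"
  unfolding lag_cov_def
  by (rule integral_process_eq, rule borel_measurable_continuous_Pair)
    (auto intro!: bounded_bilinear.continuous_on[OF bounded_bilinear_outer] continuous_on_fst continuous_on_snd continuous_on_id)

text \<open>\<open>M_map\<close> is built from infinite sums whose measurability on all operators is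
  not evident. On the differences that occur it equals the continuous
  \<open>trace_linearisation\<close> of the triple, so the integrand is a Borel function of the
  path.\<close>

lemma Q_op_process_eq: "Q_op P X h = Q_op \<Omega> (proc x0) h"
proof -
  let ?v = "mean_traces x0 h"
  let ?L = "\<lambda>x. \<lambda>n. trace_linearisation (fst ?v) (traces (x n) (x (n + int h)) - ?v)"
  have m: "(\<lambda>x. ?L x n) \<in> borel_measurable (PiM UNIV (\<lambda>_. borel))" for n
    by (rule borel_measurable_continuous_on[OF linear_continuous_on[OF bounded_linear_trace_linearisation]])
      (intro borel_measurable_diff borel_measurable_traces measurable_component_singleton UNIV_I borel_measurable_const)
  have "V_op P X h i = V_op \<Omega> (proc x0) h i" for i
  proof -
    have "(\<lambda>x. ?L x 1 \<otimes> ?L x (1 + int i)) \<in> borel_measurable (PiM UNIV (\<lambda>_. borel))"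
      by (rule borel_measurable_continuous_Pair[OF m m])
        (intro bounded_bilinear.continuous_on[OF bounded_bilinear_outer] continuous_on_fst continuous_on_snd continuous_on_id)
    from integral_process_eq[OF this] show ?thesis
      unfolding V_op_def centred_product_def lag_cov_process_eq lag_cov_proc[OF x]
        M_map_traces[OF consistent_mean_traces[OF x]] .
  qed
  then show ?thesis unfolding Q_op_def W_op_def lag_cov_process_eq by simp
qed

lemma laplace_process_eq:
  "(LINT \<omega>|P. exp (- s * test_stat X h N \<omega>)) = (LINT \<omega>|\<Omega>. exp (- s * test_stat (proc x0) h N \<omega>))"
proof -
  have "(\<lambda>x. exp (- s * test_stat (\<lambda>n x. x n) h N x)) \<in> borel_measurable (PiM UNIV (\<lambda>_ :: int. borel :: ('b ^ 's) measure))"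
    by (intro borel_measurable_exp[THEN measurable_compose[rotated]] borel_measurable_times borel_measurable_const
        borel_measurable_test_stat measurable_component_singleton UNIV_I)
  from integral_process_eq[OF this] show ?thesis by (simp add: test_stat_def sample_cov_def)
qed

end

end

theorem theorem3p3:
  fixes P :: "'w measure" and U :: "'u measure"
    and X :: "int \<Rightarrow> 'w \<Rightarrow> L2_unit ^ 's::finite" and h :: nat
    and P' :: "'z measure" and Z :: "nat \<Rightarrow> 'z \<Rightarrow> real" and \<gamma> :: "nat \<Rightarrow> real"
  assumes "prob_space P"
    and "Lp_m_approximable P U 4 X"
    and "\<forall>n. (LINT \<omega>|P. X n \<omega>) = 0"
    and "hs_trace (lag_cov P X h) \<noteq> 0"
    and H0: "lag_cov P X h = sep1 (lag_cov P X h) \<otimes>\<^sub>o sep2 (lag_cov P X h)"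
    and "eigenvalues_with_multiplicity (Q_op P X h) \<gamma>"
    and "prob_space P'"
    and "prob_space.indep_vars P' (\<lambda>_. borel) Z UNIV"
    and "\<forall>r. distr P' borel (Z r) = std_normal_distribution"
  shows "weak_conv_m (\<lambda>N. distr P borel (test_stat X h N))
           (distr P' borel (\<lambda>\<omega>. \<Sum>r. \<gamma> r * (Z r \<omega>)\<^sup>2))"
proof -
  interpret P: prob_space P by fact
  interpret P': prob_space P' by fact
  obtain \<mu> :: "'u measure" and x0 where "iid_shift \<mu>"
    and x: "fourth_integrable (PiM UNIV (\<lambda>_. \<mu>)) x0" "iid_shift.depends_on \<mu> {..0} x0" "summable (iid_shift.fourth_dep_coef \<mu> x0)"
    and law: "distr P (PiM UNIV (\<lambda>_. borel)) (\<lambda>\<omega> n. X n \<omega>)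
      = distr (PiM UNIV (\<lambda>_. \<mu>)) (PiM UNIV (\<lambda>_. borel)) (\<lambda>\<omega> n. x0 (time_shift n \<omega>))"
    by (rule L4_m_approximable_canonical[OF assms(1,2)])
  interpret iid_shift \<mu> by fact
  have X: "X n \<in> borel_measurable P" for n using assms(2) by (simp add: Lp_m_approximable_def)
  have Z: "Z r \<in> borel_measurable P'" for r using assms(8) by (simp add: P'.indep_vars_def)
  note [measurable] = Z
  have T[measurable]: "test_stat X h N \<in> borel_measurable P" for N by (rule borel_measurable_test_stat[OF X])
  note eq = lag_cov_process_eq[OF x X law, of h] Q_op_process_eq[OF x X law, of h]
  note lim = laplace_limit_proc[OF x assms(4,5,6)[unfolded eq] assms(7,8) assms(9)[rule_format]]
  have \<gamma>: "0 \<le> \<gamma> r" "summable \<gamma>" for r by (fact lim(2,3)[OF order_refl])+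
  show ?thesis
  proof (rule laplace_imp_weak_conv)
    show "real_distribution (distr P borel (test_stat X h N))" for N by (simp add: P.real_distribution_distr)
    show "real_distribution (distr P' borel (\<lambda>\<omega>. \<Sum>r. \<gamma> r * (Z r \<omega>)\<^sup>2))"
      by (intro P'.real_distribution_distr) measurable
    show "AE x in distr P borel (test_stat X h N). 0 \<le> x" for N
      by (subst AE_distr_iff) (auto simp: test_stat_def Let_def)
    \<comment> \<open>Nonnegativity of \<open>suminf\<close> rests on convergence of the series and
      is therefore obtained almost surely.\<close>
    have "AE \<omega> in P'. 0 \<le> (\<Sum>r. \<gamma> r * (Z r \<omega>)\<^sup>2)"
      using weighted_chi_square_summable[OF Z assms(9)[rule_format] \<gamma>]
      by eventually_elim (use \<gamma>(1) in \<open>auto intro!: suminf_nonneg\<close>)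
    then show "AE x in distr P' borel (\<lambda>\<omega>. \<Sum>r. \<gamma> r * (Z r \<omega>)\<^sup>2). 0 \<le> x"
      by (subst AE_distr_iff) auto
    show "(\<lambda>N. LINT x|distr P borel (test_stat X h N). exp (- real k * x))
        \<longlonglongrightarrow> (LINT x|distr P' borel (\<lambda>\<omega>. \<Sum>r. \<gamma> r * (Z r \<omega>)\<^sup>2). exp (- real k * x))" for k
      using lim(1)[of "real k"] unfolding laplace_process_eq[OF x X law, symmetric] by (simp add: integral_distr)
  qed
qed

end
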